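(* Let $K$ be a field, $\mathcal{G}$ a locally compact Hausdorff ample groupoid and $c:\mathcal{G}\to\mathbb{Z}$ a continuous cocycle. Write $\mathcal{G}_n=c^{-1}(n)$. Suppose we have clopen sets $H_0\subseteq\mathcal{G}_0$, $H_1\subseteq\mathcal{G}_1$ and $H_{-1}\subseteq\mathcal{G}_{-1}$. Define $R:=A_K(H_0)\subseteq A_K(\mathcal{G})_0$, $I:=A_K(H_1)\subseteq A_K(\mathcal{G})_1$ and $J:=A_K(H_{-1})\subseteq A_K(\mathcal{G})_{-1}$. (i) If $H_0$ is closed under multiplication, $H_0H_1\cup H_1H_0\subseteq H_1$, $H_0H_{-1}\cup H_{-1}H_0\subseteq H_{-1}$, $H_{-1}H_1\subseteq H_0$, and $r(H_1)\cup s(H_{-1})\subseteq H_1H_{-1}$, then $R$ is a subring of $A_K(\mathcal{G})_0$ and the following hold: (1) $RI\subseteq I$, $IR\subseteq I$, $RJ\subseteq J$, $JR\subseteq J$ and $JI\subseteq R$; (2) for any finite subset $\{i_1,\dots,i_n\}\subseteq I$ there is $a\in IJ$ such that $ai_l=i_l$ for each $1\le l\le n$, and for any finite subset $\{j_1,\dots,j_m\}\subseteq J$ there is $b\in IJ$ such that $j_lb=j_l$ for each $1\le l\le m$; (3) for $r\in\operatorname{ann}_R(I)^\perp$ and $a\in IJ$, if $r-a\in\operatorname{ann}_{A_K(\mathcal{G})_0}(I)$, then $a\in R$. (ii) If $H_0$ and $H_1$ have the property that for every compact open bisection $B\subseteq H_0$ with $s(B)\cap r(H_1)=\emptyset$ one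 has $s(B)\subseteq H_0$, then $\operatorname{ann}_R(I)\cap\operatorname{ann}_R(I)^\perp=\{0\}$. (iii) If every element of $\mathcal{G}$ can be written as a product of elements from $H_0$, $H_1$ and $H_{-1}$, then $R$, $I$, $J$ generate $A_K(\mathcal{G})$ as a ring. If $H_0$, $H_1$ and $H_{-1}$ satisfy the hypotheses of (i), (ii) and (iii), then there is a graded algebra isomorphism from the Steinberg algebra $A_K(\mathcal{G})$ to the Cuntz--Pimsner ring of the $A_K(H_0)$-system $(A_K(H_{-1}),A_K(H_1),\psi)$, where $\psi:A_K(H_{-1})\otimes_{A_K(H_0)}A_K(H_1)\to A_K(H_0)$ is the bimodule homomorphism with $\psi(j\otimes i)=ji$.
   Context: Groupoids and Steinberg algebras. For a groupoid $\mathcal{G}$ with range and source maps $r,s$, the product $\gamma\mu$ is defined when $s(\gamma)=r(\mu)$; for subsets $X,Y\subseteq\mathcal{G}$, $XY=\{xy:x\in X,y\in Y,s(x)=r(y)\}$. "$H_0$ is closed under multiplication" means $H_0H_0\subseteq H_0$. A product of elements means a finite composable product with at least one factor. An open bisection is an open set $B\subseteq\mathcal{G}$ on which $r$ and $s$ restrict to homeomorphisms onto open subsets of the unit space. An ample Hausdorff groupoid is a topological groupoid whose topology is Hausdorff and has a base of compact open bisections. A continuous cocycle is a continuous groupoid homomorphism $c:\mathcal{G}\to\mathbb{Z}$, with $\mathbb{Z}$ discrete. The Steinberg algebra $A_K(\mathcal{G})$ is the $K$-linear span of the characteristic functions $1_B:\mathcal{G}\to K$ of compact open bisections $B$, with pointwise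 addition and scalar multiplication, and convolution product, so that $1_B1_D=1_{BD}$. It is $\mathbb{Z}$-graded by $A_K(\mathcal{G})_n=\{f\in A_K(\mathcal{G}): f(\gamma)\ne0\Rightarrow c(\gamma)=n\}$. For a clopen $H\subseteq\mathcal{G}$, $A_K(H):=\{f\in A_K(\mathcal{G}): f(\gamma)=0\text{ for }\gamma\notin H\}$. Annihilators. For additive subgroups $X,Y$ of a ring, $XY$ is the additive subgroup generated by products $xy$. Here $\operatorname{ann}_R(I)=\{r\in R: rx=0\ \forall x\in I\}$, $\operatorname{ann}_R(I)^\perp=\{r\in R: ry=yr=0\ \forall y\in\operatorname{ann}_R(I)\}$, and $\operatorname{ann}_{A_K(\mathcal{G})_0}(I)=\{x\in A_K(\mathcal{G})_0: xi=0\ \forall i\in I\}$, with products taken in $A_K(\mathcal{G})$. Cuntz--Pimsner rings (Carlsen--Ortega). Rings are associative and need not be unital. Let $R$ be a ring. An $R$-system is a triple $(P,Q,\psi)$ with $P,Q$ $R$-bimodules and $\psi:P\otimes_R Q\to R$ an $R$-bimodule homomorphism ($\otimes_R$ is the $R$-balanced tensor product). A covariant representation $(S,T,\sigma,B)$ of $(P,Q,\psi)$ consists of a ring $B$, additive maps $S:P\to B$, $T:Q\to B$, and a ring homomorphism $\sigma:R\to B$ such that $S(pr)=S(p)\sigma(r)$, $S(rp)=\sigma(r)S(p)$, $T(qr)=T(q)\sigma(r)$, $T(rq)=\sigma(r)T(q)$ and $\sigma(\psi(p\otimes_R q))=S(p)T(q)$ for all $r\in R,p\in P,q\in Q$. The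 Toeplitz ring $\mathcal{T}_{(P,Q,\psi)}$, with maps $\iota_P,\iota_Q,\iota_R$, is the universal covariant representation: it is generated as a ring by $\iota_R(R)\cup\iota_Q(Q)\cup\iota_P(P)$, and every covariant representation $(S,T,\sigma,B)$ factors uniquely through a ring homomorphism $\mathcal{T}_{(P,Q,\psi)}\to B$. It is $\mathbb{Z}$-graded with $\iota_R(R)$ in degree $0$, $\iota_Q(Q)$ in degree $1$ and $\iota_P(P)$ in degree $-1$. For $p\in P,q\in Q$ let $\theta_{q,p}:Q\to Q$, $\theta_{q,p}(x)=q\,\psi(p\otimes_R x)$, and $\theta_{p,q}:P\to P$, $\theta_{p,q}(y)=\psi(y\otimes_R q)\,p$. Let $\mathcal{F}_P(Q)$ be the additive span of the maps $\theta_{q,p}$ and $\mathcal{F}_Q(P)$ the additive span of the maps $\theta_{p,q}$. The system satisfies condition (FS) if for all finite sets $\{q_1,\dots,q_n\}\subseteq Q$ and $\{p_1,\dots,p_m\}\subseteq P$ there are $\Theta\in\mathcal{F}_P(Q)$ and $\Phi\in\mathcal{F}_Q(P)$ with $\Theta(q_i)=q_i$ and $\Phi(p_j)=p_j$ for all $i,j$. Let $\Delta:R\to\operatorname{End}_R(Q_R)$ be $\Delta(r)(q)=rq$. Under (FS), for each covariant representation $(S,T,\sigma,B)$ there is a unique ring homomorphism $\pi_{T,S}:\mathcal{F}_P(Q)\to B$ with $\pi_{T,S}(\theta_{q,p})=T(q)S(p)$ (a known fact). A two-sided ideal $L$ of $R$ is $\psi$-compatible if $L\subseteq\Delta^{-1}(\mathcal{F}_P(Q))$,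 and a $\psi$-compatible $L$ is faithful if $L\cap\ker\Delta=\{0\}$. A faithful $\psi$-compatible two-sided ideal $L$ is uniquely maximal if it contains every faithful $\psi$-compatible two-sided ideal of $R$. If the system satisfies (FS) and a uniquely maximal faithful $\psi$-compatible two-sided ideal $L$ exists, the Cuntz--Pimsner ring is $\mathcal{O}_{(P,Q,\psi)}=\mathcal{T}_{(P,Q,\psi)}/\mathcal{T}(L)$, where $\mathcal{T}(L)$ is the two-sided ideal generated by $\{\iota_R(x)-\pi_{\iota_Q,\iota_P}(\Delta(x)):x\in L\}$; it inherits the $\mathbb{Z}$-grading of $\mathcal{T}_{(P,Q,\psi)}$. An assertion about the Cuntz--Pimsner ring of a system is understood to include that it is defined (i.e. (FS) holds and such an $L$ exists). "Graded algebra isomorphism" means an isomorphism of $\mathbb{Z}$-graded rings that is $K$-linear for the $K$-algebra structure on the Cuntz--Pimsner ring making the canonical maps from $R$, $Q$, $P$ into it $K$-linear. *)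

theory Defs
  imports "HOL-Analysis.Analysis" "HOL-Algebra.Free_Abelian_Groups" "HOL-Algebra.QuotRing" "HOL-Algebra.Module"
begin

section \<open>Rings without unit\<close>

text \<open>
  Rings are associative and need not be unital. They are represented by the record type of
  HOL-Algebra; its field for the unit is never used, and is left undefined in the concrete rings
  below. Likewise the multiplication and unit fields of a record that only serves as a bimodule
  carry no meaning.
\<close>

locale rng = abelian_group R for R (structure) +
  assumes m_closed: "\<lbrakk>x \<in> carrier R; y \<in> carrier R\<rbrakk> \<Longrightarrow> x \<otimes> y \<in> carrier R"
    and m_assoc: "\<lbrakk>x \<in> carrier R; y \<in> carrier R; z \<in> carrier R\<rbrakk> \<Longrightarrow> (x \<otimes> y) \<otimes> z = x \<otimes> (y \<otimes> z)"
    and l_distr: "\<lbrakk>x \<in> carrier R; y \<in> carrier R; z \<in> carrier R\<rbrakk> \<Longrightarrow> (x \<oplus> y) \<otimes> z = x \<otimes> z \<oplus> y \<otimes> z"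
    and r_distr: "\<lbrakk>x \<in> carrier R; y \<in> carrier R; z \<in> carrier R\<rbrakk> \<Longrightarrow> z \<otimes> (x \<oplus> y) = z \<otimes> x \<oplus> z \<otimes> y"

definition rng_hom :: "('a, 'm) ring_scheme \<Rightarrow> ('b, 'n) ring_scheme \<Rightarrow> ('a \<Rightarrow> 'b) set" where
  "rng_hom R S = {h \<in> carrier R \<rightarrow> carrier S. \<forall>x\<in>carrier R. \<forall>y\<in>carrier R.
     h (x \<oplus>\<^bsub>R\<^esub> y) = h x \<oplus>\<^bsub>S\<^esub> h y \<and> h (x \<otimes>\<^bsub>R\<^esub> y) = h x \<otimes>\<^bsub>S\<^esub> h y}"

definition rng_iso :: "('a, 'm) ring_scheme \<Rightarrow> ('b, 'n) ring_scheme \<Rightarrow> ('a \<Rightarrow> 'b) set" where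
  "rng_iso R S = {h \<in> rng_hom R S. bij_betw h (carrier R) (carrier S)}"

definition subrng :: "'a set \<Rightarrow> ('a, 'm) ring_scheme \<Rightarrow> bool" where
  "subrng S R \<longleftrightarrow> additive_subgroup S R \<and> (\<forall>x\<in>S. \<forall>y\<in>S. x \<otimes>\<^bsub>R\<^esub> y \<in> S)"

definition subrng_generated :: "('a, 'm) ring_scheme \<Rightarrow> 'a set \<Rightarrow> 'a set" where
  "subrng_generated R X = \<Inter>{S. subrng S R \<and> X \<subseteq> S}"

definition two_sided_ideal :: "'a set \<Rightarrow> ('a, 'm) ring_scheme \<Rightarrow> bool" where
  "two_sided_ideal L R \<longleftrightarrow> additive_subgroup L R \<and>
     (\<forall>a\<in>L. \<forall>x\<in>carrier R. x \<otimes>\<^bsub>R\<^esub> a \<in> L \<and> a \<otimes>\<^bsub>R\<^esub> x \<in> L)"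

definition ideal_generated :: "('a, 'm) ring_scheme \<Rightarrow> 'a set \<Rightarrow> 'a set" where
  "ideal_generated R X = \<Inter>{L. two_sided_ideal L R \<and> X \<subseteq> L}"

definition set_times :: "('a, 'm) ring_scheme \<Rightarrow> 'a set \<Rightarrow> 'a set \<Rightarrow> 'a set" where
  "set_times R X Y = generate (add_monoid R) {x \<otimes>\<^bsub>R\<^esub> y | x y. x \<in> X \<and> y \<in> Y}"

text \<open>In the following two definitions all products are taken in the ambient ring \<open>A\<close>.\<close>

definition left_ann :: "('a, 'm) ring_scheme \<Rightarrow> 'a set \<Rightarrow> 'a set \<Rightarrow> 'a set" where
  "left_ann A S I = {r \<in> S. \<forall>x\<in>I. r \<otimes>\<^bsub>A\<^esub> x = \<zero>\<^bsub>A\<^esub>}"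

definition left_ann_perp :: "('a, 'm) ring_scheme \<Rightarrow> 'a set \<Rightarrow> 'a set \<Rightarrow> 'a set" where
  "left_ann_perp A S I =
     {r \<in> S. \<forall>y\<in>left_ann A S I. r \<otimes>\<^bsub>A\<^esub> y = \<zero>\<^bsub>A\<^esub> \<and> y \<otimes>\<^bsub>A\<^esub> r = \<zero>\<^bsub>A\<^esub>}"

text \<open>An algebra over a field, given as a possibly non-unital ring with a scalar multiplication.\<close>

definition scalar_algebra :: "('k::field \<Rightarrow> 'a \<Rightarrow> 'a) \<Rightarrow> ('a, 'm) ring_scheme \<Rightarrow> bool" where
  "scalar_algebra sc A \<longleftrightarrow> rng A \<and>
     (\<forall>k. \<forall>x\<in>carrier A. sc k x \<in> carrier A) \<and>
     (\<forall>k. \<forall>x\<in>carrier A. \<forall>y\<in>carrier A. sc k (x \<oplus>\<^bsub>A\<^esub> y) = sc k x \<oplus>\<^bsub>A\<^esub> sc k y) \<and>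
     (\<forall>k l. \<forall>x\<in>carrier A. sc (k + l) x = sc k x \<oplus>\<^bsub>A\<^esub> sc l x) \<and>
     (\<forall>k l. \<forall>x\<in>carrier A. sc (k * l) x = sc k (sc l x)) \<and>
     (\<forall>x\<in>carrier A. sc 1 x = x) \<and>
     (\<forall>k. \<forall>x\<in>carrier A. \<forall>y\<in>carrier A.
        sc k (x \<otimes>\<^bsub>A\<^esub> y) = sc k x \<otimes>\<^bsub>A\<^esub> y \<and> sc k (x \<otimes>\<^bsub>A\<^esub> y) = x \<otimes>\<^bsub>A\<^esub> sc k y)"


section \<open>Ample groupoids and Steinberg algebras\<close>

text \<open>
  The elements of the groupoid are the points of the topology, units included. The operations are
  total functions that are only meaningful on these elements, and the product \<open>gmul G x y\<close> only
  if \<open>gsrc G x = grng G y\<close>.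
\<close>

record 'g top_groupoid =
  gtop :: "'g topology"
  grng :: "'g \<Rightarrow> 'g"
  gsrc :: "'g \<Rightarrow> 'g"
  gmul :: "'g \<Rightarrow> 'g \<Rightarrow> 'g"
  ginv :: "'g \<Rightarrow> 'g"

definition elems :: "'g top_groupoid \<Rightarrow> 'g set" where
  "elems G = topspace (gtop G)"

definition units :: "'g top_groupoid \<Rightarrow> 'g set" where
  "units G = grng G ` elems G"

definition unit_space :: "'g top_groupoid \<Rightarrow> 'g topology" where
  "unit_space G = subtopology (gtop G) (units G)"

definition composable :: "'g top_groupoid \<Rightarrow> ('g \<times> 'g) set" where
  "composable G = {(x, y). x \<in> elems G \<and> y \<in> elems G \<and> gsrc G x = grng G y}"

locale topological_groupoid =
  fixes G :: "'g top_groupoid"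
  assumes rng_closed: "x \<in> elems G \<Longrightarrow> grng G x \<in> elems G"
    and src_closed: "x \<in> elems G \<Longrightarrow> gsrc G x \<in> elems G"
    and rng_rng: "x \<in> elems G \<Longrightarrow> grng G (grng G x) = grng G x"
    and src_rng: "x \<in> elems G \<Longrightarrow> gsrc G (grng G x) = grng G x"
    and rng_src: "x \<in> elems G \<Longrightarrow> grng G (gsrc G x) = gsrc G x"
    and src_src: "x \<in> elems G \<Longrightarrow> gsrc G (gsrc G x) = gsrc G x"
    and mul_closed: "(x, y) \<in> composable G \<Longrightarrow> gmul G x y \<in> elems G"
    and rng_mul: "(x, y) \<in> composable G \<Longrightarrow> grng G (gmul G x y) = grng G x"
    and src_mul: "(x, y) \<in> composable G \<Longrightarrow> gsrc G (gmul G x y) = gsrc G y"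
    and mul_assoc: "\<lbrakk>(x, y) \<in> composable G; (y, z) \<in> composable G\<rbrakk>
          \<Longrightarrow> gmul G (gmul G x y) z = gmul G x (gmul G y z)"
    and rng_mul_left: "x \<in> elems G \<Longrightarrow> gmul G (grng G x) x = x"
    and src_mul_right: "x \<in> elems G \<Longrightarrow> gmul G x (gsrc G x) = x"
    and inv_closed: "x \<in> elems G \<Longrightarrow> ginv G x \<in> elems G"
    and rng_inv: "x \<in> elems G \<Longrightarrow> grng G (ginv G x) = gsrc G x"
    and src_inv: "x \<in> elems G \<Longrightarrow> gsrc G (ginv G x) = grng G x"
    and mul_inv: "x \<in> elems G \<Longrightarrow> gmul G x (ginv G x) = grng G x"
    and inv_mul: "x \<in> elems G \<Longrightarrow> gmul G (ginv G x) x = gsrc G x"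
    and continuous_mul: "continuous_map
          (subtopology (prod_topology (gtop G) (gtop G)) (composable G)) (gtop G)
          (\<lambda>(x, y). gmul G x y)"
    and continuous_inv: "continuous_map (gtop G) (gtop G) (ginv G)"

definition open_bisection :: "'g top_groupoid \<Rightarrow> 'g set \<Rightarrow> bool" where
  "open_bisection G B \<longleftrightarrow> openin (gtop G) B \<and>
     (\<forall>f\<in>{grng G, gsrc G}. openin (unit_space G) (f ` B) \<and>
        homeomorphic_map (subtopology (gtop G) B) (subtopology (unit_space G) (f ` B)) f)"

definition compact_open_bisection :: "'g top_groupoid \<Rightarrow> 'g set \<Rightarrow> bool" where
  "compact_open_bisection G B \<longleftrightarrow> compactin (gtop G) B \<and> open_bisection G B"

locale ample_Hausdorff_groupoid = topological_groupoid G for G :: "'g top_groupoid" +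
  assumes Hausdorff: "Hausdorff_space (gtop G)"
    and compact_open_bisection_base: "\<lbrakk>openin (gtop G) U; x \<in> U\<rbrakk>
          \<Longrightarrow> \<exists>B. compact_open_bisection G B \<and> x \<in> B \<and> B \<subseteq> U"

definition continuous_cocycle :: "'g top_groupoid \<Rightarrow> ('g \<Rightarrow> int) \<Rightarrow> bool" where
  "continuous_cocycle G c \<longleftrightarrow>
     continuous_map (gtop G) (discrete_topology UNIV) c \<and>
     (\<forall>(x, y)\<in>composable G. c (gmul G x y) = c x + c y)"

definition clopen_in :: "'g top_groupoid \<Rightarrow> 'g set \<Rightarrow> bool" where
  "clopen_in G H \<longleftrightarrow> openin (gtop G) H \<and> closedin (gtop G) H"

definition gset_mul :: "'g top_groupoid \<Rightarrow> 'g set \<Rightarrow> 'g set \<Rightarrow> 'g set" where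
  "gset_mul G X Y = {gmul G x y | x y. x \<in> X \<and> y \<in> Y \<and> gsrc G x = grng G y}"

text \<open>All composable products of one or more factors from \<open>X\<close>.\<close>

inductive_set gproducts :: "'g top_groupoid \<Rightarrow> 'g set \<Rightarrow> 'g set"
  for G :: "'g top_groupoid" and X :: "'g set" where
  factor: "x \<in> X \<Longrightarrow> x \<in> gproducts G X"
| mul: "\<lbrakk>x \<in> X; y \<in> gproducts G X; gsrc G x = grng G y\<rbrakk> \<Longrightarrow> gmul G x y \<in> gproducts G X"

text \<open>The linear span of the characteristic functions of compact open bisections; these vanish
  outside \<open>elems G\<close>.\<close>

definition steinberg :: "'g top_groupoid \<Rightarrow> ('g \<Rightarrow> 'k::field) set" where
  "steinberg G = {(\<lambda>x. \<Sum>B\<in>F. a B * indicator B x) | F a.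
     finite F \<and> (\<forall>B\<in>F. compact_open_bisection G B)}"

definition steinberg_on :: "'g top_groupoid \<Rightarrow> 'g set \<Rightarrow> ('g \<Rightarrow> 'k::field) set" where
  "steinberg_on G H = {f \<in> steinberg G. \<forall>x. x \<notin> H \<longrightarrow> f x = 0}"

definition steinberg_deg :: "'g top_groupoid \<Rightarrow> ('g \<Rightarrow> int) \<Rightarrow> int \<Rightarrow> ('g \<Rightarrow> 'k::field) set" where
  "steinberg_deg G c n = {f \<in> steinberg G. \<forall>x. f x \<noteq> 0 \<longrightarrow> c x = n}"

text \<open>The index set of the sum is finite for \<open>f\<close> and \<open>g\<close> in the Steinberg algebra of an ample
  Hausdorff groupoid.\<close>

definition convolution :: "'g top_groupoid \<Rightarrow> ('g \<Rightarrow> 'k::field) \<Rightarrow> ('g \<Rightarrow> 'k) \<Rightarrow> 'g \<Rightarrow> 'k" where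
  "convolution G f g x =
     (\<Sum>(y, z)\<in>{(y, z) \<in> composable G. gmul G y z = x \<and> f y \<noteq> 0 \<and> g z \<noteq> 0}. f y * g z)"

definition function_rng :: "'g top_groupoid \<Rightarrow> ('g \<Rightarrow> 'k::field) set \<Rightarrow> ('g \<Rightarrow> 'k) ring" where
  "function_rng G S = \<lparr>carrier = S, monoid.mult = convolution G, one = undefined,
     zero = (\<lambda>x. 0), add = (\<lambda>f g x. f x + g x)\<rparr>"

definition fscale :: "'k::field \<Rightarrow> ('g \<Rightarrow> 'k) \<Rightarrow> 'g \<Rightarrow> 'k" where
  "fscale k f = (\<lambda>x. k * f x)"


section \<open>Bimodules and balanced tensor products\<close>

record ('r, 'a) bimodule = "('r, 'a) module" +
  rsmult :: "'a \<Rightarrow> 'r \<Rightarrow> 'a"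

locale rng_bimodule = R: rng R + M: abelian_group M
  for R :: "('r, 'm) ring_scheme" and M :: "('r, 'a, 'n) bimodule_scheme" +
  assumes left_closed: "\<lbrakk>r \<in> carrier R; x \<in> carrier M\<rbrakk> \<Longrightarrow> smult M r x \<in> carrier M"
    and right_closed: "\<lbrakk>r \<in> carrier R; x \<in> carrier M\<rbrakk> \<Longrightarrow> rsmult M x r \<in> carrier M"
    and left_add: "\<lbrakk>r \<in> carrier R; x \<in> carrier M; y \<in> carrier M\<rbrakk>
      \<Longrightarrow> smult M r (x \<oplus>\<^bsub>M\<^esub> y) = smult M r x \<oplus>\<^bsub>M\<^esub> smult M r y"
    and right_add: "\<lbrakk>r \<in> carrier R; x \<in> carrier M; y \<in> carrier M\<rbrakk>
      \<Longrightarrow> rsmult M (x \<oplus>\<^bsub>M\<^esub> y) r = rsmult M x r \<oplus>\<^bsub>M\<^esub> rsmult M y r"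
    and add_left: "\<lbrakk>r \<in> carrier R; s \<in> carrier R; x \<in> carrier M\<rbrakk>
      \<Longrightarrow> smult M (r \<oplus>\<^bsub>R\<^esub> s) x = smult M r x \<oplus>\<^bsub>M\<^esub> smult M s x"
    and add_right: "\<lbrakk>r \<in> carrier R; s \<in> carrier R; x \<in> carrier M\<rbrakk>
      \<Longrightarrow> rsmult M x (r \<oplus>\<^bsub>R\<^esub> s) = rsmult M x r \<oplus>\<^bsub>M\<^esub> rsmult M x s"
    and left_assoc: "\<lbrakk>r \<in> carrier R; s \<in> carrier R; x \<in> carrier M\<rbrakk>
      \<Longrightarrow> smult M (r \<otimes>\<^bsub>R\<^esub> s) x = smult M r (smult M s x)"
    and right_assoc: "\<lbrakk>r \<in> carrier R; s \<in> carrier R; x \<in> carrier M\<rbrakk>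
      \<Longrightarrow> rsmult M x (r \<otimes>\<^bsub>R\<^esub> s) = rsmult M (rsmult M x r) s"
    and left_right: "\<lbrakk>r \<in> carrier R; s \<in> carrier R; x \<in> carrier M\<rbrakk>
      \<Longrightarrow> rsmult M (smult M r x) s = smult M r (rsmult M x s)"

definition bimodule_hom :: "('r, 'm) ring_scheme \<Rightarrow> ('r, 'a, 'n) bimodule_scheme
    \<Rightarrow> ('r, 'b, 'l) bimodule_scheme \<Rightarrow> ('a \<Rightarrow> 'b) set" where
  "bimodule_hom R M N = {h \<in> carrier M \<rightarrow> carrier N.
     (\<forall>x\<in>carrier M. \<forall>y\<in>carrier M. h (x \<oplus>\<^bsub>M\<^esub> y) = h x \<oplus>\<^bsub>N\<^esub> h y) \<and>
     (\<forall>r\<in>carrier R. \<forall>x\<in>carrier M. h (smult M r x) = smult N r (h x) \<and>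
        h (rsmult M x r) = rsmult N (h x) r)}"

definition regular_bimodule :: "('r, 'm) ring_scheme \<Rightarrow> ('r, 'r) bimodule" where
  "regular_bimodule R = \<lparr>carrier = carrier R, monoid.mult = monoid.mult R, one = undefined,
     zero = zero R, add = add R, smult = monoid.mult R, rsmult = monoid.mult R\<rparr>"

text \<open>The tensor product over \<open>R\<close> is the free abelian group on pairs modulo the balancing
  relations; its elements are cosets.\<close>

definition tensor_rels :: "('r, 'm) ring_scheme \<Rightarrow> ('r, 'p, 'n) bimodule_scheme
    \<Rightarrow> ('r, 'q, 'l) bimodule_scheme \<Rightarrow> ('p \<times> 'q \<Rightarrow>\<^sub>0 int) set" where
  "tensor_rels R P Q =
     {frag_of (p \<oplus>\<^bsub>P\<^esub> p', q) - frag_of (p, q) - frag_of (p', q) | p p' q.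
        p \<in> carrier P \<and> p' \<in> carrier P \<and> q \<in> carrier Q} \<union>
     {frag_of (p, q \<oplus>\<^bsub>Q\<^esub> q') - frag_of (p, q) - frag_of (p, q') | p q q'.
        p \<in> carrier P \<and> q \<in> carrier Q \<and> q' \<in> carrier Q} \<union>
     {frag_of (rsmult P p r, q) - frag_of (p, smult Q r q) | p r q.
        p \<in> carrier P \<and> r \<in> carrier R \<and> q \<in> carrier Q}"

definition tensor_null :: "('r, 'm) ring_scheme \<Rightarrow> ('r, 'p, 'n) bimodule_scheme
    \<Rightarrow> ('r, 'q, 'l) bimodule_scheme \<Rightarrow> ('p \<times> 'q \<Rightarrow>\<^sub>0 int) set" where
  "tensor_null R P Q =
     generate (free_Abelian_group (carrier P \<times> carrier Q)) (tensor_rels R P Q)"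

definition tensor_class :: "('r, 'm) ring_scheme \<Rightarrow> ('r, 'p, 'n) bimodule_scheme
    \<Rightarrow> ('r, 'q, 'l) bimodule_scheme \<Rightarrow> ('p \<times> 'q \<Rightarrow>\<^sub>0 int) \<Rightarrow> ('p \<times> 'q \<Rightarrow>\<^sub>0 int) set" where
  "tensor_class R P Q x =
     tensor_null R P Q #>\<^bsub>free_Abelian_group (carrier P \<times> carrier Q)\<^esub> x"

definition tensor_elem :: "('r, 'm) ring_scheme \<Rightarrow> ('r, 'p, 'n) bimodule_scheme
    \<Rightarrow> ('r, 'q, 'l) bimodule_scheme \<Rightarrow> 'p \<Rightarrow> 'q \<Rightarrow> ('p \<times> 'q \<Rightarrow>\<^sub>0 int) set" where
  "tensor_elem R P Q p q = tensor_class R P Q (frag_of (p, q))"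

text \<open>The actions \<open>r(p \<otimes> q) = rp \<otimes> q\<close> and \<open>(p \<otimes> q)r = p \<otimes> qr\<close> are extended linearly to
  representatives; like the library's multiplication of cosets they are written as a union over all
  representatives.\<close>

definition tensor :: "('r, 'm) ring_scheme \<Rightarrow> ('r, 'p, 'n) bimodule_scheme
    \<Rightarrow> ('r, 'q, 'l) bimodule_scheme \<Rightarrow> ('r, ('p \<times> 'q \<Rightarrow>\<^sub>0 int) set) bimodule" where
  "tensor R P Q = \<lparr>
     carrier = rcosets\<^bsub>free_Abelian_group (carrier P \<times> carrier Q)\<^esub> (tensor_null R P Q),
     monoid.mult = undefined, one = undefined,
     zero = tensor_null R P Q,
     add = set_mult (free_Abelian_group (carrier P \<times> carrier Q)),
     smult = (\<lambda>r X. \<Union>x\<in>X. tensor_class R P Q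
       (frag_extend (\<lambda>(p, q). frag_of (smult P r p, q)) x)),
     rsmult = (\<lambda>X r. \<Union>x\<in>X. tensor_class R P Q
       (frag_extend (\<lambda>(p, q). frag_of (p, rsmult Q q r)) x))\<rparr>"


section \<open>Systems and covariant representations\<close>

locale rng_system = P: rng_bimodule R P + Q: rng_bimodule R Q
  for R :: "('r, 'm) ring_scheme" and P :: "('r, 'p, 'n) bimodule_scheme"
    and Q :: "('r, 'q, 'l) bimodule_scheme" +
  fixes \<psi> :: "('p \<times> 'q \<Rightarrow>\<^sub>0 int) set \<Rightarrow> 'r"
  assumes \<psi>_hom: "\<psi> \<in> bimodule_hom R (tensor R P Q) (regular_bimodule R)"

locale covariant_rep = rng_system R P Q \<psi> + B: rng B
  for R :: "('r, 'm) ring_scheme" and P :: "('r, 'p, 'n) bimodule_scheme"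
    and Q :: "('r, 'q, 'l) bimodule_scheme" and \<psi> :: "('p \<times> 'q \<Rightarrow>\<^sub>0 int) set \<Rightarrow> 'r"
    and B :: "('b, 'k) ring_scheme" +
  fixes S :: "'p \<Rightarrow> 'b" and T :: "'q \<Rightarrow> 'b" and \<sigma> :: "'r \<Rightarrow> 'b"
  assumes S_closed: "S \<in> carrier P \<rightarrow> carrier B"
    and S_add: "\<lbrakk>p \<in> carrier P; p' \<in> carrier P\<rbrakk> \<Longrightarrow> S (p \<oplus>\<^bsub>P\<^esub> p') = S p \<oplus>\<^bsub>B\<^esub> S p'"
    and T_closed: "T \<in> carrier Q \<rightarrow> carrier B"
    and T_add: "\<lbrakk>q \<in> carrier Q; q' \<in> carrier Q\<rbrakk> \<Longrightarrow> T (q \<oplus>\<^bsub>Q\<^esub> q') = T q \<oplus>\<^bsub>B\<^esub> T q'"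
    and \<sigma>_hom: "\<sigma> \<in> rng_hom R B"
    and S_right: "\<lbrakk>p \<in> carrier P; r \<in> carrier R\<rbrakk> \<Longrightarrow> S (rsmult P p r) = S p \<otimes>\<^bsub>B\<^esub> \<sigma> r"
    and S_left: "\<lbrakk>p \<in> carrier P; r \<in> carrier R\<rbrakk> \<Longrightarrow> S (smult P r p) = \<sigma> r \<otimes>\<^bsub>B\<^esub> S p"
    and T_right: "\<lbrakk>q \<in> carrier Q; r \<in> carrier R\<rbrakk> \<Longrightarrow> T (rsmult Q q r) = T q \<otimes>\<^bsub>B\<^esub> \<sigma> r"
    and T_left: "\<lbrakk>q \<in> carrier Q; r \<in> carrier R\<rbrakk> \<Longrightarrow> T (smult Q r q) = \<sigma> r \<otimes>\<^bsub>B\<^esub> T q"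
    and \<psi>_cov: "\<lbrakk>p \<in> carrier P; q \<in> carrier Q\<rbrakk>
      \<Longrightarrow> \<sigma> (\<psi> (tensor_elem R P Q p q)) = S p \<otimes>\<^bsub>B\<^esub> T q"


section \<open>The Toeplitz ring\<close>

text \<open>
  The Toeplitz ring is constructed as the free non-unital ring on the disjoint union of \<open>R\<close>, \<open>Q\<close>
  and \<open>P\<close> (integer combinations of nonempty words) modulo the relations of a covariant
  representation. The theorems \<open>toeplitz_covariant\<close>, \<open>toeplitz_generated\<close> and
  \<open>toeplitz_universal\<close> below show that it is the universal covariant representation.
\<close>

datatype ('r, 'q, 'p) gen = GenR 'r | GenQ 'q | GenP 'p

definition gens :: "('r, 'm) ring_scheme \<Rightarrow> ('r, 'p, 'n) bimodule_scheme
    \<Rightarrow> ('r, 'q, 'l) bimodule_scheme \<Rightarrow> ('r, 'q, 'p) gen set" where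
  "gens R P Q = GenR ` carrier R \<union> GenQ ` carrier Q \<union> GenP ` carrier P"

definition word_mult :: "('a list \<Rightarrow>\<^sub>0 int) \<Rightarrow> ('a list \<Rightarrow>\<^sub>0 int) \<Rightarrow> ('a list \<Rightarrow>\<^sub>0 int)" where
  "word_mult x y = frag_extend (\<lambda>u. frag_extend (\<lambda>v. frag_of (u @ v)) y) x"

definition free_rng :: "'a set \<Rightarrow> ('a list \<Rightarrow>\<^sub>0 int) ring" where
  "free_rng X = \<lparr>carrier = {x. Poly_Mapping.keys x \<subseteq> {w. w \<noteq> [] \<and> set w \<subseteq> X}},
     monoid.mult = word_mult, one = undefined, zero = 0, add = (+)\<rparr>"

definition toeplitz_rels :: "('r, 'm) ring_scheme \<Rightarrow> ('r, 'p, 'n) bimodule_scheme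
    \<Rightarrow> ('r, 'q, 'l) bimodule_scheme \<Rightarrow> (('p \<times> 'q \<Rightarrow>\<^sub>0 int) set \<Rightarrow> 'r)
    \<Rightarrow> (('r, 'q, 'p) gen list \<Rightarrow>\<^sub>0 int) set" where
  "toeplitz_rels R P Q \<psi> =
     {frag_of [GenR (r \<oplus>\<^bsub>R\<^esub> s)] - frag_of [GenR r] - frag_of [GenR s] | r s.
        r \<in> carrier R \<and> s \<in> carrier R} \<union>
     {frag_of [GenQ (q \<oplus>\<^bsub>Q\<^esub> q')] - frag_of [GenQ q] - frag_of [GenQ q'] | q q'.
        q \<in> carrier Q \<and> q' \<in> carrier Q} \<union>
     {frag_of [GenP (p \<oplus>\<^bsub>P\<^esub> p')] - frag_of [GenP p] - frag_of [GenP p'] | p p'.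
        p \<in> carrier P \<and> p' \<in> carrier P} \<union>
     {frag_of [GenR (r \<otimes>\<^bsub>R\<^esub> s)] - frag_of [GenR r, GenR s] | r s.
        r \<in> carrier R \<and> s \<in> carrier R} \<union>
     {frag_of [GenP (rsmult P p r)] - frag_of [GenP p, GenR r] | p r.
        p \<in> carrier P \<and> r \<in> carrier R} \<union>
     {frag_of [GenP (smult P r p)] - frag_of [GenR r, GenP p] | p r.
        p \<in> carrier P \<and> r \<in> carrier R} \<union>
     {frag_of [GenQ (rsmult Q q r)] - frag_of [GenQ q, GenR r] | q r.
        q \<in> carrier Q \<and> r \<in> carrier R} \<union>
     {frag_of [GenQ (smult Q r q)] - frag_of [GenR r, GenQ q] | q r.
        q \<in> carrier Q \<and> r \<in> carrier R} \<union>
     {frag_of [GenR (\<psi> (tensor_elem R P Q p q))] - frag_of [GenP p, GenQ q] | p q.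
        p \<in> carrier P \<and> q \<in> carrier Q}"

definition toeplitz_null :: "('r, 'm) ring_scheme \<Rightarrow> ('r, 'p, 'n) bimodule_scheme
    \<Rightarrow> ('r, 'q, 'l) bimodule_scheme \<Rightarrow> (('p \<times> 'q \<Rightarrow>\<^sub>0 int) set \<Rightarrow> 'r)
    \<Rightarrow> (('r, 'q, 'p) gen list \<Rightarrow>\<^sub>0 int) set" where
  "toeplitz_null R P Q \<psi> =
     ideal_generated (free_rng (gens R P Q)) (toeplitz_rels R P Q \<psi>)"

definition toeplitz :: "('r, 'm) ring_scheme \<Rightarrow> ('r, 'p, 'n) bimodule_scheme
    \<Rightarrow> ('r, 'q, 'l) bimodule_scheme \<Rightarrow> (('p \<times> 'q \<Rightarrow>\<^sub>0 int) set \<Rightarrow> 'r)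
    \<Rightarrow> (('r, 'q, 'p) gen list \<Rightarrow>\<^sub>0 int) set ring" where
  "toeplitz R P Q \<psi> = free_rng (gens R P Q) Quot toeplitz_null R P Q \<psi>"

definition toeplitz_class :: "('r, 'm) ring_scheme \<Rightarrow> ('r, 'p, 'n) bimodule_scheme
    \<Rightarrow> ('r, 'q, 'l) bimodule_scheme \<Rightarrow> (('p \<times> 'q \<Rightarrow>\<^sub>0 int) set \<Rightarrow> 'r)
    \<Rightarrow> (('r, 'q, 'p) gen list \<Rightarrow>\<^sub>0 int) \<Rightarrow> (('r, 'q, 'p) gen list \<Rightarrow>\<^sub>0 int) set" where
  "toeplitz_class R P Q \<psi> x = toeplitz_null R P Q \<psi> +>\<^bsub>free_rng (gens R P Q)\<^esub> x"

definition "iota_R R P Q \<psi> r = toeplitz_class R P Q \<psi> (frag_of [GenR r])"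
definition "iota_Q R P Q \<psi> q = toeplitz_class R P Q \<psi> (frag_of [GenQ q])"
definition "iota_P R P Q \<psi> p = toeplitz_class R P Q \<psi> (frag_of [GenP p])"

fun gen_deg :: "('r, 'q, 'p) gen \<Rightarrow> int" where
  "gen_deg (GenR r) = 0"
| "gen_deg (GenQ q) = 1"
| "gen_deg (GenP p) = - 1"

definition toeplitz_deg :: "('r, 'm) ring_scheme \<Rightarrow> ('r, 'p, 'n) bimodule_scheme
    \<Rightarrow> ('r, 'q, 'l) bimodule_scheme \<Rightarrow> (('p \<times> 'q \<Rightarrow>\<^sub>0 int) set \<Rightarrow> 'r)
    \<Rightarrow> int \<Rightarrow> (('r, 'q, 'p) gen list \<Rightarrow>\<^sub>0 int) set set" where
  "toeplitz_deg R P Q \<psi> n = {toeplitz_class R P Q \<psi> x | x. x \<in> carrier (free_rng (gens R P Q)) \<and>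
     (\<forall>w\<in>Poly_Mapping.keys x. sum_list (map gen_deg w) = n)}"


section \<open>The Cuntz--Pimsner ring\<close>

text \<open>Additive endomorphisms under pointwise addition and composition; maps are normalised to be
  \<open>undefined\<close> outside the carrier, so that equality is equality of maps on the carrier.\<close>

definition end_rng :: "('a, 'm) ring_scheme \<Rightarrow> ('a \<Rightarrow> 'a) ring" where
  "end_rng M = \<lparr>carrier = {f \<in> carrier M \<rightarrow>\<^sub>E carrier M.
       \<forall>x\<in>carrier M. \<forall>y\<in>carrier M. f (x \<oplus>\<^bsub>M\<^esub> y) = f x \<oplus>\<^bsub>M\<^esub> f y},
     monoid.mult = compose (carrier M), one = undefined,
     zero = (\<lambda>x\<in>carrier M. \<zero>\<^bsub>M\<^esub>), add = (\<lambda>f g. \<lambda>x\<in>carrier M. f x \<oplus>\<^bsub>M\<^esub> g x)\<rparr>"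

definition theta_Q :: "('r, 'm) ring_scheme \<Rightarrow> ('r, 'p, 'n) bimodule_scheme
    \<Rightarrow> ('r, 'q, 'l) bimodule_scheme \<Rightarrow> (('p \<times> 'q \<Rightarrow>\<^sub>0 int) set \<Rightarrow> 'r) \<Rightarrow> 'q \<Rightarrow> 'p \<Rightarrow> 'q \<Rightarrow> 'q" where
  "theta_Q R P Q \<psi> q p = (\<lambda>x\<in>carrier Q. rsmult Q q (\<psi> (tensor_elem R P Q p x)))"

definition theta_P :: "('r, 'm) ring_scheme \<Rightarrow> ('r, 'p, 'n) bimodule_scheme
    \<Rightarrow> ('r, 'q, 'l) bimodule_scheme \<Rightarrow> (('p \<times> 'q \<Rightarrow>\<^sub>0 int) set \<Rightarrow> 'r) \<Rightarrow> 'p \<Rightarrow> 'q \<Rightarrow> 'p \<Rightarrow> 'p" where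
  "theta_P R P Q \<psi> p q = (\<lambda>y\<in>carrier P. smult P (\<psi> (tensor_elem R P Q y q)) p)"

definition finite_rank_Q :: "('r, 'm) ring_scheme \<Rightarrow> ('r, 'p, 'n) bimodule_scheme
    \<Rightarrow> ('r, 'q, 'l) bimodule_scheme \<Rightarrow> (('p \<times> 'q \<Rightarrow>\<^sub>0 int) set \<Rightarrow> 'r) \<Rightarrow> ('q \<Rightarrow> 'q) set" where
  "finite_rank_Q R P Q \<psi> = generate (add_monoid (end_rng Q))
     {theta_Q R P Q \<psi> q p | q p. q \<in> carrier Q \<and> p \<in> carrier P}"

definition finite_rank_P :: "('r, 'm) ring_scheme \<Rightarrow> ('r, 'p, 'n) bimodule_scheme
    \<Rightarrow> ('r, 'q, 'l) bimodule_scheme \<Rightarrow> (('p \<times> 'q \<Rightarrow>\<^sub>0 int) set \<Rightarrow> 'r) \<Rightarrow> ('p \<Rightarrow> 'p) set" where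
  "finite_rank_P R P Q \<psi> = generate (add_monoid (end_rng P))
     {theta_P R P Q \<psi> p q | p q. p \<in> carrier P \<and> q \<in> carrier Q}"

definition condition_FS :: "('r, 'm) ring_scheme \<Rightarrow> ('r, 'p, 'n) bimodule_scheme
    \<Rightarrow> ('r, 'q, 'l) bimodule_scheme \<Rightarrow> (('p \<times> 'q \<Rightarrow>\<^sub>0 int) set \<Rightarrow> 'r) \<Rightarrow> bool" where
  "condition_FS R P Q \<psi> \<longleftrightarrow>
     (\<forall>X Y. finite X \<and> X \<subseteq> carrier Q \<and> finite Y \<and> Y \<subseteq> carrier P \<longrightarrow>
        (\<exists>\<Theta>\<in>finite_rank_Q R P Q \<psi>. \<exists>\<Phi>\<in>finite_rank_P R P Q \<psi>.
           (\<forall>q\<in>X. \<Theta> q = q) \<and> (\<forall>p\<in>Y. \<Phi> p = p)))"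

definition Delta :: "('r, 'q, 'l) bimodule_scheme \<Rightarrow> 'r \<Rightarrow> 'q \<Rightarrow> 'q" where
  "Delta Q r = (\<lambda>x\<in>carrier Q. smult Q r x)"

definition psi_compatible :: "('r, 'm) ring_scheme \<Rightarrow> ('r, 'p, 'n) bimodule_scheme
    \<Rightarrow> ('r, 'q, 'l) bimodule_scheme \<Rightarrow> (('p \<times> 'q \<Rightarrow>\<^sub>0 int) set \<Rightarrow> 'r) \<Rightarrow> 'r set \<Rightarrow> bool" where
  "psi_compatible R P Q \<psi> L \<longleftrightarrow>
     two_sided_ideal L R \<and> (\<forall>x\<in>L. Delta Q x \<in> finite_rank_Q R P Q \<psi>)"

definition ker_Delta :: "('r, 'm) ring_scheme \<Rightarrow> ('r, 'q, 'l) bimodule_scheme \<Rightarrow> 'r set" where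
  "ker_Delta R Q = {r \<in> carrier R. Delta Q r = \<zero>\<^bsub>end_rng Q\<^esub>}"

definition faithful_compatible :: "('r, 'm) ring_scheme \<Rightarrow> ('r, 'p, 'n) bimodule_scheme
    \<Rightarrow> ('r, 'q, 'l) bimodule_scheme \<Rightarrow> (('p \<times> 'q \<Rightarrow>\<^sub>0 int) set \<Rightarrow> 'r) \<Rightarrow> 'r set \<Rightarrow> bool" where
  "faithful_compatible R P Q \<psi> L \<longleftrightarrow>
     psi_compatible R P Q \<psi> L \<and> L \<inter> ker_Delta R Q = {\<zero>\<^bsub>R\<^esub>}"

definition uniquely_maximal :: "('r, 'm) ring_scheme \<Rightarrow> ('r, 'p, 'n) bimodule_scheme
    \<Rightarrow> ('r, 'q, 'l) bimodule_scheme \<Rightarrow> (('p \<times> 'q \<Rightarrow>\<^sub>0 int) set \<Rightarrow> 'r) \<Rightarrow> 'r set \<Rightarrow> bool" where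
  "uniquely_maximal R P Q \<psi> L \<longleftrightarrow> faithful_compatible R P Q \<psi> L \<and>
     (\<forall>L'. faithful_compatible R P Q \<psi> L' \<longrightarrow> L' \<subseteq> L)"

text \<open>The map on the ring of finite-rank operators induced by a covariant representation into \<open>B\<close>;
  it is well defined by \<open>pi_map_unique\<close> below, provided condition (FS) holds.\<close>

definition is_pi_map :: "('r, 'm) ring_scheme \<Rightarrow> ('r, 'p, 'n) bimodule_scheme
    \<Rightarrow> ('r, 'q, 'l) bimodule_scheme \<Rightarrow> (('p \<times> 'q \<Rightarrow>\<^sub>0 int) set \<Rightarrow> 'r) \<Rightarrow> ('b, 'k) ring_scheme
    \<Rightarrow> ('p \<Rightarrow> 'b) \<Rightarrow> ('q \<Rightarrow> 'b) \<Rightarrow> (('q \<Rightarrow> 'q) \<Rightarrow> 'b) \<Rightarrow> bool" where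
  "is_pi_map R P Q \<psi> B S T h \<longleftrightarrow> h \<in> extensional (finite_rank_Q R P Q \<psi>) \<and>
     h \<in> rng_hom (end_rng Q\<lparr>carrier := finite_rank_Q R P Q \<psi>\<rparr>) B \<and>
     (\<forall>q\<in>carrier Q. \<forall>p\<in>carrier P. h (theta_Q R P Q \<psi> q p) = T q \<otimes>\<^bsub>B\<^esub> S p)"

definition pi_map :: "('r, 'm) ring_scheme \<Rightarrow> ('r, 'p, 'n) bimodule_scheme
    \<Rightarrow> ('r, 'q, 'l) bimodule_scheme \<Rightarrow> (('p \<times> 'q \<Rightarrow>\<^sub>0 int) set \<Rightarrow> 'r) \<Rightarrow> ('b, 'k) ring_scheme
    \<Rightarrow> ('p \<Rightarrow> 'b) \<Rightarrow> ('q \<Rightarrow> 'b) \<Rightarrow> ('q \<Rightarrow> 'q) \<Rightarrow> 'b" where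
  "pi_map R P Q \<psi> B S T = (THE h. is_pi_map R P Q \<psi> B S T h)"

definition toeplitz_ideal :: "('r, 'm) ring_scheme \<Rightarrow> ('r, 'p, 'n) bimodule_scheme
    \<Rightarrow> ('r, 'q, 'l) bimodule_scheme \<Rightarrow> (('p \<times> 'q \<Rightarrow>\<^sub>0 int) set \<Rightarrow> 'r) \<Rightarrow> 'r set
    \<Rightarrow> (('r, 'q, 'p) gen list \<Rightarrow>\<^sub>0 int) set set" where
  "toeplitz_ideal R P Q \<psi> L = ideal_generated (toeplitz R P Q \<psi>)
     {iota_R R P Q \<psi> x \<ominus>\<^bsub>toeplitz R P Q \<psi>\<^esub>
        pi_map R P Q \<psi> (toeplitz R P Q \<psi>) (iota_P R P Q \<psi>) (iota_Q R P Q \<psi>) (Delta Q x) | x. x \<in> L}"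

definition cuntz_pimsner_defined :: "('r, 'm) ring_scheme \<Rightarrow> ('r, 'p, 'n) bimodule_scheme
    \<Rightarrow> ('r, 'q, 'l) bimodule_scheme \<Rightarrow> (('p \<times> 'q \<Rightarrow>\<^sub>0 int) set \<Rightarrow> 'r) \<Rightarrow> bool" where
  "cuntz_pimsner_defined R P Q \<psi> \<longleftrightarrow>
     rng_system R P Q \<psi> \<and> condition_FS R P Q \<psi> \<and> (\<exists>L. uniquely_maximal R P Q \<psi> L)"

text \<open>A uniquely maximal ideal is unique if it exists, so the description operator picks it.\<close>

definition cuntz_pimsner_null :: "('r, 'm) ring_scheme \<Rightarrow> ('r, 'p, 'n) bimodule_scheme
    \<Rightarrow> ('r, 'q, 'l) bimodule_scheme \<Rightarrow> (('p \<times> 'q \<Rightarrow>\<^sub>0 int) set \<Rightarrow> 'r)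
    \<Rightarrow> (('r, 'q, 'p) gen list \<Rightarrow>\<^sub>0 int) set set" where
  "cuntz_pimsner_null R P Q \<psi> = toeplitz_ideal R P Q \<psi> (THE L. uniquely_maximal R P Q \<psi> L)"

definition cuntz_pimsner :: "('r, 'm) ring_scheme \<Rightarrow> ('r, 'p, 'n) bimodule_scheme
    \<Rightarrow> ('r, 'q, 'l) bimodule_scheme \<Rightarrow> (('p \<times> 'q \<Rightarrow>\<^sub>0 int) set \<Rightarrow> 'r)
    \<Rightarrow> (('r, 'q, 'p) gen list \<Rightarrow>\<^sub>0 int) set set ring" where
  "cuntz_pimsner R P Q \<psi> = toeplitz R P Q \<psi> Quot cuntz_pimsner_null R P Q \<psi>"

definition cuntz_pimsner_class :: "('r, 'm) ring_scheme \<Rightarrow> ('r, 'p, 'n) bimodule_scheme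
    \<Rightarrow> ('r, 'q, 'l) bimodule_scheme \<Rightarrow> (('p \<times> 'q \<Rightarrow>\<^sub>0 int) set \<Rightarrow> 'r)
    \<Rightarrow> (('r, 'q, 'p) gen list \<Rightarrow>\<^sub>0 int) set \<Rightarrow> (('r, 'q, 'p) gen list \<Rightarrow>\<^sub>0 int) set set" where
  "cuntz_pimsner_class R P Q \<psi> t = cuntz_pimsner_null R P Q \<psi> +>\<^bsub>toeplitz R P Q \<psi>\<^esub> t"

definition cuntz_pimsner_deg :: "('r, 'm) ring_scheme \<Rightarrow> ('r, 'p, 'n) bimodule_scheme
    \<Rightarrow> ('r, 'q, 'l) bimodule_scheme \<Rightarrow> (('p \<times> 'q \<Rightarrow>\<^sub>0 int) set \<Rightarrow> 'r)
    \<Rightarrow> int \<Rightarrow> (('r, 'q, 'p) gen list \<Rightarrow>\<^sub>0 int) set set set" where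
  "cuntz_pimsner_deg R P Q \<psi> n = cuntz_pimsner_class R P Q \<psi> ` toeplitz_deg R P Q \<psi> n"

text \<open>\<open>sc\<close> is an algebra structure on the Cuntz--Pimsner ring that makes the canonical maps linear
  with respect to given scalar multiplications on \<open>R\<close>, \<open>P\<close> and \<open>Q\<close>. Its values on the ring are
  uniquely determined, since the images of these maps generate the ring.\<close>

definition cuntz_pimsner_scalars :: "('r, 'm) ring_scheme \<Rightarrow> ('r, 'p, 'n) bimodule_scheme
    \<Rightarrow> ('r, 'q, 'l) bimodule_scheme \<Rightarrow> (('p \<times> 'q \<Rightarrow>\<^sub>0 int) set \<Rightarrow> 'r)
    \<Rightarrow> ('k::field \<Rightarrow> 'r \<Rightarrow> 'r) \<Rightarrow> ('k \<Rightarrow> 'p \<Rightarrow> 'p) \<Rightarrow> ('k \<Rightarrow> 'q \<Rightarrow> 'q)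
    \<Rightarrow> ('k \<Rightarrow> (('r, 'q, 'p) gen list \<Rightarrow>\<^sub>0 int) set set \<Rightarrow> (('r, 'q, 'p) gen list \<Rightarrow>\<^sub>0 int) set set)
    \<Rightarrow> bool" where
  "cuntz_pimsner_scalars R P Q \<psi> scR scP scQ sc \<longleftrightarrow>
     scalar_algebra sc (cuntz_pimsner R P Q \<psi>) \<and>
     (\<forall>k. \<forall>r\<in>carrier R. cuntz_pimsner_class R P Q \<psi> (iota_R R P Q \<psi> (scR k r)) =
        sc k (cuntz_pimsner_class R P Q \<psi> (iota_R R P Q \<psi> r))) \<and>
     (\<forall>k. \<forall>p\<in>carrier P. cuntz_pimsner_class R P Q \<psi> (iota_P R P Q \<psi> (scP k p)) =
        sc k (cuntz_pimsner_class R P Q \<psi> (iota_P R P Q \<psi> p))) \<and>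
     (\<forall>k. \<forall>q\<in>carrier Q. cuntz_pimsner_class R P Q \<psi> (iota_Q R P Q \<psi> (scQ k q)) =
        sc k (cuntz_pimsner_class R P Q \<psi> (iota_Q R P Q \<psi> q)))"

definition steinberg_bimodule ::
    "'g top_groupoid \<Rightarrow> 'g set \<Rightarrow> ('g \<Rightarrow> 'k::field, 'g \<Rightarrow> 'k) bimodule" where
  "steinberg_bimodule G H = \<lparr>carrier = steinberg_on G H, monoid.mult = convolution G,
     one = undefined, zero = (\<lambda>x. 0), add = (\<lambda>f g x. f x + g x),
     smult = convolution G, rsmult = convolution G\<rparr>"


section \<open>Universal property of the Toeplitz ring\<close>

lemma frag_extend_add_fun:
  "frag_extend (\<lambda>u. f u + g u) x = frag_extend f x + frag_extend g x"
  by (simp add: frag_extend_def sum.distrib frag_cmul_distrib2)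

lemma word_mult_of [simp]: "word_mult (frag_of u) (frag_of v) = frag_of (u @ v)"
  by (simp add: word_mult_def)

lemma word_mult_0_left [simp]: "word_mult 0 y = 0"
  by (simp add: word_mult_def)

lemma word_mult_0_right [simp]: "word_mult x 0 = 0"
  by (simp add: word_mult_def frag_extend_eq_0)

lemma word_mult_add_left: "word_mult (x + x') y = word_mult x y + word_mult x' y"
  by (simp add: word_mult_def frag_extend_add)

lemma word_mult_add_right: "word_mult x (y + y') = word_mult x y + word_mult x y'"
  by (simp add: word_mult_def frag_extend_add frag_extend_add_fun)

lemma word_mult_diff_left: "word_mult (x - x') y = word_mult x y - word_mult x' y"
  by (simp add: word_mult_def frag_extend_diff)

lemma word_mult_diff_right: "word_mult x (y - y') = word_mult x y - word_mult x y'"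
  by (metis add_diff_cancel_right' diff_add_cancel word_mult_add_right)

lemma keys_word_mult:
  "Poly_Mapping.keys (word_mult x y) \<subseteq>
     {u @ v | u v. u \<in> Poly_Mapping.keys x \<and> v \<in> Poly_Mapping.keys y}"
proof -
  have 1: "Poly_Mapping.keys (frag_extend (\<lambda>v. frag_of (u @ v)) y) \<subseteq> {u @ v | v. v \<in> Poly_Mapping.keys y}"
    for u :: "'a list"
    using keys_frag_extend[of "\<lambda>v. frag_of (u @ v)" y] by fastforce
  have "Poly_Mapping.keys (word_mult x y) \<subseteq>
      (\<Union>u\<in>Poly_Mapping.keys x. Poly_Mapping.keys (frag_extend (\<lambda>v. frag_of (u @ v)) y))"
    unfolding word_mult_def by (rule keys_frag_extend)
  also have "\<dots> \<subseteq> {u @ v | u v. u \<in> Poly_Mapping.keys x \<and> v \<in> Poly_Mapping.keys y}"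
    using 1 by blast
  finally show ?thesis .
qed

lemma word_mult_assoc: "word_mult (word_mult x y) z = word_mult x (word_mult y z)"
proof -
  have 1: "word_mult (word_mult (frag_of u) (frag_of v)) z = word_mult (frag_of u) (word_mult (frag_of v) z)" for u v
  using subset_UNIV[of "Poly_Mapping.keys z"]
  proof (induction z rule: frag_induction)
    case (diff a b) then show ?case by (simp add: word_mult_diff_right)
  qed auto
  have 2: "word_mult (word_mult (frag_of u) y) z = word_mult (frag_of u) (word_mult y z)" for u
  using subset_UNIV[of "Poly_Mapping.keys y"]
  proof (induction y rule: frag_induction)
    case (one v) then show ?case using 1 by simp
  next
    case (diff a b) then show ?case by (simp add: word_mult_diff_right word_mult_diff_left)
  qed auto
  show ?thesis
  using subset_UNIV[of "Poly_Mapping.keys x"]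
  proof (induction x rule: frag_induction)
    case (one v) then show ?case using 2 by simp
  next
    case (diff a b) then show ?case by (simp add: word_mult_diff_left)
  qed auto
qed

lemma rng_free_rng: "rng (free_rng X)"
proof (intro rng.intro rng_axioms.intro)
  show "abelian_group (free_rng X)"
  proof (rule abelian_groupI)
    fix x y assume "x \<in> carrier (free_rng X)" "y \<in> carrier (free_rng X)"
    then show "x \<oplus>\<^bsub>free_rng X\<^esub> y \<in> carrier (free_rng X)"
      using keys_add[of x y] by (auto simp: free_rng_def)
  next
    fix x assume "x \<in> carrier (free_rng X)"
    then show "\<exists>y\<in>carrier (free_rng X). y \<oplus>\<^bsub>free_rng X\<^esub> x = \<zero>\<^bsub>free_rng X\<^esub>"
      by (intro bexI[of _ "- x"]) (auto simp: free_rng_def)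
  qed (auto simp: free_rng_def)
next
  fix x y assume "x \<in> carrier (free_rng X)" "y \<in> carrier (free_rng X)"
  then show "x \<otimes>\<^bsub>free_rng X\<^esub> y \<in> carrier (free_rng X)"
    using keys_word_mult[of x y] by (fastforce simp: free_rng_def)
qed (auto simp: free_rng_def word_mult_assoc word_mult_add_left word_mult_add_right)

lemma (in rng) rng_l_null [simp]: "x \<in> carrier R \<Longrightarrow> \<zero> \<otimes> x = \<zero>"
  using l_distr[of \<zero> \<zero> x] m_closed[of \<zero> x] by simp

lemma (in rng) rng_r_null [simp]: "x \<in> carrier R \<Longrightarrow> x \<otimes> \<zero> = \<zero>"
  using r_distr[of \<zero> \<zero> x] m_closed[of x \<zero>] by simp

lemma (in rng) rng_l_minus: "\<lbrakk>x \<in> carrier R; y \<in> carrier R\<rbrakk> \<Longrightarrow> (\<ominus> x) \<otimes> y = \<ominus> (x \<otimes> y)"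
  by (metis a_inv_closed l_distr l_neg m_closed minus_equality rng_l_null)

lemma (in rng) rng_r_minus: "\<lbrakk>x \<in> carrier R; y \<in> carrier R\<rbrakk> \<Longrightarrow> x \<otimes> (\<ominus> y) = \<ominus> (x \<otimes> y)"
  by (metis a_inv_closed r_distr l_neg m_closed minus_equality rng_r_null)

locale rng_ideal = rng R for R (structure) and L +
  assumes ideal: "two_sided_ideal L R"

sublocale rng_ideal \<subseteq> abelian_subgroup L R
  using ideal unfolding two_sided_ideal_def
  by (intro abelian_subgroupI3) (auto intro: abelian_group_axioms)

context rng_ideal
begin

lemma ideal_l: "\<lbrakk>a \<in> L; x \<in> carrier R\<rbrakk> \<Longrightarrow> x \<otimes> a \<in> L"
  and ideal_r: "\<lbrakk>a \<in> L; x \<in> carrier R\<rbrakk> \<Longrightarrow> a \<otimes> x \<in> L"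
  using ideal unfolding two_sided_ideal_def by auto

lemma coset_mult:
  assumes "x \<in> carrier R" "y \<in> carrier R"
  shows "(L +> x) \<otimes>\<^bsub>R Quot L\<^esub> (L +> y) = L +> (x \<otimes> y)"
proof -
  have "L +> (x' \<otimes> y') = L +> (x \<otimes> y)" if "x' \<in> L +> x" "y' \<in> L +> y" for x' y'
  proof -
    obtain a b where a: "a \<in> L" "x' = a \<oplus> x" and b: "b \<in> L" "y' = b \<oplus> y"
      using \<open>x' \<in> L +> x\<close> \<open>y' \<in> L +> y\<close> by (auto simp: a_r_coset_def')
    have c: "a \<in> carrier R" "b \<in> carrier R" using a b a_subset by auto
    have "x' \<otimes> y' = (a \<otimes> b \<oplus> a \<otimes> y \<oplus> x \<otimes> b) \<oplus> x \<otimes> y"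
      using c assms a b by (simp add: l_distr r_distr m_closed a_ac)
    moreover have "a \<otimes> b \<oplus> a \<otimes> y \<oplus> x \<otimes> b \<in> L"
      using a b c assms by (intro a_closed ideal_l ideal_r)
    ultimately have "x' \<otimes> y' \<in> L +> (x \<otimes> y)"
      by (auto simp: a_r_coset_def')
    then show ?thesis
      using assms m_closed a_repr_independence' additive_subgroup.a_subgroup additive_subgroup_axioms by metis
  qed
  then have "(\<Union>a\<in>L +> x. \<Union>b\<in>L +> y. L +> (a \<otimes> b)) = L +> (x \<otimes> y)"
    using a_rcos_self[OF assms(1)] a_rcos_self[OF assms(2)] by blast
  then show ?thesis by (simp add: FactRing_def rcoset_mult_def)
qed

lemma coset_add:
  assumes "x \<in> carrier R" "y \<in> carrier R"
  shows "(L +> x) \<oplus>\<^bsub>R Quot L\<^esub> (L +> y) = L +> (x \<oplus> y)"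
  using a_rcos_sum[OF assms] by (simp add: FactRing_def)

lemma carrier_quot: "carrier (R Quot L) = (+>) L ` carrier R"
  by (auto simp: FactRing_def A_RCOSETS_def')

lemma coset_closed: "x \<in> carrier R \<Longrightarrow> L +> x \<in> carrier (R Quot L)"
  by (simp add: carrier_quot)

lemma zero_quot: "\<zero>\<^bsub>R Quot L\<^esub> = L +> \<zero>"
  using a_coset_add_zero[OF a_subset] by (simp add: FactRing_def)

lemma coset_eqI:
  assumes "x \<in> carrier R" "y \<in> carrier R" "x \<ominus> y \<in> L"
  shows "L +> x = L +> y"
proof -
  have "x = (x \<ominus> y) \<oplus> y" using assms(1,2) by (simp add: a_minus_def a_assoc l_neg)
  then have "x \<in> L +> y" using assms(3) by (auto simp: a_r_coset_def')
  then show ?thesis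
    using assms a_repr_independence' additive_subgroup.a_subgroup additive_subgroup_axioms by metis
qed

lemma coset_eqD:
  assumes "x \<in> carrier R" "y \<in> carrier R" "L +> x = L +> y"
  shows "x \<ominus> y \<in> L"
proof -
  obtain a where "a \<in> L" "x = a \<oplus> y"
    using a_rcos_self[OF assms(1)] assms(3) by (auto simp: a_r_coset_def')
  moreover have "a \<in> carrier R" using \<open>a \<in> L\<close> a_subset by auto
  ultimately show ?thesis using assms by (simp add: a_minus_def a_assoc r_neg)
qed

lemma rng_quot: "rng (R Quot L)"
proof (intro rng.intro rng_axioms.intro)
  show "abelian_group (R Quot L)"
    by (rule comm_group_abelian_groupI)
      (simp add: FactRing_def a_factorgroup_is_comm_group[unfolded A_FactGroup_def'])
qed (auto simp: carrier_quot coset_mult coset_add m_assoc l_distr r_distr m_closed)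

end

lemma rng_hom_zero:
  assumes "rng R" "rng S" "h \<in> rng_hom R S"
  shows "h \<zero>\<^bsub>R\<^esub> = \<zero>\<^bsub>S\<^esub>"
proof -
  interpret R: rng R by fact
  interpret S: rng S by fact
  have c: "h \<zero>\<^bsub>R\<^esub> \<in> carrier S" using assms by (auto simp: rng_hom_def)
  have "h (\<zero>\<^bsub>R\<^esub> \<oplus>\<^bsub>R\<^esub> \<zero>\<^bsub>R\<^esub>) = h \<zero>\<^bsub>R\<^esub> \<oplus>\<^bsub>S\<^esub> h \<zero>\<^bsub>R\<^esub>"
    using assms R.zero_closed unfolding rng_hom_def by blast
  then show ?thesis using c by simp
qed

lemma rng_hom_minus:
  assumes "rng R" "rng S" "h \<in> rng_hom R S" "x \<in> carrier R"
  shows "h (\<ominus>\<^bsub>R\<^esub> x) = \<ominus>\<^bsub>S\<^esub> h x"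
proof -
  interpret R: rng R by fact
  interpret S: rng S by fact
  have c: "h x \<in> carrier S" "h (\<ominus>\<^bsub>R\<^esub> x) \<in> carrier S" using assms by (auto simp: rng_hom_def)
  have "h (\<ominus>\<^bsub>R\<^esub> x) \<oplus>\<^bsub>S\<^esub> h x = h (\<ominus>\<^bsub>R\<^esub> x \<oplus>\<^bsub>R\<^esub> x)"
    using assms by (simp add: rng_hom_def)
  also have "\<dots> = \<zero>\<^bsub>S\<^esub>" using assms rng_hom_zero[OF assms(1-3)] by (simp add: R.l_neg)
  finally show ?thesis using c S.minus_equality by metis
qed

lemma rng_hom_diff:
  assumes "rng R" "rng S" "h \<in> rng_hom R S" "x \<in> carrier R" "y \<in> carrier R"
  shows "h (x \<ominus>\<^bsub>R\<^esub> y) = h x \<ominus>\<^bsub>S\<^esub> h y"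
proof -
  interpret R: rng R by fact
  show ?thesis
    using assms rng_hom_minus[OF assms(1-3)] by (simp add: a_minus_def rng_hom_def)
qed

lemma two_sided_ideal_kernel:
  assumes "rng R" "rng S" "h \<in> rng_hom R S"
  shows "two_sided_ideal {x \<in> carrier R. h x = \<zero>\<^bsub>S\<^esub>} R"
proof -
  interpret R: rng R by fact
  interpret S: rng S by fact
  have hc: "x \<in> carrier R \<Longrightarrow> h x \<in> carrier S" for x using assms by (auto simp: rng_hom_def)
  have "additive_subgroup {x \<in> carrier R. h x = \<zero>\<^bsub>S\<^esub>} R"
    unfolding additive_subgroup_def
  proof (rule R.add.subgroupI)
    show "{x \<in> carrier R. h x = \<zero>\<^bsub>S\<^esub>} \<noteq> {}" using rng_hom_zero[OF assms] by auto
  qed (use assms rng_hom_minus[OF assms] in \<open>auto simp: rng_hom_def\<close>)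
  then show ?thesis
    using assms hc by (auto simp: two_sided_ideal_def rng_hom_def R.m_closed)
qed

lemma two_sided_ideal_generated:
  assumes "rng R" "X \<subseteq> carrier R"
  shows "two_sided_ideal (ideal_generated R X) R" "X \<subseteq> ideal_generated R X"
proof -
  interpret R: rng R by fact
  let ?F = "{L. two_sided_ideal L R \<and> X \<subseteq> L}"
  have "two_sided_ideal (carrier R) R"
    by (auto simp: two_sided_ideal_def R.m_closed additive_subgroup_def intro!: R.add.subgroupI)
  then have ne: "?F \<noteq> {}" using assms by auto
  have "additive_subgroup (\<Inter>?F) R"
    unfolding additive_subgroup_def
    by (rule R.add.subgroups_Inter) (use ne in \<open>auto simp: two_sided_ideal_def additive_subgroup_def\<close>)
  then show "two_sided_ideal (ideal_generated R X) R"
    unfolding ideal_generated_def two_sided_ideal_def by auto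
  show "X \<subseteq> ideal_generated R X" by (auto simp: ideal_generated_def)
qed

lemma ideal_generated_minimal:
  "\<lbrakk>two_sided_ideal L R; X \<subseteq> L\<rbrakk> \<Longrightarrow> ideal_generated R X \<subseteq> L"
  by (auto simp: ideal_generated_def)

text \<open>The universal property of the free ring.\<close>

fun eval_word :: "('b, 'm) ring_scheme \<Rightarrow> ('x \<Rightarrow> 'b) \<Rightarrow> 'x list \<Rightarrow> 'b" where
  "eval_word B g [] = undefined"
| "eval_word B g [x] = g x"
| "eval_word B g (x # y # w) = g x \<otimes>\<^bsub>B\<^esub> eval_word B g (y # w)"

lemma eval_word_closed:
  assumes "rng B" "g ` X \<subseteq> carrier B" "w \<noteq> []" "set w \<subseteq> X"
  shows "eval_word B g w \<in> carrier B"
  using assms(3,4) by (induction w rule: induct_list012)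
    (use assms(1,2) in \<open>auto intro!: rng.m_closed\<close>)

lemma eval_word_append:
  assumes "rng B" "g ` X \<subseteq> carrier B" "u \<noteq> []" "set u \<subseteq> X" "v \<noteq> []" "set v \<subseteq> X"
  shows "eval_word B g (u @ v) = eval_word B g u \<otimes>\<^bsub>B\<^esub> eval_word B g v"
  using assms(3,4)
proof (induction u)
  case (Cons x u)
  show ?case
  proof (cases u)
    case Nil
    then show ?thesis using assms by (cases v) auto
  next
    case (Cons y u')
    then have "eval_word B g (u @ v) = eval_word B g u \<otimes>\<^bsub>B\<^esub> eval_word B g v"
      using Cons.IH Cons.prems by auto
    moreover have "g x \<in> carrier B" "eval_word B g u \<in> carrier B" "eval_word B g v \<in> carrier B"
      using Cons Cons.prems assms by (auto intro!: eval_word_closed[where X=X])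
    ultimately show ?thesis
      using Cons rng.m_assoc[OF assms(1)] by auto
  qed
qed simp

lemma free_rng_universal:
  fixes B :: "('b, 'm) ring_scheme" and X :: "'x set"
  assumes B: "rng B" and g: "g ` X \<subseteq> carrier B"
  obtains h where "h \<in> rng_hom (free_rng X) B" "\<And>x. x \<in> X \<Longrightarrow> h (frag_of [x]) = g x"
proof -
  interpret B: rng B by fact
  let ?W = "{w. w \<noteq> [] \<and> set w \<subseteq> X}"
  have cl: "eval_word B g ` ?W \<subseteq> carrier (add_monoid B)"
    using eval_word_closed[OF B g] by auto
  obtain h where h: "h \<in> hom (free_Abelian_group ?W) (add_monoid B)"
    and hw: "\<And>w. w \<in> ?W \<Longrightarrow> h (frag_of w) = eval_word B g w"
    by (rule comm_group.free_Abelian_group_universal[OF B.a_comm_group cl], rule that) auto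
  have hc: "h x \<in> carrier B" if "Poly_Mapping.keys x \<subseteq> ?W" for x
    using h that by (auto simp: hom_def)
  have hadd: "h (x + y) = h x \<oplus>\<^bsub>B\<^esub> h y"
    if "Poly_Mapping.keys x \<subseteq> ?W" "Poly_Mapping.keys y \<subseteq> ?W" for x y
    using h that by (auto simp: hom_def)
  have kd: "Poly_Mapping.keys (x - y) \<subseteq> ?W"
    if "Poly_Mapping.keys x \<subseteq> ?W" "Poly_Mapping.keys y \<subseteq> ?W" for x y :: "'x list \<Rightarrow>\<^sub>0 int"
    using that keys_diff[of x y] by blast
  have kw: "Poly_Mapping.keys (word_mult x y) \<subseteq> ?W"
    if "Poly_Mapping.keys x \<subseteq> ?W" "Poly_Mapping.keys y \<subseteq> ?W" for x y :: "'x list \<Rightarrow>\<^sub>0 int"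
    using that keys_word_mult[of x y] by fastforce
  have hdiff: "h (x - y) = h x \<ominus>\<^bsub>B\<^esub> h y"
    if "Poly_Mapping.keys x \<subseteq> ?W" "Poly_Mapping.keys y \<subseteq> ?W" for x y
  proof -
    have "h x = h (x - y) \<oplus>\<^bsub>B\<^esub> h y" using hadd[of "x - y" y] kd that by simp
    then show ?thesis
      using hc[OF that(1)] hc[OF that(2)] hc[OF kd[OF that]]
      by (simp add: a_minus_def B.a_assoc B.r_neg)
  qed
  have h0: "h 0 = \<zero>\<^bsub>B\<^esub>" using hadd[of 0 0] hc[of 0] by simp
  have m1: "h (word_mult (frag_of u) y) = h (frag_of u) \<otimes>\<^bsub>B\<^esub> h y"
    if u: "u \<in> ?W" and y: "Poly_Mapping.keys y \<subseteq> ?W" for u y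
    using y
  proof (induction y rule: free_Abelian_group_induct[consumes 1, case_names zero diff one])
    case zero then show ?case using h0 hc[of "frag_of u"] u by simp
  next
    case (diff x y)
    moreover have "Poly_Mapping.keys (frag_of u) \<subseteq> ?W" using u by simp
    ultimately show ?case
      using hc
      by (simp add: word_mult_diff_right hdiff kw a_minus_def B.r_distr B.rng_r_minus)
  next
    case (one v)
    then have "h (frag_of (u @ v)) = eval_word B g (u @ v)" using u by (intro hw) auto
    then show ?case using one u hw[of u] hw[of v] eval_word_append[OF B g] by auto
  qed
  have m2: "h (word_mult x y) = h x \<otimes>\<^bsub>B\<^esub> h y"
    if x: "Poly_Mapping.keys x \<subseteq> ?W" and y: "Poly_Mapping.keys y \<subseteq> ?W" for x y
    using x
  proof (induction x rule: free_Abelian_group_induct[consumes 1, case_names zero diff one])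
    case zero then show ?case using h0 hc[OF y] by simp
  next
    case (diff x x')
    then show ?case
      using hc y
      by (simp add: word_mult_diff_left hdiff kw a_minus_def B.l_distr B.rng_l_minus)
  next
    case (one v)
    then show ?case using m1 y by auto
  qed
  show ?thesis
  proof
    show "h \<in> rng_hom (free_rng X) B"
      using hc hadd m2 by (auto simp: rng_hom_def free_rng_def)
    show "h (frag_of [x]) = g x" if "x \<in> X" for x using hw[of "[x]"] that by simp
  qed
qed

lemma keys_diff_le:
  "\<lbrakk>Poly_Mapping.keys x \<subseteq> Z; Poly_Mapping.keys y \<subseteq> Z\<rbrakk> \<Longrightarrow> Poly_Mapping.keys (x - y) \<subseteq> Z"
  for x y :: "'x \<Rightarrow>\<^sub>0 int"
  using keys_diff[of x y] by blast

lemma keys_add_le: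
  "\<lbrakk>Poly_Mapping.keys x \<subseteq> Z; Poly_Mapping.keys y \<subseteq> Z\<rbrakk> \<Longrightarrow> Poly_Mapping.keys (x + y) \<subseteq> Z"
  for x y :: "'x \<Rightarrow>\<^sub>0 int"
  using keys_add[of x y] by blast

lemma tensor_rels_carrier:
  assumes "rng_bimodule R P" "rng_bimodule R Q"
  shows "tensor_rels R P Q \<subseteq> carrier (free_Abelian_group (carrier P \<times> carrier Q))"
proof -
  interpret P: rng_bimodule R P by fact
  interpret Q: rng_bimodule R Q by fact
  have "Poly_Mapping.keys x \<subseteq> carrier P \<times> carrier Q" if "x \<in> tensor_rels R P Q" for x
    using that unfolding tensor_rels_def
    by - (elim UnE CollectE exE conjE; hypsubst; intro keys_diff_le; simp add: P.right_closed Q.left_closed)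
  then show ?thesis by auto
qed

lemma tensor_null_subgroup:
  assumes "rng_bimodule R P" "rng_bimodule R Q"
  shows "subgroup (tensor_null R P Q) (free_Abelian_group (carrier P \<times> carrier Q))"
  unfolding tensor_null_def
  by (rule group.generate_is_subgroup[OF group_free_Abelian_group tensor_rels_carrier[OF assms]])

lemma tensor_rels_null: "x \<in> tensor_rels R P Q \<Longrightarrow> x \<in> tensor_null R P Q"
  unfolding tensor_null_def by (rule generate.incl)

lemma tensor_relsI:
  "\<lbrakk>p \<in> carrier P; p' \<in> carrier P; q \<in> carrier Q\<rbrakk> \<Longrightarrow>
     frag_of (p \<oplus>\<^bsub>P\<^esub> p', q) - frag_of (p, q) - frag_of (p', q) \<in> tensor_rels R P Q"
  "\<lbrakk>p \<in> carrier P; q \<in> carrier Q; q' \<in> carrier Q\<rbrakk> \<Longrightarrow>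
     frag_of (p, q \<oplus>\<^bsub>Q\<^esub> q') - frag_of (p, q) - frag_of (p, q') \<in> tensor_rels R P Q"
  "\<lbrakk>p \<in> carrier P; r \<in> carrier R; q \<in> carrier Q\<rbrakk> \<Longrightarrow>
     frag_of (rsmult P p r, q) - frag_of (p, smult Q r q) \<in> tensor_rels R P Q"
  unfolding tensor_rels_def by blast+

lemma tensor_relsE:
  assumes "x \<in> tensor_rels R P Q"
  obtains p p' q where "p \<in> carrier P" "p' \<in> carrier P" "q \<in> carrier Q"
      "x = frag_of (p \<oplus>\<^bsub>P\<^esub> p', q) - frag_of (p, q) - frag_of (p', q)"
  | p q q' where "p \<in> carrier P" "q \<in> carrier Q" "q' \<in> carrier Q"
      "x = frag_of (p, q \<oplus>\<^bsub>Q\<^esub> q') - frag_of (p, q) - frag_of (p, q')"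
  | p r q where "p \<in> carrier P" "r \<in> carrier R" "q \<in> carrier Q"
      "x = frag_of (rsmult P p r, q) - frag_of (p, smult Q r q)"
  using assms unfolding tensor_rels_def by blast

lemma tensor_class_closed:
  assumes "Poly_Mapping.keys x \<subseteq> carrier P \<times> carrier Q"
  shows "tensor_class R P Q x \<in> carrier (tensor R P Q)"
  using assms by (auto simp: tensor_class_def tensor_def RCOSETS_def)

lemma tensor_elem_closed:
  assumes "p \<in> carrier P" "q \<in> carrier Q"
  shows "tensor_elem R P Q p q \<in> carrier (tensor R P Q)"
  using assms by (simp add: tensor_elem_def tensor_class_closed)

lemma tensor_class_add:
  assumes "rng_bimodule R P" "rng_bimodule R Q"
    and "Poly_Mapping.keys x \<subseteq> carrier P \<times> carrier Q" "Poly_Mapping.keys y \<subseteq> carrier P \<times> carrier Q"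
  shows "tensor_class R P Q x \<oplus>\<^bsub>tensor R P Q\<^esub> tensor_class R P Q y = tensor_class R P Q (x + y)"
proof -
  interpret F: comm_group "free_Abelian_group (carrier P \<times> carrier Q)"
    by (rule abelian_free_Abelian_group)
  interpret N: normal "tensor_null R P Q" "free_Abelian_group (carrier P \<times> carrier Q)"
    by (rule F.subgroup_imp_normal[OF tensor_null_subgroup[OF assms(1,2)]])
  show ?thesis
    using N.rcos_sum[of x y] assms(3,4) by (simp add: tensor_class_def tensor_def)
qed

lemma tensor_class_eqI:
  assumes "rng_bimodule R P" "rng_bimodule R Q"
    and "Poly_Mapping.keys x \<subseteq> carrier P \<times> carrier Q" "Poly_Mapping.keys y \<subseteq> carrier P \<times> carrier Q"
    and "x - y \<in> tensor_null R P Q"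
  shows "tensor_class R P Q x = tensor_class R P Q y"
proof -
  interpret F: comm_group "free_Abelian_group (carrier P \<times> carrier Q)"
    by (rule abelian_free_Abelian_group)
  have "x \<in> tensor_null R P Q #>\<^bsub>free_Abelian_group (carrier P \<times> carrier Q)\<^esub> y"
    unfolding r_coset_def using assms(5) by (intro UN_I[of "x - y"]) auto
  then show ?thesis
    unfolding tensor_class_def
    using F.repr_independence[of x _ y] assms(3,4) tensor_null_subgroup[OF assms(1,2)] by auto
qed

lemma tensor_elem_relations:
  assumes "rng_bimodule R P" "rng_bimodule R Q"
  shows "\<lbrakk>p \<in> carrier P; p' \<in> carrier P; q \<in> carrier Q\<rbrakk> \<Longrightarrow>
      tensor_elem R P Q (p \<oplus>\<^bsub>P\<^esub> p') q = tensor_elem R P Q p q \<oplus>\<^bsub>tensor R P Q\<^esub> tensor_elem R P Q p' q"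
    and "\<lbrakk>p \<in> carrier P; q \<in> carrier Q; q' \<in> carrier Q\<rbrakk> \<Longrightarrow>
      tensor_elem R P Q p (q \<oplus>\<^bsub>Q\<^esub> q') = tensor_elem R P Q p q \<oplus>\<^bsub>tensor R P Q\<^esub> tensor_elem R P Q p q'"
    and "\<lbrakk>p \<in> carrier P; r \<in> carrier R; q \<in> carrier Q\<rbrakk> \<Longrightarrow>
      tensor_elem R P Q (rsmult P p r) q = tensor_elem R P Q p (smult Q r q)"
proof -
  interpret P: rng_bimodule R P by fact
  interpret Q: rng_bimodule R Q by fact
  show "tensor_elem R P Q (p \<oplus>\<^bsub>P\<^esub> p') q = tensor_elem R P Q p q \<oplus>\<^bsub>tensor R P Q\<^esub> tensor_elem R P Q p' q"
    if "p \<in> carrier P" "p' \<in> carrier P" "q \<in> carrier Q"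
  proof -
    have "tensor_class R P Q (frag_of (p \<oplus>\<^bsub>P\<^esub> p', q)) = tensor_class R P Q (frag_of (p, q) + frag_of (p', q))"
      by (rule tensor_class_eqI[OF assms _ keys_add_le])
        (use that tensor_rels_null[OF tensor_relsI(1)[OF that]] in \<open>simp_all add: diff_diff_eq\<close>)
    then show ?thesis using that by (simp add: tensor_elem_def tensor_class_add[OF assms])
  qed
  show "tensor_elem R P Q p (q \<oplus>\<^bsub>Q\<^esub> q') = tensor_elem R P Q p q \<oplus>\<^bsub>tensor R P Q\<^esub> tensor_elem R P Q p q'"
    if "p \<in> carrier P" "q \<in> carrier Q" "q' \<in> carrier Q"
  proof -
    have "tensor_class R P Q (frag_of (p, q \<oplus>\<^bsub>Q\<^esub> q')) = tensor_class R P Q (frag_of (p, q) + frag_of (p, q'))"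
      by (rule tensor_class_eqI[OF assms _ keys_add_le])
        (use that tensor_rels_null[OF tensor_relsI(2)[OF that]] in \<open>simp_all add: diff_diff_eq\<close>)
    then show ?thesis using that by (simp add: tensor_elem_def tensor_class_add[OF assms])
  qed
  show "tensor_elem R P Q (rsmult P p r) q = tensor_elem R P Q p (smult Q r q)"
    if "p \<in> carrier P" "r \<in> carrier R" "q \<in> carrier Q"
    unfolding tensor_elem_def
    by (rule tensor_class_eqI[OF assms])
      (use that tensor_rels_null[OF tensor_relsI(3)[OF that]] in
        \<open>simp_all add: P.right_closed Q.left_closed\<close>)
qed

text \<open>The actions on the tensor product are well defined.\<close>

lemma tensor_null_generate_le:
  assumes "subgroup N (free_Abelian_group Z)" "\<And>x. x \<in> X \<Longrightarrow> f x \<in> N"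
    and "\<And>x y. f (x + y) = f x + f y" "X \<subseteq> carrier (free_Abelian_group Y)"
    and "x \<in> generate (free_Abelian_group Y) X"
  shows "f x \<in> N"
proof -
  interpret N: subgroup N "free_Abelian_group Z" by fact
  have f0: "f 0 = 0" using assms(3)[of 0 0] by simp
  have fm: "f (- y) = - f y" for y using assms(3)[of y "- y"] f0 by (simp add: add_eq_0_iff2)
  show ?thesis
    using assms(5)
  proof (induction x rule: generate.induct)
    case one then show ?case using f0 N.one_closed by simp
  next
    case (incl h) then show ?case using assms(2) by simp
  next
    case (inv h)
    then have "inv\<^bsub>free_Abelian_group Z\<^esub> f h \<in> N" using assms(2) N.m_inv_closed by blast
    moreover have "Poly_Mapping.keys (f h) \<subseteq> Z" using subsetD[OF N.subset assms(2)[OF inv]] by simp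
    moreover have "Poly_Mapping.keys h \<subseteq> Y" using subsetD[OF assms(4) inv] by simp
    ultimately show ?case using fm by simp
  next
    case (eng a b) then show ?case using assms(3) N.m_closed by simp
  qed
qed

lemma tensor_action_class:
  assumes PQ: "rng_bimodule R P" "rng_bimodule R Q"
    and f: "\<And>p q. p \<in> carrier P \<Longrightarrow> q \<in> carrier Q \<Longrightarrow> f (p, q) \<in> carrier P \<times> carrier Q"
    and null: "\<And>x. x \<in> tensor_null R P Q \<Longrightarrow> frag_extend (\<lambda>z. frag_of (f z)) x \<in> tensor_null R P Q"
    and x: "Poly_Mapping.keys x \<subseteq> carrier P \<times> carrier Q"
  shows "(\<Union>y\<in>tensor_class R P Q x. tensor_class R P Q (frag_extend (\<lambda>z. frag_of (f z)) y)) =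
    tensor_class R P Q (frag_extend (\<lambda>z. frag_of (f z)) x)"
proof -
  interpret N: subgroup "tensor_null R P Q" "free_Abelian_group (carrier P \<times> carrier Q)"
    by (rule tensor_null_subgroup[OF PQ])
  have k: "Poly_Mapping.keys (frag_extend (\<lambda>z. frag_of (f z)) y) \<subseteq> carrier P \<times> carrier Q"
    if "Poly_Mapping.keys y \<subseteq> carrier P \<times> carrier Q" for y
    using keys_frag_extend[of "\<lambda>z. frag_of (f z)" y] f that by fastforce
  have "tensor_class R P Q (frag_extend (\<lambda>z. frag_of (f z)) y) =
      tensor_class R P Q (frag_extend (\<lambda>z. frag_of (f z)) x)" if y: "y \<in> tensor_class R P Q x" for y
  proof -
    obtain n where n: "n \<in> tensor_null R P Q" "y = n + x"
      using y by (auto simp: tensor_class_def r_coset_def)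
    then have "Poly_Mapping.keys n \<subseteq> carrier P \<times> carrier Q"
      using subsetD[OF N.subset n(1)] by simp
    then have "Poly_Mapping.keys y \<subseteq> carrier P \<times> carrier Q"
      using x keys_add[of n x] n by blast
    then show ?thesis
      using null[OF n(1)] n by (intro tensor_class_eqI[OF PQ] k x) (auto simp: frag_extend_add)
  qed
  moreover have "x \<in> tensor_class R P Q x"
    unfolding tensor_class_def r_coset_def using N.one_closed by (intro UN_I[of 0]) auto
  ultimately show ?thesis by blast
qed

lemma tensor_elem_smult:
  assumes PQ: "rng_bimodule R P" "rng_bimodule R Q"
    and "r \<in> carrier R" "p \<in> carrier P" "q \<in> carrier Q"
  shows "smult (tensor R P Q) r (tensor_elem R P Q p q) = tensor_elem R P Q (smult P r p) q"
    and "rsmult (tensor R P Q) (tensor_elem R P Q p q) r = tensor_elem R P Q p (rsmult Q q r)"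
proof -
  interpret P: rng_bimodule R P by fact
  interpret Q: rng_bimodule R Q by fact
  have "frag_extend (\<lambda>z. frag_of (smult P r (fst z), snd z)) x \<in> tensor_null R P Q"
    if "x \<in> tensor_null R P Q" for x
  proof (rule tensor_null_generate_le[OF tensor_null_subgroup[OF PQ] _ _ tensor_rels_carrier[OF PQ]
        that[unfolded tensor_null_def]])
    fix x assume "x \<in> tensor_rels R P Q"
    then show "frag_extend (\<lambda>z. frag_of (smult P r (fst z), snd z)) x \<in> tensor_null R P Q"
      by (rule tensor_relsE)
        (simp_all add: frag_extend_diff P.left_add P.left_closed P.left_right[symmetric] assms(3)
          tensor_rels_null tensor_relsI)
  qed (simp add: frag_extend_add)
  from tensor_action_class[OF PQ _ this, of "frag_of (p, q)"]
  show "smult (tensor R P Q) r (tensor_elem R P Q p q) = tensor_elem R P Q (smult P r p) q"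
    using assms P.left_closed by (simp add: tensor_def tensor_elem_def case_prod_unfold)
  have "frag_extend (\<lambda>z. frag_of (fst z, rsmult Q (snd z) r)) x \<in> tensor_null R P Q"
    if "x \<in> tensor_null R P Q" for x
  proof (rule tensor_null_generate_le[OF tensor_null_subgroup[OF PQ] _ _ tensor_rels_carrier[OF PQ]
        that[unfolded tensor_null_def]])
    fix x assume "x \<in> tensor_rels R P Q"
    then show "frag_extend (\<lambda>z. frag_of (fst z, rsmult Q (snd z) r)) x \<in> tensor_null R P Q"
      by (rule tensor_relsE)
        (simp_all add: frag_extend_diff Q.right_add Q.right_closed Q.left_right assms(3)
          tensor_rels_null tensor_relsI)
  qed (simp add: frag_extend_add)
  from tensor_action_class[OF PQ _ this, of "frag_of (p, q)"]
  show "rsmult (tensor R P Q) (tensor_elem R P Q p q) r = tensor_elem R P Q p (rsmult Q q r)"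
    using assms Q.right_closed by (simp add: tensor_def tensor_elem_def case_prod_unfold)
qed

context rng_system
begin

abbreviation "psi p q \<equiv> \<psi> (tensor_elem R P Q p q)"

lemma \<psi>_homD:
  shows "t \<in> carrier (tensor R P Q) \<Longrightarrow> \<psi> t \<in> carrier R"
    and "\<lbrakk>t \<in> carrier (tensor R P Q); u \<in> carrier (tensor R P Q)\<rbrakk>
      \<Longrightarrow> \<psi> (t \<oplus>\<^bsub>tensor R P Q\<^esub> u) = \<psi> t \<oplus>\<^bsub>R\<^esub> \<psi> u"
    and "\<lbrakk>t \<in> carrier (tensor R P Q); r \<in> carrier R\<rbrakk> \<Longrightarrow> \<psi> (smult (tensor R P Q) r t) = r \<otimes>\<^bsub>R\<^esub> \<psi> t"
    and "\<lbrakk>t \<in> carrier (tensor R P Q); r \<in> carrier R\<rbrakk> \<Longrightarrow> \<psi> (rsmult (tensor R P Q) t r) = \<psi> t \<otimes>\<^bsub>R\<^esub> r"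
  using \<psi>_hom unfolding bimodule_hom_def regular_bimodule_def bimodule.simps module.simps
    ring.simps monoid.simps partial_object.simps by blast+

lemma psi_closed: "\<lbrakk>p \<in> carrier P; q \<in> carrier Q\<rbrakk> \<Longrightarrow> psi p q \<in> carrier R"
  by (intro \<psi>_homD(1) tensor_elem_closed)

lemma psi_relations:
  shows "\<lbrakk>p \<in> carrier P; p' \<in> carrier P; q \<in> carrier Q\<rbrakk> \<Longrightarrow> psi (p \<oplus>\<^bsub>P\<^esub> p') q = psi p q \<oplus>\<^bsub>R\<^esub> psi p' q"
    and "\<lbrakk>p \<in> carrier P; q \<in> carrier Q; q' \<in> carrier Q\<rbrakk> \<Longrightarrow> psi p (q \<oplus>\<^bsub>Q\<^esub> q') = psi p q \<oplus>\<^bsub>R\<^esub> psi p q'"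
    and "\<lbrakk>p \<in> carrier P; r \<in> carrier R; q \<in> carrier Q\<rbrakk> \<Longrightarrow> psi (rsmult P p r) q = psi p (smult Q r q)"
    and "\<lbrakk>p \<in> carrier P; r \<in> carrier R; q \<in> carrier Q\<rbrakk> \<Longrightarrow> psi (smult P r p) q = r \<otimes>\<^bsub>R\<^esub> psi p q"
    and "\<lbrakk>p \<in> carrier P; r \<in> carrier R; q \<in> carrier Q\<rbrakk> \<Longrightarrow> psi p (rsmult Q q r) = psi p q \<otimes>\<^bsub>R\<^esub> r"
  using tensor_elem_relations[OF P.rng_bimodule_axioms Q.rng_bimodule_axioms]
    tensor_elem_smult[OF P.rng_bimodule_axioms Q.rng_bimodule_axioms, symmetric]
  by (simp_all add: \<psi>_homD tensor_elem_closed)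

lemma toeplitz_rels_carrier: "toeplitz_rels R P Q \<psi> \<subseteq> carrier (free_rng (gens R P Q))"
proof -
  let ?W = "{w. w \<noteq> [] \<and> set w \<subseteq> gens R P Q}"
  have "Poly_Mapping.keys x \<subseteq> ?W" if "x \<in> toeplitz_rels R P Q \<psi>" for x
    using that unfolding toeplitz_rels_def
    apply -
    apply (elim UnE CollectE exE conjE; hypsubst; intro keys_diff_le)
    by (auto simp: gens_def P.left_closed P.right_closed Q.left_closed Q.right_closed psi_closed
        P.R.m_closed)
  then show ?thesis by (auto simp: free_rng_def)
qed

lemma rng_ideal_toeplitz: "rng_ideal (free_rng (gens R P Q)) (toeplitz_null R P Q \<psi>)"
  unfolding toeplitz_null_def
  by (intro rng_ideal.intro rng_free_rng rng_ideal_axioms.intro two_sided_ideal_generated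
      toeplitz_rels_carrier)

end

sublocale rng_system \<subseteq> F: rng_ideal "free_rng (gens R P Q)" "toeplitz_null R P Q \<psi>"
  by (rule rng_ideal_toeplitz)

lemma free_rng_minus:
  assumes "x \<in> carrier (free_rng X)" "y \<in> carrier (free_rng X)"
  shows "x \<ominus>\<^bsub>free_rng X\<^esub> y = x - y"
proof -
  interpret rng "free_rng X" by (rule rng_free_rng)
  have "\<ominus>\<^bsub>free_rng X\<^esub> y = - y"
    by (rule minus_equality) (use assms in \<open>auto simp: free_rng_def\<close>)
  then show ?thesis by (simp add: a_minus_def) (simp add: free_rng_def)
qed

lemma (in rng) subrng_carrier: "subrng (carrier R) R"
  using add.subgroup_self by (simp add: subrng_def additive_subgroup_def m_closed)

lemma (in abelian_group) add_minus_minus: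
  assumes "a \<in> carrier G" "b \<in> carrier G"
  shows "(a \<oplus> b) \<ominus> a \<ominus> b = \<zero>"
proof -
  have "(a \<oplus> b) \<ominus> a = b"
    using assms a_comm[of a b] by (simp add: a_minus_def a_assoc r_neg)
  then show ?thesis using assms by (simp add: a_minus_def r_neg)
qed

lemma toeplitz_relsI:
  "\<lbrakk>r \<in> carrier R; s \<in> carrier R\<rbrakk> \<Longrightarrow>
     frag_of [GenR (r \<oplus>\<^bsub>R\<^esub> s)] - frag_of [GenR r] - frag_of [GenR s] \<in> toeplitz_rels R P Q \<psi>"
  "\<lbrakk>q \<in> carrier Q; q' \<in> carrier Q\<rbrakk> \<Longrightarrow>
     frag_of [GenQ (q \<oplus>\<^bsub>Q\<^esub> q')] - frag_of [GenQ q] - frag_of [GenQ q'] \<in> toeplitz_rels R P Q \<psi>"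
  "\<lbrakk>p \<in> carrier P; p' \<in> carrier P\<rbrakk> \<Longrightarrow>
     frag_of [GenP (p \<oplus>\<^bsub>P\<^esub> p')] - frag_of [GenP p] - frag_of [GenP p'] \<in> toeplitz_rels R P Q \<psi>"
  "\<lbrakk>r \<in> carrier R; s \<in> carrier R\<rbrakk> \<Longrightarrow>
     frag_of [GenR (r \<otimes>\<^bsub>R\<^esub> s)] - frag_of [GenR r, GenR s] \<in> toeplitz_rels R P Q \<psi>"
  "\<lbrakk>p \<in> carrier P; r \<in> carrier R\<rbrakk> \<Longrightarrow>
     frag_of [GenP (rsmult P p r)] - frag_of [GenP p, GenR r] \<in> toeplitz_rels R P Q \<psi>"
  "\<lbrakk>p \<in> carrier P; r \<in> carrier R\<rbrakk> \<Longrightarrow>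
     frag_of [GenP (smult P r p)] - frag_of [GenR r, GenP p] \<in> toeplitz_rels R P Q \<psi>"
  "\<lbrakk>q \<in> carrier Q; r \<in> carrier R\<rbrakk> \<Longrightarrow>
     frag_of [GenQ (rsmult Q q r)] - frag_of [GenQ q, GenR r] \<in> toeplitz_rels R P Q \<psi>"
  "\<lbrakk>q \<in> carrier Q; r \<in> carrier R\<rbrakk> \<Longrightarrow>
     frag_of [GenQ (smult Q r q)] - frag_of [GenR r, GenQ q] \<in> toeplitz_rels R P Q \<psi>"
  "\<lbrakk>p \<in> carrier P; q \<in> carrier Q\<rbrakk> \<Longrightarrow>
     frag_of [GenR (\<psi> (tensor_elem R P Q p q))] - frag_of [GenP p, GenQ q] \<in> toeplitz_rels R P Q \<psi>"
  unfolding toeplitz_rels_def Un_iff mem_Collect_eq by metis+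

context rng_system
begin

lemma rng_toeplitz: "rng (toeplitz R P Q \<psi>)"
  unfolding toeplitz_def by (rule F.rng_quot)

lemma toeplitz_class_eqI:
  assumes "x \<in> carrier (free_rng (gens R P Q))" "y \<in> carrier (free_rng (gens R P Q))"
    "x - y \<in> toeplitz_null R P Q \<psi>"
  shows "toeplitz_class R P Q \<psi> x = toeplitz_class R P Q \<psi> y"
  using F.coset_eqI assms free_rng_minus[OF assms(1,2)] by (simp add: toeplitz_class_def)

lemma frag_of_free: "frag_of w \<in> carrier (free_rng (gens R P Q)) \<longleftrightarrow> w \<noteq> [] \<and> set w \<subseteq> gens R P Q"
  by (simp add: free_rng_def)

lemma free_add_closed:
  "\<lbrakk>x \<in> carrier (free_rng (gens R P Q)); y \<in> carrier (free_rng (gens R P Q))\<rbrakk>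
    \<Longrightarrow> x + y \<in> carrier (free_rng (gens R P Q))"
  using F.add.m_closed[of x y] by (simp add: free_rng_def)

lemma toeplitz_class_add:
  assumes "x \<in> carrier (free_rng (gens R P Q))" "y \<in> carrier (free_rng (gens R P Q))"
  shows "toeplitz_class R P Q \<psi> x \<oplus>\<^bsub>toeplitz R P Q \<psi>\<^esub> toeplitz_class R P Q \<psi> y =
    toeplitz_class R P Q \<psi> (x + y)"
  using F.coset_add[OF assms] by (simp add: toeplitz_class_def toeplitz_def free_rng_def)

lemma toeplitz_class_mult:
  assumes "x \<in> carrier (free_rng (gens R P Q))" "y \<in> carrier (free_rng (gens R P Q))"
  shows "toeplitz_class R P Q \<psi> x \<otimes>\<^bsub>toeplitz R P Q \<psi>\<^esub> toeplitz_class R P Q \<psi> y =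
    toeplitz_class R P Q \<psi> (word_mult x y)"
  using F.coset_mult[OF assms] by (simp add: toeplitz_class_def toeplitz_def free_rng_def)

lemma carrier_toeplitz:
  "carrier (toeplitz R P Q \<psi>) = toeplitz_class R P Q \<psi> ` carrier (free_rng (gens R P Q))"
  using F.carrier_quot by (simp add: toeplitz_class_def toeplitz_def)

lemma toeplitz_rels_null: "toeplitz_rels R P Q \<psi> \<subseteq> toeplitz_null R P Q \<psi>"
  unfolding toeplitz_null_def by (rule two_sided_ideal_generated[OF rng_free_rng toeplitz_rels_carrier])

lemma gens_simps [simp]:
  "GenR r \<in> gens R P Q \<longleftrightarrow> r \<in> carrier R"
  "GenQ q \<in> gens R P Q \<longleftrightarrow> q \<in> carrier Q"
  "GenP p \<in> gens R P Q \<longleftrightarrow> p \<in> carrier P"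
  by (auto simp: gens_def)

lemma toeplitz_rel2:
  assumes "frag_of w - frag_of v \<in> toeplitz_rels R P Q \<psi>"
    "w \<noteq> []" "set w \<subseteq> gens R P Q" "v \<noteq> []" "set v \<subseteq> gens R P Q"
  shows "toeplitz_class R P Q \<psi> (frag_of w) = toeplitz_class R P Q \<psi> (frag_of v)"
  using assms toeplitz_rels_null by (intro toeplitz_class_eqI) (auto simp: frag_of_free)

lemma toeplitz_rel3:
  assumes "frag_of w - frag_of v - frag_of u \<in> toeplitz_rels R P Q \<psi>"
    "w \<noteq> []" "set w \<subseteq> gens R P Q" "v \<noteq> []" "set v \<subseteq> gens R P Q" "u \<noteq> []" "set u \<subseteq> gens R P Q"
  shows "toeplitz_class R P Q \<psi> (frag_of w) = toeplitz_class R P Q \<psi> (frag_of v + frag_of u)"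
  using assms toeplitz_rels_null
  by (intro toeplitz_class_eqI free_add_closed) (auto simp: frag_of_free diff_diff_eq)

theorem toeplitz_covariant:
  "covariant_rep R P Q \<psi> (toeplitz R P Q \<psi>) (iota_P R P Q \<psi>) (iota_Q R P Q \<psi>) (iota_R R P Q \<psi>)"
proof (intro covariant_rep.intro covariant_rep_axioms.intro rng_system_axioms rng_toeplitz)
  note defs = iota_R_def iota_Q_def iota_P_def toeplitz_class_add toeplitz_class_mult frag_of_free
    P.left_closed P.right_closed Q.left_closed Q.right_closed psi_closed P.R.m_closed
  show "iota_P R P Q \<psi> \<in> carrier P \<rightarrow> carrier (toeplitz R P Q \<psi>)"
    "iota_Q R P Q \<psi> \<in> carrier Q \<rightarrow> carrier (toeplitz R P Q \<psi>)"
    by (auto simp: defs carrier_toeplitz)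
  show "iota_P R P Q \<psi> (p \<oplus>\<^bsub>P\<^esub> p') = iota_P R P Q \<psi> p \<oplus>\<^bsub>toeplitz R P Q \<psi>\<^esub> iota_P R P Q \<psi> p'"
    if "p \<in> carrier P" "p' \<in> carrier P" for p p'
    using that toeplitz_rel3[OF toeplitz_relsI(3)] by (simp add: defs)
  show "iota_Q R P Q \<psi> (p \<oplus>\<^bsub>Q\<^esub> p') = iota_Q R P Q \<psi> p \<oplus>\<^bsub>toeplitz R P Q \<psi>\<^esub> iota_Q R P Q \<psi> p'"
    if "p \<in> carrier Q" "p' \<in> carrier Q" for p p'
    using that toeplitz_rel3[OF toeplitz_relsI(2)] by (simp add: defs)
  show "iota_R R P Q \<psi> \<in> rng_hom R (toeplitz R P Q \<psi>)"
    unfolding rng_hom_def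
  proof (intro CollectI conjI ballI)
    show "iota_R R P Q \<psi> \<in> carrier R \<rightarrow> carrier (toeplitz R P Q \<psi>)"
      by (auto simp: defs carrier_toeplitz)
    fix x y assume xy: "x \<in> carrier R" "y \<in> carrier R"
    show "iota_R R P Q \<psi> (x \<oplus>\<^bsub>R\<^esub> y) = iota_R R P Q \<psi> x \<oplus>\<^bsub>toeplitz R P Q \<psi>\<^esub> iota_R R P Q \<psi> y"
      using xy toeplitz_rel3[OF toeplitz_relsI(1)] by (simp add: defs)
    show "iota_R R P Q \<psi> (x \<otimes>\<^bsub>R\<^esub> y) = iota_R R P Q \<psi> x \<otimes>\<^bsub>toeplitz R P Q \<psi>\<^esub> iota_R R P Q \<psi> y"
      using xy toeplitz_rel2[OF toeplitz_relsI(4)] by (simp add: defs)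
  qed
  show "iota_P R P Q \<psi> (rsmult P p r) = iota_P R P Q \<psi> p \<otimes>\<^bsub>toeplitz R P Q \<psi>\<^esub> iota_R R P Q \<psi> r"
    "iota_P R P Q \<psi> (smult P r p) = iota_R R P Q \<psi> r \<otimes>\<^bsub>toeplitz R P Q \<psi>\<^esub> iota_P R P Q \<psi> p"
    if "p \<in> carrier P" "r \<in> carrier R" for p r
    using that toeplitz_rel2[OF toeplitz_relsI(5)] toeplitz_rel2[OF toeplitz_relsI(6)]
    by (simp_all add: defs)
  show "iota_Q R P Q \<psi> (rsmult Q q r) = iota_Q R P Q \<psi> q \<otimes>\<^bsub>toeplitz R P Q \<psi>\<^esub> iota_R R P Q \<psi> r"
    "iota_Q R P Q \<psi> (smult Q r q) = iota_R R P Q \<psi> r \<otimes>\<^bsub>toeplitz R P Q \<psi>\<^esub> iota_Q R P Q \<psi> q"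
    if "q \<in> carrier Q" "r \<in> carrier R" for q r
    using that toeplitz_rel2[OF toeplitz_relsI(7)] toeplitz_rel2[OF toeplitz_relsI(8)]
    by (simp_all add: defs)
  show "iota_R R P Q \<psi> (psi p q) = iota_P R P Q \<psi> p \<otimes>\<^bsub>toeplitz R P Q \<psi>\<^esub> iota_Q R P Q \<psi> q"
    if "p \<in> carrier P" "q \<in> carrier Q" for p q
    using that toeplitz_rel2[OF toeplitz_relsI(9)] by (simp add: defs)
qed

theorem toeplitz_generated:
  "subrng_generated (toeplitz R P Q \<psi>)
     (iota_R R P Q \<psi> ` carrier R \<union> iota_Q R P Q \<psi> ` carrier Q \<union> iota_P R P Q \<psi> ` carrier P) =
   carrier (toeplitz R P Q \<psi>)" (is "subrng_generated ?T ?X = _")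
proof
  interpret T: rng ?T by (rule rng_toeplitz)
  have "subrng (carrier ?T) ?T" by (rule T.subrng_carrier)
  moreover have "?X \<subseteq> carrier ?T"
    by (auto simp: iota_R_def iota_Q_def iota_P_def frag_of_free carrier_toeplitz)
  ultimately show "subrng_generated ?T ?X \<subseteq> carrier ?T" by (auto simp: subrng_generated_def)
  have "x \<in> S" if S: "subrng S ?T" "?X \<subseteq> S" and "x \<in> carrier ?T" for x S
  proof -
    have sub: "subgroup S (add_monoid ?T)" using S by (auto simp: subrng_def additive_subgroup_def)
    have mult: "x \<in> S \<Longrightarrow> y \<in> S \<Longrightarrow> x \<otimes>\<^bsub>?T\<^esub> y \<in> S" for x y using S by (auto simp: subrng_def)
    have w: "toeplitz_class R P Q \<psi> (frag_of w) \<in> S" if "w \<noteq> []" "set w \<subseteq> gens R P Q" for w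
      using that
    proof (induction w)
      case (Cons g w)
      have g: "toeplitz_class R P Q \<psi> (frag_of [g]) \<in> S"
        using S(2) Cons.prems by (auto simp: gens_def iota_R_def iota_Q_def iota_P_def)
      show ?case
      proof (cases "w = []")
        case False
        then have "toeplitz_class R P Q \<psi> (frag_of (g # w)) =
          toeplitz_class R P Q \<psi> (frag_of [g]) \<otimes>\<^bsub>?T\<^esub> toeplitz_class R P Q \<psi> (frag_of w)"
          using Cons.prems by (simp add: toeplitz_class_mult frag_of_free)
        then show ?thesis using mult g Cons False by auto
      qed (use g in simp)
    qed simp
    obtain y where y: "x = toeplitz_class R P Q \<psi> y" "Poly_Mapping.keys y \<subseteq> {w. w \<noteq> [] \<and> set w \<subseteq> gens R P Q}"
      using \<open>x \<in> carrier ?T\<close> by (auto simp: carrier_toeplitz free_rng_def)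
    have "toeplitz_class R P Q \<psi> y \<in> S"
      using y(2)
    proof (induction y rule: free_Abelian_group_induct[consumes 1, case_names zero diff one])
      case zero
      have "toeplitz_class R P Q \<psi> 0 = \<zero>\<^bsub>?T\<^esub>"
        using F.zero_quot by (simp add: toeplitz_class_def toeplitz_def free_rng_def)
      then show ?case using subgroup.one_closed[OF sub] by simp
    next
      case (diff x y)
      have c: "x \<in> carrier (free_rng (gens R P Q))" "y \<in> carrier (free_rng (gens R P Q))"
        "x - y \<in> carrier (free_rng (gens R P Q))"
        using diff keys_diff[of x y] by (auto simp: free_rng_def)
      have cT: "toeplitz_class R P Q \<psi> y \<in> carrier ?T" "toeplitz_class R P Q \<psi> (x - y) \<in> carrier ?T"
        using c by (auto simp: carrier_toeplitz)
      have "toeplitz_class R P Q \<psi> (x - y) \<oplus>\<^bsub>?T\<^esub> toeplitz_class R P Q \<psi> y = toeplitz_class R P Q \<psi> x"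
        using toeplitz_class_add[OF c(3,2)] by simp
      then have "toeplitz_class R P Q \<psi> (x - y) =
          toeplitz_class R P Q \<psi> x \<oplus>\<^bsub>?T\<^esub> \<ominus>\<^bsub>?T\<^esub> toeplitz_class R P Q \<psi> y"
        using cT by (metis T.a_assoc T.a_inv_closed T.r_neg T.r_zero)
      then show ?case
        using subgroup.m_closed[OF sub diff(3) subgroup.m_inv_closed[OF sub diff(4)]]
        by (simp add: a_inv_def)
    qed (use w in auto)
    then show ?thesis using y by simp
  qed
  then show "carrier ?T \<subseteq> subrng_generated ?T ?X" by (auto simp: subrng_generated_def)
qed

end

lemma rng_homs_agree:
  assumes "rng A" "rng B" "h \<in> rng_hom A B" "h' \<in> rng_hom A B"
    and "X \<subseteq> carrier A" "\<And>x. x \<in> X \<Longrightarrow> h x = h' x" "x \<in> subrng_generated A X"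
  shows "h x = h' x"
proof -
  interpret A: rng A by fact
  interpret B: rng B by fact
  let ?E = "{x \<in> carrier A. h x = h' x}"
  have add: "h (x \<oplus>\<^bsub>A\<^esub> y) = h' (x \<oplus>\<^bsub>A\<^esub> y)" if "x \<in> ?E" "y \<in> ?E" for x y
    using that assms by (simp add: rng_hom_def)
  have "subgroup ?E (add_monoid A)"
  proof (rule A.add.subgroupI)
    show "?E \<noteq> {}"
      using rng_hom_zero[OF assms(1,2,3)] rng_hom_zero[OF assms(1,2,4)] by force
  qed (use add rng_hom_minus[OF assms(1,2,3)] rng_hom_minus[OF assms(1,2,4)] in auto)
  then have "subrng ?E A"
    using assms by (auto simp: subrng_def additive_subgroup_def A.m_closed rng_hom_def)
  then show ?thesis using assms(5-7) by (auto simp: subrng_generated_def)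
qed

theorem toeplitz_universal:
  assumes "covariant_rep R P Q \<psi> B S T \<sigma>"
  shows "\<exists>h\<in>rng_hom (toeplitz R P Q \<psi>) B.
      (\<forall>p\<in>carrier P. h (iota_P R P Q \<psi> p) = S p) \<and> (\<forall>q\<in>carrier Q. h (iota_Q R P Q \<psi> q) = T q) \<and>
      (\<forall>r\<in>carrier R. h (iota_R R P Q \<psi> r) = \<sigma> r) \<and>
      (\<forall>h'\<in>rng_hom (toeplitz R P Q \<psi>) B.
         (\<forall>p\<in>carrier P. h' (iota_P R P Q \<psi> p) = S p) \<and> (\<forall>q\<in>carrier Q. h' (iota_Q R P Q \<psi> q) = T q) \<and>
         (\<forall>r\<in>carrier R. h' (iota_R R P Q \<psi> r) = \<sigma> r) \<longrightarrow>
         (\<forall>x\<in>carrier (toeplitz R P Q \<psi>). h' x = h x))"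
proof -
  interpret covariant_rep R P Q \<psi> B S T \<sigma> by fact
  let ?F = "free_rng (gens R P Q)" and ?c = "toeplitz_class R P Q \<psi>" and ?N = "toeplitz_null R P Q \<psi>"
  define g where "g = case_gen \<sigma> T S"
  have \<sigma>c: "r \<in> carrier R \<Longrightarrow> \<sigma> r \<in> carrier B" for r using \<sigma>_hom by (auto simp: rng_hom_def)
  have "g ` gens R P Q \<subseteq> carrier B"
    using S_closed T_closed \<sigma>c by (auto simp: g_def gens_def)
  from free_rng_universal[OF B.rng_axioms this] obtain k where
    k: "k \<in> rng_hom ?F B" and kg: "\<And>x. x \<in> gens R P Q \<Longrightarrow> k (frag_of [x]) = g x" by metis
  have kc: "x \<in> carrier ?F \<Longrightarrow> k x \<in> carrier B" for x using k by (auto simp: rng_hom_def)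
  have fc: "x \<in> gens R P Q \<Longrightarrow> frag_of [x] \<in> carrier ?F"
    "\<lbrakk>x \<in> gens R P Q; y \<in> gens R P Q\<rbrakk> \<Longrightarrow> frag_of [x, y] \<in> carrier ?F" for x y
    by (simp_all add: frag_of_free)
  have k2: "k (frag_of [x, y]) = g x \<otimes>\<^bsub>B\<^esub> g y" if "x \<in> gens R P Q" "y \<in> gens R P Q" for x y
  proof -
    have "k (frag_of [x] \<otimes>\<^bsub>?F\<^esub> frag_of [y]) = k (frag_of [x]) \<otimes>\<^bsub>B\<^esub> k (frag_of [y])"
      using k fc(1) that by (simp add: rng_hom_def)
    then show ?thesis using kg that by (simp add: free_rng_def)
  qed
  have kd: "k (x - y) = k x \<ominus>\<^bsub>B\<^esub> k y" if "x \<in> carrier ?F" "y \<in> carrier ?F" for x y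
    using rng_hom_diff[OF rng_free_rng B.rng_axioms k that] free_rng_minus[OF that] by simp
  have fd: "x - y \<in> carrier ?F" if "x \<in> carrier ?F" "y \<in> carrier ?F" for x y
    using F.minus_closed[OF that] free_rng_minus[OF that] by simp
  have r2: "k (frag_of [x] - frag_of [y, z]) = \<zero>\<^bsub>B\<^esub>"
    if "g x = g y \<otimes>\<^bsub>B\<^esub> g z" "x \<in> gens R P Q" "y \<in> gens R P Q" "z \<in> gens R P Q" for x y z
    using that kc[OF fc(1)[of x]] fc kd k2 kg by (simp add: B.r_neg a_minus_def)
  have r3: "k (frag_of [x] - frag_of [y] - frag_of [z]) = \<zero>\<^bsub>B\<^esub>"
    if "g x = g y \<oplus>\<^bsub>B\<^esub> g z" "x \<in> gens R P Q" "y \<in> gens R P Q" "z \<in> gens R P Q" for x y z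
  proof -
    have "g y \<in> carrier B" "g z \<in> carrier B" using kc[OF fc(1)] kg that by metis+
    then show ?thesis
      using that fc kd fd kg by (simp add: B.add_minus_minus)
  qed
  have "toeplitz_rels R P Q \<psi> \<subseteq> {x \<in> carrier ?F. k x = \<zero>\<^bsub>B\<^esub>}"
  proof
    fix x assume x: "x \<in> toeplitz_rels R P Q \<psi>"
    have "k x = \<zero>\<^bsub>B\<^esub>"
      using x unfolding toeplitz_rels_def
      apply -
      apply (elim UnE CollectE exE conjE; hypsubst; (rule r2 | rule r3))
      by (use \<sigma>_hom in \<open>auto simp: g_def S_add T_add S_left S_right T_left T_right \<psi>_cov psi_closed
          rng_hom_def P.left_closed P.right_closed Q.left_closed Q.right_closed P.R.m_closed\<close>)
    then show "x \<in> {x \<in> carrier ?F. k x = \<zero>\<^bsub>B\<^esub>}" using x toeplitz_rels_carrier by auto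
  qed
  then have "?N \<subseteq> {x \<in> carrier ?F. k x = \<zero>\<^bsub>B\<^esub>}"
    unfolding toeplitz_null_def
    by (intro ideal_generated_minimal two_sided_ideal_kernel[OF rng_free_rng B.rng_axioms k])
  then have kN: "k x = \<zero>\<^bsub>B\<^esub>" if "x \<in> ?N" for x using that by auto
  define h where "h = (\<lambda>C. k (SOME x. x \<in> carrier ?F \<and> ?c x = C))"
  have hc: "h (?c x) = k x" if x: "x \<in> carrier ?F" for x
  proof -
    define y where "y = (SOME y. y \<in> carrier ?F \<and> ?c y = ?c x)"
    have y: "y \<in> carrier ?F" "?c y = ?c x"
      unfolding y_def using x by (metis (mono_tags, lifting) someI)+
    have "y \<ominus>\<^bsub>?F\<^esub> x \<in> ?N" using F.coset_eqD[OF y(1) x] y(2) by (simp add: toeplitz_class_def)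
    then have "k y \<ominus>\<^bsub>B\<^esub> k x = \<zero>\<^bsub>B\<^esub>" using kN kd y x free_rng_minus by metis
    moreover have "k y = (k y \<ominus>\<^bsub>B\<^esub> k x) \<oplus>\<^bsub>B\<^esub> k x"
      using kc y x by (simp add: a_minus_def B.a_assoc B.l_neg)
    ultimately have "k y = k x" using kc x by simp
    then show ?thesis by (simp add: h_def y_def)
  qed
  have h: "h \<in> rng_hom (toeplitz R P Q \<psi>) B"
    unfolding rng_hom_def
  proof (intro CollectI conjI ballI)
    show "h \<in> carrier (toeplitz R P Q \<psi>) \<rightarrow> carrier B" using hc kc by (auto simp: carrier_toeplitz)
    fix X Y assume "X \<in> carrier (toeplitz R P Q \<psi>)" "Y \<in> carrier (toeplitz R P Q \<psi>)"
    then obtain x y where x: "X = ?c x" "x \<in> carrier ?F" and y: "Y = ?c y" "y \<in> carrier ?F"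
      by (auto simp: carrier_toeplitz)
    have "x \<oplus>\<^bsub>?F\<^esub> y = x + y" "x \<otimes>\<^bsub>?F\<^esub> y = word_mult x y" by (simp_all add: free_rng_def)
    moreover have "x \<oplus>\<^bsub>?F\<^esub> y \<in> carrier ?F" "x \<otimes>\<^bsub>?F\<^esub> y \<in> carrier ?F" using x y F.m_closed by auto
    moreover have "k (x \<oplus>\<^bsub>?F\<^esub> y) = k x \<oplus>\<^bsub>B\<^esub> k y" "k (x \<otimes>\<^bsub>?F\<^esub> y) = k x \<otimes>\<^bsub>B\<^esub> k y"
      using k x y by (auto simp: rng_hom_def)
    ultimately show "h (X \<oplus>\<^bsub>toeplitz R P Q \<psi>\<^esub> Y) = h X \<oplus>\<^bsub>B\<^esub> h Y"
      "h (X \<otimes>\<^bsub>toeplitz R P Q \<psi>\<^esub> Y) = h X \<otimes>\<^bsub>B\<^esub> h Y"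
      using x y hc by (simp_all add: toeplitz_class_add toeplitz_class_mult)
  qed
  have hi: "\<forall>p\<in>carrier P. h (iota_P R P Q \<psi> p) = S p" "\<forall>q\<in>carrier Q. h (iota_Q R P Q \<psi> q) = T q"
    "\<forall>r\<in>carrier R. h (iota_R R P Q \<psi> r) = \<sigma> r"
    by (simp_all add: iota_P_def iota_Q_def iota_R_def hc fc kg g_def)
  show ?thesis
  proof (intro bexI[OF _ h] conjI hi ballI impI, elim conjE)
    fix h' x
    assume h': "h' \<in> rng_hom (toeplitz R P Q \<psi>) B" "\<forall>p\<in>carrier P. h' (iota_P R P Q \<psi> p) = S p"
      "\<forall>q\<in>carrier Q. h' (iota_Q R P Q \<psi> q) = T q" "\<forall>r\<in>carrier R. h' (iota_R R P Q \<psi> r) = \<sigma> r"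
      and x: "x \<in> carrier (toeplitz R P Q \<psi>)"
    show "h' x = h x"
      by (rule rng_homs_agree[OF rng_toeplitz B.rng_axioms h'(1) h _ _ x[folded toeplitz_generated]])
        (use h' hi in \<open>auto simp: carrier_toeplitz iota_P_def iota_Q_def iota_R_def fc\<close>)
  qed
qed


section \<open>The homomorphism on finite-rank operators\<close>

lemma rng_end_rng:
  assumes "abelian_group M"
  shows "rng (end_rng M)"
proof -
  interpret M: abelian_group M by fact
  have closed: "f x \<in> carrier M" if "f \<in> carrier (end_rng M)" "x \<in> carrier M" for f x
    using that by (auto simp: end_rng_def)
  have addf: "f (x \<oplus>\<^bsub>M\<^esub> y) = f x \<oplus>\<^bsub>M\<^esub> f y"
    if "f \<in> carrier (end_rng M)" "x \<in> carrier M" "y \<in> carrier M" for f x y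
    using that by (auto simp: end_rng_def)
  have memI: "f \<in> carrier (end_rng M)"
    if "f \<in> extensional (carrier M)" "\<And>x. x \<in> carrier M \<Longrightarrow> f x \<in> carrier M"
      "\<And>x y. \<lbrakk>x \<in> carrier M; y \<in> carrier M\<rbrakk> \<Longrightarrow> f (x \<oplus>\<^bsub>M\<^esub> y) = f x \<oplus>\<^bsub>M\<^esub> f y" for f
    using that by (auto simp: end_rng_def PiE_def)
  have eqI: "f = g" if "f \<in> extensional (carrier M)" "g \<in> extensional (carrier M)"
    "\<And>x. x \<in> carrier M \<Longrightarrow> f x = g x" for f g
    using that extensionalityI by metis
  have ext: "f \<in> extensional (carrier M)" if "f \<in> carrier (end_rng M)" for f
    using that by (auto simp: end_rng_def PiE_def)
  have add: "f \<oplus>\<^bsub>end_rng M\<^esub> g = (\<lambda>x\<in>carrier M. f x \<oplus>\<^bsub>M\<^esub> g x)" for f g by (simp add: end_rng_def)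
  have mult: "f \<otimes>\<^bsub>end_rng M\<^esub> g = (\<lambda>x\<in>carrier M. f (g x))" for f g
    by (simp add: end_rng_def compose_def)
  have zero: "\<zero>\<^bsub>end_rng M\<^esub> = (\<lambda>x\<in>carrier M. \<zero>\<^bsub>M\<^esub>)" by (simp add: end_rng_def)
  have addc: "f \<oplus>\<^bsub>end_rng M\<^esub> g \<in> carrier (end_rng M)"
    if "f \<in> carrier (end_rng M)" "g \<in> carrier (end_rng M)" for f g
    by (rule memI) (use that in \<open>simp_all add: add closed addf M.a_ac\<close>)
  have multc: "f \<otimes>\<^bsub>end_rng M\<^esub> g \<in> carrier (end_rng M)"
    if "f \<in> carrier (end_rng M)" "g \<in> carrier (end_rng M)" for f g
    by (rule memI) (use that in \<open>simp_all add: mult closed addf\<close>)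
  show ?thesis
  proof (intro rng.intro rng_axioms.intro abelian_groupI)
    fix f assume f: "f \<in> carrier (end_rng M)"
    let ?g = "\<lambda>x\<in>carrier M. \<ominus>\<^bsub>M\<^esub> f x"
    have "?g \<in> carrier (end_rng M)"
      by (rule memI) (use f in \<open>simp_all add: closed addf M.minus_add\<close>)
    moreover have "?g \<oplus>\<^bsub>end_rng M\<^esub> f = \<zero>\<^bsub>end_rng M\<^esub>"
      by (rule eqI) (use f in \<open>simp_all add: add zero closed M.l_neg\<close>)
    ultimately show "\<exists>g\<in>carrier (end_rng M). g \<oplus>\<^bsub>end_rng M\<^esub> f = \<zero>\<^bsub>end_rng M\<^esub>" by blast
    show "\<zero>\<^bsub>end_rng M\<^esub> \<oplus>\<^bsub>end_rng M\<^esub> f = f"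
      by (rule eqI) (use f in \<open>simp_all add: add zero closed ext\<close>)
  next
    show "\<zero>\<^bsub>end_rng M\<^esub> \<in> carrier (end_rng M)" by (rule memI) (simp_all add: zero)
  next
    fix f g assume fg: "f \<in> carrier (end_rng M)" "g \<in> carrier (end_rng M)"
    show "f \<oplus>\<^bsub>end_rng M\<^esub> g = g \<oplus>\<^bsub>end_rng M\<^esub> f"
      by (rule eqI) (use fg in \<open>simp_all add: add closed M.a_comm\<close>)
  next
    fix f g h assume fgh: "f \<in> carrier (end_rng M)" "g \<in> carrier (end_rng M)" "h \<in> carrier (end_rng M)"
    show "f \<oplus>\<^bsub>end_rng M\<^esub> g \<oplus>\<^bsub>end_rng M\<^esub> h = f \<oplus>\<^bsub>end_rng M\<^esub> (g \<oplus>\<^bsub>end_rng M\<^esub> h)"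
      by (rule eqI) (use fgh in \<open>simp_all add: add closed M.a_assoc\<close>)
    show "f \<otimes>\<^bsub>end_rng M\<^esub> g \<otimes>\<^bsub>end_rng M\<^esub> h = f \<otimes>\<^bsub>end_rng M\<^esub> (g \<otimes>\<^bsub>end_rng M\<^esub> h)"
      by (rule eqI) (use fgh in \<open>simp_all add: mult closed\<close>)
    show "(f \<oplus>\<^bsub>end_rng M\<^esub> g) \<otimes>\<^bsub>end_rng M\<^esub> h = f \<otimes>\<^bsub>end_rng M\<^esub> h \<oplus>\<^bsub>end_rng M\<^esub> g \<otimes>\<^bsub>end_rng M\<^esub> h"
      by (rule eqI) (use fgh in \<open>simp_all add: mult add closed\<close>)
    show "h \<otimes>\<^bsub>end_rng M\<^esub> (f \<oplus>\<^bsub>end_rng M\<^esub> g) = h \<otimes>\<^bsub>end_rng M\<^esub> f \<oplus>\<^bsub>end_rng M\<^esub> h \<otimes>\<^bsub>end_rng M\<^esub> g"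
      by (rule eqI) (use fgh in \<open>simp_all add: mult add closed addf\<close>)
  qed (use addc multc in auto)
qed

lemma end_rng_apply:
  assumes "abelian_group M" "x \<in> carrier M"
  shows "(f \<oplus>\<^bsub>end_rng M\<^esub> g) x = f x \<oplus>\<^bsub>M\<^esub> g x" "(f \<otimes>\<^bsub>end_rng M\<^esub> g) x = f (g x)"
    "\<zero>\<^bsub>end_rng M\<^esub> x = \<zero>\<^bsub>M\<^esub>" "f \<in> carrier (end_rng M) \<Longrightarrow> (\<ominus>\<^bsub>end_rng M\<^esub> f) x = \<ominus>\<^bsub>M\<^esub> f x"
proof -
  interpret M: abelian_group M by fact
  interpret E: rng "end_rng M" by (rule rng_end_rng[OF assms(1)])
  show add: "(f \<oplus>\<^bsub>end_rng M\<^esub> g) x = f x \<oplus>\<^bsub>M\<^esub> g x" for f g using assms by (simp add: end_rng_def)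
  show "(f \<otimes>\<^bsub>end_rng M\<^esub> g) x = f (g x)" using assms by (simp add: end_rng_def compose_def)
  show zero: "\<zero>\<^bsub>end_rng M\<^esub> x = \<zero>\<^bsub>M\<^esub>" using assms by (simp add: end_rng_def)
  show "(\<ominus>\<^bsub>end_rng M\<^esub> f) x = \<ominus>\<^bsub>M\<^esub> f x" if f: "f \<in> carrier (end_rng M)"
  proof -
    have c: "\<And>f. f \<in> carrier (end_rng M) \<Longrightarrow> f x \<in> carrier M" using assms by (auto simp: end_rng_def)
    have "(\<ominus>\<^bsub>end_rng M\<^esub> f) x \<oplus>\<^bsub>M\<^esub> f x = \<zero>\<^bsub>M\<^esub>"
      using add[of "\<ominus>\<^bsub>end_rng M\<^esub> f" f] zero E.l_neg[OF f] by simp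
    then show ?thesis using c[OF f] c[OF E.a_inv_closed[OF f]] M.minus_equality by metis
  qed
qed

text \<open>The graph of the homomorphism \<open>pi_map\<close>, before it is known to be functional.\<close>

inductive pi_rel :: "('r, 'm) ring_scheme \<Rightarrow> ('r, 'p, 'n) bimodule_scheme
    \<Rightarrow> ('r, 'q, 'l) bimodule_scheme \<Rightarrow> (('p \<times> 'q \<Rightarrow>\<^sub>0 int) set \<Rightarrow> 'r) \<Rightarrow> ('b, 'k) ring_scheme
    \<Rightarrow> ('p \<Rightarrow> 'b) \<Rightarrow> ('q \<Rightarrow> 'b) \<Rightarrow> ('q \<Rightarrow> 'q) \<Rightarrow> 'b \<Rightarrow> bool"
  for R P Q \<psi> B S T where
  zero: "pi_rel R P Q \<psi> B S T \<zero>\<^bsub>end_rng Q\<^esub> \<zero>\<^bsub>B\<^esub>"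
| incl: "\<lbrakk>q \<in> carrier Q; p \<in> carrier P\<rbrakk> \<Longrightarrow> pi_rel R P Q \<psi> B S T (theta_Q R P Q \<psi> q p) (T q \<otimes>\<^bsub>B\<^esub> S p)"
| neg: "pi_rel R P Q \<psi> B S T \<Theta> b \<Longrightarrow> pi_rel R P Q \<psi> B S T (\<ominus>\<^bsub>end_rng Q\<^esub> \<Theta>) (\<ominus>\<^bsub>B\<^esub> b)"
| add: "\<lbrakk>pi_rel R P Q \<psi> B S T \<Theta> b; pi_rel R P Q \<psi> B S T \<Theta>' b'\<rbrakk>
    \<Longrightarrow> pi_rel R P Q \<psi> B S T (\<Theta> \<oplus>\<^bsub>end_rng Q\<^esub> \<Theta>') (b \<oplus>\<^bsub>B\<^esub> b')"

context rng_system
begin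

lemma theta_Q_closed:
  assumes "q \<in> carrier Q" "p \<in> carrier P"
  shows "theta_Q R P Q \<psi> q p \<in> carrier (end_rng Q)"
  using assms by (auto simp: theta_Q_def end_rng_def psi_relations psi_closed Q.right_closed Q.add_right)

lemma theta_P_closed:
  assumes "q \<in> carrier Q" "p \<in> carrier P"
  shows "theta_P R P Q \<psi> p q \<in> carrier (end_rng P)"
  using assms by (auto simp: theta_P_def end_rng_def psi_relations psi_closed P.left_closed P.add_left)

end

sublocale rng_system \<subseteq> EQ: rng "end_rng Q"
  by (rule rng_end_rng) (rule Q.M.abelian_group_axioms)

sublocale rng_system \<subseteq> EP: rng "end_rng P"
  by (rule rng_end_rng) (rule P.M.abelian_group_axioms)

context covariant_rep
begin

abbreviation "rel \<equiv> pi_rel R P Q \<psi> B S T"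

lemmas EQ_apply = end_rng_apply[OF Q.M.abelian_group_axioms]
lemmas EP_apply = end_rng_apply[OF P.M.abelian_group_axioms]

lemma EQ_closed: "\<lbrakk>\<Theta> \<in> carrier (end_rng Q); x \<in> carrier Q\<rbrakk> \<Longrightarrow> \<Theta> x \<in> carrier Q"
  and EP_closed: "\<lbrakk>\<Phi> \<in> carrier (end_rng P); y \<in> carrier P\<rbrakk> \<Longrightarrow> \<Phi> y \<in> carrier P"
  by (auto simp: end_rng_def)

lemma S_closed': "p \<in> carrier P \<Longrightarrow> S p \<in> carrier B"
  and T_closed': "q \<in> carrier Q \<Longrightarrow> T q \<in> carrier B"
  and \<sigma>_closed: "r \<in> carrier R \<Longrightarrow> \<sigma> r \<in> carrier B"
  using S_closed T_closed \<sigma>_hom by (auto simp: rng_hom_def)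

lemma additive_zero_neg:
  assumes "abelian_group M" "\<And>x. x \<in> carrier M \<Longrightarrow> f x \<in> carrier B"
    "\<And>x y. \<lbrakk>x \<in> carrier M; y \<in> carrier M\<rbrakk> \<Longrightarrow> f (x \<oplus>\<^bsub>M\<^esub> y) = f x \<oplus>\<^bsub>B\<^esub> f y"
  shows "f \<zero>\<^bsub>M\<^esub> = \<zero>\<^bsub>B\<^esub>" "x \<in> carrier M \<Longrightarrow> f (\<ominus>\<^bsub>M\<^esub> x) = \<ominus>\<^bsub>B\<^esub> f x"
proof -
  interpret M: abelian_group M by fact
  show z: "f \<zero>\<^bsub>M\<^esub> = \<zero>\<^bsub>B\<^esub>" using assms(2)[of "\<zero>\<^bsub>M\<^esub>"] assms(3)[of "\<zero>\<^bsub>M\<^esub>" "\<zero>\<^bsub>M\<^esub>"] by simp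
  show "f (\<ominus>\<^bsub>M\<^esub> x) = \<ominus>\<^bsub>B\<^esub> f x" if x: "x \<in> carrier M"
  proof -
    have "f (\<ominus>\<^bsub>M\<^esub> x) \<oplus>\<^bsub>B\<^esub> f x = \<zero>\<^bsub>B\<^esub>"
      using assms(3)[of "\<ominus>\<^bsub>M\<^esub> x" x] x z by (simp add: M.l_neg)
    then show ?thesis using assms(2) x B.minus_equality M.a_inv_closed by metis
  qed
qed

lemmas T_zero = additive_zero_neg(1)[OF Q.M.abelian_group_axioms T_closed' T_add]
lemmas T_neg = additive_zero_neg(2)[OF Q.M.abelian_group_axioms T_closed' T_add]
lemmas S_zero = additive_zero_neg(1)[OF P.M.abelian_group_axioms S_closed' S_add]
lemmas S_neg = additive_zero_neg(2)[OF P.M.abelian_group_axioms S_closed' S_add]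

lemma rel_incl: "\<lbrakk>q \<in> carrier Q; p \<in> carrier P\<rbrakk> \<Longrightarrow> rel (theta_Q R P Q \<psi> q p) (T q \<otimes>\<^bsub>B\<^esub> S p)"
  by (rule pi_rel.incl)

lemma rel_closed:
  assumes "rel \<Theta> b"
  shows "\<Theta> \<in> finite_rank_Q R P Q \<psi>" "\<Theta> \<in> carrier (end_rng Q)" "b \<in> carrier B"
proof -
  let ?X = "{theta_Q R P Q \<psi> q p | q p. q \<in> carrier Q \<and> p \<in> carrier P}"
  have X: "?X \<subseteq> carrier (end_rng Q)" using theta_Q_closed by auto
  have sub: "subgroup (finite_rank_Q R P Q \<psi>) (add_monoid (end_rng Q))"
    unfolding finite_rank_Q_def using EQ.add.generate_is_subgroup[OF X] by simp
  from assms have "\<Theta> \<in> finite_rank_Q R P Q \<psi> \<and> b \<in> carrier B"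
  proof (induction rule: pi_rel.induct)
    case zero then show ?case using subgroup.one_closed[OF sub] by simp
  next
    case (incl q p) then show ?case
      by (auto simp: finite_rank_Q_def S_closed' T_closed' B.m_closed intro!: generate.incl)
  next
    case (neg \<Theta> b) then show ?case
      using subgroup.m_inv_closed[OF sub, of \<Theta>] by (simp add: a_inv_def)
  next
    case (add \<Theta> b \<Theta>' b') then show ?case using subgroup.m_closed[OF sub, of \<Theta> \<Theta>'] by simp
  qed
  then show "\<Theta> \<in> finite_rank_Q R P Q \<psi>" "b \<in> carrier B" by auto
  then show "\<Theta> \<in> carrier (end_rng Q)" using subgroup.subset[OF sub] by auto
qed

lemma rel_total:
  assumes "\<Theta> \<in> finite_rank_Q R P Q \<psi>"
  shows "\<exists>b. rel \<Theta> b"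
  using assms unfolding finite_rank_Q_def
proof (induction rule: generate.induct)
  case one then show ?case using pi_rel.zero[of R P Q \<psi> B S T] by auto
next
  case (incl h) then show ?case using rel_incl by blast
next
  case (inv h) then show ?case
    using pi_rel.neg[OF rel_incl] unfolding a_inv_def by blast
next
  case (eng h1 h2) then show ?case using pi_rel.add[of R P Q \<psi> B S T h1 _ h2] by auto
qed

lemma rel_T:
  assumes "rel \<Theta> b" "x \<in> carrier Q"
  shows "b \<otimes>\<^bsub>B\<^esub> T x = T (\<Theta> x)"
  using assms(1)
proof (induction rule: pi_rel.induct)
  case zero then show ?case using assms(2) by (simp add: EQ_apply T_zero T_closed')
next
  case (incl q p)
  have "T q \<otimes>\<^bsub>B\<^esub> S p \<otimes>\<^bsub>B\<^esub> T x = T q \<otimes>\<^bsub>B\<^esub> \<sigma> (psi p x)"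
    using incl assms(2) by (simp add: \<psi>_cov B.m_assoc S_closed' T_closed')
  then show ?case using incl assms(2) by (simp add: theta_Q_def T_right psi_closed)
next
  case (neg \<Theta> b)
  then show ?case using rel_closed[OF neg(1)] assms(2)
    by (simp add: EQ_apply T_neg EQ_closed B.rng_l_minus T_closed')
next
  case (add \<Theta> b \<Theta>' b')
  then show ?case using rel_closed[OF add(1)] rel_closed[OF add(2)] assms(2)
    by (simp add: EQ_apply T_add EQ_closed B.l_distr T_closed')
qed

lemma right_neg: "\<lbrakk>x \<in> carrier Q; r \<in> carrier R\<rbrakk> \<Longrightarrow> rsmult Q (\<ominus>\<^bsub>Q\<^esub> x) r = \<ominus>\<^bsub>Q\<^esub> rsmult Q x r"
  and right_zero: "r \<in> carrier R \<Longrightarrow> rsmult Q \<zero>\<^bsub>Q\<^esub> r = \<zero>\<^bsub>Q\<^esub>"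
proof -
  have z: "rsmult Q \<zero>\<^bsub>Q\<^esub> r = \<zero>\<^bsub>Q\<^esub>" if "r \<in> carrier R" for r
    using Q.right_add[of r "\<zero>\<^bsub>Q\<^esub>" "\<zero>\<^bsub>Q\<^esub>"] Q.right_closed[of r "\<zero>\<^bsub>Q\<^esub>"] that by simp
  show "r \<in> carrier R \<Longrightarrow> rsmult Q \<zero>\<^bsub>Q\<^esub> r = \<zero>\<^bsub>Q\<^esub>" by (rule z)
  assume x: "x \<in> carrier Q" "r \<in> carrier R"
  have "rsmult Q (\<ominus>\<^bsub>Q\<^esub> x) r \<oplus>\<^bsub>Q\<^esub> rsmult Q x r = \<zero>\<^bsub>Q\<^esub>"
    using Q.right_add[of r "\<ominus>\<^bsub>Q\<^esub> x" x] z x by (simp add: Q.M.l_neg)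
  then show "rsmult Q (\<ominus>\<^bsub>Q\<^esub> x) r = \<ominus>\<^bsub>Q\<^esub> rsmult Q x r"
    using x Q.right_closed Q.M.minus_equality Q.M.a_inv_closed by metis
qed

lemma rel_right_linear:
  assumes "rel \<Theta> b" "x \<in> carrier Q" "r \<in> carrier R"
  shows "\<Theta> (rsmult Q x r) = rsmult Q (\<Theta> x) r"
  using assms(1)
proof (induction rule: pi_rel.induct)
  case zero then show ?case using assms(2,3) by (simp add: EQ_apply Q.right_closed right_zero)
next
  case (incl q p)
  then show ?case using assms(2,3)
    by (simp add: theta_Q_def Q.right_closed psi_relations psi_closed Q.right_assoc)
next
  case (neg \<Theta> b)
  then show ?case using rel_closed[OF neg(1)] assms(2,3)
    by (simp add: EQ_apply EQ_closed Q.right_closed right_neg)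
next
  case (add \<Theta> b \<Theta>' b')
  then show ?case using rel_closed[OF add(1)] rel_closed[OF add(2)] assms(2,3)
    by (simp add: EQ_apply EQ_closed Q.right_closed Q.right_add)
qed

lemma rel_mult:
  assumes 1: "rel \<Theta> b" and 2: "rel \<Theta>' b'"
  shows "rel (\<Theta> \<otimes>\<^bsub>end_rng Q\<^esub> \<Theta>') (b \<otimes>\<^bsub>B\<^esub> b')"
  using 2
proof (induction rule: pi_rel.induct)
  case zero then show ?case using rel_closed[OF 1] pi_rel.zero[of R P Q \<psi> B S T] by simp
next
  case (incl q p)
  have "\<Theta> \<otimes>\<^bsub>end_rng Q\<^esub> theta_Q R P Q \<psi> q p = theta_Q R P Q \<psi> (\<Theta> q) p"
  proof (rule extensionalityI[of _ "carrier Q"])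
    fix x assume "x \<in> carrier Q"
    then show "(\<Theta> \<otimes>\<^bsub>end_rng Q\<^esub> theta_Q R P Q \<psi> q p) x = theta_Q R P Q \<psi> (\<Theta> q) p x"
      using incl by (simp add: EQ_apply theta_Q_def rel_right_linear[OF 1] psi_closed)
  qed (simp_all add: theta_Q_def end_rng_def)
  moreover have "b \<otimes>\<^bsub>B\<^esub> (T q \<otimes>\<^bsub>B\<^esub> S p) = T (\<Theta> q) \<otimes>\<^bsub>B\<^esub> S p"
    using incl rel_closed[OF 1] rel_T[OF 1]
    by (simp add: B.m_assoc[symmetric] S_closed' T_closed')
  moreover have "\<Theta> q \<in> carrier Q" using rel_closed[OF 1] incl EQ_closed by blast
  ultimately show ?case using rel_incl[of "\<Theta> q" p] incl by simp
next
  case (neg \<Theta>' b')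
  then show ?case using rel_closed[OF 1] rel_closed[OF neg(1)] pi_rel.neg[OF neg(2)]
    by (simp add: EQ.rng_r_minus B.rng_r_minus)
next
  case (add \<Theta>1 b1 \<Theta>2 b2)
  then show ?case
    using rel_closed[OF 1] rel_closed[OF add(1)] rel_closed[OF add(2)] pi_rel.add[OF add(3,4)]
    by (simp add: EQ.r_distr B.r_distr)
qed

lemma rel_right_unit:
  assumes "rel \<Theta> d"
  shows "\<exists>Y. finite Y \<and> Y \<subseteq> carrier P \<and>
    (\<forall>e\<in>carrier B. (\<forall>y\<in>Y. S y \<otimes>\<^bsub>B\<^esub> e = S y) \<longrightarrow> d \<otimes>\<^bsub>B\<^esub> e = d)"
  using assms
proof (induction rule: pi_rel.induct)
  case zero then show ?case by (intro exI[of _ "{}"]) auto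
next
  case (incl q p)
  then show ?case by (intro exI[of _ "{p}"]) (auto simp: B.m_assoc S_closed' T_closed')
next
  case (neg \<Theta> b)
  then show ?case using rel_closed[OF neg(1)] by (auto simp: B.rng_l_minus)
next
  case (add \<Theta> b \<Theta>' b')
  then obtain Y Y' where "finite Y" "Y \<subseteq> carrier P"
    "\<forall>e\<in>carrier B. (\<forall>y\<in>Y. S y \<otimes>\<^bsub>B\<^esub> e = S y) \<longrightarrow> b \<otimes>\<^bsub>B\<^esub> e = b"
    "finite Y'" "Y' \<subseteq> carrier P"
    "\<forall>e\<in>carrier B. (\<forall>y\<in>Y'. S y \<otimes>\<^bsub>B\<^esub> e = S y) \<longrightarrow> b' \<otimes>\<^bsub>B\<^esub> e = b'" by blast
  then show ?case using rel_closed[OF add(1)] rel_closed[OF add(2)]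
    by (intro exI[of _ "Y \<union> Y'"]) (auto simp: B.l_distr)
qed

lemma finite_rank_P_elem:
  assumes "\<Phi> \<in> finite_rank_P R P Q \<psi>"
  shows "\<Phi> \<in> carrier (end_rng P) \<and> (\<exists>e\<in>carrier B. (\<forall>y\<in>carrier P. S y \<otimes>\<^bsub>B\<^esub> e = S (\<Phi> y)) \<and>
    (\<forall>d\<in>carrier B. (\<forall>x\<in>carrier Q. d \<otimes>\<^bsub>B\<^esub> T x = \<zero>\<^bsub>B\<^esub>) \<longrightarrow> d \<otimes>\<^bsub>B\<^esub> e = \<zero>\<^bsub>B\<^esub>))"
proof -
  have th: "\<exists>e\<in>carrier B. (\<forall>y\<in>carrier P. S y \<otimes>\<^bsub>B\<^esub> e = S (theta_P R P Q \<psi> p q y)) \<and>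
    (\<forall>d\<in>carrier B. (\<forall>x\<in>carrier Q. d \<otimes>\<^bsub>B\<^esub> T x = \<zero>\<^bsub>B\<^esub>) \<longrightarrow> d \<otimes>\<^bsub>B\<^esub> e = \<zero>\<^bsub>B\<^esub>)"
    if "q \<in> carrier Q" "p \<in> carrier P" for q p
    using that
    by (intro bexI[of _ "T q \<otimes>\<^bsub>B\<^esub> S p"] conjI ballI impI)
      (simp_all add: B.m_assoc[symmetric] S_closed' T_closed' B.m_closed theta_P_def S_left psi_closed
        \<psi>_cov)
  have neg: "\<exists>e\<in>carrier B. (\<forall>y\<in>carrier P. S y \<otimes>\<^bsub>B\<^esub> e = S ((\<ominus>\<^bsub>end_rng P\<^esub> \<Phi>) y)) \<and>
    (\<forall>d\<in>carrier B. (\<forall>x\<in>carrier Q. d \<otimes>\<^bsub>B\<^esub> T x = \<zero>\<^bsub>B\<^esub>) \<longrightarrow> d \<otimes>\<^bsub>B\<^esub> e = \<zero>\<^bsub>B\<^esub>)"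
    if "\<Phi> \<in> carrier (end_rng P)" "\<exists>e\<in>carrier B. (\<forall>y\<in>carrier P. S y \<otimes>\<^bsub>B\<^esub> e = S (\<Phi> y)) \<and>
    (\<forall>d\<in>carrier B. (\<forall>x\<in>carrier Q. d \<otimes>\<^bsub>B\<^esub> T x = \<zero>\<^bsub>B\<^esub>) \<longrightarrow> d \<otimes>\<^bsub>B\<^esub> e = \<zero>\<^bsub>B\<^esub>)" for \<Phi>
  proof -
    from that(2) obtain e where "e \<in> carrier B" "\<forall>y\<in>carrier P. S y \<otimes>\<^bsub>B\<^esub> e = S (\<Phi> y)"
      "\<forall>d\<in>carrier B. (\<forall>x\<in>carrier Q. d \<otimes>\<^bsub>B\<^esub> T x = \<zero>\<^bsub>B\<^esub>) \<longrightarrow> d \<otimes>\<^bsub>B\<^esub> e = \<zero>\<^bsub>B\<^esub>" by blast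
    then show ?thesis using that(1)
      by (intro bexI[of _ "\<ominus>\<^bsub>B\<^esub> e"])
        (auto simp: B.rng_r_minus S_closed' EP_apply EP_closed S_neg)
  qed
  show ?thesis
    using assms unfolding finite_rank_P_def
  proof (induction rule: generate.induct)
    case one
    then show ?case
      by (simp, intro bexI[of _ "\<zero>\<^bsub>B\<^esub>"]) (auto simp: EP_apply S_zero S_closed')
  next
    case (incl h) then show ?case using th theta_P_closed by blast
  next
    case (inv h)
    then obtain p q where h: "h = theta_P R P Q \<psi> p q" "p \<in> carrier P" "q \<in> carrier Q" by blast
    have "inv\<^bsub>add_monoid (end_rng P)\<^esub> h = \<ominus>\<^bsub>end_rng P\<^esub> h" by (simp add: a_inv_def)
    then show ?case using neg[OF theta_P_closed th] h theta_P_closed EP.a_inv_closed by metis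
  next
    case (eng h1 h2)
    then obtain e1 e2 where e: "e1 \<in> carrier B" "\<forall>y\<in>carrier P. S y \<otimes>\<^bsub>B\<^esub> e1 = S (h1 y)"
      "\<forall>d\<in>carrier B. (\<forall>x\<in>carrier Q. d \<otimes>\<^bsub>B\<^esub> T x = \<zero>\<^bsub>B\<^esub>) \<longrightarrow> d \<otimes>\<^bsub>B\<^esub> e1 = \<zero>\<^bsub>B\<^esub>"
      "e2 \<in> carrier B" "\<forall>y\<in>carrier P. S y \<otimes>\<^bsub>B\<^esub> e2 = S (h2 y)"
      "\<forall>d\<in>carrier B. (\<forall>x\<in>carrier Q. d \<otimes>\<^bsub>B\<^esub> T x = \<zero>\<^bsub>B\<^esub>) \<longrightarrow> d \<otimes>\<^bsub>B\<^esub> e2 = \<zero>\<^bsub>B\<^esub>" by blast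
    have h: "h1 \<in> carrier (end_rng P)" "h2 \<in> carrier (end_rng P)" using eng by auto
    show ?case
      using h e
      by (simp, intro bexI[of _ "e1 \<oplus>\<^bsub>B\<^esub> e2"])
        (auto simp: B.r_distr S_closed' EP_apply EP_closed S_add)
  qed
qed

lemma rel_functional:
  assumes FS: "condition_FS R P Q \<psi>" and 1: "rel \<Theta> b" and 2: "rel \<Theta> b'"
  shows "b = b'"
proof -
  let ?d = "b \<oplus>\<^bsub>B\<^esub> \<ominus>\<^bsub>B\<^esub> b'"
  have c: "b \<in> carrier B" "b' \<in> carrier B" "\<Theta> \<in> carrier (end_rng Q)"
    using rel_closed[OF 1] rel_closed[OF 2] by auto
  have d: "rel \<zero>\<^bsub>end_rng Q\<^esub> ?d"
    using pi_rel.add[OF 1 pi_rel.neg[OF 2]] c by (simp add: EQ.r_neg)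
  then have dT: "?d \<otimes>\<^bsub>B\<^esub> T x = \<zero>\<^bsub>B\<^esub>" if "x \<in> carrier Q" for x
    using rel_T[OF d that] that by (simp add: EQ_apply T_zero)
  obtain Y where Y: "finite Y" "Y \<subseteq> carrier P"
    "\<forall>e\<in>carrier B. (\<forall>y\<in>Y. S y \<otimes>\<^bsub>B\<^esub> e = S y) \<longrightarrow> ?d \<otimes>\<^bsub>B\<^esub> e = ?d"
    using rel_right_unit[OF d] by blast
  obtain \<Phi> where \<Phi>: "\<Phi> \<in> finite_rank_P R P Q \<psi>" "\<forall>y\<in>Y. \<Phi> y = y"
    using FS Y(1,2) unfolding condition_FS_def by (metis finite.emptyI empty_subsetI)
  obtain e where e: "e \<in> carrier B" "\<forall>y\<in>carrier P. S y \<otimes>\<^bsub>B\<^esub> e = S (\<Phi> y)"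
    "\<forall>d\<in>carrier B. (\<forall>x\<in>carrier Q. d \<otimes>\<^bsub>B\<^esub> T x = \<zero>\<^bsub>B\<^esub>) \<longrightarrow> d \<otimes>\<^bsub>B\<^esub> e = \<zero>\<^bsub>B\<^esub>"
    using finite_rank_P_elem[OF \<Phi>(1)] by blast
  have "?d \<otimes>\<^bsub>B\<^esub> e = ?d" using Y e \<Phi> by (metis subsetD)
  moreover have "?d \<otimes>\<^bsub>B\<^esub> e = \<zero>\<^bsub>B\<^esub>" using e(3) dT c by simp
  ultimately have "?d = \<zero>\<^bsub>B\<^esub>" by simp
  then have "\<ominus>\<^bsub>B\<^esub> b' = \<ominus>\<^bsub>B\<^esub> b"
    using c B.minus_equality[of "\<ominus>\<^bsub>B\<^esub> b'" b] by (metis B.a_comm B.a_inv_closed)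
  then show ?thesis using c B.minus_minus by metis
qed

theorem pi_map_unique:
  assumes FS: "condition_FS R P Q \<psi>"
  shows "\<exists>!h. is_pi_map R P Q \<psi> B S T h"
proof -
  let ?F = "finite_rank_Q R P Q \<psi>"
  define h where "h = (\<lambda>\<Theta>\<in>?F. THE b. rel \<Theta> b)"
  have h: "h \<Theta> = b" if "rel \<Theta> b" for \<Theta> b
  proof -
    have "(THE b. rel \<Theta> b) = b"
      by (rule the_equality, rule that) (rule rel_functional[OF FS _ that])
    then show ?thesis using rel_closed(1)[OF that] by (simp add: h_def)
  qed
  have "is_pi_map R P Q \<psi> B S T h"
    unfolding is_pi_map_def
  proof (intro conjI ballI)
    show "h \<in> extensional ?F" by (simp add: h_def)
    show "h (theta_Q R P Q \<psi> q p) = T q \<otimes>\<^bsub>B\<^esub> S p" if "q \<in> carrier Q" "p \<in> carrier P" for q p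
      by (rule h[OF pi_rel.incl[OF that]])
    show "h \<in> rng_hom (end_rng Q\<lparr>carrier := ?F\<rparr>) B"
      unfolding rng_hom_def
    proof (intro CollectI conjI ballI funcsetI)
      show "h \<Theta> \<in> carrier B" if "\<Theta> \<in> carrier (end_rng Q\<lparr>carrier := ?F\<rparr>)" for \<Theta>
        using that rel_total[of \<Theta>] h rel_closed(3) by auto
      fix \<Theta> \<Theta>' assume "\<Theta> \<in> carrier (end_rng Q\<lparr>carrier := ?F\<rparr>)" "\<Theta>' \<in> carrier (end_rng Q\<lparr>carrier := ?F\<rparr>)"
      then obtain b b' where b: "rel \<Theta> b" "rel \<Theta>' b'" using rel_total by simp metis
      show "h (\<Theta> \<oplus>\<^bsub>end_rng Q\<lparr>carrier := ?F\<rparr>\<^esub> \<Theta>') = h \<Theta> \<oplus>\<^bsub>B\<^esub> h \<Theta>'"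
        using h[OF pi_rel.add[OF b]] h[OF b(1)] h[OF b(2)] by simp
      show "h (\<Theta> \<otimes>\<^bsub>end_rng Q\<lparr>carrier := ?F\<rparr>\<^esub> \<Theta>') = h \<Theta> \<otimes>\<^bsub>B\<^esub> h \<Theta>'"
        using h[OF rel_mult[OF b]] h[OF b(1)] h[OF b(2)] by simp
    qed
  qed
  moreover have val: "k \<Theta> = b" if k: "is_pi_map R P Q \<psi> B S T k" and "rel \<Theta> b" for k \<Theta> b
    using \<open>rel \<Theta> b\<close>
  proof (induction rule: pi_rel.induct)
    have kc: "\<And>\<Theta>. \<Theta> \<in> ?F \<Longrightarrow> k \<Theta> \<in> carrier B"
      and ka: "\<And>\<Theta> \<Theta>'. \<lbrakk>\<Theta> \<in> ?F; \<Theta>' \<in> ?F\<rbrakk> \<Longrightarrow> k (\<Theta> \<oplus>\<^bsub>end_rng Q\<^esub> \<Theta>') = k \<Theta> \<oplus>\<^bsub>B\<^esub> k \<Theta>'"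
      using k by (auto simp: is_pi_map_def rng_hom_def)
    have z: "\<zero>\<^bsub>end_rng Q\<^esub> \<in> ?F" using rel_closed(1)[OF pi_rel.zero] .
    have k0: "k \<zero>\<^bsub>end_rng Q\<^esub> = \<zero>\<^bsub>B\<^esub>" using kc[OF z] ka[OF z z] by simp
    {
      case zero show ?case by (rule k0)
    next
      case (incl q p) then show ?case using k by (simp add: is_pi_map_def)
    next
      case (neg \<Theta> b)
      have c: "\<Theta> \<in> ?F" "\<ominus>\<^bsub>end_rng Q\<^esub> \<Theta> \<in> ?F" "\<Theta> \<in> carrier (end_rng Q)" "b \<in> carrier B"
        using rel_closed[OF neg(1)] rel_closed[OF pi_rel.neg[OF neg(1)]] by auto
      have "k (\<ominus>\<^bsub>end_rng Q\<^esub> \<Theta>) \<oplus>\<^bsub>B\<^esub> b = \<zero>\<^bsub>B\<^esub>"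
        using ka[OF c(2,1)] k0 neg c by (simp add: EQ.l_neg)
      then show ?case using kc[OF c(2)] c B.minus_equality by metis
    next
      case (add \<Theta> b \<Theta>' b')
      then show ?case using ka rel_closed[OF add(1)] rel_closed[OF add(2)] by simp
    }
  qed
  ultimately show ?thesis
  proof (intro ex1I)
    fix k assume k: "is_pi_map R P Q \<psi> B S T k"
    show "k = h"
    proof (rule extensionalityI[of _ ?F])
      show "k \<Theta> = h \<Theta>" if "\<Theta> \<in> ?F" for \<Theta>
        using rel_total[OF that] val[OF k] h by metis
    qed (use k in \<open>simp_all add: is_pi_map_def h_def\<close>)
  qed
qed

lemma is_pi_map_pi_map:
  assumes "condition_FS R P Q \<psi>"
  shows "is_pi_map R P Q \<psi> B S T (pi_map R P Q \<psi> B S T)"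
  unfolding pi_map_def by (rule theI'[OF pi_map_unique[OF assms]])

end

end

theory Submission
  imports Defs
begin

text \<open>
  The inclusions of \<open>R\<close>, \<open>I\<close> and \<open>J\<close> into the Steinberg algebra \<open>A\<close> form a covariant representation
  and induce a graded homomorphism \<open>eta\<close> from the Toeplitz ring to \<open>A\<close>, which is onto because \<open>R\<close>,
  \<open>I\<close> and \<open>J\<close> generate \<open>A\<close>. The uniquely maximal faithful compatible ideal turns out to be
  \<open>L = R \<inter> IJ\<close>, so the relations of the Cuntz--Pimsner ring say that each \<open>x = \<Sum> i\<^sub>k j\<^sub>k\<close> in \<open>L\<close> equals
  its lift \<open>\<Sum> \<iota>\<^sub>Q(i\<^sub>k) \<iota>\<^sub>P(j\<^sub>k)\<close>, and \<open>eta\<close> kills them.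

  Conversely let \<open>t\<close> be homogeneous in the kernel of \<open>eta\<close>. In positive degree \<open>t = e t\<close> for a lifted
  local unit \<open>e\<close> of \<open>IJ\<close>, and \<open>\<iota>\<^sub>P(j) t\<close> has smaller degree, so induction applies; negative degrees
  are symmetric. In degree zero, \<open>t = \<iota>\<^sub>R(r) + u\<close> with \<open>u = e u e'\<close>. By induction on the number of
  times that \<open>t\<close> has to be compressed by \<open>t \<mapsto> \<iota>\<^sub>P(j) t \<iota>\<^sub>Q(i)\<close> to reach \<open>\<iota>\<^sub>R(R)\<close>, the element
  \<open>e t e'\<close> vanishes modulo the relations. Hence \<open>t\<close> is congruent to \<open>\<iota>\<^sub>R(r) - e \<iota>\<^sub>R(r) e'\<close>, the
  difference of \<open>\<iota>\<^sub>R(r)\<close> and the lift of some \<open>b\<close> in \<open>IJ\<close>; applying \<open>eta\<close> shows that \<open>r = b\<close> lies in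
  \<open>L\<close>, so this difference is itself a relation.

  For the groupoid, the local units are characteristic functions of compact open sets of units
  covered by sets \<open>r(B)\<close> with \<open>B \<subseteq> H1\<close> and \<open>B\<inverse> \<subseteq> Hm\<close>, and a function that annihilates \<open>I\<close> vanishes at
  all points whose source lies in \<open>r(H1)\<close>.
\<close>

section \<open>Subrings, bimodules and products inside a ring\<close>

text \<open>The obstacle in degree zero is that lifted local units need not fix the images of
  \<open>R\<close> in the Toeplitz ring: \<open>lifted a \<cdot> iR r\<close> is again a lift. So
  the summand from \<open>R\<close> has to be split off before compressing.

  The annihilator conditions exist to turn equality of operators into equality of elements. A
  finite-rank operator on \<open>I\<close> is left multiplication by an element of IJ, so an element
  x of a compatible ideal acts on \<open>I\<close> like some a in IJ. Faithfulness puts x into the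
  perp of the annihilator, condition (3) puts a into \<open>R\<close>, and then x - a lies both in
  the annihilator and in its perp, hence is zero. This identifies the maximal ideal.

  Local units live in IJ, inside the Steinberg algebra. They can be moved into the Toeplitz ring
  because the canonical map on finite-rank operators makes the assignment of
  \<open>iQ i \<cdot> iP j\<close> to the product i j well defined on all of IJ.

  The passage from conditions (1) to (3) to the isomorphism is pure ring theory in an arbitrary
  ambient ring; the groupoid enters only where the conditions are checked and through the grading by
  level sets of the cocycle.\<close>

definition sub_rng :: "('a, 'm) ring_scheme \<Rightarrow> 'a set \<Rightarrow> 'a ring" where
  "sub_rng A S = \<lparr>carrier = S, monoid.mult = monoid.mult A, one = undefined,
     zero = zero A, add = add A\<rparr>"

text \<open>Field by field, undefined unit included, the two records coincide with
  \<open>function_rng\<close> and \<open>steinberg_bimodule\<close> when the ambient ring is the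
  Steinberg algebra, so the abstract results transfer by rewriting.\<close>

definition sub_bimodule :: "('a, 'm) ring_scheme \<Rightarrow> 'a set \<Rightarrow> ('a, 'a) bimodule" where
  "sub_bimodule A S = \<lparr>carrier = S, monoid.mult = monoid.mult A, one = undefined,
     zero = zero A, add = add A, smult = monoid.mult A, rsmult = monoid.mult A\<rparr>"

lemma sub_rng_simps [simp]:
  "carrier (sub_rng A S) = S" "x \<otimes>\<^bsub>sub_rng A S\<^esub> y = x \<otimes>\<^bsub>A\<^esub> y"
  "x \<oplus>\<^bsub>sub_rng A S\<^esub> y = x \<oplus>\<^bsub>A\<^esub> y" "\<zero>\<^bsub>sub_rng A S\<^esub> = \<zero>\<^bsub>A\<^esub>"
  by (simp_all add: sub_rng_def)

lemma sub_bimodule_simps [simp]: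
  "carrier (sub_bimodule A S) = S" "x \<oplus>\<^bsub>sub_bimodule A S\<^esub> y = x \<oplus>\<^bsub>A\<^esub> y"
  "\<zero>\<^bsub>sub_bimodule A S\<^esub> = \<zero>\<^bsub>A\<^esub>"
  "smult (sub_bimodule A S) x y = x \<otimes>\<^bsub>A\<^esub> y" "rsmult (sub_bimodule A S) y x = y \<otimes>\<^bsub>A\<^esub> x"
  by (simp_all add: sub_bimodule_def)

lemma (in abelian_group) additive_subgroupI:
  assumes "H \<subseteq> carrier G" "\<zero> \<in> H" "\<And>x y. \<lbrakk>x \<in> H; y \<in> H\<rbrakk> \<Longrightarrow> x \<oplus> y \<in> H"
    "\<And>x. x \<in> H \<Longrightarrow> \<ominus> x \<in> H"
  shows "additive_subgroup H G"
  unfolding additive_subgroup_def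
  by (rule add.subgroupI) (use assms in \<open>auto simp: a_inv_def\<close>)

lemma (in abelian_group) additive_subgroupD:
  assumes "additive_subgroup H G"
  shows "H \<subseteq> carrier G" "x \<in> H \<Longrightarrow> x \<in> carrier G" "\<zero> \<in> H"
    "\<lbrakk>x \<in> H; y \<in> H\<rbrakk> \<Longrightarrow> x \<oplus> y \<in> H" "x \<in> H \<Longrightarrow> \<ominus> x \<in> H" "\<lbrakk>x \<in> H; y \<in> H\<rbrakk> \<Longrightarrow> x \<ominus> y \<in> H"
proof -
  interpret H: additive_subgroup H G by fact
  show "H \<subseteq> carrier G" "x \<in> H \<Longrightarrow> x \<in> carrier G" "\<zero> \<in> H"
    using H.a_subset H.a_Hcarr H.zero_closed by auto
  show "\<lbrakk>x \<in> H; y \<in> H\<rbrakk> \<Longrightarrow> x \<oplus> y \<in> H" by (rule H.a_closed)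
  show n: "x \<in> H \<Longrightarrow> \<ominus> x \<in> H" for x
    using subgroup.m_inv_closed[OF H.a_subgroup] by (simp add: a_inv_def)
  show "\<lbrakk>x \<in> H; y \<in> H\<rbrakk> \<Longrightarrow> x \<ominus> y \<in> H"
    using n H.a_closed by (simp add: a_minus_def)
qed

lemma (in abelian_group) abelian_group_restrict:
  assumes "additive_subgroup H G" "carrier M = H" "add M = add G" "zero M = zero G"
  shows "abelian_group M"
proof (rule abelian_groupI)
  fix x assume "x \<in> carrier M"
  then show "\<exists>y\<in>carrier M. y \<oplus>\<^bsub>M\<^esub> x = \<zero>\<^bsub>M\<^esub>"
    using additive_subgroupD[OF assms(1)] assms(2-4) by (intro bexI[of _ "\<ominus> x"]) (auto simp: l_neg)
qed (use additive_subgroupD[OF assms(1)] assms(2-4) in \<open>auto simp: a_assoc intro: a_comm\<close>)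

lemma (in rng) rng_sub_rng:
  assumes "subrng S R"
  shows "rng (sub_rng R S)"
proof (intro rng.intro rng_axioms.intro)
  have S: "additive_subgroup S R" "\<And>x y. \<lbrakk>x \<in> S; y \<in> S\<rbrakk> \<Longrightarrow> x \<otimes> y \<in> S"
    using assms by (auto simp: subrng_def)
  show "abelian_group (sub_rng R S)"
    by (rule abelian_group_restrict[OF S(1)]) (simp_all add: sub_rng_def)
qed (use assms additive_subgroupD[of S] in \<open>auto simp: subrng_def m_assoc l_distr r_distr\<close>)

lemma (in rng) rng_bimodule_sub:
  assumes "subrng S R" "additive_subgroup M R"
    "\<And>r x. \<lbrakk>r \<in> S; x \<in> M\<rbrakk> \<Longrightarrow> r \<otimes> x \<in> M" "\<And>r x. \<lbrakk>r \<in> S; x \<in> M\<rbrakk> \<Longrightarrow> x \<otimes> r \<in> M"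
  shows "rng_bimodule (sub_rng R S) (sub_bimodule R M)"
proof (intro rng_bimodule.intro rng_bimodule_axioms.intro rng_sub_rng assms(1))
  show "abelian_group (sub_bimodule R M)"
    by (rule abelian_group_restrict[OF assms(2)]) (simp_all add: sub_bimodule_def)
  have "S \<subseteq> carrier R" "M \<subseteq> carrier R"
    using assms additive_subgroupD(1) by (auto simp: subrng_def)
  then have "\<And>x. x \<in> S \<Longrightarrow> x \<in> carrier R" "\<And>x. x \<in> M \<Longrightarrow> x \<in> carrier R" by auto
qed (use assms additive_subgroupD(2)[of S] additive_subgroupD(2)[of M] in
  \<open>auto simp: subrng_def m_assoc l_distr r_distr\<close>)

lemma (in rng) set_times_subgroup:
  assumes "X \<subseteq> carrier R" "Y \<subseteq> carrier R"
  shows "additive_subgroup (set_times R X Y) R"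
  unfolding additive_subgroup_def set_times_def
  using assms by (intro add.generate_is_subgroup) (auto intro: m_closed)

lemma set_times_prod: "\<lbrakk>x \<in> X; y \<in> Y\<rbrakk> \<Longrightarrow> x \<otimes>\<^bsub>R\<^esub> y \<in> set_times R X Y"
  unfolding set_times_def by (rule generate.incl) auto

text \<open>There is no case for negatives because - (x y) = (- x) y, and \<open>X\<close> is closed
  under negation.\<close>

lemma (in rng) set_times_induct [consumes 3, case_names zero prod add]:
  assumes a: "a \<in> set_times R X Y" and X: "additive_subgroup X R" "Y \<subseteq> carrier R"
    and P: "P \<zero>" "\<And>x y. \<lbrakk>x \<in> X; y \<in> Y\<rbrakk> \<Longrightarrow> P (x \<otimes> y)"
      "\<And>a b. \<lbrakk>a \<in> set_times R X Y; b \<in> set_times R X Y; P a; P b\<rbrakk> \<Longrightarrow> P (a \<oplus> b)"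
  shows "P a"
  using a[unfolded set_times_def]
proof (induction rule: generate.induct)
  case one then show ?case using P(1) by simp
next
  case (incl h) then show ?case using P(2) by auto
next
  case (inv h)
  then obtain x y where h: "h = x \<otimes> y" "x \<in> X" "y \<in> Y" by auto
  have "\<ominus> h = (\<ominus> x) \<otimes> y"
    using h additive_subgroupD[OF X(1)] X(2) by (auto simp: rng_l_minus)
  then show ?case using h P(2)[of "\<ominus> x" y] additive_subgroupD[OF X(1)]
    by (simp add: a_inv_def)
next
  case (eng a b) then show ?case using P(3) by (auto simp: set_times_def)
qed

lemma (in rng) set_times_subset:
  assumes "additive_subgroup X R" "Y \<subseteq> carrier R" "additive_subgroup Z R"
    "\<And>x y. \<lbrakk>x \<in> X; y \<in> Y\<rbrakk> \<Longrightarrow> x \<otimes> y \<in> Z"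
  shows "set_times R X Y \<subseteq> Z"
proof
  fix a assume "a \<in> set_times R X Y"
  from this assms(1,2) show "a \<in> Z"
    by (induction rule: set_times_induct) (use assms(4) additive_subgroupD[OF assms(3)] in auto)
qed

text \<open>Condition (1) in an arbitrary ring. It is lopsided: JI lies in \<open>R\<close>, whereas
  IJ may stick out of it, and the theory revolves around how IJ meets \<open>R\<close>.\<close>

locale rng_triple = rng A for A (structure) +
  fixes R I J :: "'a set"
  assumes R_subrng: "subrng R A"
    and I_sub: "additive_subgroup I A" and J_sub: "additive_subgroup J A"
    and RI: "\<lbrakk>r \<in> R; i \<in> I\<rbrakk> \<Longrightarrow> r \<otimes> i \<in> I" and IR: "\<lbrakk>r \<in> R; i \<in> I\<rbrakk> \<Longrightarrow> i \<otimes> r \<in> I"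
    and RJ: "\<lbrakk>r \<in> R; j \<in> J\<rbrakk> \<Longrightarrow> r \<otimes> j \<in> J" and JR: "\<lbrakk>r \<in> R; j \<in> J\<rbrakk> \<Longrightarrow> j \<otimes> r \<in> J"
    and JI: "\<lbrakk>j \<in> J; i \<in> I\<rbrakk> \<Longrightarrow> j \<otimes> i \<in> R"
begin

abbreviation "Rr \<equiv> sub_rng A R"
abbreviation "P \<equiv> sub_bimodule A J"
abbreviation "Q \<equiv> sub_bimodule A I"
abbreviation "IJ \<equiv> set_times A I J"

lemma R_sub: "additive_subgroup R A" and RR: "\<lbrakk>r \<in> R; s \<in> R\<rbrakk> \<Longrightarrow> r \<otimes> s \<in> R"
  using R_subrng by (auto simp: subrng_def)

lemma R_c: "x \<in> R \<Longrightarrow> x \<in> carrier A" and I_c: "x \<in> I \<Longrightarrow> x \<in> carrier A"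
  and J_c: "x \<in> J \<Longrightarrow> x \<in> carrier A"
  using additive_subgroupD[OF R_sub] additive_subgroupD[OF I_sub] additive_subgroupD[OF J_sub] by auto

lemma IJ_sub: "additive_subgroup IJ A"
  using I_c J_c by (intro set_times_subgroup) auto

lemma IJ_c: "x \<in> IJ \<Longrightarrow> x \<in> carrier A" using additive_subgroupD[OF IJ_sub] by auto

lemma P_bimodule: "rng_bimodule Rr P" and Q_bimodule: "rng_bimodule Rr Q"
  by (intro rng_bimodule_sub R_subrng J_sub I_sub RJ JR RI IR; assumption)+

lemma IJ_induct [consumes 1, case_names zero prod add]:
  assumes "a \<in> IJ" "F \<zero>" "\<And>i j. \<lbrakk>i \<in> I; j \<in> J\<rbrakk> \<Longrightarrow> F (i \<otimes> j)"
    "\<And>a b. \<lbrakk>a \<in> IJ; b \<in> IJ; F a; F b\<rbrakk> \<Longrightarrow> F (a \<oplus> b)"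
  shows "F a"
proof -
  have "J \<subseteq> carrier A" using J_c by auto
  from assms(1) I_sub this show ?thesis
    by (induction rule: set_times_induct) (use assms in auto)
qed

lemma IJ_prod: "\<lbrakk>i \<in> I; j \<in> J\<rbrakk> \<Longrightarrow> i \<otimes> j \<in> IJ" by (rule set_times_prod)

text \<open>Reassociating (i j) i' = i (j i') brings the factor j i' of \<open>R\<close> into play;
  the closure rules below are obtained likewise.\<close>

lemma IJ_I: "\<lbrakk>a \<in> IJ; i \<in> I\<rbrakk> \<Longrightarrow> a \<otimes> i \<in> I"
  by (induction rule: IJ_induct)
    (use additive_subgroupD[OF I_sub] in \<open>auto simp: IJ_c I_c J_c m_assoc l_distr intro: IR JI\<close>)

lemma J_IJ: "\<lbrakk>a \<in> IJ; j \<in> J\<rbrakk> \<Longrightarrow> j \<otimes> a \<in> J"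
  by (induction rule: IJ_induct)
    (use additive_subgroupD[OF J_sub] in
      \<open>auto simp: IJ_c I_c J_c m_assoc[symmetric] r_distr intro: RJ JI\<close>)

lemma R_IJ: "\<lbrakk>a \<in> IJ; r \<in> R\<rbrakk> \<Longrightarrow> r \<otimes> a \<in> IJ"
  by (induction rule: IJ_induct)
    (use additive_subgroupD[OF IJ_sub] in
      \<open>auto simp: IJ_c I_c J_c R_c m_assoc[symmetric] r_distr intro: RI IJ_prod\<close>)

lemma IJ_R: "\<lbrakk>a \<in> IJ; r \<in> R\<rbrakk> \<Longrightarrow> a \<otimes> r \<in> IJ"
  by (induction rule: IJ_induct)
    (use additive_subgroupD[OF IJ_sub] in
      \<open>auto simp: IJ_c I_c J_c R_c m_assoc l_distr intro: JR IJ_prod\<close>)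

lemma IJ_IJ: "\<lbrakk>a \<in> IJ; b \<in> IJ\<rbrakk> \<Longrightarrow> a \<otimes> b \<in> IJ"
  by (induction rule: IJ_induct)
    (use additive_subgroupD[OF IJ_sub] in
      \<open>auto simp: IJ_c I_c J_c m_assoc l_distr intro: J_IJ IJ_prod\<close>)

end

text \<open>Either action sends each defining relation of the tensor product to a relation of the
  same kind. This makes the actions computable on arbitrary classes, not only on elementary tensors,
  as the bimodule law for the multiplication map demands.\<close>

lemma tensor_null_smult:
  assumes PQ: "rng_bimodule R P" "rng_bimodule R Q" and r: "r \<in> carrier R"
    and x: "x \<in> tensor_null R P Q"
  shows "frag_extend (\<lambda>z. frag_of (smult P r (fst z), snd z)) x \<in> tensor_null R P Q"
    and "frag_extend (\<lambda>z. frag_of (fst z, rsmult Q (snd z) r)) x \<in> tensor_null R P Q"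
proof -
  interpret P: rng_bimodule R P by fact
  interpret Q: rng_bimodule R Q by fact
  note le = tensor_null_generate_le[OF tensor_null_subgroup[OF PQ] _ _ tensor_rels_carrier[OF PQ]
        x[unfolded tensor_null_def]]
  show "frag_extend (\<lambda>z. frag_of (smult P r (fst z), snd z)) x \<in> tensor_null R P Q"
  proof (rule le)
    fix x assume "x \<in> tensor_rels R P Q"
    then show "frag_extend (\<lambda>z. frag_of (smult P r (fst z), snd z)) x \<in> tensor_null R P Q"
      by (rule tensor_relsE)
        (simp_all add: frag_extend_diff P.left_add P.left_closed P.left_right[symmetric] r
          tensor_rels_null tensor_relsI)
  qed (simp add: frag_extend_add)
  show "frag_extend (\<lambda>z. frag_of (fst z, rsmult Q (snd z) r)) x \<in> tensor_null R P Q"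
  proof (rule le)
    fix x assume "x \<in> tensor_rels R P Q"
    then show "frag_extend (\<lambda>z. frag_of (fst z, rsmult Q (snd z) r)) x \<in> tensor_null R P Q"
      by (rule tensor_relsE)
        (simp_all add: frag_extend_diff Q.right_add Q.right_closed Q.left_right r
          tensor_rels_null tensor_relsI)
  qed (simp add: frag_extend_add)
qed

section \<open>The coefficient system of a triple of additive subgroups\<close>

text \<open>Multiplication of pairs extends to the free abelian group and kills the balancing
  relations by distributivity and associativity, so it is constant on cosets.\<close>

lemma (in rng_triple) ex_multiplication_map:
  "\<exists>\<psi>. \<psi> \<in> bimodule_hom Rr (tensor Rr P Q) (regular_bimodule Rr) \<and>
     (\<forall>j\<in>J. \<forall>i\<in>I. \<psi> (tensor_elem Rr P Q j i) = j \<otimes> i)"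
proof -
  interpret Rr: rng Rr by (rule rng_sub_rng[OF R_subrng])
  interpret PB: rng_bimodule Rr P by (rule P_bimodule)
  interpret QB: rng_bimodule Rr Q by (rule Q_bimodule)
  let ?Z = "J \<times> I"
  let ?F = "free_Abelian_group ?Z"
  have cl: "(\<lambda>z. fst z \<otimes> snd z) ` ?Z \<subseteq> carrier (add_monoid Rr)" using JI by auto
  obtain h where h: "h \<in> hom ?F (add_monoid Rr)"
    and hz: "\<And>z. z \<in> ?Z \<Longrightarrow> h (frag_of z) = fst z \<otimes> snd z"
    by (rule comm_group.free_Abelian_group_universal[OF Rr.a_comm_group cl], rule that) auto
  interpret h: group_hom ?F "add_monoid Rr" h
    using h by (intro group_hom.intro group_hom_axioms.intro) (simp_all add: comm_group.axioms(2)[OF Rr.a_comm_group, simplified])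
  have hc: "h x \<in> R" if "Poly_Mapping.keys x \<subseteq> ?Z" for x using h that by (auto simp: hom_def)
  have hadd: "h (x + y) = h x \<oplus> h y"
    if "Poly_Mapping.keys x \<subseteq> ?Z" "Poly_Mapping.keys y \<subseteq> ?Z" for x y
    using h that by (auto simp: hom_def)
  have h0: "h 0 = \<zero>" using h.hom_one by simp
  have hdiff: "h (x - y) = h x \<ominus> h y"
    if k: "Poly_Mapping.keys x \<subseteq> ?Z" "Poly_Mapping.keys y \<subseteq> ?Z" for x y
  proof -
    have k': "Poly_Mapping.keys (x - y) \<subseteq> ?Z" by (rule keys_diff_le[OF k])
    have "h x = h (x - y) \<oplus> h y" using hadd[OF k' k(2)] by simp
    then show ?thesis using hc[OF k(1)] hc[OF k(2)] hc[OF k'] R_c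
      by (simp add: a_minus_def a_assoc r_neg)
  qed
  have kz: "Poly_Mapping.keys (frag_of z) \<subseteq> ?Z" if "z \<in> ?Z" for z using that by simp
  have "tensor_rels Rr P Q \<subseteq> kernel ?F (add_monoid Rr) h"
  proof
    fix x assume x: "x \<in> tensor_rels Rr P Q"
    then have "x \<in> carrier ?F" using subsetD[OF tensor_rels_carrier[OF P_bimodule Q_bimodule] x] by simp
    moreover have "h x = \<zero>"
      using x
    proof (cases rule: tensor_relsE)
      case (1 p p' q)
      then have c: "p \<in> J" "p' \<in> J" "q \<in> I" "p \<oplus> p' \<in> J"
        using PB.M.a_closed[of p p'] by auto
      then show ?thesis using 1
        by (simp add: hdiff keys_diff_le hz l_distr J_c I_c add_minus_minus m_closed)
    next
      case (2 p q q')
      then have c: "p \<in> J" "q \<in> I" "q' \<in> I" "q \<oplus> q' \<in> I"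
        using QB.M.a_closed[of q q'] by auto
      then show ?thesis using 2
        by (simp add: hdiff keys_diff_le hz r_distr J_c I_c add_minus_minus m_closed)
    next
      case (3 p r q)
      then show ?thesis
        by (simp add: hdiff hz J_c I_c R_c m_assoc JR RI m_closed a_minus_def r_neg)
    qed
    ultimately show "x \<in> kernel ?F (add_monoid Rr) h" by (simp add: kernel_def)
  qed
  then have "tensor_null Rr P Q \<subseteq> kernel ?F (add_monoid Rr) h"
    unfolding tensor_null_def sub_bimodule_simps
    by (rule h.G.generate_subgroup_incl) (rule h.subgroup_kernel)
  then have hN: "n \<in> tensor_null Rr P Q \<Longrightarrow> h n = \<zero> \<and> Poly_Mapping.keys n \<subseteq> ?Z" for n
    by (auto simp: kernel_def)
  \<comment> \<open>The choice of representative is immaterial, since \<open>h\<close> vanishes on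
    the null group by \<open>hN\<close>.\<close>
  define \<psi> where "\<psi> X = h (SOME y. y \<in> X)" for X
  have \<psi>: "\<psi> (tensor_class Rr P Q x) = h x" if x: "Poly_Mapping.keys x \<subseteq> ?Z" for x
  proof -
    have "x \<in> tensor_class Rr P Q x"
      unfolding tensor_class_def r_coset_def
      using subgroup.one_closed[OF tensor_null_subgroup[OF P_bimodule Q_bimodule]]
      by (intro UN_I[of 0]) auto
    then have "(SOME y. y \<in> tensor_class Rr P Q x) \<in> tensor_class Rr P Q x" by (rule someI)
    then obtain n where "n \<in> tensor_null Rr P Q" "(SOME y. y \<in> tensor_class Rr P Q x) = n + x"
      by (auto simp: tensor_class_def r_coset_def)
    then show ?thesis using hN x hc R_c by (simp add: \<psi>_def hadd)
  qed
  have car: "\<exists>x. X = tensor_class Rr P Q x \<and> Poly_Mapping.keys x \<subseteq> ?Z"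
    if "X \<in> carrier (tensor Rr P Q)" for X
    using that by (auto simp: tensor_def RCOSETS_def tensor_class_def)
  have act: "Poly_Mapping.keys (frag_extend (\<lambda>z. frag_of (f z)) x) \<subseteq> ?Z"
    if "Poly_Mapping.keys x \<subseteq> ?Z" "\<And>z. z \<in> ?Z \<Longrightarrow> f z \<in> ?Z" for f x
    using keys_frag_extend[of "\<lambda>z. frag_of (f z)" x] that by fastforce
  \<comment> \<open>Applied with \<open>g\<close> the left and the right multiplication by a ring
    element, matching the two actions on representatives.\<close>
  have hact: "h (frag_extend (\<lambda>z. frag_of (f z)) x) = g (h x)"
    if x: "Poly_Mapping.keys x \<subseteq> ?Z" and f: "\<And>z. z \<in> ?Z \<Longrightarrow> f z \<in> ?Z"
      and fg: "\<And>z. z \<in> ?Z \<Longrightarrow> fst (f z) \<otimes> snd (f z) = g (fst z \<otimes> snd z)"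
      and g: "g \<zero> = \<zero>" "\<And>a b. \<lbrakk>a \<in> R; b \<in> R\<rbrakk> \<Longrightarrow> g (a \<ominus> b) = g a \<ominus> g b" for f g x
    using x
  proof (induction x rule: free_Abelian_group_induct[consumes 1, case_names zero diff one])
    case zero then show ?case by (simp add: h0 g)
  next
    case (diff x y) then show ?case
      by (simp add: frag_extend_diff hdiff act f g hc)
  next
    case (one z) then show ?case using f[of z] fg[of z] hz[of z] hz[of "f z"] by auto
  qed
  show ?thesis
  proof (intro exI conjI ballI)
    show "\<psi> (tensor_elem Rr P Q j i) = j \<otimes> i" if "j \<in> J" "i \<in> I" for i j
      using that \<psi>[OF kz] hz by (simp add: tensor_elem_def)
    show "\<psi> \<in> bimodule_hom Rr (tensor Rr P Q) (regular_bimodule Rr)"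
      unfolding bimodule_hom_def
    proof (intro CollectI conjI ballI funcsetI)
      fix X assume X: "X \<in> carrier (tensor Rr P Q)"
      then obtain x where x: "X = tensor_class Rr P Q x" "Poly_Mapping.keys x \<subseteq> ?Z"
        using car by blast
      show "\<psi> X \<in> carrier (regular_bimodule Rr)" using x \<psi> hc by (simp add: regular_bimodule_def)
      fix Y assume "Y \<in> carrier (tensor Rr P Q)"
      then obtain y where y: "Y = tensor_class Rr P Q y" "Poly_Mapping.keys y \<subseteq> ?Z"
        using car by blast
      show "\<psi> (X \<oplus>\<^bsub>tensor Rr P Q\<^esub> Y) = \<psi> X \<oplus>\<^bsub>regular_bimodule Rr\<^esub> \<psi> Y"
        using x y tensor_class_add[OF P_bimodule Q_bimodule, of x y] \<psi> hadd
        by (simp add: regular_bimodule_def keys_add_le)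
    next
      fix r X assume r: "r \<in> carrier Rr" and X: "X \<in> carrier (tensor Rr P Q)"
      then obtain x where x: "X = tensor_class Rr P Q x" "Poly_Mapping.keys x \<subseteq> ?Z"
        using car by blast
      have rR: "r \<in> R" using r by simp
      let ?f = "\<lambda>z. (smult P r (fst z), snd z)"
      have "smult (tensor Rr P Q) r X = tensor_class Rr P Q (frag_extend (\<lambda>z. frag_of (?f z)) x)"
        using tensor_action_class[OF P_bimodule Q_bimodule _ tensor_null_smult(1)[OF P_bimodule
            Q_bimodule r], of x] x rR RJ
        by (simp add: tensor_def case_prod_unfold)
      moreover have "h (frag_extend (\<lambda>z. frag_of (?f z)) x) = r \<otimes> h x"
        by (rule hact[OF x(2)])
          (use rR in \<open>auto simp: R_c I_c J_c m_assoc RJ a_minus_def r_distr rng_r_minus\<close>)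
      moreover have "Poly_Mapping.keys (frag_extend (\<lambda>z. frag_of (?f z)) x) \<subseteq> ?Z"
        by (rule act[OF x(2)]) (use rR RJ in auto)
      ultimately show "\<psi> (smult (tensor Rr P Q) r X) = smult (regular_bimodule Rr) r (\<psi> X)"
        using \<psi> x by (simp add: regular_bimodule_def)
      let ?f = "\<lambda>z. (fst z, rsmult Q (snd z) r)"
      have "rsmult (tensor Rr P Q) X r = tensor_class Rr P Q (frag_extend (\<lambda>z. frag_of (?f z)) x)"
        using tensor_action_class[OF P_bimodule Q_bimodule _ tensor_null_smult(2)[OF P_bimodule
            Q_bimodule r], of x] x rR IR
        by (simp add: tensor_def case_prod_unfold)
      moreover have "h (frag_extend (\<lambda>z. frag_of (?f z)) x) = h x \<otimes> r"
        by (rule hact[OF x(2), where g="\<lambda>a. a \<otimes> r"])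
          (use rR in \<open>auto simp: R_c I_c J_c m_assoc IR a_minus_def l_distr rng_l_minus\<close>)
      moreover have "Poly_Mapping.keys (frag_extend (\<lambda>z. frag_of (?f z)) x) \<subseteq> ?Z"
        by (rule act[OF x(2)]) (use rR IR in auto)
      ultimately show "\<psi> (rsmult (tensor Rr P Q) X r) = rsmult (regular_bimodule Rr) (\<psi> X) r"
        using \<psi> x by (simp add: regular_bimodule_def)
    qed
  qed
qed

text \<open>Conditions (2) and (3) and the annihilator condition. In \<open>perp_IJ\<close> the
  difference r - a merely has to annihilate \<open>I\<close>, without a degree condition, as the
  ring carries no grading yet.\<close>

locale cp_triple = rng_triple A R I J for A (structure) and R I J +
  fixes \<psi>
  assumes mult_hom: "\<psi> \<in> bimodule_hom (sub_rng A R)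
      (tensor (sub_rng A R) (sub_bimodule A J) (sub_bimodule A I)) (regular_bimodule (sub_rng A R))"
    and mult_elem: "\<lbrakk>j \<in> J; i \<in> I\<rbrakk>
      \<Longrightarrow> \<psi> (tensor_elem (sub_rng A R) (sub_bimodule A J) (sub_bimodule A I) j i) = j \<otimes> i"
    and unit_I: "\<lbrakk>finite X; X \<subseteq> I\<rbrakk> \<Longrightarrow> \<exists>a\<in>set_times A I J. \<forall>i\<in>X. a \<otimes> i = i"
    and unit_J: "\<lbrakk>finite Y; Y \<subseteq> J\<rbrakk> \<Longrightarrow> \<exists>b\<in>set_times A I J. \<forall>j\<in>Y. j \<otimes> b = j"
    and perp_IJ: "\<lbrakk>r \<in> left_ann_perp A R I; a \<in> set_times A I J; \<And>i. i \<in> I \<Longrightarrow> (r \<ominus> a) \<otimes> i = \<zero>\<rbrakk>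
      \<Longrightarrow> a \<in> R"
    and ann_perp: "left_ann A R I \<inter> left_ann_perp A R I = {\<zero>}"

sublocale cp_triple \<subseteq> sys: rng_system "sub_rng A R" "sub_bimodule A J" "sub_bimodule A I" \<psi>
  by (intro rng_system.intro rng_system_axioms.intro P_bimodule Q_bimodule mult_hom)

context cp_triple
begin

section \<open>Finite-rank operators as multiplications by elements of IJ\<close>

definition left_op :: "'a \<Rightarrow> 'a \<Rightarrow> 'a" where "left_op a = (\<lambda>x\<in>I. a \<otimes> x)"

abbreviation "FQ \<equiv> finite_rank_Q Rr P Q \<psi>"
abbreviation "FP \<equiv> finite_rank_P Rr P Q \<psi>"

lemma left_op_zero: "left_op \<zero> = \<zero>\<^bsub>end_rng Q\<^esub>"
  by (auto simp: left_op_def end_rng_def I_c restrict_def fun_eq_iff)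

lemma left_op_add: "\<lbrakk>a \<in> carrier A; b \<in> carrier A\<rbrakk> \<Longrightarrow> left_op (a \<oplus> b) = left_op a \<oplus>\<^bsub>end_rng Q\<^esub> left_op b"
  by (auto simp: left_op_def end_rng_def I_c l_distr restrict_def fun_eq_iff)

text \<open>The operator sends x to i (j x) = (i j) x. This ties the finite-rank operators to
  IJ.\<close>

lemma left_op_prod: "\<lbrakk>i \<in> I; j \<in> J\<rbrakk> \<Longrightarrow> left_op (i \<otimes> j) = theta_Q Rr P Q \<psi> i j"
  by (auto simp: left_op_def theta_Q_def I_c J_c m_assoc restrict_def fun_eq_iff mult_elem)

lemma left_op_closed: "a \<in> IJ \<Longrightarrow> left_op a \<in> carrier (end_rng Q)"
  by (auto simp: left_op_def end_rng_def IJ_I IJ_c I_c r_distr additive_subgroupD[OF I_sub])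

lemma left_op_minus:
  assumes "a \<in> IJ" shows "left_op (\<ominus> a) = \<ominus>\<^bsub>end_rng Q\<^esub> left_op a"
proof -
  have n: "\<ominus> a \<in> IJ" using assms additive_subgroupD[OF IJ_sub] by auto
  have "left_op (\<ominus> a) \<oplus>\<^bsub>end_rng Q\<^esub> left_op a = \<zero>\<^bsub>end_rng Q\<^esub>"
    using left_op_add[of "\<ominus> a" a] assms IJ_c left_op_zero by (simp add: l_neg)
  then show ?thesis using sys.EQ.minus_equality[OF _ left_op_closed[OF assms] left_op_closed[OF n]] by simp
qed

lemma left_op_finite_rank: "a \<in> IJ \<Longrightarrow> left_op a \<in> FQ"
proof (induction rule: IJ_induct)
  case zero then show ?case
    unfolding finite_rank_Q_def left_op_zero using generate.one[of "add_monoid (end_rng Q)"] by simp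
next
  case (prod i j)
  then show ?case unfolding left_op_prod[OF prod] finite_rank_Q_def by (intro generate.incl) auto
next
  case (add a b)
  then show ?case
    using generate.eng[of "left_op a" "add_monoid (end_rng Q)" _ "left_op b"]
    by (simp add: left_op_add IJ_c finite_rank_Q_def)
qed

text \<open>Together with \<open>left_op_finite_rank\<close>, the finite-rank operators are exactly
  the image of IJ under \<open>left_op\<close>.\<close>

lemma finite_rank_left_op: "\<Theta> \<in> FQ \<Longrightarrow> \<exists>a\<in>IJ. \<Theta> = left_op a"
  unfolding finite_rank_Q_def
proof (induction rule: generate.induct)
  case one then show ?case using left_op_zero additive_subgroupD(3)[OF IJ_sub] by (metis monoid.simps(2))
next
  case (incl h) then obtain i j where "i \<in> I" "j \<in> J" "h = theta_Q Rr P Q \<psi> i j" by auto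
  then show ?case using left_op_prod[of i j] IJ_prod[of i j] by metis
next
  case (inv h)
  then obtain i j where ij: "i \<in> I" "j \<in> J" "h = theta_Q Rr P Q \<psi> i j" by auto
  have "inv\<^bsub>add_monoid (end_rng Q)\<^esub> h = \<ominus>\<^bsub>end_rng Q\<^esub> h" by (simp add: a_inv_def)
  also have "\<dots> = left_op (\<ominus> (i \<otimes> j))" using ij by (simp add: left_op_minus IJ_prod left_op_prod)
  finally show ?case using ij additive_subgroupD(5)[OF IJ_sub] IJ_prod by metis
next
  case (eng h1 h2)
  then obtain a b where "a \<in> IJ" "b \<in> IJ" "h1 = left_op a" "h2 = left_op b" by auto
  then show ?case using left_op_add[of a b] IJ_c additive_subgroupD[OF IJ_sub]
    by (intro bexI[of _ "a \<oplus> b"]) auto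
qed

definition right_op :: "'a \<Rightarrow> 'a \<Rightarrow> 'a" where "right_op a = (\<lambda>y\<in>J. y \<otimes> a)"

lemma right_op_finite_rank: "a \<in> IJ \<Longrightarrow> right_op a \<in> FP"
proof (induction rule: IJ_induct)
  case zero
  have "right_op \<zero> = \<zero>\<^bsub>end_rng P\<^esub>"
    by (auto simp: right_op_def end_rng_def J_c restrict_def fun_eq_iff)
  then show ?case
    unfolding finite_rank_P_def using generate.one[of "add_monoid (end_rng P)"] by simp
next
  case (prod i j)
  have "right_op (i \<otimes> j) = theta_P Rr P Q \<psi> j i"
    using prod
    by (auto simp: right_op_def theta_P_def I_c J_c m_assoc restrict_def fun_eq_iff mult_elem)
  then show ?case unfolding finite_rank_P_def using prod by (intro generate.incl) auto
next
  case (add a b)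
  have "right_op (a \<oplus> b) = right_op a \<oplus>\<^bsub>end_rng P\<^esub> right_op b"
    using add(1,2) by (auto simp: right_op_def end_rng_def J_c IJ_c r_distr restrict_def fun_eq_iff)
  then show ?case
    using generate.eng[OF add(3,4)[unfolded finite_rank_P_def]] by (simp add: finite_rank_P_def)
qed

text \<open>A local unit in IJ acts as a finite-rank operator fixing the given elements, on
  \<open>I\<close> from the left and on \<open>J\<close> from the right.\<close>

lemma FS: "condition_FS Rr P Q \<psi>"
  unfolding condition_FS_def
proof (intro allI impI, elim conjE)
  fix X Y assume X: "finite X" "X \<subseteq> carrier Q" and Y: "finite Y" "Y \<subseteq> carrier P"
  have "X \<subseteq> I" "Y \<subseteq> J" using X Y by auto
  then obtain a b where a: "a \<in> IJ" "\<forall>i\<in>X. a \<otimes> i = i" and b: "b \<in> IJ" "\<forall>j\<in>Y. j \<otimes> b = j"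
    using unit_I[OF X(1)] unit_J[OF Y(1)] by blast
  show "\<exists>\<Theta>\<in>FQ. \<exists>\<Phi>\<in>FP. (\<forall>q\<in>X. \<Theta> q = q) \<and> (\<forall>p\<in>Y. \<Phi> p = p)"
  proof (intro bexI[OF _ left_op_finite_rank[OF a(1)]] bexI[OF _ right_op_finite_rank[OF b(1)]] conjI ballI)
    show "left_op a q = q" if "q \<in> X" for q using that a X by (auto simp: left_op_def)
    show "right_op b p = p" if "p \<in> Y" for p using that b Y by (auto simp: right_op_def)
  qed
qed

section \<open>The maximal faithful compatible ideal\<close>

lemma ann_IJ:
  assumes y: "y \<in> left_ann A R I" and a: "a \<in> IJ"
  shows "y \<otimes> a = \<zero>" "a \<otimes> y = \<zero>"
proof -
  have yR: "y \<in> R" and yI: "\<And>i. i \<in> I \<Longrightarrow> y \<otimes> i = \<zero>" using y by (auto simp: left_ann_def)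
  have ya: "y \<otimes> a = \<zero>" if "a \<in> IJ" for a
    using that by (induction rule: IJ_induct)
      (use yR yI in \<open>auto simp: R_c IJ_c r_distr I_c J_c m_assoc[symmetric]\<close>)
  then show "y \<otimes> a = \<zero>" using a by simp
  \<comment> \<open>The element j y of \<open>J\<close> has a right unit b in IJ, and j y = j (y b)
    = 0 because y annihilates IJ from the left.\<close>
  have "j \<otimes> y = \<zero>" if j: "j \<in> J" for j
  proof -
    obtain b where b: "b \<in> IJ" "(j \<otimes> y) \<otimes> b = j \<otimes> y"
      using unit_J[of "{j \<otimes> y}"] JR[OF yR j] by auto
    then show ?thesis using ya j yR by (simp add: m_assoc J_c R_c IJ_c)
  qed
  with a show "a \<otimes> y = \<zero>"
    by (induction rule: IJ_induct)
      (use yR in \<open>auto simp: R_c IJ_c l_distr I_c J_c m_assoc\<close>)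
qed

lemma IJ_R_perp: "\<lbrakk>a \<in> IJ; a \<in> R\<rbrakk> \<Longrightarrow> a \<in> left_ann_perp A R I"
  using ann_IJ by (auto simp: left_ann_perp_def)

text \<open>The difference x - a kills \<open>I\<close>, so \<open>perp_IJ\<close> puts
  \<open>a\<close> into \<open>R\<close>; then x - a lies both in the annihilator of
  \<open>I\<close> and in its perp, which meet in zero.\<close>

lemma perp_left_op:
  assumes x: "x \<in> left_ann_perp A R I" and a: "a \<in> IJ" "\<And>i. i \<in> I \<Longrightarrow> x \<otimes> i = a \<otimes> i"
  shows "x = a"
proof -
  have xR: "x \<in> R" using x by (simp add: left_ann_perp_def)
  have 0: "(x \<ominus> a) \<otimes> i = \<zero>" if "i \<in> I" for i
    using that a(2)[OF that] a(1) xR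
    by (simp add: a_minus_def l_distr rng_l_minus R_c IJ_c I_c r_neg m_closed)
  have aR: "a \<in> R" using perp_IJ[OF x a(1) 0] .
  then have "x \<ominus> a \<in> left_ann A R I"
    using 0 xR additive_subgroupD[OF R_sub] by (auto simp: left_ann_def)
  moreover have "x \<ominus> a \<in> left_ann_perp A R I"
    using x IJ_R_perp[OF a(1) aR] additive_subgroupD[OF R_sub]
    by (auto simp: left_ann_perp_def left_ann_def a_minus_def l_distr r_distr rng_l_minus
        rng_r_minus R_c)
  ultimately have "x \<ominus> a = \<zero>" using ann_perp by auto
  moreover have "x = (x \<ominus> a) \<oplus> a" using xR aR by (simp add: a_minus_def a_assoc l_neg R_c)
  ultimately show ?thesis using aR R_c by simp
qed

lemma Delta_left_op: "Delta Q x = left_op x" by (simp add: Delta_def left_op_def)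

lemma left_op_eqD: "\<lbrakk>left_op x = left_op a; i \<in> I\<rbrakk> \<Longrightarrow> x \<otimes> i = a \<otimes> i"
  unfolding left_op_def by (metis restrict_apply')

text \<open>Compatibility yields \<open>a\<close> in IJ acting like \<open>x\<close>; by
  \<open>perp_left_op\<close> it remains to place \<open>x\<close> in the perp. For y in the
  annihilator, x y and y x belong to the ideal and kill \<open>I\<close>, so they lie in the kernel
  of \<open>Delta\<close> and vanish by faithfulness.\<close>

lemma faithful_compatible_le:
  assumes "faithful_compatible Rr P Q \<psi> L"
  shows "L \<subseteq> R \<inter> IJ"
proof
  fix x assume x: "x \<in> L"
  have id: "two_sided_ideal L Rr" and ker: "L \<inter> ker_Delta Rr Q = {\<zero>}"
    using assms by (auto simp: faithful_compatible_def psi_compatible_def)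
  have LR: "y \<in> R" if "y \<in> L" for y
    using that id additive_subgroup.a_Hcarr[of L Rr] by (simp add: two_sided_ideal_def)
  obtain a where a: "a \<in> IJ" "left_op x = left_op a"
    using assms x finite_rank_left_op[of "left_op x"]
    by (auto simp: faithful_compatible_def psi_compatible_def Delta_left_op)
  have "x \<in> left_ann_perp A R I"
    unfolding left_ann_perp_def
  proof (intro CollectI conjI ballI LR[OF x])
    fix y assume y: "y \<in> left_ann A R I"
    then have yR: "y \<in> R" and yI: "\<And>i. i \<in> I \<Longrightarrow> y \<otimes> i = \<zero>" by (auto simp: left_ann_def)
    have z: "z = \<zero>" if "z \<in> L" "\<And>i. i \<in> I \<Longrightarrow> z \<otimes> i = \<zero>" for z
    proof -
      have "left_op z = \<zero>\<^bsub>end_rng Q\<^esub>"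
        using that unfolding left_op_zero[symmetric] by (auto simp: left_op_def I_c restrict_def fun_eq_iff)
      then have "z \<in> L \<inter> ker_Delta Rr Q" using that LR by (simp add: ker_Delta_def Delta_left_op)
      then show ?thesis using ker by auto
    qed
    have L: "x \<otimes> y \<in> L" "y \<otimes> x \<in> L" using id x yR by (auto simp: two_sided_ideal_def)
    show "x \<otimes> y = \<zero>"
      by (rule z[OF L(1)]) (simp add: m_assoc R_c I_c yI yR LR[OF x])
    show "y \<otimes> x = \<zero>"
      by (rule z[OF L(2)]) (simp add: m_assoc R_c I_c RI yI yR LR[OF x])
  qed
  then have "x = a" using perp_left_op a left_op_eqD by blast
  then show "x \<in> R \<inter> IJ" using a LR[OF x] by auto
qed

lemma uniquely_maximal_IJ: "uniquely_maximal Rr P Q \<psi> (R \<inter> IJ)"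
  unfolding uniquely_maximal_def
proof (intro conjI allI impI faithful_compatible_le)
  show "faithful_compatible Rr P Q \<psi> (R \<inter> IJ)"
    unfolding faithful_compatible_def psi_compatible_def
  proof (intro conjI ballI)
    note S = additive_subgroupD[OF R_sub] additive_subgroupD[OF IJ_sub]
    have z: "\<zero> \<in> R" "\<zero> \<in> IJ" using S by auto
    have inv: "\<ominus>\<^bsub>Rr\<^esub> x = \<ominus> x" if "x \<in> R" for x
      by (rule sys.P.R.minus_equality) (use that S in \<open>auto simp: l_neg\<close>)
    show "two_sided_ideal (R \<inter> IJ) Rr"
      unfolding two_sided_ideal_def
      by (intro conjI sys.P.R.additive_subgroupI) (use S inv in \<open>auto intro: RR R_IJ IJ_R\<close>)
    show "Delta Q x \<in> FQ" if "x \<in> R \<inter> IJ" for x using that left_op_finite_rank by (simp add: Delta_left_op)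
    \<comment> \<open>Faithfulness is \<open>perp_left_op\<close> for the element zero of IJ, since
      \<open>IJ_R_perp\<close> places all of \<open>R \<inter> IJ\<close> in the perp.\<close>
    have "x = \<zero>" if "x \<in> R \<inter> IJ" "x \<in> ker_Delta Rr Q" for x
    proof -
      have "left_op x = left_op \<zero>" using that by (simp add: ker_Delta_def Delta_left_op left_op_zero)
      then show ?thesis
        by (intro perp_left_op[OF IJ_R_perp z(2)] left_op_eqD) (use that in simp_all)
    qed
    moreover have "\<zero> \<in> ker_Delta Rr Q" using z by (simp add: ker_Delta_def Delta_left_op left_op_zero)
    ultimately show "R \<inter> IJ \<inter> ker_Delta Rr Q = {\<zero>\<^bsub>Rr\<^esub>}"
      using z unfolding sub_rng_simps by blast
  qed
qed

lemma cuntz_pimsner_defined: "cuntz_pimsner_defined Rr P Q \<psi>"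
  unfolding cuntz_pimsner_defined_def
  using uniquely_maximal_IJ FS sys.rng_system_axioms by auto

lemma cuntz_pimsner_null: "cuntz_pimsner_null Rr P Q \<psi> = toeplitz_ideal Rr P Q \<psi> (R \<inter> IJ)"
proof -
  have "(THE L. uniquely_maximal Rr P Q \<psi> L) = R \<inter> IJ"
    by (rule the_equality) (use uniquely_maximal_IJ in \<open>auto simp: uniquely_maximal_def\<close>)
  then show ?thesis by (simp add: cuntz_pimsner_null_def)
qed

section \<open>The Toeplitz ring and its evaluation map\<close>

abbreviation "TT \<equiv> toeplitz Rr P Q \<psi>"
abbreviation TT_mult (infixl "\<cdot>" 70) where "x \<cdot> y \<equiv> x \<otimes>\<^bsub>TT\<^esub> y"
abbreviation TT_add (infixl "\<boxplus>" 65) where "x \<boxplus> y \<equiv> x \<oplus>\<^bsub>TT\<^esub> y"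
abbreviation TT_minus (infixl "\<boxminus>" 65) where "x \<boxminus> y \<equiv> x \<ominus>\<^bsub>TT\<^esub> y"
abbreviation "TD \<equiv> toeplitz_deg Rr P Q \<psi>"
abbreviation "iR \<equiv> iota_R Rr P Q \<psi>"
abbreviation "iQ \<equiv> iota_Q Rr P Q \<psi>"
abbreviation "iP \<equiv> iota_P Rr P Q \<psi>"
abbreviation "NN \<equiv> cuntz_pimsner_null Rr P Q \<psi>"

sublocale tc: covariant_rep Rr P Q \<psi> TT iP iQ iR
  by (rule sys.toeplitz_covariant)

lemma iota_closed [simp]:
  "r \<in> R \<Longrightarrow> iR r \<in> carrier TT" "i \<in> I \<Longrightarrow> iQ i \<in> carrier TT" "j \<in> J \<Longrightarrow> iP j \<in> carrier TT"
  using tc.S_closed' tc.T_closed' tc.\<sigma>_closed by auto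

lemma iota_add:
  "\<lbrakk>r \<in> R; s \<in> R\<rbrakk> \<Longrightarrow> iR (r \<oplus> s) = iR r \<boxplus> iR s"
  "\<lbrakk>i \<in> I; i' \<in> I\<rbrakk> \<Longrightarrow> iQ (i \<oplus> i') = iQ i \<boxplus> iQ i'"
  "\<lbrakk>j \<in> J; j' \<in> J\<rbrakk> \<Longrightarrow> iP (j \<oplus> j') = iP j \<boxplus> iP j'"
  using tc.S_add tc.T_add tc.\<sigma>_hom by (auto simp: rng_hom_def)

lemma iota_mult:
  "\<lbrakk>r \<in> R; s \<in> R\<rbrakk> \<Longrightarrow> iR r \<cdot> iR s = iR (r \<otimes> s)"
  "\<lbrakk>r \<in> R; i \<in> I\<rbrakk> \<Longrightarrow> iR r \<cdot> iQ i = iQ (r \<otimes> i)"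
  "\<lbrakk>r \<in> R; i \<in> I\<rbrakk> \<Longrightarrow> iQ i \<cdot> iR r = iQ (i \<otimes> r)"
  "\<lbrakk>r \<in> R; j \<in> J\<rbrakk> \<Longrightarrow> iR r \<cdot> iP j = iP (r \<otimes> j)"
  "\<lbrakk>r \<in> R; j \<in> J\<rbrakk> \<Longrightarrow> iP j \<cdot> iR r = iP (j \<otimes> r)"
  "\<lbrakk>j \<in> J; i \<in> I\<rbrakk> \<Longrightarrow> iP j \<cdot> iQ i = iR (j \<otimes> i)"
  using tc.\<sigma>_hom tc.S_left tc.S_right tc.T_left tc.T_right tc.\<psi>_cov[of j i] mult_elem[of j i]
  by (auto simp: rng_hom_def)

lemma iota_zero: "iR \<zero> = \<zero>\<^bsub>TT\<^esub>" "iQ \<zero> = \<zero>\<^bsub>TT\<^esub>" "iP \<zero> = \<zero>\<^bsub>TT\<^esub>"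
  using tc.S_zero tc.T_zero rng_hom_zero[OF sys.P.R.rng_axioms tc.B.rng_axioms tc.\<sigma>_hom] by auto

lemma iR_minus:
  assumes "r \<in> R" "s \<in> R"
  shows "iR (r \<ominus> s) = iR r \<boxminus> iR s"
proof -
  have "r \<ominus>\<^bsub>Rr\<^esub> s = r \<ominus> s"
    unfolding a_minus_def using assms additive_subgroupD[OF R_sub] R_c
    by (subst sys.P.R.minus_equality[of "\<ominus> s"]) (auto simp: l_neg)
  then show ?thesis
    using rng_hom_diff[OF sys.P.R.rng_axioms tc.B.rng_axioms tc.\<sigma>_hom] assms by (metis sub_rng_simps(1))
qed

lemma ex_eta: "\<exists>h. h \<in> rng_hom TT A \<and> (\<forall>p\<in>J. h (iP p) = p) \<and> (\<forall>q\<in>I. h (iQ q) = q) \<and>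
  (\<forall>r\<in>R. h (iR r) = r)"
proof -
  have "covariant_rep Rr P Q \<psi> A (\<lambda>x. x) (\<lambda>x. x) (\<lambda>x. x)"
    by (intro covariant_rep.intro covariant_rep_axioms.intro sys.rng_system_axioms rng_axioms)
      (auto simp: J_c I_c R_c rng_hom_def mult_elem)
  from toeplitz_universal[OF this] show ?thesis unfolding sub_bimodule_simps sub_rng_simps by blast
qed

definition eta where "eta = (SOME h. h \<in> rng_hom TT A \<and> (\<forall>p\<in>J. h (iP p) = p) \<and>
  (\<forall>q\<in>I. h (iQ q) = q) \<and> (\<forall>r\<in>R. h (iR r) = r))"

lemma eta_hom: "eta \<in> rng_hom TT A"
  and eta_iota: "p \<in> J \<Longrightarrow> eta (iP p) = p" "q \<in> I \<Longrightarrow> eta (iQ q) = q" "r \<in> R \<Longrightarrow> eta (iR r) = r"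
  using someI_ex[OF ex_eta, folded eta_def] by blast+

lemma eta_simps:
  shows "t \<in> carrier TT \<Longrightarrow> eta t \<in> carrier A"
    "\<lbrakk>t \<in> carrier TT; u \<in> carrier TT\<rbrakk> \<Longrightarrow> eta (t \<boxplus> u) = eta t \<oplus> eta u"
    "\<lbrakk>t \<in> carrier TT; u \<in> carrier TT\<rbrakk> \<Longrightarrow> eta (t \<cdot> u) = eta t \<otimes> eta u"
    "\<lbrakk>t \<in> carrier TT; u \<in> carrier TT\<rbrakk> \<Longrightarrow> eta (t \<boxminus> u) = eta t \<ominus> eta u"
    "eta \<zero>\<^bsub>TT\<^esub> = \<zero>"
  using eta_hom rng_hom_diff[OF tc.B.rng_axioms rng_axioms eta_hom]
    rng_hom_zero[OF tc.B.rng_axioms rng_axioms eta_hom]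
  by (auto simp: rng_hom_def)

text \<open>The copy of IJ in the Toeplitz ring. Defining it through \<open>pi_map\<close> settles
  that the value does not depend on how an element of IJ is written as a sum of products; it is a
  section of \<open>eta\<close> over IJ (\<open>eta_lifted\<close>).\<close>

definition lifted :: "'a \<Rightarrow> _" where "lifted a = pi_map Rr P Q \<psi> TT iP iQ (left_op a)"

lemma lifted_closed: "a \<in> IJ \<Longrightarrow> lifted a \<in> carrier TT"
  and lifted_add: "\<lbrakk>a \<in> IJ; b \<in> IJ\<rbrakk> \<Longrightarrow> lifted (a \<oplus> b) = lifted a \<boxplus> lifted b"
  and lifted_prod: "\<lbrakk>i \<in> I; j \<in> J\<rbrakk> \<Longrightarrow> lifted (i \<otimes> j) = iQ i \<cdot> iP j"
  using tc.is_pi_map_pi_map[OF FS] left_op_finite_rank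
  by (auto simp: is_pi_map_def rng_hom_def lifted_def left_op_add IJ_c left_op_prod)

lemma lifted_zero: "lifted \<zero> = \<zero>\<^bsub>TT\<^esub>"
proof -
  have z: "\<zero> \<in> IJ" using additive_subgroupD[OF IJ_sub] by auto
  show ?thesis using lifted_add[OF z z] lifted_closed[OF z] by simp
qed

text \<open>Here and up to \<open>lifted_mult\<close>, adjacent canonical images are contracted by
  \<open>iota_mult\<close>, so the products that occur are those of the ambient ring.\<close>

lemma lifted_Q: "\<lbrakk>a \<in> IJ; i \<in> I\<rbrakk> \<Longrightarrow> lifted a \<cdot> iQ i = iQ (a \<otimes> i)"
proof (induction rule: IJ_induct)
  case (prod i' j)
  then show ?case by (simp add: lifted_prod tc.B.m_assoc iota_mult JI I_c J_c m_assoc)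
next
  case (add a b)
  then show ?case by (simp add: lifted_add tc.B.l_distr lifted_closed IJ_c I_c l_distr iota_add IJ_I)
qed (simp add: lifted_zero iota_zero I_c)

lemma P_lifted: "\<lbrakk>a \<in> IJ; j \<in> J\<rbrakk> \<Longrightarrow> iP j \<cdot> lifted a = iP (j \<otimes> a)"
proof (induction rule: IJ_induct)
  case (prod i j')
  then show ?case by (simp add: lifted_prod tc.B.m_assoc[symmetric] iota_mult JI I_c J_c m_assoc[symmetric])
next
  case (add a b)
  then show ?case by (simp add: lifted_add tc.B.r_distr lifted_closed IJ_c J_c r_distr iota_add J_IJ)
qed (simp add: lifted_zero iota_zero J_c)

lemma lifted_R: "\<lbrakk>a \<in> IJ; r \<in> R\<rbrakk> \<Longrightarrow> lifted a \<cdot> iR r = lifted (a \<otimes> r)"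
proof (induction rule: IJ_induct)
  case (prod i j)
  then have "lifted (i \<otimes> (j \<otimes> r)) = iQ i \<cdot> iP (j \<otimes> r)" by (intro lifted_prod JR)
  then show ?case using prod by (simp add: lifted_prod tc.B.m_assoc iota_mult R_c I_c J_c m_assoc)
next
  case (add a b)
  then show ?case by (simp add: lifted_add tc.B.l_distr lifted_closed IJ_c R_c l_distr IJ_R)
qed (simp add: lifted_zero R_c)

lemma lifted_mult: "\<lbrakk>a \<in> IJ; b \<in> IJ\<rbrakk> \<Longrightarrow> lifted a \<cdot> lifted b = lifted (a \<otimes> b)"
proof (induction rule: IJ_induct)
  case (prod i j)
  then have "lifted (i \<otimes> (j \<otimes> b)) = iQ i \<cdot> iP (j \<otimes> b)" by (intro lifted_prod J_IJ)
  then show ?case using prod by (simp add: lifted_prod tc.B.m_assoc P_lifted lifted_closed IJ_c I_c J_c m_assoc)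
next
  case (add a c)
  then show ?case by (simp add: lifted_add tc.B.l_distr lifted_closed IJ_c l_distr IJ_IJ)
qed (simp add: lifted_zero IJ_c lifted_closed)

lemma eta_lifted: "a \<in> IJ \<Longrightarrow> eta (lifted a) = a"
  by (induction rule: IJ_induct) (simp_all add: lifted_zero lifted_prod lifted_add eta_simps eta_iota lifted_closed)

lemma NN_gen: "NN = ideal_generated TT {iR x \<boxminus> lifted x | x. x \<in> R \<inter> IJ}"
  by (simp add: cuntz_pimsner_null toeplitz_ideal_def Delta_left_op lifted_def)

lemma NN_gens_closed: "{iR x \<boxminus> lifted x | x. x \<in> R \<inter> IJ} \<subseteq> carrier TT"
  using lifted_closed by auto

lemma NN_ideal: "two_sided_ideal NN TT"
  unfolding NN_gen by (rule two_sided_ideal_generated[OF tc.B.rng_axioms NN_gens_closed])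

sublocale nn: rng_ideal TT NN
  by (intro rng_ideal.intro rng_ideal_axioms.intro NN_ideal tc.B.rng_axioms)

lemma NN_relation: "\<lbrakk>x \<in> R; x \<in> IJ\<rbrakk> \<Longrightarrow> iR x \<boxminus> lifted x \<in> NN"
  unfolding NN_gen using two_sided_ideal_generated(2)[OF tc.B.rng_axioms NN_gens_closed] by blast

lemma eta_NN: "t \<in> NN \<Longrightarrow> eta t = \<zero>"
proof -
  have z: "x \<ominus> x = \<zero>" if "x \<in> IJ" for x using IJ_c[OF that] by (simp add: a_minus_def r_neg)
  have "NN \<subseteq> {t \<in> carrier TT. eta t = \<zero>}"
    unfolding NN_gen
    by (rule ideal_generated_minimal[OF two_sided_ideal_kernel[OF tc.B.rng_axioms rng_axioms eta_hom]])
      (use lifted_closed in \<open>auto simp: eta_simps eta_lifted eta_iota z\<close>)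
  then show "t \<in> NN \<Longrightarrow> eta t = \<zero>" by auto
qed

lemmas NN_sub = tc.B.additive_subgroupD[OF nn.additive_subgroup_axioms]

text \<open>\<open>lifted a\<close> is a sum of products \<open>iQ i \<cdot> iP j\<close>, so
  membership of \<open>lifted a \<cdot> t\<close> in the ideal can be tested on the elements
  \<open>iP j \<cdot> t\<close>, whose degree is one lower.\<close>

lemma lifted_times_NN:
  assumes "a \<in> IJ" "t \<in> carrier TT" "\<And>j. j \<in> J \<Longrightarrow> iP j \<cdot> t \<in> NN"
  shows "lifted a \<cdot> t \<in> NN"
  using assms(1) by (induction rule: IJ_induct)
    (use assms(2,3) NN_sub nn.ideal_l in
      \<open>auto simp: lifted_zero lifted_prod lifted_add tc.B.m_assoc tc.B.l_distr lifted_closed\<close>)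

lemma NN_times_lifted:
  assumes "a \<in> IJ" "t \<in> carrier TT" "\<And>i. i \<in> I \<Longrightarrow> t \<cdot> iQ i \<in> NN"
  shows "t \<cdot> lifted a \<in> NN"
  using assms(1) by (induction rule: IJ_induct)
    (use assms(2,3) NN_sub nn.ideal_r in
      \<open>auto simp: lifted_zero lifted_prod lifted_add tc.B.m_assoc[symmetric] tc.B.r_distr lifted_closed\<close>)

section \<open>Normal forms of homogeneous elements\<close>

abbreviation "GG \<equiv> gens Rr P Q"
abbreviation "FR \<equiv> free_rng (gens Rr P Q)"
abbreviation "tcl \<equiv> toeplitz_class Rr P Q \<psi>"

definition cls :: "('a, 'a, 'a) gen list \<Rightarrow> _" where "cls w = tcl (frag_of w)"
definition wdeg :: "('a, 'a, 'a) gen list \<Rightarrow> int" where "wdeg w = sum_list (map gen_deg w)"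

text \<open>Letters of \<open>R\<close> are absorbed by a neighbour and a factor PQ contracts to a
  letter of \<open>R\<close>, so these words are what remains. A class may have several normal
  words.\<close>

definition normal_word :: "('a, 'a, 'a) gen list \<Rightarrow> bool" where
  "normal_word w \<longleftrightarrow> (\<exists>r\<in>R. w = [GenR r]) \<or>
     (\<exists>qs ps. set qs \<subseteq> I \<and> set ps \<subseteq> J \<and> w = map GenQ qs @ map GenP ps \<and> w \<noteq> [])"

lemma wdeg_simps [simp]: "wdeg [] = 0" "wdeg (g # w) = gen_deg g + wdeg w"
  "wdeg (u @ v) = wdeg u + wdeg v" "wdeg (map GenQ qs) = int (length qs)"
  "wdeg (map GenP ps) = - int (length ps)"
proof -
  show "wdeg (map GenQ qs) = int (length qs)" by (induction qs) (auto simp: wdeg_def)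
  show "wdeg (map GenP ps) = - int (length ps)" by (induction ps) (auto simp: wdeg_def)
qed (auto simp: wdeg_def)

lemma free_mem: "frag_of w \<in> carrier FR \<longleftrightarrow> w \<noteq> [] \<and> set w \<subseteq> GG"
  by (rule sys.frag_of_free)

lemma gens_iff [simp]: "GenR r \<in> GG \<longleftrightarrow> r \<in> R" "GenQ i \<in> GG \<longleftrightarrow> i \<in> I" "GenP j \<in> GG \<longleftrightarrow> j \<in> J"
  by (auto simp: gens_def)

lemma cls_iota: "cls [GenR r] = iR r" "cls [GenQ i] = iQ i" "cls [GenP j] = iP j"
  by (simp_all add: cls_def iota_R_def iota_Q_def iota_P_def)

lemma cls_closed: "\<lbrakk>w \<noteq> []; set w \<subseteq> GG\<rbrakk> \<Longrightarrow> cls w \<in> carrier TT"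
  using free_mem[of w] by (simp add: cls_def sys.carrier_toeplitz)

lemma cls_append: "\<lbrakk>u \<noteq> []; set u \<subseteq> GG; v \<noteq> []; set v \<subseteq> GG\<rbrakk> \<Longrightarrow> cls (u @ v) = cls u \<cdot> cls v"
  using free_mem[of u] free_mem[of v] by (simp add: cls_def sys.toeplitz_class_mult)

lemma cls_Cons: "\<lbrakk>g \<in> GG; v \<noteq> []; set v \<subseteq> GG\<rbrakk> \<Longrightarrow> cls (g # v) = cls [g] \<cdot> cls v"
  using cls_append[of "[g]" v] by simp

lemma normal_word_R1: "r \<in> R \<Longrightarrow> normal_word [GenR r]"
  by (simp add: normal_word_def)

lemma normal_word_QP:
  "\<lbrakk>set qs \<subseteq> I; set ps \<subseteq> J; qs \<noteq> [] \<or> ps \<noteq> []\<rbrakk> \<Longrightarrow> normal_word (map GenQ qs @ map GenP ps)"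
  unfolding normal_word_def by (intro disjI2 exI[of _ qs] exI[of _ ps]) auto

lemma QP_valid: "\<lbrakk>set qs \<subseteq> I; set ps \<subseteq> J\<rbrakk> \<Longrightarrow> set (map GenQ qs @ map GenP ps) \<subseteq> GG"
  by (auto simp: gens_def)

lemma normal_word_cases:
  assumes "normal_word w"
  obtains r where "r \<in> R" "w = [GenR r]"
  | qs ps where "set qs \<subseteq> I" "set ps \<subseteq> J" "w = map GenQ qs @ map GenP ps" "qs \<noteq> [] \<or> ps \<noteq> []"
  using assms unfolding normal_word_def by force

lemma normal_word_valid: "normal_word w \<Longrightarrow> w \<noteq> [] \<and> set w \<subseteq> GG"
  by (erule normal_word_cases) (use QP_valid in force)+

lemma cls_merge:
  assumes "cls [g, h] = cls [k]" "g \<in> GG" "h \<in> GG" "k \<in> GG" "set w \<subseteq> GG"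
  shows "cls (g # h # w) = cls (k # w)"
proof (cases "w = []")
  case False
  then have "cls ([g, h] @ w) = cls ([k] @ w)"
    using assms by (subst (1 2) cls_append) simp_all
  then show ?thesis by simp
qed (simp only: assms(1))

lemma cls_merges:
  assumes "set w \<subseteq> GG"
  shows "\<lbrakk>r \<in> R; q \<in> I\<rbrakk> \<Longrightarrow> cls (GenR r # GenQ q # w) = cls (GenQ (r \<otimes> q) # w)"
    "\<lbrakk>r \<in> R; p \<in> J\<rbrakk> \<Longrightarrow> cls (GenR r # GenP p # w) = cls (GenP (r \<otimes> p) # w)"
    "\<lbrakk>p \<in> J; q \<in> I\<rbrakk> \<Longrightarrow> cls (GenP p # GenQ q # w) = cls (GenR (p \<otimes> q) # w)"
  by (rule cls_merge; simp add: assms cls_Cons[of _ "[_]"] cls_iota iota_mult RI RJ JI)+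

lemma normal_word_R:
  assumes r: "r \<in> R" and w: "normal_word w"
  shows "\<exists>w'. normal_word w' \<and> cls w' = cls (GenR r # w) \<and> wdeg w' = wdeg w"
  using w
proof (cases rule: normal_word_cases)
  case (1 s)
  then have "cls [GenR (r \<otimes> s)] = cls (GenR r # w)"
    using r by (simp add: cls_Cons[of "GenR r"] cls_iota iota_mult)
  then show ?thesis using 1 r by (intro exI[of _ "[GenR (r \<otimes> s)]"]) (simp add: normal_word_R1 RR)
next
  case (2 qs ps)
  show ?thesis
  proof (cases qs)
    case (Cons q qs')
    let ?w = "map GenQ (r \<otimes> q # qs') @ map GenP ps"
    have "cls ?w = cls (GenR r # w)"
      using 2 Cons r cls_merges(1)[OF QP_valid[of qs' ps]] by simp
    moreover have "normal_word ?w"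
      by (rule normal_word_QP) (use 2 Cons r RI in auto)
    ultimately show ?thesis using 2 Cons by (intro exI[of _ ?w]) simp
  next
    case Nil
    then obtain p ps' where ps: "ps = p # ps'" using 2 by (cases ps) auto
    let ?w = "map GenQ [] @ map GenP (r \<otimes> p # ps')"
    have "cls ?w = cls (GenR r # w)"
      using 2 Nil ps r cls_merges(2)[OF QP_valid[of "[]" ps']] by simp
    moreover have "normal_word ?w"
      by (rule normal_word_QP) (use 2 ps r RJ in auto)
    ultimately show ?thesis using 2 Nil ps by (intro exI[of _ ?w]) simp
  qed
qed

text \<open>The case with content is P before Q: the pair contracts to a letter of \<open>R\<close>,
  which \<open>normal_word_R\<close> absorbs into the rest. The degree survives since - 1 + 1 =
  0.\<close>

lemma normal_word_Cons:
  assumes g: "g \<in> GG" and w: "normal_word w"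
  shows "\<exists>w'. normal_word w' \<and> cls w' = cls (g # w) \<and> wdeg w' = gen_deg g + wdeg w"
proof (cases g)
  case (GenR r)
  then show ?thesis using normal_word_R[OF _ w, of r] g by simp
next
  case (GenQ q)
  then have q: "q \<in> I" using g by simp
  from w show ?thesis
  proof (cases rule: normal_word_cases)
    case (1 r)
    then have "cls [GenQ (q \<otimes> r)] = cls (g # w)"
      using GenQ q by (simp add: cls_Cons[of "GenQ q"] cls_iota iota_mult)
    moreover have "normal_word [GenQ (q \<otimes> r)]"
      using normal_word_QP[of "[q \<otimes> r]" "[]"] q 1 by (simp add: IR)
    ultimately show ?thesis using GenQ 1 by (intro exI[of _ "[GenQ (q \<otimes> r)]"]) simp
  next
    case (2 qs ps)
    then have "normal_word (g # w)" using normal_word_QP[of "q # qs" ps] GenQ q by simp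
    then show ?thesis by (intro exI[of _ "g # w"]) simp
  qed
next
  case (GenP p)
  then have p: "p \<in> J" using g by simp
  from w show ?thesis
  proof (cases rule: normal_word_cases)
    case (1 r)
    then have "cls [GenP (p \<otimes> r)] = cls (g # w)"
      using GenP p by (simp add: cls_Cons[of "GenP p"] cls_iota iota_mult)
    moreover have "normal_word [GenP (p \<otimes> r)]"
      using normal_word_QP[of "[]" "[p \<otimes> r]"] p 1 by (simp add: JR)
    ultimately show ?thesis using GenP 1 by (intro exI[of _ "[GenP (p \<otimes> r)]"]) simp
  next
    case (2 qs ps)
    show ?thesis
    proof (cases qs)
      case Nil
      then have "normal_word (g # w)" using normal_word_QP[of "[]" "p # ps"] 2 GenP p by simp
      then show ?thesis by (intro exI[of _ "g # w"]) simp
    next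
      case (Cons q qs')
      let ?w = "map GenQ qs' @ map GenP ps"
      have pq: "p \<otimes> q \<in> R" using p Cons 2 JI by auto
      have m: "cls (GenR (p \<otimes> q) # ?w) = cls (g # w)"
        using 2 Cons GenP p cls_merges(3)[OF QP_valid[of qs' ps]] by simp
      show ?thesis
      \<comment> \<open>In a ring without unit there is no empty word, so a word consisting of PQ
        alone becomes a single letter of \<open>R\<close>.\<close>
      proof (cases "?w = []")
        case True
        then show ?thesis using m pq GenP 2 Cons
          by (intro exI[of _ "[GenR (p \<otimes> q)]"]) (simp add: normal_word_R1)
      next
        case False
        then have "normal_word ?w" using normal_word_QP[of qs' ps] 2 Cons by simp
        then show ?thesis using normal_word_R[OF pq, of ?w] m 2 Cons GenP by simp
      qed
    qed
  qed
qed

lemma normal_form: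
  assumes "w \<noteq> []" "set w \<subseteq> GG"
  shows "\<exists>w'. normal_word w' \<and> cls w' = cls w \<and> wdeg w' = wdeg w"
  using assms
proof (induction w)
  case (Cons g w)
  show ?case
  proof (cases "w = []")
    case True
    then have "normal_word [g]"
      using Cons.prems normal_word_R1 normal_word_QP[of "[_]" "[]"] normal_word_QP[of "[]" "[_]"]
      by (cases g) simp_all
    then show ?thesis using True by (intro exI[of _ "[g]"]) simp
  next
    case False
    then obtain w' where w': "normal_word w'" "cls w' = cls w" "wdeg w' = wdeg w"
      using Cons by auto
    then show ?thesis
      using normal_word_Cons[of g w'] Cons.prems False normal_word_valid[of w'] cls_Cons[of g w] cls_Cons[of g w']
      by simp
  qed
qed simp

section \<open>Homogeneous elements of the Toeplitz ring\<close>

lemma tcl_zero: "tcl 0 = \<zero>\<^bsub>TT\<^esub>"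
  using sys.F.zero_quot by (simp add: toeplitz_class_def toeplitz_def free_rng_def)

lemma tcl_closed: "x \<in> carrier FR \<Longrightarrow> tcl x \<in> carrier TT"
  by (simp add: sys.carrier_toeplitz)

lemma free_diff: "\<lbrakk>x \<in> carrier FR; y \<in> carrier FR\<rbrakk> \<Longrightarrow> x - y \<in> carrier FR"
  unfolding free_rng_def by (simp add: keys_diff_le)

lemma tcl_diff:
  assumes "x \<in> carrier FR" "y \<in> carrier FR"
  shows "tcl (x - y) = tcl x \<boxminus> tcl y"
proof -
  have "tcl (x - y) \<boxplus> tcl y = tcl x" 
    using sys.toeplitz_class_add[OF free_diff[OF assms] assms(2)] by simp
  then show ?thesis
    using tcl_closed[OF assms(2)] tcl_closed[OF free_diff[OF assms]]
    by (metis tc.B.a_assoc tc.B.a_inv_closed tc.B.r_neg tc.B.r_zero a_minus_def)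
qed

text \<open>A homogeneous element has a representative all of whose words have its degree, and each
  word can be replaced by a normal one of the same degree. Coefficients are integers, so zero and
  differences cover all combinations.\<close>

lemma deg_induct [consumes 1, case_names zero diff word]:
  assumes t: "t \<in> TD n"
    and zero: "F \<zero>\<^bsub>TT\<^esub>"
    and diff: "\<And>x y. \<lbrakk>x \<in> carrier TT; y \<in> carrier TT; F x; F y\<rbrakk> \<Longrightarrow> F (x \<boxminus> y)"
    and word: "\<And>w. \<lbrakk>normal_word w; wdeg w = n\<rbrakk> \<Longrightarrow> F (cls w)"
  shows "F t"
proof -
  let ?W = "{w. w \<noteq> [] \<and> set w \<subseteq> GG \<and> wdeg w = n}"
  obtain x where x: "t = tcl x" "Poly_Mapping.keys x \<subseteq> ?W"
    using t by (auto simp: toeplitz_deg_def free_rng_def wdeg_def)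
  have c: "x \<in> carrier FR" if "Poly_Mapping.keys x \<subseteq> ?W" for x
    using that by (auto simp: free_rng_def)
  from x(2) have "F (tcl x)"
  proof (induction x rule: free_Abelian_group_induct[consumes 1, case_names zero diff one])
    case zero then show ?case by (simp add: tcl_zero assms(2))
  next
    case (diff x y)
    have cxy: "x \<in> carrier FR" "y \<in> carrier FR"
      using c[OF diff(1)] c[OF diff(2)] by blast+
    show ?case
      using assms(3)[OF tcl_closed[OF cxy(1)] tcl_closed[OF cxy(2)] diff(3,4)] tcl_diff[OF cxy] by simp
  next
    case (one w)
    then obtain w' where "normal_word w'" "cls w' = cls w" "wdeg w' = n"
      using normal_form[of w] by auto
    then have "F (cls w)" using word by metis
    then show ?case by (simp add: cls_def)
  qed
  then show ?thesis using x by simp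
qed

lemma toeplitz_deg_closed: "t \<in> TD n \<Longrightarrow> t \<in> carrier TT"
  by (auto simp: toeplitz_deg_def sys.carrier_toeplitz)

lemma toeplitz_deg_mult_gen:
  assumes t: "t \<in> TD n" and g: "g \<in> GG"
  shows "cls [g] \<cdot> t \<in> TD (gen_deg g + n)"
    and "t \<cdot> cls [g] \<in> TD (n + gen_deg g)"
proof -
  obtain x where x: "t = tcl x" "x \<in> carrier FR"
    "\<And>w. w \<in> Poly_Mapping.keys x \<Longrightarrow> sum_list (map gen_deg w) = n"
    using t by (auto simp: toeplitz_deg_def)
  have f: "frag_of [g] \<in> carrier FR" using g by (simp add: free_mem)
  have eq: "cls [g] \<cdot> t = tcl (word_mult (frag_of [g]) x)"
    "t \<cdot> cls [g] = tcl (word_mult x (frag_of [g]))"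
    using sys.toeplitz_class_mult[OF f x(2)] sys.toeplitz_class_mult[OF x(2) f] x(1)
    by (simp_all add: cls_def)
  have c: "word_mult (frag_of [g]) x \<in> carrier FR" "word_mult x (frag_of [g]) \<in> carrier FR"
    using rng.m_closed[OF rng_free_rng f x(2)] rng.m_closed[OF rng_free_rng x(2) f]
    by (simp_all add: free_rng_def)
  have "\<forall>w\<in>Poly_Mapping.keys (word_mult (frag_of [g]) x). sum_list (map gen_deg w) = gen_deg g + n"
    using keys_word_mult[of "frag_of [g]" x] x(3) by fastforce
  then show "cls [g] \<cdot> t \<in> TD (gen_deg g + n)"
    unfolding toeplitz_deg_def using eq c by blast
  have "\<forall>w\<in>Poly_Mapping.keys (word_mult x (frag_of [g])). sum_list (map gen_deg w) = n + gen_deg g"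
    using keys_word_mult[of x "frag_of [g]"] x(3) by fastforce
  then show "t \<cdot> cls [g] \<in> TD (n + gen_deg g)"
    unfolding toeplitz_deg_def using eq c by blast
qed

lemma toeplitz_deg_P: "\<lbrakk>t \<in> TD n; j \<in> J\<rbrakk> \<Longrightarrow> iP j \<cdot> t \<in> TD (n - 1)"
  and toeplitz_deg_Q: "\<lbrakk>t \<in> TD n; i \<in> I\<rbrakk> \<Longrightarrow> t \<cdot> iQ i \<in> TD (n + 1)"
  using toeplitz_deg_mult_gen(1)[of t n "GenP j"] toeplitz_deg_mult_gen(2)[of t n "GenQ i"]
  by (simp_all add: cls_iota)

text \<open>Asking for all sufficiently large local units, instead of just one, makes these two sets closed
  under differences.\<close>

definition left_unital :: "_ set" where
  "left_unital = {t \<in> carrier TT. \<exists>F. finite F \<and> F \<subseteq> I \<and> (\<forall>a\<in>IJ. (\<forall>i\<in>F. a \<otimes> i = i) \<longrightarrow> lifted a \<cdot> t = t)}"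

definition right_unital :: "_ set" where
  "right_unital = {t \<in> carrier TT. \<exists>F. finite F \<and> F \<subseteq> J \<and> (\<forall>a\<in>IJ. (\<forall>j\<in>F. j \<otimes> a = j) \<longrightarrow> t \<cdot> lifted a = t)}"

lemma left_unital_I:
  "\<lbrakk>t \<in> carrier TT; finite F; F \<subseteq> I; \<And>a. \<lbrakk>a \<in> IJ; \<forall>i\<in>F. a \<otimes> i = i\<rbrakk> \<Longrightarrow> lifted a \<cdot> t = t\<rbrakk> \<Longrightarrow> t \<in> left_unital"
  unfolding left_unital_def by blast

lemma right_unital_I:
  "\<lbrakk>t \<in> carrier TT; finite F; F \<subseteq> J; \<And>a. \<lbrakk>a \<in> IJ; \<forall>j\<in>F. j \<otimes> a = j\<rbrakk> \<Longrightarrow> t \<cdot> lifted a = t\<rbrakk> \<Longrightarrow> t \<in> right_unital"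
  unfolding right_unital_def by blast

lemma left_unital_E:
  assumes "t \<in> left_unital"
  obtains F where "finite F" "F \<subseteq> I" "\<forall>a\<in>IJ. (\<forall>i\<in>F. a \<otimes> i = i) \<longrightarrow> lifted a \<cdot> t = t"
  using assms unfolding left_unital_def by blast

lemma right_unital_E:
  assumes "t \<in> right_unital"
  obtains F where "finite F" "F \<subseteq> J" "\<forall>a\<in>IJ. (\<forall>j\<in>F. j \<otimes> a = j) \<longrightarrow> t \<cdot> lifted a = t"
  using assms unfolding right_unital_def by blast

lemma left_unital_unit: "t \<in> left_unital \<Longrightarrow> \<exists>a\<in>IJ. lifted a \<cdot> t = t"
  by (erule left_unital_E) (use unit_I in meson)

lemma right_unital_unit: "t \<in> right_unital \<Longrightarrow> \<exists>a\<in>IJ. t \<cdot> lifted a = t"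
  by (erule right_unital_E) (use unit_J in meson)

lemma unital_closed: "t \<in> left_unital \<Longrightarrow> t \<in> carrier TT" "t \<in> right_unital \<Longrightarrow> t \<in> carrier TT"
  by (auto simp: left_unital_def right_unital_def)

lemma unital_zero: "\<zero>\<^bsub>TT\<^esub> \<in> left_unital" "\<zero>\<^bsub>TT\<^esub> \<in> right_unital"
  by (rule left_unital_I[of _ "{}"] right_unital_I[of _ "{}"]; simp add: lifted_closed)+

lemma left_unital_diff:
  assumes "t \<in> left_unital" "u \<in> left_unital" shows "t \<boxminus> u \<in> left_unital"
proof -
  have c: "t \<in> carrier TT" "u \<in> carrier TT" using assms unital_closed by auto
  obtain F where F: "finite F" "F \<subseteq> I" "\<forall>a\<in>IJ. (\<forall>i\<in>F. a \<otimes> i = i) \<longrightarrow> lifted a \<cdot> t = t"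
    using assms(1) by (rule left_unital_E)
  obtain F' where F': "finite F'" "F' \<subseteq> I" "\<forall>a\<in>IJ. (\<forall>i\<in>F'. a \<otimes> i = i) \<longrightarrow> lifted a \<cdot> u = u"
    using assms(2) by (rule left_unital_E)
  show ?thesis
  proof (rule left_unital_I[of _ "F \<union> F'"])
    fix a assume "a \<in> IJ" "\<forall>i\<in>F \<union> F'. a \<otimes> i = i"
    then show "lifted a \<cdot> (t \<boxminus> u) = t \<boxminus> u"
      using F(3)[rule_format, of a] F'(3)[rule_format, of a] c
      by (simp add: lifted_closed a_minus_def tc.B.r_distr tc.B.rng_r_minus)
  qed (use c F F' in auto)
qed

lemma right_unital_diff:
  assumes "t \<in> right_unital" "u \<in> right_unital" shows "t \<boxminus> u \<in> right_unital"
proof -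
  have c: "t \<in> carrier TT" "u \<in> carrier TT" using assms unital_closed by auto
  obtain F where F: "finite F" "F \<subseteq> J" "\<forall>a\<in>IJ. (\<forall>j\<in>F. j \<otimes> a = j) \<longrightarrow> t \<cdot> lifted a = t"
    using assms(1) by (rule right_unital_E)
  obtain F' where F': "finite F'" "F' \<subseteq> J" "\<forall>a\<in>IJ. (\<forall>j\<in>F'. j \<otimes> a = j) \<longrightarrow> u \<cdot> lifted a = u"
    using assms(2) by (rule right_unital_E)
  show ?thesis
  proof (rule right_unital_I[of _ "F \<union> F'"])
    fix a assume "a \<in> IJ" "\<forall>j\<in>F \<union> F'. j \<otimes> a = j"
    then show "(t \<boxminus> u) \<cdot> lifted a = t \<boxminus> u"
      using F(3)[rule_format, of a] F'(3)[rule_format, of a] c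
      by (simp add: lifted_closed a_minus_def tc.B.l_distr tc.B.rng_l_minus)
  qed (use c F F' in auto)
qed

lemma left_unital_word:
  assumes "i \<in> I" "set w \<subseteq> GG"
  shows "cls (GenQ i # w) \<in> left_unital"
proof -
  have w: "cls (GenQ i # w) \<in> carrier TT" using assms by (intro cls_closed) auto
  have "lifted a \<cdot> cls (GenQ i # w) = cls (GenQ i # w)" if "a \<in> IJ" "a \<otimes> i = i" for a
  proof (cases "w = []")
    case True
    then show ?thesis using that assms by (simp add: cls_iota lifted_Q)
  next
    case False
    then show ?thesis
      using that assms cls_closed[of w]
      by (simp add: cls_Cons[of "GenQ i"] cls_iota lifted_Q lifted_closed tc.B.m_assoc[symmetric])
  qed
  then show ?thesis using assms(1) w by (intro left_unital_I[of _ "{i}"]) auto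
qed

lemma right_unital_word:
  assumes "j \<in> J" "set w \<subseteq> GG"
  shows "cls (w @ [GenP j]) \<in> right_unital"
proof -
  have w: "cls (w @ [GenP j]) \<in> carrier TT" using assms by (intro cls_closed) auto
  have "cls (w @ [GenP j]) \<cdot> lifted a = cls (w @ [GenP j])" if "a \<in> IJ" "j \<otimes> a = j" for a
  proof (cases "w = []")
    case True
    then show ?thesis using that assms by (simp add: cls_iota P_lifted)
  next
    case False
    then show ?thesis
      using that assms cls_closed[of w]
      by (simp add: cls_append cls_iota P_lifted lifted_closed tc.B.m_assoc)
  qed
  then show ?thesis using assms(1) w by (intro right_unital_I[of _ "{j}"]) auto
qed

text \<open>A normal word of positive degree cannot be a letter of \<open>R\<close>, and it begins
  with a letter of \<open>I\<close>, which a local unit fixes.\<close>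

lemma deg_pos_left_unital:
  assumes "t \<in> TD n" "n > 0"
  shows "t \<in> left_unital"
  using assms(1)
proof (induction rule: deg_induct)
  case (word w)
  then obtain qs ps where w: "set qs \<subseteq> I" "set ps \<subseteq> J" "w = map GenQ qs @ map GenP ps"
    using assms(2) by (auto simp: normal_word_def)
  then obtain q qs' where "qs = q # qs'" using word assms(2) by (cases qs) auto
  then show ?case using w left_unital_word[OF _ QP_valid[of qs' ps], of q] by simp
qed (auto intro: unital_zero left_unital_diff)

lemma deg_neg_right_unital:
  assumes "t \<in> TD n" "n < 0"
  shows "t \<in> right_unital"
  using assms(1)
proof (induction rule: deg_induct)
  case (word w)
  then obtain qs ps where w: "set qs \<subseteq> I" "set ps \<subseteq> J" "w = map GenQ qs @ map GenP ps"
    using assms(2) by (auto simp: normal_word_def)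
  then obtain p ps' where "ps = ps' @ [p]" using word assms(2) by (cases ps rule: rev_cases) auto
  then show ?case using w right_unital_word[OF _ QP_valid[of qs ps'], of p] by simp
qed (auto intro: unital_zero right_unital_diff)

text \<open>A normal word of degree zero is a letter of \<open>R\<close>, or it begins with a letter
  of \<open>I\<close> and ends with one of \<open>J\<close>. Words of the second kind are fixed by
  local units on both sides; the others are collected in the summand from \<open>R\<close>.\<close>

lemma deg_zero_decomp:
  assumes "t \<in> TD 0"
  shows "\<exists>r\<in>R. \<exists>u\<in>left_unital \<inter> right_unital. t = iR r \<boxplus> u"
  using assms
proof (induction rule: deg_induct)
  case zero
  show ?case using additive_subgroupD[OF R_sub] unital_zero
    by (intro bexI[of _ \<zero>] bexI[of _ "\<zero>\<^bsub>TT\<^esub>"]) (auto simp: iota_zero)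
next
  case (diff x y)
  then obtain r u s v where x: "r \<in> R" "u \<in> left_unital" "u \<in> right_unital" "x = iR r \<boxplus> u"
    and y: "s \<in> R" "v \<in> left_unital" "v \<in> right_unital" "y = iR s \<boxplus> v" by auto
  have c: "u \<in> carrier TT" "v \<in> carrier TT" using x y unital_closed by auto
  have "x \<boxminus> y = iR (r \<ominus> s) \<boxplus> (u \<boxminus> v)"
    unfolding iR_minus[OF x(1) y(1)] using x y c by (simp add: a_minus_def tc.B.minus_add tc.B.a_ac)
  then show ?case using x y additive_subgroupD[OF R_sub] left_unital_diff right_unital_diff
    by (intro bexI[of _ "r \<ominus> s"] bexI[of _ "u \<boxminus> v"]) auto
next
  case (word w)
  show ?case
    using word(1) unfolding normal_word_def
  proof (elim disjE bexE exE conjE)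
    fix r assume "r \<in> R" "w = [GenR r]"
    then show ?thesis using unital_zero by (intro bexI[of _ r] bexI[of _ "\<zero>\<^bsub>TT\<^esub>"]) (auto simp: cls_iota)
  next
    fix qs ps assume w: "set qs \<subseteq> I" "set ps \<subseteq> J" "w = map GenQ qs @ map GenP ps" "w \<noteq> []"
    then obtain q qs' p ps' where "qs = q # qs'" "ps = ps' @ [p]"
      using word(2) by (cases qs; cases ps rule: rev_cases) auto
    then have "cls w \<in> left_unital \<inter> right_unital"
      using w left_unital_word[OF _ QP_valid[of qs' ps], of q] right_unital_word[OF _ QP_valid[of qs ps'], of p] by simp
    then show ?thesis using additive_subgroupD[OF R_sub] unital_closed
      by (intro bexI[of _ \<zero>] bexI[of _ "cls w"]) (auto simp: iota_zero)
  qed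
qed

section \<open>Compression in degree zero\<close>

primrec compressible :: "nat \<Rightarrow> _ set" where
  "compressible 0 = iR ` R"
| "compressible (Suc n) = {t \<in> carrier TT. \<forall>j\<in>J. \<forall>i\<in>I. iP j \<cdot> t \<cdot> iQ i \<in> compressible n}"

lemma compressible_diff: "\<lbrakk>t \<in> compressible n; u \<in> compressible n\<rbrakk> \<Longrightarrow> t \<boxminus> u \<in> compressible n"
proof (induction n arbitrary: t u)
  case 0
  then show ?case using iR_minus[symmetric] additive_subgroupD[OF R_sub] by auto
next
  case (Suc n)
  then have c: "t \<in> carrier TT" "u \<in> carrier TT" by auto
  have "iP j \<cdot> (t \<boxminus> u) \<cdot> iQ i =
      (iP j \<cdot> t \<cdot> iQ i) \<boxminus> (iP j \<cdot> u \<cdot> iQ i)" if "j \<in> J" "i \<in> I" for i j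
    using c that by (simp add: a_minus_def tc.B.r_distr tc.B.l_distr tc.B.rng_r_minus tc.B.rng_l_minus tc.B.m_closed)
  then show ?case using Suc c by auto
qed

text \<open>Outer factors from \<open>R\<close> are absorbed into the compressing elements, as j r
  is in \<open>J\<close> and s i is in \<open>I\<close>. Such factors appear when the outermost
  letters of a word are contracted.\<close>

lemma compressible_R: "\<lbrakk>t \<in> compressible n; r \<in> R; s \<in> R\<rbrakk> \<Longrightarrow> iR r \<cdot> t \<cdot> iR s \<in> compressible n"
proof (cases n)
  case 0
  assume "t \<in> compressible n" "r \<in> R" "s \<in> R"
  then show ?thesis using 0 RR by (auto simp: iota_mult)
next
  case (Suc m)
  assume *: "t \<in> compressible n" "r \<in> R" "s \<in> R"
  then have c: "t \<in> carrier TT" using Suc by auto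
  have "iP j \<cdot> (iR r \<cdot> t \<cdot> iR s) \<cdot> iQ i = iP (j \<otimes> r) \<cdot> t \<cdot> iQ (s \<otimes> i)"
    if "j \<in> J" "i \<in> I" for i j
    using c * that by (simp add: tc.B.m_assoc tc.B.m_closed iota_mult[symmetric])
  then show ?thesis using * Suc JR RI c by (auto simp: tc.B.m_closed)
qed

text \<open>\<open>R\<close> is stable under compression because j r i lies in \<open>R\<close>. The
  sets therefore grow, and a difference can be treated at the larger of two indices.\<close>

lemma compressible_Suc: "t \<in> compressible n \<Longrightarrow> t \<in> compressible (Suc n)"
proof (induction n arbitrary: t)
  case 0
  then show ?case by (auto simp: iota_mult JI JR)
qed auto

lemma compressible_mono: "\<lbrakk>t \<in> compressible m; m \<le> n\<rbrakk> \<Longrightarrow> t \<in> compressible n"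
  by (induction n) (use compressible_Suc le_Suc_eq in auto)

text \<open>One compression contracts a pair at either end, j with the first letter q and the last
  letter p with i. What is left is the word with one letter less on each side, between the factors j
  q and p i of \<open>R\<close>.\<close>

lemma compressible_word:
  assumes "length qs = length ps" "qs \<noteq> []" "set qs \<subseteq> I" "set ps \<subseteq> J"
  shows "cls (map GenQ qs @ map GenP ps) \<in> compressible (length qs)"
  using assms
proof (induction qs arbitrary: ps)
  case (Cons q qs)
  obtain ps' p where ps: "ps = ps' @ [p]" using Cons.prems by (cases ps rule: rev_cases) auto
  let ?u = "map GenQ qs @ map GenP ps'"
  have v: "set ?u \<subseteq> GG" using Cons.prems ps by auto
  have c: "cls (map GenQ (q # qs) @ map GenP ps) \<in> carrier TT"
    using Cons.prems by (intro cls_closed) auto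
  have "iP j \<cdot> cls (map GenQ (q # qs) @ map GenP ps) \<cdot> iQ i \<in> compressible (length qs)"
    if ji: "j \<in> J" "i \<in> I" for i j
  \<comment> \<open>Nothing remains between the two contracted pairs, so their product is already in
    the image of \<open>R\<close>.\<close>
  proof (cases "qs = []")
    case True
    then have "cls (map GenQ (q # qs) @ map GenP ps) = iQ q \<cdot> iP p"
      using Cons.prems ps by (simp add: cls_Cons[of "GenQ q"] cls_iota)
    then have "iP j \<cdot> cls (map GenQ (q # qs) @ map GenP ps) \<cdot> iQ i =
        (iP j \<cdot> iQ q) \<cdot> (iP p \<cdot> iQ i)"
      using Cons.prems ps ji by (simp add: tc.B.m_assoc tc.B.m_closed)
    also have "\<dots> = iR ((j \<otimes> q) \<otimes> (p \<otimes> i))" using Cons.prems ps ji by (simp add: iota_mult JI)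
    finally show ?thesis using True Cons.prems ps ji by (simp add: RR JI)
  next
    case False
    then have u: "cls ?u \<in> compressible (length qs)" using Cons ps by auto
    have uc: "cls ?u \<in> carrier TT" using False v by (intro cls_closed) auto
    have "cls (map GenQ (q # qs) @ map GenP ps) = cls (GenQ q # (?u @ [GenP p]))" using ps by simp
    also have "\<dots> = iQ q \<cdot> (cls ?u \<cdot> iP p)"
      using v False Cons.prems ps by (subst cls_Cons; (subst cls_append)?) (auto simp: cls_iota)
    finally have "iP j \<cdot> cls (map GenQ (q # qs) @ map GenP ps) \<cdot> iQ i =
        (iP j \<cdot> iQ q) \<cdot> cls ?u \<cdot> (iP p \<cdot> iQ i)"
      using Cons.prems ps ji uc by (simp add: tc.B.m_assoc tc.B.m_closed)
    also have "\<dots> = iR (j \<otimes> q) \<cdot> cls ?u \<cdot> iR (p \<otimes> i)"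
      using Cons.prems ps ji by (simp add: iota_mult)
    finally show ?thesis using compressible_R[OF u] Cons.prems ps ji JI by simp
  qed
  then show ?case using c by simp
qed simp

lemma deg_zero_compressible:
  assumes "t \<in> TD 0"
  shows "\<exists>n. t \<in> compressible n"
  using assms
proof (induction rule: deg_induct)
  case zero
  show ?case using additive_subgroupD(3)[OF R_sub] iota_zero(1) by (intro exI[of _ 0]) force
next
  case (diff x y)
  then obtain m n where "x \<in> compressible m" "y \<in> compressible n" by auto
  then show ?case using compressible_diff compressible_mono[of x m "max m n"] compressible_mono[of y n "max m n"] by auto
next
  case (word w)
  show ?case
    using word(1) unfolding normal_word_def
  proof (elim disjE bexE exE conjE)
    fix r assume "r \<in> R" "w = [GenR r]"
    then show ?thesis by (intro exI[of _ 0]) (auto simp: cls_iota)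
  next
    fix qs ps assume w: "set qs \<subseteq> I" "set ps \<subseteq> J" "w = map GenQ qs @ map GenP ps" "w \<noteq> []"
    then show ?thesis using word(2) compressible_word[of qs ps] by (cases "qs = []") auto
  qed
qed

section \<open>The kernel of the evaluation map\<close>

lemma tdeg_zero_kernel:
  assumes "t \<in> TD 0" "t \<in> compressible n" "eta t = \<zero>"
  shows "t \<in> NN"
  using assms
proof (induction n arbitrary: t)
  case 0
  then obtain r where "r \<in> R" "t = iR r" by auto
  then show ?case using 0 NN_sub(3) by (simp add: eta_iota iota_zero)
next
  case (Suc n)
  note t = Suc.prems(1)
  have tc: "t \<in> carrier TT" by (rule toeplitz_deg_closed[OF t])
  have PtQ: "iP j \<cdot> t \<cdot> iQ i \<in> NN" if "j \<in> J" "i \<in> I" for i j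
  proof (rule Suc.IH)
    show "iP j \<cdot> t \<cdot> iQ i \<in> TD 0"
      using toeplitz_deg_Q[OF toeplitz_deg_P[OF t]] that by simp
    show "eta (iP j \<cdot> t \<cdot> iQ i) = \<zero>"
      using that tc Suc.prems(3) by (simp add: eta_simps eta_iota tc.B.m_closed J_c I_c)
  qed (use Suc.prems(2) that in auto)
  obtain r u where ru: "r \<in> R" "u \<in> left_unital" "u \<in> right_unital" "t = iR r \<boxplus> u"
    using deg_zero_decomp[OF t] by auto
  have uc: "u \<in> carrier TT" using ru unital_closed by auto
  obtain a where a: "a \<in> IJ" "lifted a \<cdot> u = u" using left_unital_unit ru by blast
  obtain b where b: "b \<in> IJ" "u \<cdot> lifted b = u" using right_unital_unit ru by blast
  have arb: "a \<otimes> r \<otimes> b \<in> IJ" using a b ru by (intro IJ_IJ IJ_R)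
  have "lifted a \<cdot> (t \<cdot> lifted b) \<in> NN"
    by (rule lifted_times_NN[OF a(1)])
      (use tc b in \<open>auto simp: lifted_closed tc.B.m_closed tc.B.m_assoc[symmetric] intro!: NN_times_lifted PtQ\<close>)
  \<comment> \<open>The local units fix \<open>u\<close> on both sides and turn \<open>iR r\<close>
    into the lift of a r b.\<close>
  moreover have "lifted a \<cdot> (t \<cdot> lifted b) = lifted (a \<otimes> r \<otimes> b) \<boxplus> u"
    using a b ru uc lifted_closed
    by (simp add: tc.B.l_distr tc.B.r_distr tc.B.m_closed tc.B.m_assoc[symmetric] lifted_R lifted_mult IJ_R)
  ultimately have 1: "lifted (a \<otimes> r \<otimes> b) \<boxplus> u \<in> NN" by simp
  have eu: "eta u \<in> carrier A" using uc eta_simps by auto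
  \<comment> \<open>Both \<open>t\<close> and the lift of a r b plus \<open>u\<close> are sent to
    zero by \<open>eta\<close>, so r and a r b have the same additive inverse \<open>eta u\<close>
    and agree. In particular r lies in IJ.\<close>
  have "r \<oplus> eta u = \<zero>" using Suc.prems(3) ru uc by (simp add: eta_simps eta_iota)
  moreover have "a \<otimes> r \<otimes> b \<oplus> eta u = \<zero>"
    using eta_NN[OF 1] arb uc lifted_closed by (simp add: eta_simps eta_lifted)
  ultimately have r: "r = a \<otimes> r \<otimes> b" using eu R_c[OF ru(1)] IJ_c[OF arb] minus_equality by metis
  then have rIJ: "r \<in> IJ" using arb by simp
  have "t = (iR r \<boxminus> lifted r) \<boxplus> (lifted r \<boxplus> u)"
    using ru uc lifted_closed[OF rIJ]
    by (simp add: a_minus_def tc.B.a_assoc tc.B.r_neg2 tc.B.r_neg1)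
  moreover have "lifted r \<boxplus> u \<in> NN" using 1 r by simp
  ultimately show ?case using NN_sub(4)[OF NN_relation[OF ru(1) rIJ]] by simp
qed

lemma tdeg_pos_kernel:
  assumes "t \<in> TD (int n)" "eta t = \<zero>"
  shows "t \<in> NN"
  using assms
proof (induction n arbitrary: t)
  case 0
  then show ?case using deg_zero_compressible tdeg_zero_kernel by auto
next
  case (Suc n)
  have tc: "t \<in> carrier TT" by (rule toeplitz_deg_closed[OF Suc.prems(1)])
  obtain a where a: "a \<in> IJ" "lifted a \<cdot> t = t"
    using left_unital_unit deg_pos_left_unital[OF Suc.prems(1)] by auto
  have "iP j \<cdot> t \<in> NN" if "j \<in> J" for j
    by (rule Suc.IH)
      (use toeplitz_deg_P[OF Suc.prems(1) that] Suc.prems(2) tc that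
        in \<open>simp_all add: eta_simps eta_iota J_c\<close>)
  then show ?case using lifted_times_NN[OF a(1) tc] a by simp
qed

lemma tdeg_neg_kernel:
  assumes "t \<in> TD (- int n)" "eta t = \<zero>"
  shows "t \<in> NN"
  using assms
proof (induction n arbitrary: t)
  case 0
  then show ?case using deg_zero_compressible tdeg_zero_kernel by auto
next
  case (Suc n)
  have tc: "t \<in> carrier TT" by (rule toeplitz_deg_closed[OF Suc.prems(1)])
  obtain a where a: "a \<in> IJ" "t \<cdot> lifted a = t"
    using right_unital_unit deg_neg_right_unital[OF Suc.prems(1)] by auto
  have "t \<cdot> iQ i \<in> NN" if "i \<in> I" for i
    by (rule Suc.IH)
      (use toeplitz_deg_Q[OF Suc.prems(1) that] Suc.prems(2) tc that
        in \<open>simp_all add: eta_simps eta_iota I_c\<close>)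
  then show ?case using NN_times_lifted[OF a(1) tc] a by simp
qed

lemma tdeg_kernel:
  assumes "t \<in> TD n" "eta t = \<zero>"
  shows "t \<in> NN"
  using tdeg_pos_kernel[of t "nat n"] tdeg_neg_kernel[of t "nat (- n)"] assms
  by (cases "n \<ge> 0") auto

end

section \<open>From homogeneous kernel elements to the graded isomorphism\<close>

definition word_part :: "('x list \<Rightarrow> int) \<Rightarrow> int \<Rightarrow> ('x list \<Rightarrow>\<^sub>0 int) \<Rightarrow> ('x list \<Rightarrow>\<^sub>0 int)" where
  "word_part d n x = frag_extend (\<lambda>w. if d w = n then frag_of w else 0) x"

lemma word_part_simps:
  "word_part d n 0 = 0" "word_part d n (x - y) = word_part d n x - word_part d n y"
  "word_part d n (frag_of w) = (if d w = n then frag_of w else 0)"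
  by (simp_all add: word_part_def frag_extend_diff)

lemma keys_word_part: "Poly_Mapping.keys (word_part d n x) \<subseteq> {w \<in> Poly_Mapping.keys x. d w = n}"
  using keys_frag_extend[of "\<lambda>w. if d w = n then frag_of w else 0" x]
  by (fastforce simp: word_part_def split: if_splits)

lemma sum_word_part:
  assumes "finite N" "Poly_Mapping.keys x \<subseteq> {w. d w \<in> N}"
  shows "(\<Sum>n\<in>N. word_part d n x) = x"
  using assms(2)
  by (induction x rule: free_Abelian_group_induct[consumes 1])
    (use assms(1) in \<open>auto simp: word_part_simps sum_subtractf\<close>)

text \<open>The grading is encoded by projections: \<open>proj n x = x\<close> says that
  \<open>x\<close> is homogeneous of degree n. For functions on the groupoid the projection is
  restriction to a level set of the cocycle.\<close>

locale graded_cp_triple = cp_triple A R I J \<psi> for A (structure) and R I J \<psi> +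
  fixes proj :: "int \<Rightarrow> 'a \<Rightarrow> 'a" and sc :: "'k::field \<Rightarrow> 'a \<Rightarrow> 'a"
  assumes proj_closed: "x \<in> carrier A \<Longrightarrow> proj n x \<in> carrier A"
    and proj_add: "\<lbrakk>x \<in> carrier A; y \<in> carrier A\<rbrakk> \<Longrightarrow> proj n (x \<oplus> y) = proj n x \<oplus> proj n y"
    and proj_other: "\<lbrakk>x \<in> carrier A; proj m x = x; n \<noteq> m\<rbrakk> \<Longrightarrow> proj n x = \<zero>"
    and proj_mult: "\<lbrakk>x \<in> carrier A; y \<in> carrier A; proj m x = x; proj n y = y\<rbrakk>
      \<Longrightarrow> proj (m + n) (x \<otimes> y) = x \<otimes> y"
    and proj_RIJ: "r \<in> R \<Longrightarrow> proj 0 r = r" "i \<in> I \<Longrightarrow> proj 1 i = i" "j \<in> J \<Longrightarrow> proj (- 1) j = j"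
    and generated: "subrng_generated A (R \<union> I \<union> J) = carrier A"
    and sc: "scalar_algebra sc A"
    and sc_RIJ: "r \<in> R \<Longrightarrow> sc k r \<in> R" "i \<in> I \<Longrightarrow> sc k i \<in> I" "j \<in> J \<Longrightarrow> sc k j \<in> J"
begin

lemma proj_zero: "proj n \<zero> = \<zero>"
  using proj_add[of \<zero> \<zero> n] proj_closed[of \<zero> n] by simp

lemma proj_diff:
  assumes "x \<in> carrier A" "y \<in> carrier A"
  shows "proj n (x \<ominus> y) = proj n x \<ominus> proj n y"
proof -
  have "proj n x = proj n (x \<ominus> y) \<oplus> proj n y"
    using proj_add[of "x \<ominus> y" y n] assms by (simp add: a_minus_def a_assoc l_neg)
  then show ?thesis
    using assms proj_closed[of "x \<ominus> y" n] proj_closed[of y n] by (simp add: a_minus_def a_assoc r_neg)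
qed

lemma eta_cls_deg: "\<lbrakk>w \<noteq> []; set w \<subseteq> GG\<rbrakk> \<Longrightarrow> proj (wdeg w) (eta (cls w)) = eta (cls w)"
proof (induction w)
  case (Cons g w)
  have g: "proj (gen_deg g) (eta (cls [g])) = eta (cls [g])"
    using Cons.prems by (cases g) (auto simp: cls_iota eta_iota proj_RIJ)
  show ?case
  proof (cases "w = []")
    case False
    then have "eta (cls (g # w)) = eta (cls [g]) \<otimes> eta (cls w)"
      using Cons.prems by (simp add: cls_Cons[of g w] eta_simps cls_closed)
    then show ?thesis
      using proj_mult[OF _ _ g, of "eta (cls w)" "wdeg w"] Cons False by (simp add: eta_simps cls_closed)
  qed (use g in simp)
qed simp

lemma word_part_free:
  assumes "x \<in> carrier FR"
  shows "word_part wdeg n x \<in> carrier FR" "tcl (word_part wdeg n x) \<in> TD n"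
proof -
  show "word_part wdeg n x \<in> carrier FR"
    using keys_word_part[of wdeg n x] assms by (auto simp: free_rng_def)
  then show "tcl (word_part wdeg n x) \<in> TD n"
    using keys_word_part[of wdeg n x] unfolding toeplitz_deg_def wdeg_def[symmetric] by blast
qed

text \<open>\<open>eta\<close> sends a word of degree n to a homogeneous element of degree n. Hence
  the homogeneous components of a kernel element lie in the kernel again.\<close>

lemma eta_word_part:
  assumes "x \<in> carrier FR"
  shows "eta (tcl (word_part wdeg n x)) = proj n (eta (tcl x))"
proof -
  have fr: "x \<in> carrier FR \<longleftrightarrow> Poly_Mapping.keys x \<subseteq> {w. w \<noteq> [] \<and> set w \<subseteq> GG}" for x
    by (simp add: free_rng_def)
  from assms[unfolded fr] show ?thesis
  proof (induction x rule: free_Abelian_group_induct[consumes 1, case_names zero diff one])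
    case zero then show ?case by (simp add: word_part_simps tcl_zero eta_simps proj_zero)
  next
    case (diff x y)
    then show ?case
      using diff(1,2)[folded fr]
      by (simp add: word_part_simps tcl_diff word_part_free eta_simps tcl_closed proj_diff)
  next
    case (one w)
    then have "proj (wdeg w) (eta (cls w)) = eta (cls w)" "eta (cls w) \<in> carrier A"
      using eta_cls_deg[of w] cls_closed[of w] eta_simps by auto
    then show ?case
      using proj_other[of "eta (cls w)" "wdeg w" n]
      by (auto simp: word_part_simps cls_def tcl_zero eta_simps)
  qed
qed

lemma eta_kernel:
  assumes "t \<in> carrier TT" "eta t = \<zero>"
  shows "t \<in> NN"
proof -
  obtain x where x: "t = tcl x" "x \<in> carrier FR" using assms(1) by (auto simp: sys.carrier_toeplitz)
  define N where "N = wdeg ` Poly_Mapping.keys x"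
  have N: "finite N" by (simp add: N_def)
  have part: "tcl (word_part wdeg n x) \<in> NN" for n
    by (rule tdeg_kernel[OF word_part_free(2)[OF x(2)]])
      (use assms x in \<open>simp add: eta_word_part proj_zero\<close>)
  have "tcl (\<Sum>n\<in>M. word_part wdeg n x) \<in> NN \<and> (\<Sum>n\<in>M. word_part wdeg n x) \<in> carrier FR"
    if "finite M" for M
    using that
  proof (induction M)
    case empty
    show ?case using tcl_zero NN_sub(3) by (simp add: free_rng_def)
  next
    case (insert n M)
    then have "tcl (word_part wdeg n x + (\<Sum>n\<in>M. word_part wdeg n x)) =
        tcl (word_part wdeg n x) \<boxplus> tcl (\<Sum>n\<in>M. word_part wdeg n x)"
      using sys.toeplitz_class_add word_part_free[OF x(2)] by simp
    then show ?case
      using insert NN_sub(4)[OF part] sys.free_add_closed word_part_free[OF x(2)] by simp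
  qed
  moreover have "(\<Sum>n\<in>N. word_part wdeg n x) = x"
    by (rule sum_word_part[OF N]) (auto simp: N_def)
  ultimately show ?thesis using N x(1) by metis
qed

lemma eta_surj: "eta ` carrier TT = carrier A"
proof
  show "eta ` carrier TT \<subseteq> carrier A" using eta_simps by auto
  have "subrng (eta ` carrier TT) A"
    unfolding subrng_def
  proof (intro conjI additive_subgroupI)
    show "eta ` carrier TT \<subseteq> carrier A" using eta_simps by auto
    show "\<zero> \<in> eta ` carrier TT" using eta_simps(5) tc.B.zero_closed by (metis imageI)
    show "x \<oplus> y \<in> eta ` carrier TT" if "x \<in> eta ` carrier TT" "y \<in> eta ` carrier TT" for x y
      using that eta_simps(2)[symmetric] by auto
    show "\<ominus> x \<in> eta ` carrier TT" if "x \<in> eta ` carrier TT" for x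
      using that rng_hom_minus[OF tc.B.rng_axioms rng_axioms eta_hom, symmetric] by auto
    show "\<forall>x\<in>eta ` carrier TT. \<forall>y\<in>eta ` carrier TT. x \<otimes> y \<in> eta ` carrier TT"
      using eta_simps(3)[symmetric] tc.B.m_closed by auto
  qed
  moreover have "R \<union> I \<union> J \<subseteq> eta ` carrier TT"
  proof (intro Un_least subsetI)
    show "x \<in> eta ` carrier TT" if "x \<in> R" for x
      using that by (intro image_eqI[of _ _ "iR x"]) (simp_all add: eta_iota)
    show "x \<in> eta ` carrier TT" if "x \<in> I" for x
      using that by (intro image_eqI[of _ _ "iQ x"]) (simp_all add: eta_iota)
    show "x \<in> eta ` carrier TT" if "x \<in> J" for x
      using that by (intro image_eqI[of _ _ "iP x"]) (simp_all add: eta_iota)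
  qed
  ultimately have "subrng_generated A (R \<union> I \<union> J) \<subseteq> eta ` carrier TT"
    by (auto simp: subrng_generated_def)
  then show "carrier A \<subseteq> eta ` carrier TT" by (simp add: generated)
qed

abbreviation "CP \<equiv> cuntz_pimsner Rr P Q \<psi>"
abbreviation "ocl \<equiv> cuntz_pimsner_class Rr P Q \<psi>"

text \<open>The inverse of the map that \<open>eta\<close> induces on the quotient;
  \<open>phi_eta\<close> shows that the choice of preimage is immaterial, two preimages differing by
  an element of the kernel.\<close>

definition phi :: "'a \<Rightarrow> _" where "phi f = ocl (SOME t. t \<in> carrier TT \<and> eta t = f)"

lemma phi_eta:
  assumes "t \<in> carrier TT" shows "phi (eta t) = ocl t"
proof -
  define u where "u = (SOME u. u \<in> carrier TT \<and> eta u = eta t)"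
  have u: "u \<in> carrier TT" "eta u = eta t"
    unfolding u_def using someI[of "\<lambda>u. u \<in> carrier TT \<and> eta u = eta t" t] assms by auto
  have "eta t \<ominus> eta t = \<zero>" using eta_simps(1)[OF assms] by (simp add: a_minus_def r_neg)
  then have "eta (u \<boxminus> t) = \<zero>" using u eta_simps(4)[OF u(1) assms] by simp
  then have "u \<boxminus> t \<in> NN" using eta_kernel u assms by simp
  then show ?thesis
    using nn.coset_eqI[OF u(1) assms] by (simp add: phi_def u_def cuntz_pimsner_class_def)
qed

lemma ocl_eqD:
  assumes "t \<in> carrier TT" "u \<in> carrier TT" "ocl t = ocl u"
  shows "eta t = eta u"
proof -
  have "t \<boxminus> u \<in> NN" using nn.coset_eqD assms by (simp add: cuntz_pimsner_class_def)
  then have "eta t \<ominus> eta u = \<zero>" using eta_NN eta_simps(4)[OF assms(1,2)] by metis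
  moreover have "eta t = (eta t \<ominus> eta u) \<oplus> eta u"
    using assms eta_simps(1) by (simp add: a_minus_def a_assoc l_neg)
  ultimately show ?thesis using eta_simps(1)[OF assms(2)] by simp
qed

lemma ex_eta_preimage: "f \<in> carrier A \<Longrightarrow> \<exists>t\<in>carrier TT. f = eta t"
  using eta_surj by auto

lemma phi_iso: "phi \<in> rng_iso A CP"
  unfolding rng_iso_def rng_hom_def
proof (intro CollectI conjI funcsetI ballI)
  have CP: "CP = TT Quot NN" by (simp add: cuntz_pimsner_def)
  fix f assume "f \<in> carrier A"
  then obtain t where t: "t \<in> carrier TT" "f = eta t" using ex_eta_preimage by auto
  then show "phi f \<in> carrier CP"
    using nn.coset_closed CP by (simp add: phi_eta cuntz_pimsner_class_def)
  fix g assume "g \<in> carrier A"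
  then obtain u where u: "u \<in> carrier TT" "g = eta u" using ex_eta_preimage by auto
  show "phi (f \<oplus> g) = phi f \<oplus>\<^bsub>CP\<^esub> phi g"
    using t u nn.coset_add[OF t(1) u(1)] CP
    by (simp add: eta_simps(2)[symmetric] phi_eta cuntz_pimsner_class_def)
  show "phi (f \<otimes> g) = phi f \<otimes>\<^bsub>CP\<^esub> phi g"
    using t u nn.coset_mult[OF t(1) u(1)] CP
    by (simp add: eta_simps(3)[symmetric] phi_eta cuntz_pimsner_class_def tc.B.m_closed)
next
  show "bij_betw phi (carrier A) (carrier CP)"
  proof (rule bij_betwI')
    fix f g assume "f \<in> carrier A" "g \<in> carrier A"
    then obtain t u where t: "t \<in> carrier TT" "f = eta t" "u \<in> carrier TT" "g = eta u"
      using ex_eta_preimage by meson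
    then show "phi f = phi g \<longleftrightarrow> f = g" using ocl_eqD phi_eta by metis
  next
    show "phi f \<in> carrier CP" if "f \<in> carrier A" for f
      using ex_eta_preimage[OF that] nn.coset_closed
      by (auto simp: phi_eta cuntz_pimsner_class_def cuntz_pimsner_def)
  next
    fix X assume "X \<in> carrier CP"
    then obtain t where "t \<in> carrier TT" "X = ocl t"
      using nn.carrier_quot by (auto simp: cuntz_pimsner_class_def cuntz_pimsner_def)
    then show "\<exists>f\<in>carrier A. X = phi f" using phi_eta eta_simps(1) by metis
  qed
qed

lemma phi_deg: "phi ` {f \<in> carrier A. proj n f = f} = cuntz_pimsner_deg Rr P Q \<psi> n"
proof
  show "phi ` {f \<in> carrier A. proj n f = f} \<subseteq> cuntz_pimsner_deg Rr P Q \<psi> n"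
  proof
    fix X assume "X \<in> phi ` {f \<in> carrier A. proj n f = f}"
    then obtain f where f: "f \<in> carrier A" "proj n f = f" "X = phi f" by auto
    then obtain x where x: "x \<in> carrier FR" "f = eta (tcl x)"
      using ex_eta_preimage[OF f(1)] by (auto simp: sys.carrier_toeplitz)
    \<comment> \<open>As \<open>f\<close> is homogeneous, its preimage can be cut down to the part
      of degree n without changing the image.\<close>
    then have "f = eta (tcl (word_part wdeg n x))" using f eta_word_part by simp
    then have "X = ocl (tcl (word_part wdeg n x))"
      using f(3) phi_eta[OF toeplitz_deg_closed[OF word_part_free(2)[OF x(1)]]] by simp
    then show "X \<in> cuntz_pimsner_deg Rr P Q \<psi> n"
      using word_part_free(2)[OF x(1)] by (simp add: cuntz_pimsner_deg_def)
  qed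
  show "cuntz_pimsner_deg Rr P Q \<psi> n \<subseteq> phi ` {f \<in> carrier A. proj n f = f}"
  proof
    fix X assume "X \<in> cuntz_pimsner_deg Rr P Q \<psi> n"
    then obtain t where t: "t \<in> TD n" "X = ocl t"
      by (auto simp: cuntz_pimsner_deg_def)
    have "eta t \<in> carrier A \<and> proj n (eta t) = eta t"
      using t(1)
    proof (induction rule: deg_induct)
      case (word w)
      then show ?case using eta_cls_deg[of w] normal_word_valid[of w] cls_closed[of w] eta_simps by auto
    qed (auto simp: eta_simps proj_zero proj_diff)
    then show "X \<in> phi ` {f \<in> carrier A. proj n f = f}"
      using phi_eta[OF toeplitz_deg_closed[OF t(1)]] t(2) by (intro image_eqI[of _ _ "eta t"]) auto
  qed
qed

text \<open>Scalars are transported along \<open>phi\<close>. The canonical maps become linear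
  because they are the restrictions of \<open>phi\<close> to \<open>R\<close>, \<open>I\<close> and
  \<open>J\<close> (\<open>phi_iota\<close>).\<close>

definition cp_scale :: "'k \<Rightarrow> _ \<Rightarrow> _" where
  "cp_scale k X = phi (sc k (inv_into (carrier A) phi X))"

lemma cp_scale_phi: "f \<in> carrier A \<Longrightarrow> cp_scale k (phi f) = phi (sc k f)"
  using phi_iso inv_into_f_f[of phi "carrier A" f]
  by (simp add: cp_scale_def rng_iso_def bij_betw_def)

lemma phi_iota: "r \<in> R \<Longrightarrow> ocl (iR r) = phi r" "j \<in> J \<Longrightarrow> ocl (iP j) = phi j" "i \<in> I \<Longrightarrow> ocl (iQ i) = phi i"
  using phi_eta[of "iR r"] phi_eta[of "iP j"] phi_eta[of "iQ i"] by (simp_all add: eta_iota)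

lemma cp_scalars: "cuntz_pimsner_scalars Rr P Q \<psi> sc sc sc cp_scale"
proof -
  note c1 = sc[unfolded scalar_algebra_def, THEN conjunct2]
  note c2 = c1[THEN conjunct2] note c3 = c2[THEN conjunct2] note c4 = c3[THEN conjunct2]
  note c5 = c4[THEN conjunct2] note c6 = c5[THEN conjunct2]
  note S = c1[THEN conjunct1] c1[THEN conjunct1] c2[THEN conjunct1] c3[THEN conjunct1]
    c4[THEN conjunct1] c5[THEN conjunct1] c6
  have h: "phi (f \<oplus> g) = phi f \<oplus>\<^bsub>CP\<^esub> phi g" "phi (f \<otimes> g) = phi f \<otimes>\<^bsub>CP\<^esub> phi g"
    if "f \<in> carrier A" "g \<in> carrier A" for f g
    using phi_iso that by (auto simp: rng_iso_def rng_hom_def)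
  have car: "carrier CP = phi ` carrier A"
    using phi_iso by (auto simp: rng_iso_def bij_betw_def)
  have scc: "sc k f \<in> carrier A" if "f \<in> carrier A" for k f using S(1) that by simp
  have s: "sc k (f \<oplus> g) = sc k f \<oplus> sc k g" "sc (k + l) f = sc k f \<oplus> sc l f"
    "sc (k * l) f = sc k (sc l f)" "sc 1 f = f" "sc k (f \<otimes> g) = sc k f \<otimes> g" "f \<otimes> sc k g = sc k f \<otimes> g"
    if "f \<in> carrier A" "g \<in> carrier A" for k l f g
    using S(3)[rule_format, OF that] S(4)[rule_format, OF that(1)] S(5)[rule_format, OF that(1)]
      S(6)[rule_format, OF that(1)] S(7)[rule_format, OF that, of k] by metis+
  have "rng CP" using nn.rng_quot by (simp add: cuntz_pimsner_def)
  then have "scalar_algebra cp_scale CP"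
    unfolding scalar_algebra_def car
    by (intro conjI allI ballI; (elim imageE)?; hypsubst?)
      (simp_all add: h[symmetric] cp_scale_phi scc s m_closed)
  then show ?thesis
    unfolding cuntz_pimsner_scalars_def sub_rng_simps sub_bimodule_simps
    by (intro conjI allI ballI) (simp_all add: phi_iota cp_scale_phi R_c I_c J_c sc_RIJ)
qed

theorem cuntz_pimsner_iso:
  "cuntz_pimsner_defined Rr P Q \<psi> \<and>
   (\<exists>sc' \<phi>. cuntz_pimsner_scalars Rr P Q \<psi> sc sc sc sc' \<and> \<phi> \<in> rng_iso A (cuntz_pimsner Rr P Q \<psi>) \<and>
      (\<forall>n. \<phi> ` {f \<in> carrier A. proj n f = f} = cuntz_pimsner_deg Rr P Q \<psi> n) \<and>
      (\<forall>k. \<forall>f\<in>carrier A. \<phi> (sc k f) = sc' k (\<phi> f)))"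
  by (intro conjI exI[of _ cp_scale] exI[of _ phi] allI ballI cuntz_pimsner_defined cp_scalars
      phi_iso phi_deg cp_scale_phi[symmetric])

end

section \<open>Topology of ample groupoids\<close>

lemma cob_elems: "compact_open_bisection G B \<Longrightarrow> B \<subseteq> elems G"
  by (auto simp: compact_open_bisection_def elems_def dest: compactin_subset_topspace)

lemma composableI: "\<lbrakk>x \<in> elems G; y \<in> elems G; gsrc G x = grng G y\<rbrakk> \<Longrightarrow> (x, y) \<in> composable G"
  by (simp add: composable_def)

context topological_groupoid
begin

lemma src_closed_units: "x \<in> elems G \<Longrightarrow> gsrc G x \<in> units G"
  unfolding units_def by (metis imageI rng_src src_closed)

lemma rng_closed_units: "x \<in> elems G \<Longrightarrow> grng G x \<in> units G"
  unfolding units_def by simp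

lemma unitsD: "u \<in> units G \<Longrightarrow> u \<in> elems G" "u \<in> units G \<Longrightarrow> grng G u = u" "u \<in> units G \<Longrightarrow> gsrc G u = u"
  by (auto simp: units_def rng_closed rng_rng src_rng)

lemma mul_elems: "\<lbrakk>x \<in> elems G; y \<in> elems G; gsrc G x = grng G y\<rbrakk> \<Longrightarrow> gmul G x y \<in> elems G"
  and rng_mul': "\<lbrakk>x \<in> elems G; y \<in> elems G; gsrc G x = grng G y\<rbrakk> \<Longrightarrow> grng G (gmul G x y) = grng G x"
  and src_mul': "\<lbrakk>x \<in> elems G; y \<in> elems G; gsrc G x = grng G y\<rbrakk> \<Longrightarrow> gsrc G (gmul G x y) = gsrc G y"
  by (simp_all add: mul_closed rng_mul src_mul composableI)

lemma mul_assoc': "\<lbrakk>x \<in> elems G; y \<in> elems G; z \<in> elems G; gsrc G x = grng G y; gsrc G y = grng G z\<rbrakk>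
    \<Longrightarrow> gmul G (gmul G x y) z = gmul G x (gmul G y z)"
  by (simp add: mul_assoc composableI)

lemmas gsimps = rng_closed src_closed inv_closed rng_inv src_inv mul_elems rng_mul' src_mul'
  rng_rng src_rng rng_src src_src

lemma inv_mul_cancel: "\<lbrakk>x \<in> elems G; y \<in> elems G; gsrc G x = grng G y\<rbrakk> \<Longrightarrow> gmul G (ginv G x) (gmul G x y) = y"
  using mul_assoc'[of "ginv G x" x y] by (simp add: gsimps inv_mul rng_mul_left)

lemma mul_inv_cancel: "\<lbrakk>x \<in> elems G; y \<in> elems G; grng G x = grng G y\<rbrakk> \<Longrightarrow> gmul G x (gmul G (ginv G x) y) = y"
  using mul_assoc'[of x "ginv G x" y] by (simp add: gsimps mul_inv rng_mul_left)

lemma mul_inv_cancel_right: "\<lbrakk>x \<in> elems G; y \<in> elems G; gsrc G x = grng G y\<rbrakk> \<Longrightarrow> gmul G (gmul G x y) (ginv G y) = x"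
  using mul_assoc'[of x y "ginv G y"] src_mul_right[of x] by (simp add: gsimps mul_inv)

lemma inv_mul_cancel_right: "\<lbrakk>x \<in> elems G; y \<in> elems G; gsrc G x = gsrc G y\<rbrakk> \<Longrightarrow> gmul G (gmul G x (ginv G y)) y = x"
  using mul_assoc'[of x "ginv G y" y] src_mul_right[of x] by (simp add: gsimps inv_mul)

text \<open>A unit x y equals its own range r(x); cancelling \<open>x\<close> leaves the inverse.
  Later this forces a unit h k in H1 Hm to have k inverse to h.\<close>

lemma inv_unique: "\<lbrakk>x \<in> elems G; y \<in> elems G; gsrc G x = grng G y; gmul G x y \<in> units G\<rbrakk> \<Longrightarrow> y = ginv G x"
proof -
  assume a: "x \<in> elems G" "y \<in> elems G" "gsrc G x = grng G y" "gmul G x y \<in> units G"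
  then have "gmul G x y = grng G x" using unitsD(2)[OF a(4)] by (simp add: rng_mul')
  then have "y = gmul G (ginv G x) (grng G x)" using inv_mul_cancel[OF a(1-3)] by simp
  also have "\<dots> = ginv G x" using src_mul_right[of "ginv G x"] a by (simp add: gsimps)
  finally show ?thesis .
qed

lemma inv_inv: "x \<in> elems G \<Longrightarrow> ginv G (ginv G x) = x"
  using inv_unique[of "ginv G x" x] by (simp add: gsimps inv_mul src_closed_units)

text \<open>Solving x = b y for y turns membership in a product set into a preimage
  condition.\<close>

lemma gset_mul_iff_left:
  assumes "X \<subseteq> elems G" "Y \<subseteq> elems G"
  shows "x \<in> gset_mul G X Y \<longleftrightarrow> x \<in> elems G \<and> (\<exists>b\<in>X. grng G b = grng G x \<and> gmul G (ginv G b) x \<in> Y)"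
proof
  assume "x \<in> gset_mul G X Y"
  then obtain b y where by_: "b \<in> X" "y \<in> Y" "gsrc G b = grng G y" "x = gmul G b y"
    by (auto simp: gset_mul_def)
  then have "gmul G (ginv G b) x = y" "grng G b = grng G x" "x \<in> elems G"
    using assms by (auto simp: inv_mul_cancel gsimps subset_iff)
  then show "x \<in> elems G \<and> (\<exists>b\<in>X. grng G b = grng G x \<and> gmul G (ginv G b) x \<in> Y)" using by_ by auto
next
  assume "x \<in> elems G \<and> (\<exists>b\<in>X. grng G b = grng G x \<and> gmul G (ginv G b) x \<in> Y)"
  then obtain b where b: "x \<in> elems G" "b \<in> X" "grng G b = grng G x" "gmul G (ginv G b) x \<in> Y" by auto
  then have be: "b \<in> elems G" using assms by auto
  have "x = gmul G b (gmul G (ginv G b) x)" using mul_inv_cancel[OF be b(1,3)] by simp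
  moreover have "gsrc G b = grng G (gmul G (ginv G b) x)" using b be by (simp add: gsimps)
  ultimately show "x \<in> gset_mul G X Y" using b unfolding gset_mul_def by blast
qed

lemma continuous_gmul:
  assumes "continuous_map X (gtop G) f" "continuous_map X (gtop G) g"
    "\<And>x. x \<in> topspace X \<Longrightarrow> gsrc G (f x) = grng G (g x)"
  shows "continuous_map X (gtop G) (\<lambda>x. gmul G (f x) (g x))"
proof -
  have "continuous_map X (subtopology (prod_topology (gtop G) (gtop G)) (composable G)) (\<lambda>x. (f x, g x))"
    using assms continuous_map_funspace[OF assms(1)] continuous_map_funspace[OF assms(2)]
    by (auto simp: continuous_map_in_subtopology continuous_map_paired composable_def elems_def)
  from continuous_map_compose[OF this continuous_mul] show ?thesis by (simp add: o_def)
qed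

lemma continuous_rng: "continuous_map (gtop G) (gtop G) (grng G)"
proof (rule continuous_map_eq)
  show "continuous_map (gtop G) (gtop G) (\<lambda>x. gmul G x (ginv G x))"
    by (rule continuous_gmul) (auto simp: continuous_inv rng_inv elems_def[symmetric])
qed (simp add: mul_inv elems_def[symmetric])

lemma continuous_src: "continuous_map (gtop G) (gtop G) (gsrc G)"
proof (rule continuous_map_eq)
  show "continuous_map (gtop G) (gtop G) (\<lambda>x. gmul G (ginv G x) x)"
    by (rule continuous_gmul) (auto simp: continuous_inv src_inv elems_def[symmetric])
qed (simp add: inv_mul elems_def[symmetric])

lemma inv_image: "B \<subseteq> elems G \<Longrightarrow> ginv G ` B = {x \<in> elems G. ginv G x \<in> B}"
proof (intro equalityI subsetI)
  fix x assume "B \<subseteq> elems G" "x \<in> {x \<in> elems G. ginv G x \<in> B}"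
  then show "x \<in> ginv G ` B" by (intro image_eqI[of _ _ "ginv G x"]) (simp_all add: inv_inv)
qed (auto simp: inv_inv gsimps subset_iff)

lemma openin_inv: "openin (gtop G) B \<Longrightarrow> openin (gtop G) (ginv G ` B)"
  using openin_continuous_map_preimage[OF continuous_inv, of B] openin_subset[of "gtop G" B]
  by (simp add: inv_image elems_def)

end

context ample_Hausdorff_groupoid
begin

text \<open>Take a bisection \<open>B\<close> around a unit. If x and r(x) both lie in
  \<open>B\<close>, they have the same range, so injectivity gives x = r(x). Such x form an open
  set.\<close>

lemma openin_units: "openin (gtop G) (units G)"
proof (subst openin_subopen, intro ballI)
  fix u assume u: "u \<in> units G"
  obtain B where B: "compact_open_bisection G B" "u \<in> B"
    using compact_open_bisection_base[of "topspace (gtop G)" u] unitsD(1)[OF u] by (auto simp: elems_def)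
  have Bo: "openin (gtop G) B" and "homeomorphic_map (subtopology (gtop G) B)
      (subtopology (unit_space G) (grng G ` B)) (grng G)"
    using B by (auto simp: compact_open_bisection_def open_bisection_def)
  then have inj: "inj_on (grng G) B"
    using cob_elems[OF B(1)] unfolding homeomorphic_eq_everything_map elems_def
    by (simp add: Int_absorb1)
  let ?U = "{x \<in> B. grng G x \<in> B}"
  have "openin (gtop G) (B \<inter> {x \<in> topspace (gtop G). grng G x \<in> B})"
    by (intro openin_Int Bo openin_continuous_map_preimage[OF continuous_rng])
  moreover have "B \<inter> {x \<in> topspace (gtop G). grng G x \<in> B} = ?U"
    using openin_subset[OF Bo] by auto
  moreover have "?U \<subseteq> units G"
  proof
    fix x assume x: "x \<in> ?U"
    then have xe: "x \<in> elems G" using openin_subset[OF Bo] by (auto simp: elems_def)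
    then have "grng G x = x" using inj_onD[OF inj, of "grng G x" x] x by (simp add: rng_rng)
    then show "x \<in> units G" using xe rng_closed_units[of x] by simp
  qed
  moreover have "u \<in> ?U" using B u unitsD by simp
  ultimately show "\<exists>T. openin (gtop G) T \<and> u \<in> T \<and> T \<subseteq> units G" by auto
qed

lemma openin_unit_space: "openin (unit_space G) V \<longleftrightarrow> openin (gtop G) V \<and> V \<subseteq> units G"
  unfolding unit_space_def using openin_open_subtopology[OF openin_units] by auto

lemma openin_range_image:
  assumes f: "f \<in> {grng G, gsrc G}" and U: "openin (gtop G) U"
  shows "openin (gtop G) (f ` U)"
proof (subst openin_subopen, intro ballI)
  fix y assume "y \<in> f ` U"
  then obtain x where x: "x \<in> U" "y = f x" by auto
  obtain B where B: "compact_open_bisection G B" "x \<in> B" "B \<subseteq> U"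
    using compact_open_bisection_base[OF U x(1)] by auto
  then have "openin (gtop G) (f ` B)"
    using f openin_unit_space by (auto simp: compact_open_bisection_def open_bisection_def)
  then show "\<exists>T. openin (gtop G) T \<and> y \<in> T \<and> T \<subseteq> f ` U" using B x by (intro exI[of _ "f ` B"]) auto
qed

text \<open>The range and source maps are continuous and open, so injectivity already makes them
  homeomorphisms onto open images. From here on bisections are handled through openness and
  injectivity.\<close>

lemma open_bisection_iff:
  "open_bisection G B \<longleftrightarrow> openin (gtop G) B \<and> inj_on (grng G) B \<and> inj_on (gsrc G) B"
proof
  assume "open_bisection G B"
  then have B: "openin (gtop G) B" and h: "\<And>f. f \<in> {grng G, gsrc G} \<Longrightarrow>
      homeomorphic_map (subtopology (gtop G) B) (subtopology (unit_space G) (f ` B)) f"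
    by (auto simp: open_bisection_def)
  have "inj_on f B" if "f \<in> {grng G, gsrc G}" for f
    using h[OF that] openin_subset[OF B] unfolding homeomorphic_eq_everything_map by (simp add: Int_absorb1)
  then show "openin (gtop G) B \<and> inj_on (grng G) B \<and> inj_on (gsrc G) B" using B by auto
next
  assume B: "openin (gtop G) B \<and> inj_on (grng G) B \<and> inj_on (gsrc G) B"
  have Be: "B \<subseteq> elems G" using B openin_subset by (auto simp: elems_def)
  have "openin (unit_space G) (f ` B) \<and>
      homeomorphic_map (subtopology (gtop G) B) (subtopology (unit_space G) (f ` B)) f"
    if f: "f \<in> {grng G, gsrc G}" for f
  proof -
    have fB: "f ` B \<subseteq> units G" using f Be rng_closed_units src_closed_units by auto
    have o: "openin (gtop G) (f ` B)" using openin_range_image[OF f] B by simp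
    have st: "subtopology (unit_space G) (f ` B) = subtopology (gtop G) (f ` B)"
      using fB by (simp add: unit_space_def subtopology_subtopology Int_absorb1)
    have "continuous_map (gtop G) (gtop G) f" using f continuous_rng continuous_src by auto
    then have "homeomorphic_map (subtopology (gtop G) B) (subtopology (gtop G) (f ` B)) f"
    proof (intro bijective_open_imp_homeomorphic_map)
      show "open_map (subtopology (gtop G) B) (subtopology (gtop G) (f ` B)) f"
        unfolding open_map_def using B o openin_range_image[OF f]
        by (auto simp: openin_open_subtopology)
      show "f ` topspace (subtopology (gtop G) B) = topspace (subtopology (gtop G) (f ` B))"
        using openin_subset[OF o] openin_subset[of "gtop G" B] B by (simp add: Int_absorb1)
      show "inj_on f (topspace (subtopology (gtop G) B))"
        using f B openin_subset[of "gtop G" B] by (auto simp: Int_absorb1)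
    qed (auto simp: continuous_map_in_subtopology continuous_map_from_subtopology)
    then show ?thesis using st o fB openin_unit_space by simp
  qed
  then show "open_bisection G B" using B by (simp add: open_bisection_def)
qed

section \<open>Compact open bisections and locally constant functions\<close>

abbreviation "cob \<equiv> compact_open_bisection G"

lemma cob_iff: "cob B \<longleftrightarrow> compactin (gtop G) B \<and> openin (gtop G) B \<and> inj_on (grng G) B \<and> inj_on (gsrc G) B"
  by (simp add: compact_open_bisection_def open_bisection_iff)

lemma compactin_closedin: "compactin (gtop G) K \<Longrightarrow> closedin (gtop G) K"
  by (rule compactin_imp_closedin[OF Hausdorff])

lemma cob_subset: "\<lbrakk>cob B; C \<subseteq> B; openin (gtop G) C; closedin (gtop G) C\<rbrakk> \<Longrightarrow> cob C"
  unfolding cob_iff by (meson closed_compactin inj_on_subset)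

lemma cob_Int: "\<lbrakk>cob B; clopen_in G C\<rbrakk> \<Longrightarrow> cob (B \<inter> C)"
  by (rule cob_subset[of B]) (auto simp: clopen_in_def cob_iff intro: compactin_closedin)

lemma cob_open_subset: "\<lbrakk>openin (gtop G) U; x \<in> U\<rbrakk> \<Longrightarrow> \<exists>B. cob B \<and> x \<in> B \<and> B \<subseteq> U"
  by (rule compact_open_bisection_base)

text \<open>A point x with range in r(B) determines the b in \<open>B\<close> with that range, and b
  depends continuously on x. So the product set is the preimage of \<open>D\<close> under the
  continuous map that multiplies x on the left by the inverse of b.\<close>

lemma openin_gset_mul:
  assumes B: "open_bisection G B" and D: "openin (gtop G) D"
  shows "openin (gtop G) (gset_mul G B D)"
proof -
  have Bo: "openin (gtop G) B" and inj: "inj_on (grng G) B" using B by (auto simp: open_bisection_iff)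
  have Be: "B \<subseteq> elems G" and De: "D \<subseteq> elems G" using Bo D openin_subset by (auto simp: elems_def)
  have st: "subtopology (unit_space G) (grng G ` B) = subtopology (gtop G) (grng G ` B)"
  proof -
    have "grng G ` B \<subseteq> units G" using Be rng_closed_units by auto
    then show ?thesis by (simp add: unit_space_def subtopology_subtopology Int_absorb1)
  qed
  have oB: "openin (gtop G) (grng G ` B)" using openin_range_image[OF _ Bo] by simp
  have "homeomorphic_map (subtopology (gtop G) B) (subtopology (gtop G) (grng G ` B)) (grng G)"
    using B st by (auto simp: open_bisection_def)
  then obtain g where g: "homeomorphic_maps (subtopology (gtop G) B) (subtopology (gtop G) (grng G ` B)) (grng G) g"
    using homeomorphic_map_maps by blast
  have gr: "g (grng G b) = b" if "b \<in> B" for b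
    using g that openin_subset[OF Bo] by (auto simp: homeomorphic_maps_def)
  let ?X = "{x \<in> topspace (gtop G). grng G x \<in> grng G ` B}"
  have X: "openin (gtop G) ?X" by (rule openin_continuous_map_preimage[OF continuous_rng oB])
  have tX: "topspace (subtopology (gtop G) ?X) = ?X" by auto
  have "continuous_map (subtopology (gtop G) ?X) (subtopology (gtop G) (grng G ` B)) (grng G)"
    by (auto simp: continuous_map_in_subtopology continuous_map_from_subtopology continuous_rng)
  moreover have "continuous_map (subtopology (gtop G) (grng G ` B)) (gtop G) g"
    using g by (simp add: homeomorphic_maps_def continuous_map_in_subtopology)
  ultimately have "continuous_map (subtopology (gtop G) ?X) (gtop G) (g \<circ> grng G)"
    by (rule continuous_map_compose)
  then have "continuous_map (subtopology (gtop G) ?X) (gtop G) (ginv G \<circ> (g \<circ> grng G))"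
    by (rule continuous_map_compose[OF _ continuous_inv])
  then have "continuous_map (subtopology (gtop G) ?X) (gtop G) (\<lambda>x. gmul G ((ginv G \<circ> (g \<circ> grng G)) x) x)"
  proof (rule continuous_gmul)
    show "continuous_map (subtopology (gtop G) ?X) (gtop G) (\<lambda>x. x)"
      by (simp add: continuous_map_from_subtopology)
    fix x assume "x \<in> topspace (subtopology (gtop G) ?X)"
    then obtain b where "b \<in> B" "grng G x = grng G b" by auto
    then show "gsrc G ((ginv G \<circ> (g \<circ> grng G)) x) = grng G x"
      using gr[of b] Be by (auto simp: gsimps)
  qed
  from openin_continuous_map_preimage[OF this D]
  have "openin (gtop G) {x \<in> ?X. gmul G (ginv G (g (grng G x))) x \<in> D}"
    unfolding tX openin_open_subtopology[OF X] by simp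
  moreover have "{x \<in> ?X. gmul G (ginv G (g (grng G x))) x \<in> D} = gset_mul G B D"
  proof (intro equalityI subsetI)
    fix x assume "x \<in> {x \<in> ?X. gmul G (ginv G (g (grng G x))) x \<in> D}"
    then obtain b where b: "b \<in> B" "grng G x = grng G b" "x \<in> elems G" "gmul G (ginv G (g (grng G x))) x \<in> D"
      by (auto simp: elems_def)
    then have "gmul G (ginv G b) x \<in> D" using gr[OF b(1)] by simp
    then show "x \<in> gset_mul G B D" using b unfolding gset_mul_iff_left[OF Be De] by auto
  next
    fix x assume "x \<in> gset_mul G B D"
    then obtain b where b: "b \<in> B" "grng G b = grng G x" "x \<in> elems G" "gmul G (ginv G b) x \<in> D"
      unfolding gset_mul_iff_left[OF Be De] by auto
    then have "g (grng G x) = b" using gr[OF b(1)] by simp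
    moreover have "grng G x \<in> grng G ` B" using b(2)[symmetric] b(1) by simp
    ultimately show "x \<in> {x \<in> ?X. gmul G (ginv G (g (grng G x))) x \<in> D}"
      using b by (simp add: elems_def)
  qed
  ultimately show ?thesis by simp
qed

text \<open>Composability is the equation s(x) = r(y), a closed condition in a Hausdorff space. The
  product set is the continuous image of the closed set of composable pairs in the compact product
  of \<open>B\<close> and \<open>D\<close>.\<close>

lemma compactin_gset_mul:
  assumes "compactin (gtop G) B" "compactin (gtop G) D"
  shows "compactin (gtop G) (gset_mul G B D)"
proof -
  let ?P = "prod_topology (gtop G) (gtop G)"
  have 1: "continuous_map ?P (gtop G) (gsrc G \<circ> fst)" "continuous_map ?P (gtop G) (grng G \<circ> snd)"
    by (rule continuous_map_compose[OF continuous_map_fst continuous_src]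
        continuous_map_compose[OF continuous_map_snd continuous_rng])+
  have "closedin ?P {x \<in> topspace ?P. (gsrc G \<circ> fst) x = (grng G \<circ> snd) x}"
    by (rule closedin_continuous_maps_eq[OF Hausdorff 1])
  moreover have "{x \<in> topspace ?P. (gsrc G \<circ> fst) x = (grng G \<circ> snd) x} = composable G"
    by (auto simp: composable_def elems_def)
  ultimately have cl: "closedin ?P (composable G)" by simp
  have "compactin ?P (B \<times> D)" using assms by (simp add: compactin_Times)
  then have "compactin ?P (composable G \<inter> B \<times> D)" by (rule closed_Int_compactin[OF cl])
  then have "compactin (subtopology ?P (composable G)) (composable G \<inter> B \<times> D)"
    by (simp add: compactin_subtopology)
  from image_compactin[OF this continuous_mul]
  have "compactin (gtop G) ((\<lambda>(x, y). gmul G x y) ` (composable G \<inter> B \<times> D))" .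
  moreover have "(\<lambda>(x, y). gmul G x y) ` (composable G \<inter> B \<times> D) = gset_mul G B D"
    using assms[THEN compactin_subset_topspace]
    by (force simp: gset_mul_def composable_def elems_def)
  ultimately show ?thesis by simp
qed

text \<open>In a product b d the range determines b, and then r(d) = s(b) determines d; dually for
  the source.\<close>

lemma cob_mul:
  assumes B: "cob B" and D: "cob D"
  shows "cob (gset_mul G B D)"
  unfolding cob_iff
proof (intro conjI)
  note Be = cob_elems[OF B] and De = cob_elems[OF D]
  show "compactin (gtop G) (gset_mul G B D)" "openin (gtop G) (gset_mul G B D)"
    using B D by (auto simp: compact_open_bisection_def open_bisection_def
        intro: compactin_gset_mul openin_gset_mul)
  have inj: "inj_on (grng G) B" "inj_on (gsrc G) B" "inj_on (grng G) D" "inj_on (gsrc G) D"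
    using B D by (auto simp: cob_iff)
  show "inj_on (grng G) (gset_mul G B D)"
  proof (rule inj_onI)
    fix x y assume "x \<in> gset_mul G B D" "y \<in> gset_mul G B D" and eq: "grng G x = grng G y"
    then obtain b d b' d' where *: "b \<in> B" "d \<in> D" "gsrc G b = grng G d" "x = gmul G b d"
      "b' \<in> B" "d' \<in> D" "gsrc G b' = grng G d'" "y = gmul G b' d'" by (auto simp: gset_mul_def)
    then have e: "b \<in> elems G" "d \<in> elems G" "b' \<in> elems G" "d' \<in> elems G" using Be De by auto
    have "b = b'" using inj_onD[OF inj(1), of b b'] * e eq by (simp add: gsimps)
    moreover have "d = d'" using inj_onD[OF inj(3), of d d'] * calculation by simp
    ultimately show "x = y" using * by simp
  qed
  show "inj_on (gsrc G) (gset_mul G B D)"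
  proof (rule inj_onI)
    fix x y assume "x \<in> gset_mul G B D" "y \<in> gset_mul G B D" and eq: "gsrc G x = gsrc G y"
    then obtain b d b' d' where *: "b \<in> B" "d \<in> D" "gsrc G b = grng G d" "x = gmul G b d"
      "b' \<in> B" "d' \<in> D" "gsrc G b' = grng G d'" "y = gmul G b' d'" by (auto simp: gset_mul_def)
    then have e: "b \<in> elems G" "d \<in> elems G" "b' \<in> elems G" "d' \<in> elems G" using Be De by auto
    have "d = d'" using inj_onD[OF inj(4), of d d'] * e eq by (simp add: gsimps)
    moreover have "b = b'" using inj_onD[OF inj(2), of b b'] * calculation by simp
    ultimately show "x = y" using * by simp
  qed
qed

lemma cob_inv: "cob B \<Longrightarrow> cob (ginv G ` B)"
  using cob_elems[of G B] inv_inv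
  by (auto simp: cob_iff image_compactin[OF _ continuous_inv] openin_inv inj_on_def gsimps subset_iff)

lemma cob_range: "cob B \<Longrightarrow> cob (grng G ` B)" and cob_source: "cob B \<Longrightarrow> cob (gsrc G ` B)"
proof -
  assume B: "cob B"
  note Be = cob_elems[OF B]
  have u: "grng G ` B \<subseteq> units G" "gsrc G ` B \<subseteq> units G"
    using Be rng_closed_units src_closed_units by auto
  have "inj_on (grng G) U" "inj_on (gsrc G) U" if "U \<subseteq> units G" for U
    using that unitsD(2,3)[OF subsetD[OF that]] by (auto intro!: inj_onI)
  then show "cob (grng G ` B)" "cob (gsrc G ` B)"
    using B u openin_range_image[of _ B]
    by (auto simp: cob_iff image_compactin[OF _ continuous_rng] image_compactin[OF _ continuous_src])
qed

section \<open>Steinberg functions as locally constant functions with compact support\<close>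

lemma steinberg_zero: "(\<lambda>x. 0) \<in> steinberg G"
  unfolding steinberg_def by (intro CollectI exI[of _ "{}"]) auto

text \<open>\<open>B\<close> may already occur in the index set of \<open>f\<close>; its
  coefficients are then added.\<close>

lemma steinberg_add_ind:
  assumes "f \<in> steinberg G" "cob B"
  shows "(\<lambda>x. k * indicator B x + f x) \<in> steinberg G"
proof -
  obtain F a where F: "finite F" "\<forall>B\<in>F. cob B" "f = (\<lambda>x. \<Sum>B\<in>F. a B * indicator B x)"
    using assms(1) by (auto simp: steinberg_def)
  define a' where "a' C = (if C = B then k else 0) + (if C \<in> F then a C else 0)" for C
  have "(\<Sum>C\<in>insert B F. a' C * indicator C x) = k * indicator B x + f x" for x
  proof -
    have "(\<Sum>C\<in>insert B F. a' C * indicator C x) =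
      (\<Sum>C\<in>insert B F. (if C = B then k * indicator C x else 0) + (if C \<in> F then a C * indicator C x else 0))"
      by (rule sum.cong) (auto simp: a'_def algebra_simps)
    also have "\<dots> = k * indicator B x + (\<Sum>C\<in>F. a C * indicator C x)"
      using F(1) by (simp add: sum.distrib sum.inter_restrict[symmetric] Int_absorb1 subset_insertI)
    finally show ?thesis using F(3) by simp
  qed
  then show ?thesis
    unfolding steinberg_def using F assms(2) by (intro CollectI exI[of _ "insert B F"] exI[of _ a']) auto
qed

lemma steinberg_ind: "cob B \<Longrightarrow> (\<lambda>x. k * indicator B x) \<in> steinberg G"
  using steinberg_add_ind[OF steinberg_zero, of B k] by simp

lemma steinberg_induct [consumes 1, case_names zero add]:
  assumes f: "f \<in> steinberg G"
    and P: "P (\<lambda>x. 0)"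
      "\<And>B k g. \<lbrakk>cob B; g \<in> steinberg G; P g\<rbrakk> \<Longrightarrow> P (\<lambda>x. k * indicator B x + g x)"
  shows "P f"
proof -
  obtain F a where F: "finite F" "\<forall>B\<in>F. cob B" "f = (\<lambda>x. \<Sum>B\<in>F. a B * indicator B x)"
    using f by (auto simp: steinberg_def)
  have "P (\<lambda>x. \<Sum>B\<in>F. a B * indicator B x)"
    using F(1,2)
  proof (induction F)
    case empty then show ?case using P(1) by simp
  next
    case (insert B F)
    have "(\<lambda>x. \<Sum>B\<in>F. a B * indicator B x) \<in> steinberg G"
      unfolding steinberg_def using insert by (intro CollectI exI[of _ F] exI[of _ a]) simp
    moreover have "cob B" "P (\<lambda>x. \<Sum>B\<in>F. a B * indicator B x)" using insert by auto
    ultimately show ?case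
      using P(2)[of B "\<lambda>x. \<Sum>B\<in>F. a B * indicator B x" "a B"] by (simp only: sum.insert[OF insert(1,2)])
  qed
  then show ?thesis using F(3) by simp
qed

lemma steinberg_add:
  assumes "f \<in> steinberg G" "g \<in> steinberg G"
  shows "(\<lambda>x. f x + g x) \<in> steinberg G"
  using assms(1)
proof (induction rule: steinberg_induct)
  case (add B k f) then show ?case using steinberg_add_ind[OF add(3), of B k] by (simp add: add.assoc)
qed (use assms(2) in simp)

lemma steinberg_scale:
  assumes "f \<in> steinberg G"
  shows "(\<lambda>x. l * f x) \<in> steinberg G"
  using assms
proof (induction rule: steinberg_induct)
  case (add B k f)
  then show ?case using steinberg_add_ind[OF add(3), of B "l * k"] by (simp add: algebra_simps)
qed (simp add: steinberg_zero)

lemma cob_complement: "cob B \<Longrightarrow> openin (gtop G) (elems G - B)"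
  using compactin_closedin[of B] by (auto simp: cob_iff elems_def closedin_def)

lemma steinberg_level:
  assumes "f \<in> steinberg G"
  shows "openin (gtop G) {x \<in> elems G. f x = l}"
  using assms
proof (induction arbitrary: l rule: steinberg_induct)
  case zero show ?case by (cases "l = 0") (auto simp: elems_def)
next
  case (add B k g)
  have "{x \<in> elems G. k * indicator B x + g x = l} =
      (B \<inter> {x \<in> elems G. g x = l - k}) \<union> ((elems G - B) \<inter> {x \<in> elems G. g x = l})"
    using cob_elems[OF add(1)]
    by (auto simp: indicator_def algebra_simps split: if_splits)
  moreover have "openin (gtop G) B" using add(1) by (simp add: cob_iff)
  ultimately show ?case using add cob_complement[OF add(1)] by auto
qed

lemma steinberg_outside: "\<lbrakk>f \<in> steinberg G; x \<notin> elems G\<rbrakk> \<Longrightarrow> f x = 0"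
proof (induction rule: steinberg_induct)
  case (add B k g) then show ?case using cob_elems[OF add(1)] by (auto simp: indicator_def)
qed simp

text \<open>The support is a union of level sets and its complement is the zero level, so it is
  clopen. It is compact as a closed subset of a finite union of compact bisections.\<close>

lemma steinberg_support:
  assumes "f \<in> steinberg G"
  shows "openin (gtop G) {x. f x \<noteq> 0}" "closedin (gtop G) {x. f x \<noteq> 0}" "compactin (gtop G) {x. f x \<noteq> 0}"
proof -
  have eq: "{x. f x \<noteq> 0} = (\<Union>l\<in>UNIV - {0}. {x \<in> elems G. f x = l})"
    using steinberg_outside[OF assms] by auto
  show "openin (gtop G) {x. f x \<noteq> 0}" unfolding eq using steinberg_level[OF assms] by auto
  have closed: "closedin (gtop G) {x. f x \<noteq> 0}" if "f \<in> steinberg G" for f :: "'g \<Rightarrow> 'b::field"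
  proof -
    have "topspace (gtop G) - {x. f x \<noteq> 0} = {x \<in> elems G. f x = 0}" by (auto simp: elems_def)
    moreover have "{x. f x \<noteq> 0} \<subseteq> topspace (gtop G)"
      using steinberg_outside[OF that] by (auto simp: elems_def)
    ultimately show ?thesis using steinberg_level[OF that] unfolding closedin_def by auto
  qed
  show "closedin (gtop G) {x. f x \<noteq> 0}" by (rule closed[OF assms])
  show "compactin (gtop G) {x. f x \<noteq> 0}"
    using assms
  proof (induction rule: steinberg_induct)
    case (add B k g)
    have "compactin (gtop G) (B \<union> {x. g x \<noteq> 0})" using add by (intro compactin_Un) (auto simp: cob_iff)
    moreover have "{x. k * indicator B x + g x \<noteq> 0} \<subseteq> B \<union> {x. g x \<noteq> 0}" by (auto simp: indicator_def)
    ultimately show ?case using closed_compactin closed[OF steinberg_add_ind[OF add(2,1)]] by blast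
  qed simp
qed

text \<open>The support is covered by finitely many bisections on which \<open>f\<close> is
  constant, and the cover is made disjoint. The criterion gives closure under restriction to clopen
  sets, which the description as a span hides.\<close>

lemma steinbergI:
  assumes out: "\<And>x. x \<notin> elems G \<Longrightarrow> f x = 0"
    and lev: "\<And>l. openin (gtop G) {x \<in> elems G. f x = l}"
    and comp: "compactin (gtop G) {x. f x \<noteq> 0}"
  shows "f \<in> steinberg G"
proof -
  let ?U = "{B. cob B \<and> (\<exists>k. \<forall>x\<in>B. f x = k)}"
  have cov: "{x. f x \<noteq> 0} \<subseteq> \<Union>?U"
  proof
    fix x assume "x \<in> {x. f x \<noteq> 0}"
    then have "x \<in> elems G" using out by auto
    then obtain B where "cob B" "x \<in> B" "B \<subseteq> {y \<in> elems G. f y = f x}"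
      using cob_open_subset[OF lev[of "f x"], of x] by auto
    then show "x \<in> \<Union>?U" by (intro UnionI[of B]) auto
  qed
  obtain F where F: "finite F" "F \<subseteq> ?U" "{x. f x \<noteq> 0} \<subseteq> \<Union>F"
    using compactinD[OF comp _ cov] by (auto simp: cob_iff)
  \<comment> \<open>The clopen set \<open>C\<close> is what carries the induction: a bisection
    \<open>B\<close> is peeled off and the others are treated on \<open>C - B\<close>, so that
    overlaps are not counted twice.\<close>
  have "(\<lambda>x. if x \<in> C \<inter> \<Union>F then f x else 0) \<in> steinberg G" if "clopen_in G C" for C
    using F(1,2) that
  proof (induction F arbitrary: C)
    case empty then show ?case by (simp add: steinberg_zero)
  next
    case (insert B F)
    then obtain k where k: "cob B" "\<forall>x\<in>B. f x = k" by auto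
    have "clopen_in G B" using k(1) compactin_closedin by (simp add: clopen_in_def cob_iff)
    then have "clopen_in G (C - B)" using insert.prems
      by (auto simp: clopen_in_def openin_diff closedin_diff)
    then have "(\<lambda>x. if x \<in> (C - B) \<inter> \<Union>F then f x else 0) \<in> steinberg G"
      using insert.IH[of "C - B"] insert.prems(1) by blast
    from steinberg_add_ind[OF this cob_Int[OF k(1) insert.prems(2)], of k]
    have "(\<lambda>x. k * indicator (B \<inter> C) x + (if x \<in> (C - B) \<inter> \<Union>F then f x else 0)) \<in> steinberg G" .
    moreover have "k * indicator (B \<inter> C) x + (if x \<in> (C - B) \<inter> \<Union>F then f x else 0) =
        (if x \<in> C \<inter> \<Union>(insert B F) then f x else 0)" for x
      using k(2) by (cases "x \<in> B"; cases "x \<in> C") (simp_all add: indicator_def)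
    ultimately show ?case by simp
  qed
  from this[of "topspace (gtop G)"]
  have "(\<lambda>x. if x \<in> topspace (gtop G) \<inter> \<Union>F then f x else 0) \<in> steinberg G"
    by (simp only: clopen_in_def openin_topspace closedin_topspace)
  moreover have "(if x \<in> topspace (gtop G) \<inter> \<Union>F then f x else 0) = f x" for x
    using subsetD[OF F(3), of x] out[of x] by (cases "f x = 0") (auto simp: elems_def)
  ultimately show ?thesis by simp
qed

lemma steinberg_restrict:
  assumes f: "f \<in> steinberg G" and C: "clopen_in G C"
  shows "(\<lambda>x. if x \<in> C then f x else 0) \<in> steinberg G"
proof (rule steinbergI)
  show "openin (gtop G) {x \<in> elems G. (if x \<in> C then f x else 0) = l}" for l
  proof -
    have "{x \<in> elems G. (if x \<in> C then f x else 0) = l} =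
      (C \<inter> {x \<in> elems G. f x = l}) \<union> (if l = 0 then topspace (gtop G) - C else {})"
      using openin_subset[of "gtop G" C] C by (auto simp: elems_def clopen_in_def)
    moreover have "openin (gtop G) (C \<inter> {x \<in> elems G. f x = l})" "openin (gtop G) (topspace (gtop G) - C)"
      using C steinberg_level[OF f] by (auto simp: clopen_in_def)
    ultimately show ?thesis by auto
  qed
  have "{x. (if x \<in> C then f x else 0) \<noteq> 0} = C \<inter> {x. f x \<noteq> 0}" by auto
  then show "compactin (gtop G) {x. (if x \<in> C then f x else 0) \<noteq> 0}"
    using closed_Int_compactin[OF _ steinberg_support(3)[OF f]] C by (simp add: clopen_in_def)
qed (use steinberg_outside[OF f] in auto)

text \<open>A bisection meets a fibre of the range map at most once. This is what makes the
  convolution sums finite.\<close>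

lemma finite_fibre:
  assumes "f \<in> steinberg G"
  shows "finite {y \<in> elems G. grng G y = u \<and> f y \<noteq> 0}"
  using assms
proof (induction rule: steinberg_induct)
  case (add B k g)
  have "finite {y \<in> B. grng G y = u}"
  proof (cases "\<exists>b\<in>B. grng G b = u")
    case True
    then obtain b where "b \<in> B" "grng G b = u" by auto
    then have "{y \<in> B. grng G y = u} \<subseteq> {b}" using add(1) by (auto simp: cob_iff dest: inj_onD)
    then show ?thesis by (rule finite_subset) simp
  qed (auto intro: finite_subset[of _ "{}"])
  then have "finite ({y \<in> B. grng G y = u} \<union> {y \<in> elems G. grng G y = u \<and> g y \<noteq> 0})" using add by simp
  then show ?case by (rule rev_finite_subset) (auto simp: indicator_def)
qed simp

section \<open>The convolution algebra\<close>

abbreviation "conv \<equiv> convolution G"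
abbreviation "ci \<equiv> (\<lambda>B k x. k * indicator B x)"

text \<open>A factorization x = y z is determined by y with r(y) = r(x). The index set
  \<open>T\<close> may exceed the support of \<open>f\<close>, so that one \<open>T\<close> can
  serve several functions in the proof of linearity.\<close>

lemma convolution_eq_sum:
  assumes x: "x \<in> elems G" and T: "finite T" "T \<subseteq> {y \<in> elems G. grng G y = grng G x}"
    and f: "\<And>y. \<lbrakk>y \<in> elems G; grng G y = grng G x; f y \<noteq> 0\<rbrakk> \<Longrightarrow> y \<in> T"
  shows "conv f g x = (\<Sum>y\<in>T. f y * g (gmul G (ginv G y) x))"
proof -
  let ?T = "{y \<in> T. f y \<noteq> 0 \<and> g (gmul G (ginv G y) x) \<noteq> 0}"
  have "(\<Sum>y\<in>T. f y * g (gmul G (ginv G y) x)) = (\<Sum>y\<in>?T. f y * g (gmul G (ginv G y) x))"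
    by (rule sum.mono_neutral_right) (use T in auto)
  also have "\<dots> = conv f g x"
    unfolding convolution_def
  proof (rule sum.reindex_bij_witness[of _ fst "\<lambda>y. (y, gmul G (ginv G y) x)"])
    fix y assume y: "y \<in> ?T"
    then have "y \<in> elems G" "grng G y = grng G x" using T by auto
    then show "(y, gmul G (ginv G y) x) \<in> {(y, z) \<in> composable G. gmul G y z = x \<and> f y \<noteq> 0 \<and> g z \<noteq> 0}"
      using y x by (simp add: composable_def gsimps mul_inv_cancel)
  next
    fix p assume "p \<in> {(y, z) \<in> composable G. gmul G y z = x \<and> f y \<noteq> 0 \<and> g z \<noteq> 0}"
    then obtain y z where p: "p = (y, z)" "y \<in> elems G" "z \<in> elems G" "gsrc G y = grng G z" "gmul G y z = x"
      "f y \<noteq> 0" "g z \<noteq> 0" by (auto simp: composable_def)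
    then have "grng G y = grng G x" "gmul G (ginv G y) x = z"
      using rng_mul'[of y z] inv_mul_cancel[of y z] by auto
    then show "(fst p, gmul G (ginv G (fst p)) x) = p" "fst p \<in> ?T" using p f by auto
  qed auto
  finally show ?thesis by simp
qed

lemma convolution_nonzero:
  assumes "conv f g x \<noteq> 0"
  shows "\<exists>y z. y \<in> elems G \<and> z \<in> elems G \<and> gsrc G y = grng G z \<and> x = gmul G y z \<and> f y \<noteq> 0 \<and> g z \<noteq> 0"
proof (rule ccontr)
  assume "\<not> ?thesis"
  then have "{(y, z) \<in> composable G. gmul G y z = x \<and> f y \<noteq> 0 \<and> g z \<noteq> 0} = {}"
    by (auto simp: composable_def)
  then show False using assms unfolding convolution_def by (metis sum.empty)
qed

lemma convolution_outside: "x \<notin> elems G \<Longrightarrow> conv f g x = 0"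
  using convolution_nonzero[of f g x] mul_elems by auto

lemma convolution_zero [simp]: "conv (\<lambda>x. 0) g = (\<lambda>x. 0)" "conv f (\<lambda>x. 0) = (\<lambda>x. 0)"
  by (simp_all add: convolution_def fun_eq_iff)

lemma convolution_lin_left:
  assumes "f \<in> steinberg G" "f' \<in> steinberg G"
  shows "conv (\<lambda>x. k * f x + f' x) g = (\<lambda>x. k * conv f g x + conv f' g x)"
proof
  fix x
  show "conv (\<lambda>x. k * f x + f' x) g x = k * conv f g x + conv f' g x"
  proof (cases "x \<in> elems G")
    case True
    let ?T = "{y \<in> elems G. grng G y = grng G x \<and> f y \<noteq> 0} \<union> {y \<in> elems G. grng G y = grng G x \<and> f' y \<noteq> 0}"
    have T: "finite ?T" "?T \<subseteq> {y \<in> elems G. grng G y = grng G x}" using assms finite_fibre by auto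
    show ?thesis
      by (subst (1 2 3) convolution_eq_sum[OF True T]) (auto simp: algebra_simps sum.distrib sum_distrib_left)
  qed (simp add: convolution_outside)
qed

lemma convolution_lin_right:
  assumes "f \<in> steinberg G"
  shows "conv f (\<lambda>x. k * g x + g' x) = (\<lambda>x. k * conv f g x + conv f g' x)"
proof
  fix x
  show "conv f (\<lambda>x. k * g x + g' x) x = k * conv f g x + conv f g' x"
  proof (cases "x \<in> elems G")
    case True
    let ?T = "{y \<in> elems G. grng G y = grng G x \<and> f y \<noteq> 0}"
    have T: "finite ?T" "?T \<subseteq> {y \<in> elems G. grng G y = grng G x}" using assms finite_fibre by auto
    show ?thesis
      by (subst (1 2 3) convolution_eq_sum[OF True T]) (auto simp: algebra_simps sum.distrib sum_distrib_left)
  qed (simp add: convolution_outside)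
qed

lemmas convolution_add_left = convolution_lin_left[where k=1, simplified]
  and convolution_add_right = convolution_lin_right[where k=1, simplified]

lemma convolution_scale:
  assumes "f \<in> steinberg G"
  shows "conv (\<lambda>x. k * f x) g = (\<lambda>x. k * conv f g x)"
    and "conv f (\<lambda>x. k * g x) = (\<lambda>x. k * conv f g x)"
  using convolution_lin_left[OF assms steinberg_zero, of k g]
    convolution_lin_right[OF assms, of k g "\<lambda>x. 0"] by simp_all

lemma cob_rng_eqD: "\<lbrakk>cob B; b \<in> B; b' \<in> B; grng G b = grng G b'\<rbrakk> \<Longrightarrow> b = b'"
  and cob_src_eqD: "\<lbrakk>cob B; b \<in> B; b' \<in> B; gsrc G b = gsrc G b'\<rbrakk> \<Longrightarrow> b = b'"
  by (auto simp: cob_iff dest: inj_onD)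

lemma convolution_ind_left:
  assumes B: "cob B" and x: "x \<in> elems G"
  shows "\<lbrakk>b \<in> B; grng G b = grng G x\<rbrakk> \<Longrightarrow> conv (ci B k) f x = k * f (gmul G (ginv G b) x)"
    and "grng G x \<notin> grng G ` B \<Longrightarrow> conv (ci B k) f x = 0"
proof -
  note Be = cob_elems[OF B]
  show "conv (ci B k) f x = k * f (gmul G (ginv G b) x)" if b: "b \<in> B" "grng G b = grng G x"
  proof -
    have "conv (ci B k) f x = (\<Sum>y\<in>{b}. ci B k y * f (gmul G (ginv G y) x))"
    proof (rule convolution_eq_sum[OF x])
      fix y assume "grng G y = grng G x" "ci B k y \<noteq> 0"
      then have "y = b" using b by - (rule cob_rng_eqD[OF B], auto simp: indicator_def split: if_splits)
      then show "y \<in> {b}" by simp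
    qed (use b Be in auto)
    then show ?thesis using b by simp
  qed
  show "conv (ci B k) f x = 0" if "grng G x \<notin> grng G ` B"
  proof -
    have "conv (ci B k) f x = (\<Sum>y\<in>{}. ci B k y * f (gmul G (ginv G y) x))"
    proof (rule convolution_eq_sum[OF x])
      fix y assume "grng G y = grng G x" "ci B k y \<noteq> 0"
      then have "y \<in> B" "grng G y = grng G x" by (auto simp: indicator_def split: if_splits)
      then show "y \<in> {}" using that by (metis imageI)
    qed auto
    then show ?thesis by simp
  qed
qed

text \<open>The second factor must be the one point of \<open>B\<close> with source s(x), so the sum
  has at most one term. It is computed on pairs, because \<open>convolution_eq_sum\<close> is
  indexed by the first factor and asks for finitely many of these.\<close>

lemma convolution_ind_right:
  assumes B: "cob B" and x: "x \<in> elems G"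
  shows "\<lbrakk>b \<in> B; gsrc G b = gsrc G x\<rbrakk> \<Longrightarrow> conv f (ci B k) x = f (gmul G x (ginv G b)) * k"
    and "gsrc G x \<notin> gsrc G ` B \<Longrightarrow> conv f (ci B k) x = 0"
proof -
  note Be = cob_elems[OF B]
  let ?S = "{(y, z) \<in> composable G. gmul G y z = x \<and> f y \<noteq> 0 \<and> ci B k z \<noteq> 0}"
  have S: "z \<in> B \<and> k \<noteq> 0 \<and> gsrc G z = gsrc G x \<and> y = gmul G x (ginv G z) \<and> f y \<noteq> 0" if "(y, z) \<in> ?S" for y z
    using that src_mul'[of y z] mul_inv_cancel_right[of y z]
    by (auto simp: composable_def indicator_def split: if_splits)
  show "conv f (ci B k) x = f (gmul G x (ginv G b)) * k" if b: "b \<in> B" "gsrc G b = gsrc G x"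
  proof (cases "k = 0 \<or> f (gmul G x (ginv G b)) = 0")
    case True
    have "?S = {}"
    proof (rule ccontr)
      assume "?S \<noteq> {}"
      then obtain y z where yz: "(y, z) \<in> ?S" by auto
      have "z = b" by (rule cob_src_eqD[OF B]) (use S[OF yz] b in simp_all)
      then show False using S[OF yz] True by auto
    qed
    then have "conv f (ci B k) x = 0" unfolding convolution_def by (simp only: sum.empty)
    then show ?thesis using True by auto
  next
    case False
    have "(gmul G x (ginv G b), b) \<in> ?S"
      using False b x Be inv_mul_cancel_right[of x b] by (auto simp: composable_def gsimps)
    moreover have "p = (gmul G x (ginv G b), b)" if "p \<in> ?S" for p
    proof -
      obtain y z where p: "p = (y, z)" by (cases p)
      have yz: "(y, z) \<in> ?S" using that unfolding p .
      have "z = b" by (rule cob_src_eqD[OF B]) (use S[OF yz] b in simp_all)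
      then show ?thesis using S[OF yz] p by simp
    qed
    ultimately have "?S = {(gmul G x (ginv G b), b)}" by blast
    then show ?thesis using b unfolding convolution_def by simp
  qed
  show "conv f (ci B k) x = 0" if "gsrc G x \<notin> gsrc G ` B"
  proof -
    have "?S = {}" using S that by (metis (no_types, lifting) image_eqI subrelI subset_empty)
    then show ?thesis unfolding convolution_def by (metis sum.empty)
  qed
qed

lemma convolution_ind_ind:
  assumes B: "cob B" and D: "cob D"
  shows "conv (ci B k) (ci D l) = ci (gset_mul G B D) (k * l)"
proof
  fix x
  note iff = gset_mul_iff_left[OF cob_elems[OF B] cob_elems[OF D]]
  show "conv (ci B k) (ci D l) x = ci (gset_mul G B D) (k * l) x"
  proof (cases "x \<in> elems G")
    case True
    show ?thesis
    proof (cases "grng G x \<in> grng G ` B")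
      case r: True
      then obtain b where b: "b \<in> B" "grng G b = grng G x" by auto
      have "b' = b" if "b' \<in> B" "grng G b' = grng G x" for b'
        using cob_rng_eqD[OF B that(1) b(1)] that(2) b(2) by simp
      then have "x \<in> gset_mul G B D \<longleftrightarrow> gmul G (ginv G b) x \<in> D"
        unfolding iff using b True by metis
      then have "k * (l * indicator D (gmul G (ginv G b) x)) = ci (gset_mul G B D) (k * l) x"
        by (simp add: indicator_def)
      then show ?thesis by (simp only: convolution_ind_left(1)[OF B True b])
    next
      case False
      then have "x \<notin> gset_mul G B D" unfolding iff by (metis imageI)
      then show ?thesis using convolution_ind_left(2)[OF B True False] by simp
    qed
  next
    case False
    then have "x \<notin> gset_mul G B D" unfolding iff by auto
    then show ?thesis using False by (simp add: convolution_outside)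
  qed
qed

lemma convolution_closed:
  assumes f: "f \<in> steinberg G" and g: "g \<in> steinberg G"
  shows "conv f g \<in> steinberg G"
proof -
  have 1: "conv (ci B k) g \<in> steinberg G" if B: "cob B" for B k
    using g
  proof (induction rule: steinberg_induct)
    case (add D l g)
    have "conv (ci B k) (\<lambda>x. ci D l x + g x) =
        (\<lambda>x. conv (ci B k) (ci D l) x + conv (ci B k) g x)"
      by (rule convolution_add_right[OF steinberg_ind[OF B]])
    then show ?case
      using steinberg_add[OF steinberg_ind[OF cob_mul[OF B add(1)]] add(3)]
      by (simp add: convolution_ind_ind[OF B add(1)])
  qed (simp add: steinberg_zero)
  show ?thesis
    using f
  proof (induction rule: steinberg_induct)
    case (add B k f)
    have "conv (\<lambda>x. ci B k x + f x) g =
        (\<lambda>x. conv (ci B k) g x + conv f g x)"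
      by (rule convolution_add_left[OF steinberg_ind[OF add(1)] add(2)])
    then show ?case using steinberg_add[OF 1[OF add(1)] add(3)] by simp
  qed (simp add: steinberg_zero)
qed

lemma gset_mul_assoc:
  assumes "X \<subseteq> elems G" "Y \<subseteq> elems G" "Z \<subseteq> elems G"
  shows "gset_mul G (gset_mul G X Y) Z = gset_mul G X (gset_mul G Y Z)"
proof (intro equalityI subsetI)
  fix w assume "w \<in> gset_mul G (gset_mul G X Y) Z"
  then obtain x y z where *: "x \<in> X" "y \<in> Y" "z \<in> Z" "gsrc G x = grng G y"
    "gsrc G (gmul G x y) = grng G z" "w = gmul G (gmul G x y) z" by (auto simp: gset_mul_def)
  then have e: "x \<in> elems G" "y \<in> elems G" "z \<in> elems G" using assms by auto
  have yz: "gsrc G y = grng G z" using * e by (simp add: gsimps)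
  then have "w = gmul G x (gmul G y z)" "gsrc G x = grng G (gmul G y z)"
    using * e by (simp_all add: mul_assoc' gsimps)
  then show "w \<in> gset_mul G X (gset_mul G Y Z)" using * yz unfolding gset_mul_def by blast
next
  fix w assume "w \<in> gset_mul G X (gset_mul G Y Z)"
  then obtain x y z where *: "x \<in> X" "y \<in> Y" "z \<in> Z" "gsrc G y = grng G z"
    "gsrc G x = grng G (gmul G y z)" "w = gmul G x (gmul G y z)" by (auto simp: gset_mul_def)
  then have e: "x \<in> elems G" "y \<in> elems G" "z \<in> elems G" using assms by auto
  have xy: "gsrc G x = grng G y" using * e by (simp add: gsimps)
  then have "w = gmul G (gmul G x y) z" "gsrc G (gmul G x y) = grng G z"
    using * e by (simp_all add: mul_assoc' gsimps)
  then show "w \<in> gset_mul G (gset_mul G X Y) Z" using * xy unfolding gset_mul_def by blast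
qed

text \<open>For multiples of indicators this is associativity of the product of sets; linearity
  extends it one argument at a time, starting with the last.\<close>

lemma convolution_assoc:
  assumes f: "f \<in> steinberg G" and g: "g \<in> steinberg G" and h: "h \<in> steinberg G"
  shows "conv (conv f g) h = conv f (conv g h)"
proof -
  have 1: "conv (conv (ci B k) (ci D l)) h = conv (ci B k) (conv (ci D l) h)"
    if B: "cob B" and D: "cob D" for B D k l
    using h
  proof (induction rule: steinberg_induct)
    case (add E m h)
    note s = steinberg_ind[OF B, of k] steinberg_ind[OF D, of l] steinberg_ind[OF add(1), of m]
    have "gset_mul G (gset_mul G B D) E = gset_mul G B (gset_mul G D E)"
      by (intro gset_mul_assoc cob_elems B D add(1))
    then have "conv (conv (ci B k) (ci D l)) (ci E m) =
        conv (ci B k) (conv (ci D l) (ci E m))"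
      by (simp only: convolution_ind_ind[OF B D] convolution_ind_ind[OF D add(1)]
        convolution_ind_ind[OF cob_mul[OF B D] add(1)] convolution_ind_ind[OF B cob_mul[OF D add(1)]])
        (simp only: mult.assoc)
    then show ?case
      using add(3) by (simp only: convolution_add_right[OF convolution_closed[OF s(1,2)]]
        convolution_add_right[OF s(1)] convolution_add_right[OF s(2)])
  qed simp
  have 2: "conv (conv (ci B k) g) h = conv (ci B k) (conv g h)"
    if B: "cob B" for B k
    using g
  proof (induction rule: steinberg_induct)
    case (add D l g)
    note s = steinberg_ind[OF B, of k] steinberg_ind[OF add(1), of l]
    show ?case
      using add(3) 1[OF B add(1), of k l]
      by (simp only: convolution_add_right[OF s(1)] convolution_add_left[OF s(2) add(2)]
        convolution_add_left[OF convolution_closed[OF s(1,2)] convolution_closed[OF s(1) add(2)]])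
  qed simp
  show ?thesis
    using f
  proof (induction rule: steinberg_induct)
    case (add B k f)
    note s = steinberg_ind[OF add(1), of k]
    show ?case
      using add(3) 2[OF add(1), of k]
      by (simp only: convolution_add_left[OF s add(2)]
        convolution_add_left[OF convolution_closed[OF s g] convolution_closed[OF add(2) g]])
  qed simp
qed

end

lemma function_rng_simps [simp]:
  "carrier (function_rng G S) = S" "f \<otimes>\<^bsub>function_rng G S\<^esub> g = convolution G f g"
  "f \<oplus>\<^bsub>function_rng G S\<^esub> g = (\<lambda>x. f x + g x)" "\<zero>\<^bsub>function_rng G S\<^esub> = (\<lambda>x. 0)"
  by (simp_all add: function_rng_def)

lemma sub_rng_function_rng: "sub_rng (function_rng G S) S' = function_rng G S'"
  by (simp add: sub_rng_def function_rng_def)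

lemma sub_bimodule_function_rng: "sub_bimodule (function_rng G S) (steinberg_on G H) = steinberg_bimodule G H"
  by (simp add: sub_bimodule_def function_rng_def steinberg_bimodule_def)

text \<open>The homogeneous components are thereby handled like any \<open>steinberg_on\<close>. The
  level set may contain points outside \<open>elems G\<close>, where Steinberg functions
  vanish.\<close>

lemma steinberg_deg_eq: "steinberg_deg G c n = steinberg_on G {x. c x = n}"
  by (auto simp: steinberg_deg_def steinberg_on_def)

context ample_Hausdorff_groupoid
begin

lemma steinberg_neg: "f \<in> steinberg G \<Longrightarrow> (\<lambda>x. - f x) \<in> steinberg G"
  using steinberg_scale[of f "- 1"] by simp

lemma steinberg_on_zero: "(\<lambda>x. 0) \<in> steinberg_on G H"
  and steinberg_on_add: "\<lbrakk>f \<in> steinberg_on G H; g \<in> steinberg_on G H\<rbrakk> \<Longrightarrow> (\<lambda>x. f x + g x) \<in> steinberg_on G H"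
  and steinberg_on_neg: "f \<in> steinberg_on G H \<Longrightarrow> (\<lambda>x. - f x) \<in> steinberg_on G H"
  by (auto simp: steinberg_on_def steinberg_zero steinberg_add steinberg_neg)

lemma steinberg_on_D: "f \<in> steinberg_on G H \<Longrightarrow> f \<in> steinberg G" "\<lbrakk>f \<in> steinberg_on G H; f x \<noteq> 0\<rbrakk> \<Longrightarrow> x \<in> H"
  by (auto simp: steinberg_on_def)

lemma steinberg_on_UNIV: "steinberg_on G UNIV = steinberg G"
  by (simp add: steinberg_on_def)

lemma steinberg_on_mono: "H \<subseteq> H' \<Longrightarrow> steinberg_on G H \<subseteq> steinberg_on G H'"
  by (auto simp: steinberg_on_def)

lemma abelian_group_function_rng: "abelian_group (function_rng G (steinberg_on G H))"
proof (rule abelian_groupI)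
  fix f assume "f \<in> carrier (function_rng G (steinberg_on G H))"
  then show "\<exists>g\<in>carrier (function_rng G (steinberg_on G H)).
      g \<oplus>\<^bsub>function_rng G (steinberg_on G H)\<^esub> f = \<zero>\<^bsub>function_rng G (steinberg_on G H)\<^esub>"
    by (intro bexI[of _ "\<lambda>x. - f x"]) (simp_all add: steinberg_on_neg)
qed (simp_all add: steinberg_on_zero steinberg_on_add ac_simps)

lemma rng_steinberg: "rng (function_rng G (steinberg G))"
proof (intro rng.intro rng_axioms.intro)
  show "abelian_group (function_rng G (steinberg G))"
    using abelian_group_function_rng[of UNIV] by (simp add: steinberg_on_UNIV)
qed (simp_all add: convolution_closed convolution_assoc convolution_add_left convolution_add_right)

lemma function_rng_minus:
  assumes "f \<in> steinberg_on G H"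
  shows "\<ominus>\<^bsub>function_rng G (steinberg_on G H)\<^esub> f = (\<lambda>x. - f x)"
proof -
  interpret abelian_group "function_rng G (steinberg_on G H)" by (rule abelian_group_function_rng)
  show ?thesis by (rule minus_equality) (use assms in \<open>simp_all add: steinberg_on_neg\<close>)
qed

lemma steinberg_a_minus:
  assumes "f \<in> steinberg G" "g \<in> steinberg G"
  shows "f \<ominus>\<^bsub>function_rng G (steinberg G)\<^esub> g = (\<lambda>x. f x - g x)"
  using function_rng_minus[of g UNIV] assms by (simp add: a_minus_def steinberg_on_UNIV)

lemma additive_subgroup_steinberg_on:
  assumes "H \<subseteq> H'"
  shows "additive_subgroup (steinberg_on G H) (function_rng G (steinberg_on G H'))"
proof -
  interpret abelian_group "function_rng G (steinberg_on G H')" by (rule abelian_group_function_rng)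
  show ?thesis
    using subsetD[OF steinberg_on_mono[OF assms]]
    by (intro additive_subgroupI)
      (auto simp: steinberg_on_zero steinberg_on_add steinberg_on_neg function_rng_minus)
qed

lemma additive_subgroup_steinberg: "additive_subgroup (steinberg_on G H) (function_rng G (steinberg G))"
  using additive_subgroup_steinberg_on[of H UNIV] by (simp add: steinberg_on_UNIV)

lemma convolution_on:
  assumes "f \<in> steinberg_on G X" "g \<in> steinberg_on G Y" "gset_mul G X Y \<subseteq> Z"
  shows "conv f g \<in> steinberg_on G Z"
proof -
  have "x \<in> Z" if nz: "conv f g x \<noteq> 0" for x
  proof -
    obtain y z where "gsrc G y = grng G z" "x = gmul G y z" "f y \<noteq> 0" "g z \<noteq> 0"
      using convolution_nonzero[OF nz] by auto
    then have "x \<in> gset_mul G X Y"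
      using steinberg_on_D(2)[OF assms(1)] steinberg_on_D(2)[OF assms(2)] unfolding gset_mul_def by blast
    then show ?thesis using assms(3) by auto
  qed
  then show ?thesis
    using assms(1,2) convolution_closed[of f g] by (auto simp: steinberg_on_def)
qed

section \<open>Subalgebras supported on clopen sets\<close>

lemma inv_unit: "u \<in> units G \<Longrightarrow> ginv G u = u"
  using inv_unique[of u u] rng_mul_left[of u] unitsD[of u] by simp

lemma steinberg_indicator: "cob B \<Longrightarrow> indicator B \<in> steinberg G"
  using steinberg_ind[of B 1] by simp

lemma steinberg_on_indicator: "\<lbrakk>cob B; B \<subseteq> H\<rbrakk> \<Longrightarrow> indicator B \<in> steinberg_on G H"
  by (auto simp: steinberg_on_def steinberg_indicator indicator_def)

text \<open>A set of units acts as a cut-off: the only unit composable with x on the left is r(x),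
  on the right s(x), and multiplying by it changes nothing.\<close>

lemma convolution_units:
  assumes V: "cob V" "V \<subseteq> units G" and f: "f \<in> steinberg G"
  shows "conv (indicator V) f = (\<lambda>x. if grng G x \<in> V then f x else 0)"
    and "conv f (indicator V) = (\<lambda>x. if gsrc G x \<in> V then f x else 0)"
proof -
  have im: "grng G ` V = V" "gsrc G ` V = V" using V(2) unitsD(2,3) by force+
  have "conv (indicator V) f x = (if grng G x \<in> V then f x else 0) \<and>
      conv f (indicator V) x = (if gsrc G x \<in> V then f x else 0)" for x
  proof (cases "x \<in> elems G")
    case True
    have u: "grng G x \<in> units G" "gsrc G x \<in> units G"
      using True by (simp_all add: rng_closed_units src_closed_units)
    have "conv (indicator V) f x = f x" if "grng G x \<in> V"
      using convolution_ind_left(1)[OF V(1) True that, of 1 f] True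
      by (simp add: rng_rng inv_unit u rng_mul_left)
    moreover have "conv (indicator V) f x = 0" if "grng G x \<notin> V"
      using convolution_ind_left(2)[OF V(1) True, of 1 f] that im by simp
    moreover have "conv f (indicator V) x = f x" if "gsrc G x \<in> V"
      using convolution_ind_right(1)[OF V(1) True that, of f 1] True
      by (simp add: src_src inv_unit u src_mul_right)
    moreover have "conv f (indicator V) x = 0" if "gsrc G x \<notin> V"
      using convolution_ind_right(2)[OF V(1) True, of f 1] that im by simp
    ultimately show ?thesis by simp
  next
    case False
    then show ?thesis using steinberg_outside[OF f False] by (simp add: convolution_outside)
  qed
  then show "conv (indicator V) f = (\<lambda>x. if grng G x \<in> V then f x else 0)"
    "conv f (indicator V) = (\<lambda>x. if gsrc G x \<in> V then f x else 0)" by auto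
qed

text \<open>Composability of b with the inverse of b' means s(b) = s(b'), hence b = b' on a
  bisection.\<close>

lemma gset_mul_inv:
  assumes B: "cob B"
  shows "gset_mul G B (ginv G ` B) = grng G ` B"
proof (intro equalityI subsetI)
  note Be = subsetD[OF cob_elems[OF B]]
  fix x assume "x \<in> gset_mul G B (ginv G ` B)"
  then obtain b b' where b: "b \<in> B" "b' \<in> B" "gsrc G b = grng G (ginv G b')" "x = gmul G b (ginv G b')"
    by (auto simp: gset_mul_def)
  then have "gsrc G b = gsrc G b'" using Be by (simp add: rng_inv)
  then have "b = b'" by (rule cob_src_eqD[OF B b(1,2)])
  then show "x \<in> grng G ` B" using b Be by (simp add: mul_inv)
next
  note Be = subsetD[OF cob_elems[OF B]]
  fix x assume "x \<in> grng G ` B"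
  then obtain b where "b \<in> B" "x = gmul G b (ginv G b)" "gsrc G b = grng G (ginv G b)"
    using Be by (auto simp: mul_inv rng_inv)
  then show "x \<in> gset_mul G B (ginv G ` B)" unfolding gset_mul_def by blast
qed

lemma convolution_indicator:
  "\<lbrakk>cob B; cob D\<rbrakk> \<Longrightarrow> conv (indicator B) (indicator D) = indicator (gset_mul G B D)"
  using convolution_ind_ind[of B D 1 1] by simp

text \<open>Choose h in \<open>H\<close> with r(h) = s(x) and a bisection around h inside
  \<open>H\<close>. The product of \<open>f\<close> with its indicator takes the value f(x) at the
  point x h.\<close>

lemma annihilated_vanishes:
  fixes f :: "'g \<Rightarrow> 'k::field"
  assumes f: "f \<in> steinberg G" and H: "openin (gtop G) H"
    and ann: "\<And>i. i \<in> steinberg_on G H \<Longrightarrow> conv f i = (\<lambda>x. 0)"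
    and x: "x \<in> elems G" "gsrc G x \<in> grng G ` H"
  shows "f x = 0"
proof -
  obtain h where h: "h \<in> H" "gsrc G x = grng G h" using x by auto
  then have he: "h \<in> elems G" using openin_subset[OF H] by (auto simp: elems_def)
  obtain B where B: "cob B" "h \<in> B" "B \<subseteq> H" using cob_open_subset[OF H h(1)] by auto
  have m: "gmul G x h \<in> elems G" using x h he by (simp add: gsimps)
  have "conv f (ci B 1) (gmul G x h) = f (gmul G (gmul G x h) (ginv G h)) * 1"
    by (rule convolution_ind_right(1)[OF B(1) m B(2)]) (use x h he in \<open>simp add: gsimps\<close>)
  also have "\<dots> = f x" using x h he by (simp add: mul_inv_cancel_right)
  finally show ?thesis using ann[OF steinberg_on_indicator[OF B(1,3)]] by simp
qed

text \<open>A union of bisections is not a bisection in general; on units both the range and the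
  source map are the identity, which gives injectivity.\<close>

lemma cob_Un_units: "\<lbrakk>cob V; cob W; V \<subseteq> units G; W \<subseteq> units G\<rbrakk> \<Longrightarrow> cob (V \<union> W)"
proof -
  assume VW: "cob V" "cob W" "V \<subseteq> units G" "W \<subseteq> units G"
  have "x \<in> V \<union> W \<Longrightarrow> grng G x = x \<and> gsrc G x = x" for x using VW(3,4) unitsD(2,3) by blast
  then have "inj_on (grng G) (V \<union> W)" "inj_on (gsrc G) (V \<union> W)" by (metis inj_onI)+
  then show ?thesis using VW(1,2) by (simp add: cob_iff compactin_Un openin_Un)
qed

text \<open>In the inductive step, a function \<open>f\<close> on \<open>B D\<close> with \<open>B\<close> a compact open bisection equals
  \<open>1\<^sub>B (1\<^bsub>B\<inverse>\<^esub> f)\<close>, and \<open>1\<^bsub>B\<inverse>\<^esub> f\<close> lives on \<open>D\<close>.\<close>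

lemma gproducts_local:
  fixes S :: "('g \<Rightarrow> 'k::field) set"
  assumes S: "\<And>f g. \<lbrakk>f \<in> S; g \<in> S\<rbrakk> \<Longrightarrow> conv f g \<in> S"
    and X: "\<And>x. x \<in> X \<Longrightarrow> \<exists>H. openin (gtop G) H \<and> x \<in> H \<and> steinberg_on G H \<subseteq> S"
    and x: "x \<in> gproducts G X"
  shows "\<exists>D. openin (gtop G) D \<and> x \<in> D \<and> steinberg_on G D \<subseteq> S"
  using x
proof (induction rule: gproducts.induct)
  case (mul x y)
  obtain H where H: "openin (gtop G) H" "x \<in> H" "steinberg_on G H \<subseteq> S" using X[OF mul(1)] by auto
  obtain B where B: "cob B" "x \<in> B" "B \<subseteq> H" using cob_open_subset[OF H(1,2)] by auto
  obtain D where D: "openin (gtop G) D" "y \<in> D" "steinberg_on G D \<subseteq> S" using mul.IH by auto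
  note Be = subsetD[OF cob_elems[OF B(1)]]
  have De: "d \<in> elems G" if "d \<in> D" for d using openin_subset[OF D(1)] that by (auto simp: elems_def)
  have inv: "cob (ginv G ` B)" by (rule cob_inv[OF B(1)])
  have iB: "indicator B \<in> S" using H(3) steinberg_on_indicator[OF B(1,3)] by auto
  have "f \<in> S" if f: "f \<in> steinberg_on G (gset_mul G B D)" for f
  proof -
    let ?g = "conv (indicator (ginv G ` B)) f"
    note fs = steinberg_on_D(1)[OF f]
    have "gset_mul G (ginv G ` B) (gset_mul G B D) \<subseteq> D"
    proof
      fix z assume "z \<in> gset_mul G (ginv G ` B) (gset_mul G B D)"
      then obtain b b' d where z: "b \<in> B" "b' \<in> B" "d \<in> D" "gsrc G b' = grng G d"
        "gsrc G (ginv G b) = grng G (gmul G b' d)" "z = gmul G (ginv G b) (gmul G b' d)"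
        unfolding gset_mul_def by auto
      then have "grng G b = grng G b'" using Be De by (simp add: gsimps)
      then have "b = b'" by (rule cob_rng_eqD[OF B(1) z(1,2)])
      then show "z \<in> D" using z Be De by (simp add: inv_mul_cancel)
    qed
    then have "?g \<in> steinberg_on G D"
      by (intro convolution_on[OF steinberg_on_indicator[OF inv subset_refl] f])
    then have "?g \<in> S" using D(3) by auto
    then have "conv (indicator B) ?g \<in> S" by (rule S[OF iB])
    moreover have "conv (indicator B) ?g = f"
    proof -
      have "conv (indicator B) ?g = conv (indicator (grng G ` B)) f"
        using convolution_assoc[OF steinberg_indicator[OF B(1)] steinberg_indicator[OF inv] fs]
        by (simp add: convolution_indicator[OF B(1) inv] gset_mul_inv[OF B(1)])
      also have "\<dots> = (\<lambda>x. if grng G x \<in> grng G ` B then f x else 0)"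
        by (rule convolution_units(1)[OF cob_range[OF B(1)] _ fs]) (use Be rng_closed_units in auto)
      also have "\<dots> = f"
      proof
        fix z
        have "grng G z \<in> grng G ` B" if nz: "f z \<noteq> 0"
        proof -
          obtain b d where "b \<in> B" "d \<in> D" "gsrc G b = grng G d" "z = gmul G b d"
            using steinberg_on_D(2)[OF f nz] by (auto simp: gset_mul_def)
          then show ?thesis using Be De by (simp add: gsimps)
        qed
        then show "(if grng G z \<in> grng G ` B then f z else 0) = f z" by auto
      qed
      finally show ?thesis .
    qed
    ultimately show "f \<in> S" by simp
  qed
  moreover have "openin (gtop G) (gset_mul G B D)"
    using B(1) D(1) by (intro openin_gset_mul) (simp_all add: compact_open_bisection_def)
  moreover have "gmul G x y \<in> gset_mul G B D"
    using B(2) D(2) mul(3) unfolding gset_mul_def by blast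
  ultimately show ?case by blast
qed (use X in blast)

text \<open>The compact support is covered by finitely many bisections whose functions lie in
  \<open>S\<close>. Split \<open>f\<close> into its restrictions to one of them and to the
  complement; the second part is covered by the rest.\<close>

lemma steinberg_subset_of_local:
  fixes S :: "('g \<Rightarrow> 'k::field) set"
  assumes S: "(\<lambda>x. 0) \<in> S" "\<And>f g. \<lbrakk>f \<in> S; g \<in> S\<rbrakk> \<Longrightarrow> (\<lambda>x. f x + g x) \<in> S"
    and loc: "\<And>x. x \<in> elems G \<Longrightarrow> \<exists>D. openin (gtop G) D \<and> x \<in> D \<and> steinberg_on G D \<subseteq> S"
  shows "steinberg G \<subseteq> S"
proof
  fix f :: "'g \<Rightarrow> 'k" assume f: "f \<in> steinberg G"
  let ?U = "{B. cob B \<and> steinberg_on G B \<subseteq> S}"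
  have cov: "{x. f x \<noteq> 0} \<subseteq> \<Union>?U"
  proof
    fix x assume "x \<in> {x. f x \<noteq> 0}"
    then have "x \<in> elems G" using steinberg_outside[OF f] by auto
    then obtain D where D: "openin (gtop G) D" "x \<in> D" "steinberg_on G D \<subseteq> S" using loc by blast
    obtain B where B: "cob B" "x \<in> B" "B \<subseteq> D" using cob_open_subset[OF D(1,2)] by auto
    have "steinberg_on G B \<subseteq> S" using D(3) steinberg_on_mono[OF B(3)] by blast
    then show "x \<in> \<Union>?U" using B by auto
  qed
  obtain F where F: "finite F" "F \<subseteq> ?U" "{x. f x \<noteq> 0} \<subseteq> \<Union>F"
    using compactinD[OF steinberg_support(3)[OF f] _ cov] by (auto simp: cob_iff)
  from F f show "f \<in> S"
  proof (induction F arbitrary: f)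
    case empty
    then have "f = (\<lambda>x. 0)" by auto
    then show ?case using S(1) by simp
  next
    case (insert B F)
    have B: "cob B" "steinberg_on G B \<subseteq> S" using insert.prems by auto
    have cl: "clopen_in G B" using B(1) compactin_closedin by (simp add: clopen_in_def cob_iff)
    then have cl': "clopen_in G (topspace (gtop G) - B)"
      by (auto simp: clopen_in_def openin_diff closedin_diff)
    let ?f1 = "\<lambda>x. if x \<in> B then f x else 0"
    let ?f2 = "\<lambda>x. if x \<in> topspace (gtop G) - B then f x else 0"
    have "?f1 \<in> S"
      using B(2) steinberg_restrict[OF insert.prems(3) cl] by (auto simp: steinberg_on_def)
    moreover have "?f2 \<in> S"
    proof (rule insert.IH)
      show "{x. ?f2 x \<noteq> 0} \<subseteq> \<Union>F" using insert.prems(2) by auto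
    qed (use insert.prems(1) steinberg_restrict[OF insert.prems(3) cl'] in auto)
    ultimately have "(\<lambda>x. ?f1 x + ?f2 x) \<in> S" by (rule S(2))
    moreover have "?f1 x + ?f2 x = f x" for x
      using steinberg_outside[OF insert.prems(3), of x] by (auto simp: elems_def)
    ultimately show ?case by simp
  qed
qed

end

text \<open>Kept apart from \<open>multiplicative_triple\<close>, since parts (ii) and (iii) are
  claimed without the hypotheses of (i).\<close>

locale clopen_triple = ample_Hausdorff_groupoid G for G :: "'g top_groupoid" +
  fixes H0 H1 Hm :: "'g set"
  assumes clopen: "clopen_in G H0" "clopen_in G H1" "clopen_in G Hm"
begin

lemma H_elems: "H0 \<subseteq> elems G" "H1 \<subseteq> elems G" "Hm \<subseteq> elems G"
  and H_open: "openin (gtop G) H0" "openin (gtop G) H1" "openin (gtop G) Hm"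
  using clopen openin_subset by (auto simp: clopen_in_def elems_def)

text \<open>If f(x) is nonzero, a bisection \<open>B\<close> around x inside the support has s(B)
  disjoint from r(H1) by \<open>annihilated_vanishes\<close>, so (ii) puts s(B) into H0. The
  indicator of s(B) then annihilates \<open>I\<close>, so its product with \<open>f\<close> is zero;
  but that product takes the value f(x) at x.\<close>

lemma ann_perp_trivial:
  fixes A :: "('g \<Rightarrow> 'k::field) ring"
  defines "A \<equiv> function_rng G (steinberg G)"
  assumes ii: "\<And>B. \<lbrakk>cob B; B \<subseteq> H0; gsrc G ` B \<inter> grng G ` H1 = {}\<rbrakk> \<Longrightarrow> gsrc G ` B \<subseteq> H0"
  shows "left_ann A (steinberg_on G H0) (steinberg_on G H1) \<inter>
    left_ann_perp A (steinberg_on G H0) (steinberg_on G H1) = {\<zero>\<^bsub>A\<^esub>}"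
proof (intro equalityI subsetI)
  fix f assume "f \<in> left_ann A (steinberg_on G H0) (steinberg_on G H1) \<inter>
    left_ann_perp A (steinberg_on G H0) (steinberg_on G H1)"
  then have f: "f \<in> steinberg_on G H0" and ann: "\<And>i. i \<in> steinberg_on G H1 \<Longrightarrow> conv f i = (\<lambda>x. 0)"
    and perp: "\<And>y. y \<in> left_ann A (steinberg_on G H0) (steinberg_on G H1) \<Longrightarrow> conv f y = (\<lambda>x. 0)"
    by (auto simp: left_ann_def left_ann_perp_def A_def)
  note fs = steinberg_on_D(1)[OF f]
  have "f x = 0" for x
  proof (rule ccontr)
    assume x: "f x \<noteq> 0"
    obtain B where B: "cob B" "x \<in> B" "B \<subseteq> {x. f x \<noteq> 0}"
      using cob_open_subset[OF steinberg_support(1)[OF fs], of x] x by auto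
    note Be = cob_elems[OF B(1)]
    have BH: "B \<subseteq> H0" using B(3) steinberg_on_D(2)[OF f] by auto
    have disj: "gsrc G ` B \<inter> grng G ` H1 = {}"
      using annihilated_vanishes[OF fs H_open(2) ann] B(3) Be by (auto simp: subset_iff)
    let ?V = "gsrc G ` B"
    have V: "cob ?V" "?V \<subseteq> units G" using cob_source[OF B(1)] Be src_closed_units by auto
    have "indicator ?V \<in> left_ann A (steinberg_on G H0) (steinberg_on G H1)"
      unfolding left_ann_def A_def
    proof (intro CollectI conjI ballI)
      show "indicator ?V \<in> steinberg_on G H0" by (rule steinberg_on_indicator[OF V(1) ii[OF B(1) BH disj]])
      fix i :: "'g \<Rightarrow> 'k" assume i: "i \<in> steinberg_on G H1"
      have "(if grng G y \<in> ?V then i y else 0) = 0" for y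
        using disj steinberg_on_D(2)[OF i, of y] by auto
      then show "indicator ?V \<otimes>\<^bsub>function_rng G (steinberg G)\<^esub> i = \<zero>\<^bsub>function_rng G (steinberg G)\<^esub>"
        using convolution_units(1)[OF V steinberg_on_D(1)[OF i]] by simp
    qed
    from perp[OF this] have "(if gsrc G x \<in> ?V then f x else 0) = 0"
      unfolding convolution_units(2)[OF V fs] by (rule fun_cong)
    then show False using x B(2) by auto
  qed
  then show "f \<in> {\<zero>\<^bsub>A\<^esub>}" by (auto simp: A_def)
qed (auto simp: left_ann_def left_ann_perp_def A_def steinberg_on_zero)

text \<open>By \<open>gproducts_local\<close> a subring containing the three pieces contains all
  functions supported near a given point, and compactness of supports does the rest.\<close>

lemma steinberg_generated:
  fixes A :: "('g \<Rightarrow> 'k::field) ring"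
  defines "A \<equiv> function_rng G (steinberg G)"
  assumes iii: "elems G \<subseteq> gproducts G (H0 \<union> H1 \<union> Hm)"
  shows "subrng_generated A (steinberg_on G H0 \<union> steinberg_on G H1 \<union> steinberg_on G Hm) = carrier A"
    (is "subrng_generated A ?X = _")
proof
  interpret A: rng A unfolding A_def by (rule rng_steinberg)
  have "?X \<subseteq> carrier A" by (auto simp: A_def steinberg_on_def)
  then show "subrng_generated A ?X \<subseteq> carrier A" using A.subrng_carrier by (auto simp: subrng_generated_def)
  have "steinberg G \<subseteq> S" if S: "subrng S A" "?X \<subseteq> S" for S
  proof (rule steinberg_subset_of_local)
    have sub: "additive_subgroup S A" and mult: "\<And>f g. \<lbrakk>f \<in> S; g \<in> S\<rbrakk> \<Longrightarrow> conv f g \<in> S"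
      using S by (auto simp: subrng_def A_def)
    show "(\<lambda>x. 0) \<in> S" using A.additive_subgroupD(3)[OF sub] by (simp add: A_def)
    show "(\<lambda>x. f x + g x) \<in> S" if "f \<in> S" "g \<in> S" for f g
      using A.additive_subgroupD(4)[OF sub that] by (simp add: A_def)
    show "\<exists>D. openin (gtop G) D \<and> x \<in> D \<and> steinberg_on G D \<subseteq> S" if "x \<in> elems G" for x
    proof (rule gproducts_local[OF mult])
      show "x \<in> gproducts G (H0 \<union> H1 \<union> Hm)" using iii that by auto
      show "\<exists>H. openin (gtop G) H \<and> x \<in> H \<and> steinberg_on G H \<subseteq> S" if "x \<in> H0 \<union> H1 \<union> Hm" for x
        using that H_open S(2) by auto
    qed
  qed
  then show "carrier A \<subseteq> subrng_generated A ?X" by (auto simp: subrng_generated_def A_def)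
qed

end

section \<open>Bimodule conditions, local units and condition (3)\<close>

locale multiplicative_triple = clopen_triple G H0 H1 Hm
  for G :: "'g top_groupoid" and H0 H1 Hm :: "'g set" +
  assumes H0_H0: "gset_mul G H0 H0 \<subseteq> H0"
    and H0_H1: "gset_mul G H0 H1 \<subseteq> H1" and H1_H0: "gset_mul G H1 H0 \<subseteq> H1"
    and H0_Hm: "gset_mul G H0 Hm \<subseteq> Hm" and Hm_H0: "gset_mul G Hm H0 \<subseteq> Hm"
    and Hm_H1: "gset_mul G Hm H1 \<subseteq> H0"
    and rng_H1: "grng G ` H1 \<subseteq> gset_mul G H1 Hm" and src_Hm: "gsrc G ` Hm \<subseteq> gset_mul G H1 Hm"
begin

text \<open>The set H' is left open because the subring is wanted both inside the component of
  degree zero, with H' a level set of the cocycle, and inside the whole Steinberg algebra.\<close>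

lemma subrng_H0:
  assumes "H0 \<subseteq> H'"
  shows "subrng (steinberg_on G H0) (function_rng G (steinberg_on G H'))"
  by (simp add: subrng_def additive_subgroup_steinberg_on[OF assms] convolution_on[OF _ _ H0_H0])

lemma rng_triple:
  "rng_triple (function_rng G (steinberg G)) (steinberg_on G H0) (steinberg_on G H1) (steinberg_on G Hm)"
proof (intro rng_triple.intro rng_triple_axioms.intro rng_steinberg additive_subgroup_steinberg)
  show "subrng (steinberg_on G H0) (function_rng G (steinberg G))"
    using subrng_H0[of UNIV] by (simp add: steinberg_on_UNIV)
qed (auto intro: convolution_on[OF _ _ H0_H1] convolution_on[OF _ _ H1_H0] convolution_on[OF _ _ H0_Hm]
      convolution_on[OF _ _ Hm_H0] convolution_on[OF _ _ Hm_H1])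

text \<open>If the unit u is h k, then k is the inverse of h. Continuity of inversion gives a
  bisection \<open>B\<close> around h in H1 whose inverse lies in Hm, and the product of the two
  indicators is the indicator of r(B).\<close>

lemma unit_neighbourhood:
  fixes A :: "('g \<Rightarrow> 'k::field) ring"
  defines "A \<equiv> function_rng G (steinberg G)"
  assumes u: "u \<in> gset_mul G H1 Hm" "u \<in> units G"
  shows "\<exists>V. u \<in> V \<and> cob V \<and> V \<subseteq> units G \<and>
    indicator V \<in> set_times A (steinberg_on G H1) (steinberg_on G Hm)"
proof -
  obtain h k where hk: "h \<in> H1" "k \<in> Hm" "gsrc G h = grng G k" "u = gmul G h k"
    using u(1) by (auto simp: gset_mul_def)
  then have e: "h \<in> elems G" "k \<in> elems G" using H_elems by auto
  have k: "k = ginv G h" using inv_unique[OF e hk(3)] u(2) hk(4) by simp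
  have "openin (gtop G) (H1 \<inter> {x \<in> topspace (gtop G). ginv G x \<in> Hm})"
    by (intro openin_Int H_open openin_continuous_map_preimage[OF continuous_inv])
  moreover have "h \<in> H1 \<inter> {x \<in> topspace (gtop G). ginv G x \<in> Hm}" using hk k e by (simp add: elems_def)
  ultimately obtain B where B: "cob B" "h \<in> B" "B \<subseteq> H1 \<inter> {x \<in> topspace (gtop G). ginv G x \<in> Hm}"
    using cob_open_subset by blast
  have "indicator B \<in> steinberg_on G H1" "indicator (ginv G ` B) \<in> steinberg_on G Hm"
    using B by (auto intro!: steinberg_on_indicator cob_inv)
  from set_times_prod[OF this, of A]
  have "indicator (grng G ` B) \<in> set_times A (steinberg_on G H1) (steinberg_on G Hm)"
    using B(1) cob_inv[OF B(1)] by (simp add: A_def convolution_indicator gset_mul_inv)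
  moreover have "u = grng G h" using hk e k by (simp add: mul_inv)
  ultimately show ?thesis
    using B cob_range[OF B(1)] rng_closed_units cob_elems[OF B(1)]
    by (intro exI[of _ "grng G ` B"]) auto
qed

lemma unit_cover:
  fixes A :: "('g \<Rightarrow> 'k::field) ring"
  defines "A \<equiv> function_rng G (steinberg G)"
  assumes K: "compactin (gtop G) K" "K \<subseteq> gset_mul G H1 Hm" "K \<subseteq> units G"
  shows "\<exists>V. K \<subseteq> V \<and> cob V \<and> V \<subseteq> units G \<and>
    indicator V \<in> set_times A (steinberg_on G H1) (steinberg_on G Hm)"
proof -
  interpret rng_triple A "steinberg_on G H0" "steinberg_on G H1" "steinberg_on G Hm"
    unfolding A_def by (rule rng_triple)
  let ?P = "\<lambda>V. cob V \<and> V \<subseteq> units G \<and> (indicator V :: 'g \<Rightarrow> 'k) \<in> IJ"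
  have Un: "?P (V \<union> W)" if VW: "?P V" "?P W" for V W
  proof -
    let ?v = "indicator V :: 'g \<Rightarrow> 'k" and ?w = "indicator W :: 'g \<Rightarrow> 'k"
    have s: "?v \<in> steinberg G" "?w \<in> steinberg G" using VW steinberg_indicator by auto
    \<comment> \<open>Inclusion-exclusion: on units the convolution of two indicators is the
      indicator of the intersection, and IJ is closed under products.\<close>
    have "(?v \<oplus>\<^bsub>A\<^esub> ?w) \<ominus>\<^bsub>A\<^esub> (?v \<otimes>\<^bsub>A\<^esub> ?w) \<in> IJ"
      using VW additive_subgroupD[OF IJ_sub] IJ_IJ by auto
    also have "(?v \<oplus>\<^bsub>A\<^esub> ?w) \<ominus>\<^bsub>A\<^esub> (?v \<otimes>\<^bsub>A\<^esub> ?w) = (\<lambda>x. (?v x + ?w x) - conv ?v ?w x)"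
      unfolding A_def using steinberg_a_minus[OF steinberg_add[OF s] convolution_closed[OF s]] by simp
    also have "\<dots> = indicator (V \<union> W)"
    proof
      fix x
      have "grng G x = x" if "x \<in> W" using that VW unitsD(2)[of x] by auto
      then show "(?v x + ?w x) - conv ?v ?w x = indicator (V \<union> W) x"
        using VW convolution_units(1)[of V ?w] s(2) by (auto simp: indicator_def)
    qed
    finally show ?thesis using VW cob_Un_units[of V W] by auto
  qed
  let ?U = "{V. ?P V}"
  have cov: "K \<subseteq> \<Union>?U"
  proof
    fix u assume u: "u \<in> K"
    obtain V where "u \<in> V" "?P V"
      using unit_neighbourhood[of u, where 'k='k] u K(2,3) unfolding A_def by blast
    then show "u \<in> \<Union>?U" by auto
  qed
  obtain F where F: "finite F" "F \<subseteq> ?U" "K \<subseteq> \<Union>F"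
    using compactinD[OF K(1) _ cov] by (auto simp: cob_iff)
  have "?P (\<Union>F)"
    using F(1,2)
  proof (induction F)
    case empty
    have "cob {}" by (simp add: cob_iff)
    moreover have "(indicator {} :: 'g \<Rightarrow> 'k) = \<zero>\<^bsub>A\<^esub>" by (simp add: A_def fun_eq_iff)
    ultimately show ?case using additive_subgroupD(3)[OF IJ_sub] by simp
  next
    case (insert V F)
    then show ?case using Un[of V "\<Union>F"] by simp
  qed
  with F(3) show ?thesis by (intro exI[of _ "\<Union>F"] conjI) simp_all
qed

text \<open>The map \<open>p\<close> is the range for left units on \<open>I\<close> and the source
  for right units on \<open>J\<close>. The units to be covered are the images of finitely many
  compact supports.\<close>

lemma unit_on_supports:
  fixes A :: "('g \<Rightarrow> 'k::field) ring"
  defines "A \<equiv> function_rng G (steinberg G)"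
  assumes X: "finite X" "X \<subseteq> steinberg_on G H" and H: "H \<subseteq> elems G"
    and p: "p \<in> {grng G, gsrc G}" "p ` H \<subseteq> gset_mul G H1 Hm"
  shows "\<exists>V. (\<forall>f\<in>X. f \<in> steinberg G \<and> (\<forall>x. f x \<noteq> 0 \<longrightarrow> p x \<in> V)) \<and> cob V \<and> V \<subseteq> units G \<and>
    indicator V \<in> set_times A (steinberg_on G H1) (steinberg_on G Hm)"
proof -
  let ?K = "\<Union>f\<in>X. p ` {x. f x \<noteq> 0}"
  have pc: "continuous_map (gtop G) (gtop G) p" using p(1) continuous_rng continuous_src by auto
  have XH: "x \<in> H" if "f \<in> X" "f x \<noteq> 0" for f x using X(2) that steinberg_on_D(2) by blast
  have s: "f \<in> steinberg G" if "f \<in> X" for f using X(2) that steinberg_on_D(1) by blast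
  have "compactin (gtop G) ?K"
    using X(1) s steinberg_support(3) by (intro compactin_Union) (auto intro!: image_compactin[OF _ pc])
  moreover have "?K \<subseteq> gset_mul G H1 Hm" using XH p(2) by blast
  moreover have "?K \<subseteq> units G"
    using p(1) rng_closed_units[OF subsetD[OF H XH]] src_closed_units[OF subsetD[OF H XH]] by auto
  ultimately have "\<exists>V. ?K \<subseteq> V \<and> cob V \<and> V \<subseteq> units G \<and>
      indicator V \<in> set_times A (steinberg_on G H1) (steinberg_on G Hm)"
    unfolding A_def by (rule unit_cover)
  then obtain V where "?K \<subseteq> V" "cob V" "V \<subseteq> units G"
      "indicator V \<in> set_times A (steinberg_on G H1) (steinberg_on G Hm)"
    by (elim exE conjE)
  then show ?thesis using s by (intro exI[of _ V]) auto
qed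

lemma local_units:
  fixes A :: "('g \<Rightarrow> 'k::field) ring"
  defines "A \<equiv> function_rng G (steinberg G)"
  defines "IJ \<equiv> set_times A (steinberg_on G H1) (steinberg_on G Hm)"
  shows "\<lbrakk>finite X; X \<subseteq> steinberg_on G H1\<rbrakk> \<Longrightarrow> \<exists>a\<in>IJ. \<forall>i\<in>X. a \<otimes>\<^bsub>A\<^esub> i = i"
    and "\<lbrakk>finite X; X \<subseteq> steinberg_on G Hm\<rbrakk> \<Longrightarrow> \<exists>b\<in>IJ. \<forall>j\<in>X. j \<otimes>\<^bsub>A\<^esub> b = j"
proof -
  have id: "(if P then x else 0) = x" if "x \<noteq> 0 \<longrightarrow> P" for P and x :: 'k using that by auto
  show "\<exists>a\<in>IJ. \<forall>i\<in>X. a \<otimes>\<^bsub>A\<^esub> i = i" if X: "finite X" "X \<subseteq> steinberg_on G H1"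
  proof -
    obtain V where V: "\<forall>f\<in>X. f \<in> steinberg G \<and> (\<forall>x. f x \<noteq> 0 \<longrightarrow> grng G x \<in> V)" "cob V" "V \<subseteq> units G"
      "indicator V \<in> IJ"
      unfolding IJ_def A_def using unit_on_supports[OF X H_elems(2) insertI1 rng_H1] by (elim exE conjE)
    then show ?thesis
      by (intro bexI[OF _ V(4)] ballI) (simp add: A_def convolution_units(1) id)
  qed
  show "\<exists>b\<in>IJ. \<forall>j\<in>X. j \<otimes>\<^bsub>A\<^esub> b = j" if X: "finite X" "X \<subseteq> steinberg_on G Hm"
  proof -
    obtain V where V: "\<forall>f\<in>X. f \<in> steinberg G \<and> (\<forall>x. f x \<noteq> 0 \<longrightarrow> gsrc G x \<in> V)" "cob V" "V \<subseteq> units G"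
      "indicator V \<in> IJ"
      unfolding IJ_def A_def using unit_on_supports[OF X H_elems(3) insertI2[OF singletonI] src_Hm]
      by (elim exE conjE)
    then show ?thesis
      by (intro bexI[OF _ V(4)] ballI) (simp add: A_def convolution_units(2) id)
  qed
qed

lemma IJ_support:
  fixes A :: "('g \<Rightarrow> 'k::field) ring"
  defines "A \<equiv> function_rng G (steinberg G)"
  shows "set_times A (steinberg_on G H1) (steinberg_on G Hm) \<subseteq> steinberg_on G (gset_mul G H1 Hm)"
proof -
  interpret A: rng A unfolding A_def by (rule rng_steinberg)
  show ?thesis
  proof (rule A.set_times_subset)
    show "x \<otimes>\<^bsub>A\<^esub> y \<in> steinberg_on G (gset_mul G H1 Hm)"
      if "x \<in> steinberg_on G H1" "y \<in> steinberg_on G Hm" for x y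
      using convolution_on[OF that subset_refl] by (simp add: A_def)
    show "steinberg_on G Hm \<subseteq> carrier A" by (auto simp: A_def steinberg_on_def)
  qed (simp_all add: A_def additive_subgroup_steinberg)
qed

text \<open>Where a(x) is nonzero, x = h k, and the source of x is that of k, which lies in H1 Hm
  and hence in the range of H1. There the function r - a vanishes by
  \<open>annihilated_vanishes\<close>, so r is nonzero at x and x lies in H0.\<close>

lemma IJ_in_R:
  fixes A :: "('g \<Rightarrow> 'k::field) ring"
  defines "A \<equiv> function_rng G (steinberg G)"
  assumes r: "r \<in> steinberg_on G H0" and a: "a \<in> set_times A (steinberg_on G H1) (steinberg_on G Hm)"
    and ann: "\<And>i. i \<in> steinberg_on G H1 \<Longrightarrow> (r \<ominus>\<^bsub>A\<^esub> a) \<otimes>\<^bsub>A\<^esub> i = \<zero>\<^bsub>A\<^esub>"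
  shows "a \<in> steinberg_on G H0"
proof -
  have a': "a \<in> steinberg_on G (gset_mul G H1 Hm)"
    using a IJ_support[where 'k='k] unfolding A_def by blast
  note s = steinberg_on_D(1)[OF r] steinberg_on_D(1)[OF a']
  have ra: "r \<ominus>\<^bsub>A\<^esub> a = (\<lambda>x. r x - a x)" unfolding A_def by (rule steinberg_a_minus[OF s])
  have ras: "(\<lambda>x. r x - a x) \<in> steinberg G"
    using steinberg_add[OF s(1) steinberg_neg[OF s(2)]] by simp
  have "x \<in> H0" if ax: "a x \<noteq> 0" for x
  proof -
    obtain h k where hk: "h \<in> H1" "k \<in> Hm" "gsrc G h = grng G k" "x = gmul G h k"
      using steinberg_on_D(2)[OF a' ax] by (auto simp: gset_mul_def)
    have e: "h \<in> elems G" "k \<in> elems G" using hk H_elems by auto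
    have "gsrc G k \<in> gset_mul G H1 Hm" using src_Hm hk by auto
    then obtain h' k' where hk': "h' \<in> H1" "k' \<in> Hm" "gsrc G h' = grng G k'" "gsrc G k = gmul G h' k'"
      by (auto simp: gset_mul_def)
    have e': "h' \<in> elems G" "k' \<in> elems G" using hk' H_elems by auto
    \<comment> \<open>The source of k is a unit, so it is its own range, and this is the range of
      its first factor h'.\<close>
    have "grng G (gsrc G k) = grng G h'" using hk' e' by (simp add: gsimps)
    then have "gsrc G x = grng G h'" using hk e by (simp add: gsimps)
    then have "gsrc G x \<in> grng G ` H1" using hk'(1) by simp
    moreover have "x \<in> elems G" using hk e by (simp add: gsimps)
    ultimately have "r x - a x = 0"
      using annihilated_vanishes[OF ras H_open(2)] ann unfolding ra by (simp add: A_def)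
    then show ?thesis using ax steinberg_on_D(2)[OF r, of x] by auto
  qed
  then show ?thesis using s(2) by (auto simp: steinberg_on_def)
qed

end

section \<open>The Cuntz--Pimsner model\<close>

definition degree_part :: "('g \<Rightarrow> int) \<Rightarrow> int \<Rightarrow> ('g \<Rightarrow> 'k::field) \<Rightarrow> 'g \<Rightarrow> 'k" where
  "degree_part c n f = (\<lambda>x. if c x = n then f x else 0)"

lemma degree_part_fixed: "degree_part c n f = f \<longleftrightarrow> (\<forall>x. f x \<noteq> 0 \<longrightarrow> c x = n)"
  unfolding degree_part_def fun_eq_iff by auto

lemma steinberg_deg_fixed: "steinberg_deg G c n = {f \<in> steinberg G. degree_part c n f = f}"
  by (simp add: steinberg_deg_def degree_part_fixed)

context ample_Hausdorff_groupoid
begin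

text \<open>Singletons are clopen in the discrete integers, so the level sets of a continuous
  cocycle are clopen and \<open>steinberg_restrict\<close> applies.\<close>

lemma degree_part_closed:
  assumes c: "continuous_cocycle G c" and f: "f \<in> steinberg G"
  shows "degree_part c n f \<in> steinberg G"
proof -
  let ?C = "{x \<in> topspace (gtop G). c x \<in> {n}}"
  have cont: "continuous_map (gtop G) (discrete_topology UNIV) c"
    using c by (simp add: continuous_cocycle_def)
  have "clopen_in G ?C"
    unfolding clopen_in_def
    by (intro conjI openin_continuous_map_preimage[OF cont] closedin_continuous_map_preimage[OF cont]) auto
  from steinberg_restrict[OF f this] show ?thesis
    by (rule back_subst[of "\<lambda>f. f \<in> steinberg G"])
      (use steinberg_outside[OF f] in \<open>force simp: degree_part_def elems_def\<close>)
qed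

lemma convolution_deg:
  assumes c: "continuous_cocycle G c" and f: "\<forall>x. f x \<noteq> 0 \<longrightarrow> c x = m" and g: "\<forall>x. g x \<noteq> 0 \<longrightarrow> c x = n"
    and x: "conv f g x \<noteq> 0"
  shows "c x = m + n"
proof -
  obtain y z where "y \<in> elems G" "z \<in> elems G" "gsrc G y = grng G z" "x = gmul G y z" "f y \<noteq> 0" "g z \<noteq> 0"
    using convolution_nonzero[OF x] by auto
  then show ?thesis using c f g by (auto simp: continuous_cocycle_def composable_def)
qed

lemma scalar_algebra_steinberg: "scalar_algebra fscale (function_rng G (steinberg G))"
  unfolding scalar_algebra_def fscale_def
  by (simp add: rng_steinberg steinberg_scale convolution_scale algebra_simps)

end

context multiplicative_triple
begin

text \<open>The second half covers every admissible map, since the conditions fix its values only on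
  the carrier of the tensor product and leave the others open.\<close>

lemma steinberg_cuntz_pimsner:
  fixes A :: "('g \<Rightarrow> 'k::field) ring" and Rr :: "('g \<Rightarrow> 'k) ring" and Q P :: "('g \<Rightarrow> 'k, 'g \<Rightarrow> 'k) bimodule"
  defines "A \<equiv> function_rng G (steinberg G)" and "Rr \<equiv> function_rng G (steinberg_on G H0)"
    and "Q \<equiv> steinberg_bimodule G H1" and "P \<equiv> steinberg_bimodule G Hm"
  assumes c: "continuous_cocycle G c"
    and deg: "H0 \<subseteq> {x \<in> elems G. c x = 0}" "H1 \<subseteq> {x \<in> elems G. c x = 1}" "Hm \<subseteq> {x \<in> elems G. c x = - 1}"
    and ii: "\<And>B. \<lbrakk>cob B; B \<subseteq> H0; gsrc G ` B \<inter> grng G ` H1 = {}\<rbrakk> \<Longrightarrow> gsrc G ` B \<subseteq> H0"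
    and iii: "elems G \<subseteq> gproducts G (H0 \<union> H1 \<union> Hm)"
  shows "(\<exists>\<psi>. \<psi> \<in> bimodule_hom Rr (tensor Rr P Q) (regular_bimodule Rr) \<and>
      (\<forall>j\<in>steinberg_on G Hm. \<forall>i\<in>steinberg_on G H1. \<psi> (tensor_elem Rr P Q j i) = j \<otimes>\<^bsub>A\<^esub> i)) \<and>
    (\<forall>\<psi>. \<psi> \<in> bimodule_hom Rr (tensor Rr P Q) (regular_bimodule Rr) \<and>
      (\<forall>j\<in>steinberg_on G Hm. \<forall>i\<in>steinberg_on G H1. \<psi> (tensor_elem Rr P Q j i) = j \<otimes>\<^bsub>A\<^esub> i) \<longrightarrow>
      cuntz_pimsner_defined Rr P Q \<psi> \<and>
      (\<exists>sc \<phi>. cuntz_pimsner_scalars Rr P Q \<psi> fscale fscale fscale sc \<and>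
         \<phi> \<in> rng_iso A (cuntz_pimsner Rr P Q \<psi>) \<and>
         (\<forall>n. \<phi> ` steinberg_deg G c n = cuntz_pimsner_deg Rr P Q \<psi> n) \<and>
         (\<forall>k. \<forall>f\<in>carrier A. \<phi> (fscale k f) = sc k (\<phi> f))))"
proof -
  let ?R = "steinberg_on G H0 :: ('g \<Rightarrow> 'k) set" and ?I = "steinberg_on G H1 :: ('g \<Rightarrow> 'k) set"
    and ?J = "steinberg_on G Hm :: ('g \<Rightarrow> 'k) set"
  have eqs: "sub_rng A ?R = Rr" "sub_bimodule A ?I = Q" "sub_bimodule A ?J = P"
    by (simp_all add: A_def Rr_def Q_def P_def sub_rng_function_rng sub_bimodule_function_rng)
  have on_deg: "degree_part c n f = f" if "f \<in> steinberg_on G H" "H \<subseteq> {x \<in> elems G. c x = n}"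
    for f :: "'g \<Rightarrow> 'k" and H n
    unfolding degree_part_fixed using steinberg_on_D(2)[OF that(1)] that(2) by auto
  have triple: "rng_triple A ?R ?I ?J" unfolding A_def by (rule rng_triple)
  show ?thesis
  proof (rule conjI, goal_cases)
    case 1
    show ?case using rng_triple.ex_multiplication_map[OF triple] unfolding eqs .
  next
    case 2
    show ?case
    proof (intro allI impI, elim conjE, goal_cases)
      case psi: (1 \<psi>)
      interpret graded_cp_triple A ?R ?I ?J \<psi> "degree_part c" fscale
      proof (intro graded_cp_triple.intro cp_triple.intro cp_triple_axioms.intro graded_cp_triple_axioms.intro)
        show "rng_triple A ?R ?I ?J" by (rule triple)
        show "\<psi> \<in> bimodule_hom (sub_rng A ?R) (tensor (sub_rng A ?R) (sub_bimodule A ?J) (sub_bimodule A ?I))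
            (regular_bimodule (sub_rng A ?R))"
          unfolding eqs by (rule psi(1))
        show "\<psi> (tensor_elem (sub_rng A ?R) (sub_bimodule A ?J) (sub_bimodule A ?I) j i) = j \<otimes>\<^bsub>A\<^esub> i"
          if "j \<in> ?J" "i \<in> ?I" for i j
          unfolding eqs using psi(2) that by blast
        show "\<exists>a\<in>set_times A ?I ?J. \<forall>i\<in>X. a \<otimes>\<^bsub>A\<^esub> i = i" if "finite X" "X \<subseteq> ?I" for X
          unfolding A_def by (rule local_units(1)[OF that])
        show "\<exists>b\<in>set_times A ?I ?J. \<forall>j\<in>X. j \<otimes>\<^bsub>A\<^esub> b = j" if "finite X" "X \<subseteq> ?J" for X
          unfolding A_def by (rule local_units(2)[OF that])
        show "a \<in> ?R" if "r \<in> left_ann_perp A ?R ?I" "a \<in> set_times A ?I ?J"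
          "\<And>i. i \<in> ?I \<Longrightarrow> (r \<ominus>\<^bsub>A\<^esub> a) \<otimes>\<^bsub>A\<^esub> i = \<zero>\<^bsub>A\<^esub>" for r a
        proof -
          have "r \<in> ?R" using that(1) by (simp add: left_ann_perp_def)
          from IJ_in_R[OF this that(2,3)[unfolded A_def]] show ?thesis .
        qed
        show "left_ann A ?R ?I \<inter> left_ann_perp A ?R ?I = {\<zero>\<^bsub>A\<^esub>}"
          unfolding A_def by (rule ann_perp_trivial[OF ii])
        show "subrng_generated A (?R \<union> ?I \<union> ?J) = carrier A"
          unfolding A_def by (rule steinberg_generated[OF iii])
        show "scalar_algebra fscale A" unfolding A_def by (rule scalar_algebra_steinberg)
        show "degree_part c n f \<in> carrier A" if "f \<in> carrier A" for f n
          using degree_part_closed[OF c] that by (simp add: A_def)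
        show "degree_part c (m + n) (f \<otimes>\<^bsub>A\<^esub> g) = f \<otimes>\<^bsub>A\<^esub> g"
          if "degree_part c m f = f" "degree_part c n g = g" for f g m n
          using that unfolding A_def degree_part_fixed function_rng_simps
          by (intro allI impI) (rule convolution_deg[OF c])
        show "degree_part c n f = \<zero>\<^bsub>A\<^esub>" if "degree_part c m f = f" "n \<noteq> m" for f m n
          using that unfolding degree_part_fixed by (auto simp: A_def degree_part_def fun_eq_iff)
        show "degree_part c n (f \<oplus>\<^bsub>A\<^esub> g) = degree_part c n f \<oplus>\<^bsub>A\<^esub> degree_part c n g" for f g n
          by (simp add: A_def degree_part_def fun_eq_iff)
      qed (auto simp: on_deg[OF _ deg(1)] on_deg[OF _ deg(2)] on_deg[OF _ deg(3)] steinberg_on_def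
          fscale_def steinberg_scale)
      show ?case
        using cuntz_pimsner_iso unfolding eqs steinberg_deg_fixed by (simp add: A_def)
    qed
  qed
qed

end

theorem theorem4p1:
  fixes G :: "'g top_groupoid" and c :: "'g \<Rightarrow> int" and H0 H1 Hm :: "'g set"
    and A :: "('g \<Rightarrow> 'k::field) ring" and R I J :: "('g \<Rightarrow> 'k) set"
    and Rr :: "('g \<Rightarrow> 'k) ring" and Q P :: "('g \<Rightarrow> 'k, 'g \<Rightarrow> 'k) bimodule"
    and hyp_i hyp_ii hyp_iii :: bool
  defines "A \<equiv> function_rng G (steinberg G)"
    and "R \<equiv> steinberg_on G H0" and "I \<equiv> steinberg_on G H1" and "J \<equiv> steinberg_on G Hm"
    and "Rr \<equiv> function_rng G (steinberg_on G H0)"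
    and "Q \<equiv> steinberg_bimodule G H1" and "P \<equiv> steinberg_bimodule G Hm"
    and "hyp_i \<equiv> gset_mul G H0 H0 \<subseteq> H0 \<and>
           gset_mul G H0 H1 \<union> gset_mul G H1 H0 \<subseteq> H1 \<and>
           gset_mul G H0 Hm \<union> gset_mul G Hm H0 \<subseteq> Hm \<and>
           gset_mul G Hm H1 \<subseteq> H0 \<and>
           grng G ` H1 \<union> gsrc G ` Hm \<subseteq> gset_mul G H1 Hm"
    and "hyp_ii \<equiv> \<forall>B. compact_open_bisection G B \<and> B \<subseteq> H0 \<and> gsrc G ` B \<inter> grng G ` H1 = {}
           \<longrightarrow> gsrc G ` B \<subseteq> H0"
    and "hyp_iii \<equiv> elems G \<subseteq> gproducts G (H0 \<union> H1 \<union> Hm)"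
  assumes "ample_Hausdorff_groupoid G" and "locally_compact_space (gtop G)"
    and "continuous_cocycle G c"
    and "clopen_in G H0" and "H0 \<subseteq> {x \<in> elems G. c x = 0}"
    and "clopen_in G H1" and "H1 \<subseteq> {x \<in> elems G. c x = 1}"
    and "clopen_in G Hm" and "Hm \<subseteq> {x \<in> elems G. c x = - 1}"
  shows
    "(hyp_i \<longrightarrow>
        subrng R (function_rng G (steinberg_deg G c 0)) \<and>
        set_times A R I \<subseteq> I \<and> set_times A I R \<subseteq> I \<and>
        set_times A R J \<subseteq> J \<and> set_times A J R \<subseteq> J \<and> set_times A J I \<subseteq> R \<and>
        (\<forall>F. finite F \<and> F \<subseteq> I \<longrightarrow> (\<exists>a\<in>set_times A I J. \<forall>i\<in>F. a \<otimes>\<^bsub>A\<^esub> i = i)) \<and>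
        (\<forall>F. finite F \<and> F \<subseteq> J \<longrightarrow> (\<exists>b\<in>set_times A I J. \<forall>j\<in>F. j \<otimes>\<^bsub>A\<^esub> b = j)) \<and>
        (\<forall>r\<in>left_ann_perp A R I. \<forall>a\<in>set_times A I J.
           r \<ominus>\<^bsub>A\<^esub> a \<in> left_ann A (steinberg_deg G c 0) I \<longrightarrow> a \<in> R)) \<and>
     (hyp_ii \<longrightarrow> left_ann A R I \<inter> left_ann_perp A R I = {\<zero>\<^bsub>A\<^esub>}) \<and>
     (hyp_iii \<longrightarrow> subrng_generated A (R \<union> I \<union> J) = carrier A) \<and>
     (hyp_i \<and> hyp_ii \<and> hyp_iii \<longrightarrow>
        (let is_psi = (\<lambda>\<psi>. \<psi> \<in> bimodule_hom Rr (tensor Rr P Q) (regular_bimodule Rr) \<and>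
               (\<forall>j\<in>J. \<forall>i\<in>I. \<psi> (tensor_elem Rr P Q j i) = j \<otimes>\<^bsub>A\<^esub> i))
         in (\<exists>\<psi>. is_psi \<psi>) \<and>
            (\<forall>\<psi>. is_psi \<psi> \<longrightarrow>
               cuntz_pimsner_defined Rr P Q \<psi> \<and>
               (\<exists>sc \<phi>. cuntz_pimsner_scalars Rr P Q \<psi> fscale fscale fscale sc \<and>
                  \<phi> \<in> rng_iso A (cuntz_pimsner Rr P Q \<psi>) \<and>
                  (\<forall>n. \<phi> ` steinberg_deg G c n = cuntz_pimsner_deg Rr P Q \<psi> n) \<and>
                  (\<forall>k. \<forall>f\<in>carrier A. \<phi> (fscale k f) = sc k (\<phi> f))))))"
proof -
  interpret clopen_triple G H0 H1 Hm
    by (intro clopen_triple.intro clopen_triple_axioms.intro assms)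
  have mult: "multiplicative_triple G H0 H1 Hm" if hyp_i
    using that unfolding hyp_i_def
    by (intro multiplicative_triple.intro multiplicative_triple_axioms.intro clopen_triple_axioms) auto
  note deg = \<open>H0 \<subseteq> {x \<in> elems G. c x = 0}\<close> \<open>H1 \<subseteq> {x \<in> elems G. c x = 1}\<close>
    \<open>Hm \<subseteq> {x \<in> elems G. c x = - 1}\<close>
  show ?thesis
  proof (intro conjI impI)
    assume hyp_i
    then interpret multiplicative_triple G H0 H1 Hm by (rule mult)
    interpret T: rng_triple A R I J
      unfolding A_def R_def I_def J_def by (rule rng_triple)
    show "subrng R (function_rng G (steinberg_deg G c 0))"
      unfolding R_def steinberg_deg_eq by (rule subrng_H0) (use deg in auto)
    have sub: "R \<subseteq> carrier A" "I \<subseteq> carrier A" "J \<subseteq> carrier A" using T.R_c T.I_c T.J_c by auto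
    show "set_times A R I \<subseteq> I" by (rule T.set_times_subset[OF T.R_sub sub(2) T.I_sub T.RI])
    show "set_times A I R \<subseteq> I" by (rule T.set_times_subset[OF T.I_sub sub(1) T.I_sub T.IR])
    show "set_times A R J \<subseteq> J" by (rule T.set_times_subset[OF T.R_sub sub(3) T.J_sub T.RJ])
    show "set_times A J R \<subseteq> J" by (rule T.set_times_subset[OF T.J_sub sub(1) T.J_sub T.JR])
    show "set_times A J I \<subseteq> R" by (rule T.set_times_subset[OF T.J_sub sub(2) T.R_sub T.JI])
    show "\<forall>F. finite F \<and> F \<subseteq> I \<longrightarrow> (\<exists>a\<in>set_times A I J. \<forall>i\<in>F. a \<otimes>\<^bsub>A\<^esub> i = i)"
      unfolding A_def I_def J_def by (intro allI impI, elim conjE, rule local_units(1))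
    show "\<forall>F. finite F \<and> F \<subseteq> J \<longrightarrow> (\<exists>b\<in>set_times A I J. \<forall>j\<in>F. j \<otimes>\<^bsub>A\<^esub> b = j)"
      unfolding A_def I_def J_def by (intro allI impI, elim conjE, rule local_units(2))
    show "\<forall>r\<in>left_ann_perp A R I. \<forall>a\<in>set_times A I J.
        r \<ominus>\<^bsub>A\<^esub> a \<in> left_ann A (steinberg_deg G c 0) I \<longrightarrow> a \<in> R"
    proof (intro ballI impI)
      fix r a assume "r \<in> left_ann_perp A R I" and a: "a \<in> set_times A I J"
        and "r \<ominus>\<^bsub>A\<^esub> a \<in> left_ann A (steinberg_deg G c 0) I"
      then have "r \<in> R" "\<And>i. i \<in> I \<Longrightarrow> (r \<ominus>\<^bsub>A\<^esub> a) \<otimes>\<^bsub>A\<^esub> i = \<zero>\<^bsub>A\<^esub>"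
        by (simp_all add: left_ann_def left_ann_perp_def)
      then show "a \<in> R"
        using a unfolding A_def R_def I_def J_def by - (rule IJ_in_R)
    qed
  next
    assume hyp_ii
    then show "left_ann A R I \<inter> left_ann_perp A R I = {\<zero>\<^bsub>A\<^esub>}"
      unfolding A_def R_def I_def hyp_ii_def by (intro ann_perp_trivial) blast
  next
    assume hyp_iii
    then show "subrng_generated A (R \<union> I \<union> J) = carrier A"
      unfolding A_def R_def I_def J_def hyp_iii_def by (rule steinberg_generated)
  qed (unfold Let_def A_def Rr_def P_def Q_def I_def J_def hyp_ii_def hyp_iii_def, elim conjE,
      rule multiplicative_triple.steinberg_cuntz_pimsner[OF mult \<open>continuous_cocycle G c\<close> deg], blast+)
qed

end
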